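(* Let $\mathbb{F}$ be a finite field of characteristic $p$, and let $K$ be a commutative ring in which $p$ is invertible. Then there is a natural equivalence of $K$-linear abelian categories $$\operatorname{Rep}(\mathbb{F};K) \simeq \prod_{n=0}^{\infty} K[GL_n(\mathbb{F})]\text{-modules}.$$
   Context: $\operatorname{Rep}(\mathbb{F};K)$ denotes the category whose objects are the (arbitrary, covariant) functors from the category of finite dimensional $\mathbb{F}$-vector spaces and $\mathbb{F}$-linear maps to the category of $K$-modules, and whose morphisms are natural transformations. It is a $K$-linear abelian category with kernels, cokernels and exactness defined objectwise. For each $n\ge 0$, $K[GL_n(\mathbb{F})]$ is the group ring of the general linear group $GL_n(\mathbb{F})$ (with $GL_0(\mathbb{F})$ the trivial group), and the right-hand side is the product, over all $n \geq 0$, of the categories of $K[GL_n(\mathbb{F})]$-modules. *)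

theory Defs
  imports "Jordan_Normal_Form.VS_Connect"
begin

hide_const (open) Modules.module_hom

section \<open>Categories\<close>

text \<open>
  Hom-sets of different pairs of objects are allowed to overlap, so composition carries the objects
  involved: for \<open>f\<close> in \<open>Hom C X Y\<close> and \<open>g\<close> in \<open>Hom C Y Z\<close>, the composite \<open>g \<circ> f\<close> is
  \<open>Comp C X Y Z g f\<close>.
\<close>

record ('o, 'a) cat =
  Obj :: "'o set"
  Hom :: "'o \<Rightarrow> 'o \<Rightarrow> 'a set"
  Ident :: "'o \<Rightarrow> 'a"
  Comp :: "'o \<Rightarrow> 'o \<Rightarrow> 'o \<Rightarrow> 'a \<Rightarrow> 'a \<Rightarrow> 'a"

locale category =
  fixes C :: "('o, 'a, 'z) cat_scheme" (structure)
  assumes Ident_closed: "X \<in> Obj C \<Longrightarrow> Ident C X \<in> Hom C X X"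
    and Comp_closed:
      "\<lbrakk>X \<in> Obj C; Y \<in> Obj C; Z \<in> Obj C; f \<in> Hom C X Y; g \<in> Hom C Y Z\<rbrakk>
        \<Longrightarrow> Comp C X Y Z g f \<in> Hom C X Z"
    and Comp_Ident_left:
      "\<lbrakk>X \<in> Obj C; Y \<in> Obj C; f \<in> Hom C X Y\<rbrakk> \<Longrightarrow> Comp C X Y Y (Ident C Y) f = f"
    and Comp_Ident_right:
      "\<lbrakk>X \<in> Obj C; Y \<in> Obj C; f \<in> Hom C X Y\<rbrakk> \<Longrightarrow> Comp C X X Y f (Ident C X) = f"
    and Comp_assoc:
      "\<lbrakk>W \<in> Obj C; X \<in> Obj C; Y \<in> Obj C; Z \<in> Obj C;
        f \<in> Hom C W X; g \<in> Hom C X Y; h \<in> Hom C Y Z\<rbrakk>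
        \<Longrightarrow> Comp C W Y Z h (Comp C W X Y g f) = Comp C W X Z (Comp C X Y Z h g) f"

definition is_iso :: "('o, 'a, 'z) cat_scheme \<Rightarrow> 'o \<Rightarrow> 'o \<Rightarrow> 'a \<Rightarrow> bool" where
  "is_iso C X Y f \<longleftrightarrow> f \<in> Hom C X Y \<and>
     (\<exists>g \<in> Hom C Y X. Comp C X Y X g f = Ident C X \<and> Comp C Y X Y f g = Ident C Y)"

definition is_mono :: "('o, 'a, 'z) cat_scheme \<Rightarrow> 'o \<Rightarrow> 'o \<Rightarrow> 'a \<Rightarrow> bool" where
  "is_mono C X Y f \<longleftrightarrow> f \<in> Hom C X Y \<and>
     (\<forall>W \<in> Obj C. \<forall>g \<in> Hom C W X. \<forall>h \<in> Hom C W X.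
        Comp C W X Y f g = Comp C W X Y f h \<longrightarrow> g = h)"

definition is_epi :: "('o, 'a, 'z) cat_scheme \<Rightarrow> 'o \<Rightarrow> 'o \<Rightarrow> 'a \<Rightarrow> bool" where
  "is_epi C X Y f \<longleftrightarrow> f \<in> Hom C X Y \<and>
     (\<forall>Z \<in> Obj C. \<forall>g \<in> Hom C Y Z. \<forall>h \<in> Hom C Y Z.
        Comp C X Y Z g f = Comp C X Y Z h f \<longrightarrow> g = h)"

definition is_zero_object :: "('o, 'a, 'z) cat_scheme \<Rightarrow> 'o \<Rightarrow> bool" where
  "is_zero_object C Z \<longleftrightarrow> Z \<in> Obj C \<and>
     (\<forall>X \<in> Obj C. (\<exists>!f. f \<in> Hom C X Z) \<and> (\<exists>!f. f \<in> Hom C Z X))"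


section \<open>Linear and abelian categories\<close>

record ('k, 'o, 'a) lin_cat = "('o, 'a) cat" +
  Hadd :: "'o \<Rightarrow> 'o \<Rightarrow> 'a \<Rightarrow> 'a \<Rightarrow> 'a"
  Hzero :: "'o \<Rightarrow> 'o \<Rightarrow> 'a"
  Hsmult :: "'o \<Rightarrow> 'o \<Rightarrow> 'k \<Rightarrow> 'a \<Rightarrow> 'a"

text \<open>
  The records for modules extend those for rings; the fields \<open>mult\<close> and \<open>one\<close> play no role
  for modules.
\<close>

definition hom_module :: "('k, 'o, 'a, 'z) lin_cat_scheme \<Rightarrow> 'o \<Rightarrow> 'o \<Rightarrow> ('k, 'a) module" where
  "hom_module C X Y =
    \<lparr>carrier = Hom C X Y, mult = undefined, one = undefined,
     zero = Hzero C X Y, add = Hadd C X Y, smult = Hsmult C X Y\<rparr>"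

locale linear_category = K?: cring K + category C
  for K :: "'k ring" and C :: "('k, 'o, 'a, 'z) lin_cat_scheme" +
  assumes hom_module:
      "\<lbrakk>X \<in> Obj C; Y \<in> Obj C\<rbrakk> \<Longrightarrow> module K (hom_module C X Y)"
    and Comp_Hadd_left:
      "\<lbrakk>X \<in> Obj C; Y \<in> Obj C; Z \<in> Obj C; f \<in> Hom C X Y; g \<in> Hom C Y Z; g' \<in> Hom C Y Z\<rbrakk>
        \<Longrightarrow> Comp C X Y Z (Hadd C Y Z g g') f
            = Hadd C X Z (Comp C X Y Z g f) (Comp C X Y Z g' f)"
    and Comp_Hadd_right:
      "\<lbrakk>X \<in> Obj C; Y \<in> Obj C; Z \<in> Obj C; f \<in> Hom C X Y; f' \<in> Hom C X Y; g \<in> Hom C Y Z\<rbrakk>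
        \<Longrightarrow> Comp C X Y Z g (Hadd C X Y f f')
            = Hadd C X Z (Comp C X Y Z g f) (Comp C X Y Z g f')"
    and Comp_Hsmult_left:
      "\<lbrakk>X \<in> Obj C; Y \<in> Obj C; Z \<in> Obj C; c \<in> carrier K; f \<in> Hom C X Y; g \<in> Hom C Y Z\<rbrakk>
        \<Longrightarrow> Comp C X Y Z (Hsmult C Y Z c g) f = Hsmult C X Z c (Comp C X Y Z g f)"
    and Comp_Hsmult_right:
      "\<lbrakk>X \<in> Obj C; Y \<in> Obj C; Z \<in> Obj C; c \<in> carrier K; f \<in> Hom C X Y; g \<in> Hom C Y Z\<rbrakk>
        \<Longrightarrow> Comp C X Y Z g (Hsmult C X Y c f) = Hsmult C X Z c (Comp C X Y Z g f)"

definition is_biproduct ::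
    "('k, 'o, 'a, 'z) lin_cat_scheme \<Rightarrow> 'o \<Rightarrow> 'o \<Rightarrow> 'o \<Rightarrow> 'a \<Rightarrow> 'a \<Rightarrow> 'a \<Rightarrow> 'a \<Rightarrow> bool" where
  "is_biproduct C X Y B i j p q \<longleftrightarrow>
     B \<in> Obj C \<and> i \<in> Hom C X B \<and> j \<in> Hom C Y B \<and> p \<in> Hom C B X \<and> q \<in> Hom C B Y \<and>
     Comp C X B X p i = Ident C X \<and> Comp C Y B Y q j = Ident C Y \<and>
     Comp C Y B X p j = Hzero C Y X \<and> Comp C X B Y q i = Hzero C X Y \<and>
     Hadd C B B (Comp C B X B i p) (Comp C B Y B j q) = Ident C B"

definition is_kernel ::
    "('k, 'o, 'a, 'z) lin_cat_scheme \<Rightarrow> 'o \<Rightarrow> 'o \<Rightarrow> 'a \<Rightarrow> 'o \<Rightarrow> 'a \<Rightarrow> bool" where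
  "is_kernel C X Y f N k \<longleftrightarrow>
     N \<in> Obj C \<and> k \<in> Hom C N X \<and> Comp C N X Y f k = Hzero C N Y \<and>
     (\<forall>W \<in> Obj C. \<forall>g \<in> Hom C W X. Comp C W X Y f g = Hzero C W Y \<longrightarrow>
        (\<exists>!u. u \<in> Hom C W N \<and> Comp C W N X k u = g))"

definition is_cokernel ::
    "('k, 'o, 'a, 'z) lin_cat_scheme \<Rightarrow> 'o \<Rightarrow> 'o \<Rightarrow> 'a \<Rightarrow> 'o \<Rightarrow> 'a \<Rightarrow> bool" where
  "is_cokernel C X Y f Q c \<longleftrightarrow>
     Q \<in> Obj C \<and> c \<in> Hom C Y Q \<and> Comp C X Y Q c f = Hzero C X Q \<and>
     (\<forall>Z \<in> Obj C. \<forall>g \<in> Hom C Y Z. Comp C X Y Z g f = Hzero C X Z \<longrightarrow>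
        (\<exists>!u. u \<in> Hom C Q Z \<and> Comp C Y Q Z u c = g))"

locale linear_abelian_category = linear_category K C
  for K :: "'k ring" and C :: "('k, 'o, 'a, 'z) lin_cat_scheme" +
  assumes ex_zero_object: "\<exists>Z. is_zero_object C Z"
    and ex_biproduct:
      "\<lbrakk>X \<in> Obj C; Y \<in> Obj C\<rbrakk> \<Longrightarrow> \<exists>B i j p q. is_biproduct C X Y B i j p q"
    and ex_kernel:
      "\<lbrakk>X \<in> Obj C; Y \<in> Obj C; f \<in> Hom C X Y\<rbrakk> \<Longrightarrow> \<exists>N k. is_kernel C X Y f N k"
    and ex_cokernel:
      "\<lbrakk>X \<in> Obj C; Y \<in> Obj C; f \<in> Hom C X Y\<rbrakk> \<Longrightarrow> \<exists>Q c. is_cokernel C X Y f Q c"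
    and mono_normal:
      "\<lbrakk>X \<in> Obj C; Y \<in> Obj C; is_mono C X Y f\<rbrakk>
        \<Longrightarrow> \<exists>Z g. Z \<in> Obj C \<and> g \<in> Hom C Y Z \<and> is_kernel C Y Z g X f"
    and epi_normal:
      "\<lbrakk>X \<in> Obj C; Y \<in> Obj C; is_epi C X Y f\<rbrakk>
        \<Longrightarrow> \<exists>W g. W \<in> Obj C \<and> g \<in> Hom C W X \<and> is_cokernel C W X g Y f"


section \<open>Functors, natural transformations, equivalences\<close>

record ('o, 'a, 'p, 'b) fctr =
  omap :: "'o \<Rightarrow> 'p"
  amap :: "'o \<Rightarrow> 'o \<Rightarrow> 'a \<Rightarrow> 'b"

definition is_functor ::
    "('o, 'a, 'y) cat_scheme \<Rightarrow> ('p, 'b, 'z) cat_scheme \<Rightarrow> ('o, 'a, 'p, 'b) fctr \<Rightarrow> bool" where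
  "is_functor C D F \<longleftrightarrow>
     (\<forall>X \<in> Obj C. omap F X \<in> Obj D) \<and>
     (\<forall>X \<in> Obj C. \<forall>Y \<in> Obj C. \<forall>f \<in> Hom C X Y. amap F X Y f \<in> Hom D (omap F X) (omap F Y)) \<and>
     (\<forall>X \<in> Obj C. amap F X X (Ident C X) = Ident D (omap F X)) \<and>
     (\<forall>X \<in> Obj C. \<forall>Y \<in> Obj C. \<forall>Z \<in> Obj C. \<forall>f \<in> Hom C X Y. \<forall>g \<in> Hom C Y Z.
        amap F X Z (Comp C X Y Z g f)
        = Comp D (omap F X) (omap F Y) (omap F Z) (amap F Y Z g) (amap F X Y f))"

definition id_functor :: "('o, 'a, 'o, 'a) fctr" where
  "id_functor = \<lparr>omap = (\<lambda>X. X), amap = (\<lambda>X Y f. f)\<rparr>"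

definition comp_functor ::
    "('p, 'b, 'q, 'c) fctr \<Rightarrow> ('o, 'a, 'p, 'b) fctr \<Rightarrow> ('o, 'a, 'q, 'c) fctr" where
  "comp_functor G F =
    \<lparr>omap = (\<lambda>X. omap G (omap F X)),
     amap = (\<lambda>X Y f. amap G (omap F X) (omap F Y) (amap F X Y f))\<rparr>"

text \<open>
  Families of arrows are extensional (equal to \<open>undefined\<close> off \<open>Obj C\<close>), so that equality of
  natural transformations is equality of their components.
\<close>

definition nat_trans ::
    "('o, 'a, 'y) cat_scheme \<Rightarrow> ('p, 'b, 'z) cat_scheme \<Rightarrow>
     ('o, 'a, 'p, 'b) fctr \<Rightarrow> ('o, 'a, 'p, 'b) fctr \<Rightarrow> ('o \<Rightarrow> 'b) set" where
  "nat_trans C D F G =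
    {\<eta> \<in> (\<Pi>\<^sub>E X \<in> Obj C. Hom D (omap F X) (omap G X)).
       \<forall>X \<in> Obj C. \<forall>Y \<in> Obj C. \<forall>f \<in> Hom C X Y.
         Comp D (omap F X) (omap F Y) (omap G Y) (\<eta> Y) (amap F X Y f)
         = Comp D (omap F X) (omap G X) (omap G Y) (amap G X Y f) (\<eta> X)}"

definition naturally_isomorphic ::
    "('o, 'a, 'y) cat_scheme \<Rightarrow> ('p, 'b, 'z) cat_scheme \<Rightarrow>
     ('o, 'a, 'p, 'b) fctr \<Rightarrow> ('o, 'a, 'p, 'b) fctr \<Rightarrow> bool" where
  "naturally_isomorphic C D F G \<longleftrightarrow>
     (\<exists>\<eta> \<in> nat_trans C D F G. \<forall>X \<in> Obj C. is_iso D (omap F X) (omap G X) (\<eta> X))"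

definition is_linear_functor ::
    "'k ring \<Rightarrow> ('k, 'o, 'a, 'y) lin_cat_scheme \<Rightarrow> ('k, 'p, 'b, 'z) lin_cat_scheme \<Rightarrow>
     ('o, 'a, 'p, 'b) fctr \<Rightarrow> bool" where
  "is_linear_functor K C D F \<longleftrightarrow> is_functor C D F \<and>
     (\<forall>X \<in> Obj C. \<forall>Y \<in> Obj C.
        amap F X Y \<in> module_hom K (hom_module C X Y) (hom_module D (omap F X) (omap F Y)))"

definition linear_equivalence ::
    "'k ring \<Rightarrow> ('k, 'o, 'a, 'y) lin_cat_scheme \<Rightarrow> ('k, 'p, 'b, 'z) lin_cat_scheme \<Rightarrow>
     ('o, 'a, 'p, 'b) fctr \<Rightarrow> ('p, 'b, 'o, 'a) fctr \<Rightarrow> bool" where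
  "linear_equivalence K C D \<Phi> \<Psi> \<longleftrightarrow>
     is_linear_functor K C D \<Phi> \<and> is_linear_functor K D C \<Psi> \<and>
     naturally_isomorphic C C id_functor (comp_functor \<Psi> \<Phi>) \<and>
     naturally_isomorphic D D (comp_functor \<Phi> \<Psi>) id_functor"

text \<open>
  An equivalence preserves all limits and colimits, so exactness of \<open>\<Phi>\<close> and \<open>\<Psi>\<close> need not be
  demanded.
\<close>

definition equivalent_linear_abelian_categories ::
    "'k ring \<Rightarrow> ('k, 'o, 'a, 'y) lin_cat_scheme \<Rightarrow> ('k, 'p, 'b, 'z) lin_cat_scheme \<Rightarrow> bool" where
  "equivalent_linear_abelian_categories K C D \<longleftrightarrow>
     linear_abelian_category K C \<and> linear_abelian_category K D \<and>
     (\<exists>\<Phi> \<Psi>. linear_equivalence K C D \<Phi> \<Psi>)"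

text \<open>
  The functors themselves are not required to be extensional: two that agree on the objects and
  arrows of \<open>C\<close> are isomorphic via identities. The linear structure is objectwise.
\<close>

definition functor_category ::
    "('o, 'a, 'y) cat_scheme \<Rightarrow> ('k, 'p, 'b, 'z) lin_cat_scheme \<Rightarrow>
     ('k, ('o, 'a, 'p, 'b) fctr, 'o \<Rightarrow> 'b) lin_cat" where
  "functor_category C D =
    \<lparr>Obj = {F. is_functor C D F},
     Hom = nat_trans C D,
     Ident = (\<lambda>F. \<lambda>X \<in> Obj C. Ident D (omap F X)),
     Comp = (\<lambda>F G H \<beta> \<alpha>. \<lambda>X \<in> Obj C. Comp D (omap F X) (omap G X) (omap H X) (\<beta> X) (\<alpha> X)),
     Hadd = (\<lambda>F G \<alpha> \<beta>. \<lambda>X \<in> Obj C. Hadd D (omap F X) (omap G X) (\<alpha> X) (\<beta> X)),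
     Hzero = (\<lambda>F G. \<lambda>X \<in> Obj C. Hzero D (omap F X) (omap G X)),
     Hsmult = (\<lambda>F G c \<alpha>. \<lambda>X \<in> Obj C. Hsmult D (omap F X) (omap G X) c (\<alpha> X))\<rparr>"

definition product_category ::
    "('i \<Rightarrow> ('k, 'o, 'a) lin_cat) \<Rightarrow> ('k, 'i \<Rightarrow> 'o, 'i \<Rightarrow> 'a) lin_cat" where
  "product_category C =
    \<lparr>Obj = {X. \<forall>i. X i \<in> Obj (C i)},
     Hom = (\<lambda>X Y. {f. \<forall>i. f i \<in> Hom (C i) (X i) (Y i)}),
     Ident = (\<lambda>X i. Ident (C i) (X i)),
     Comp = (\<lambda>X Y Z g f i. Comp (C i) (X i) (Y i) (Z i) (g i) (f i)),
     Hadd = (\<lambda>X Y f g i. Hadd (C i) (X i) (Y i) (f i) (g i)),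
     Hzero = (\<lambda>X Y i. Hzero (C i) (X i) (Y i)),
     Hsmult = (\<lambda>X Y c f i. Hsmult (C i) (X i) (Y i) c (f i))\<rparr>"


section \<open>Modules\<close>

text \<open>The library's \<open>module\<close> asks for a commutative base ring; group rings need this version.\<close>

locale left_module = R?: ring R + M?: abelian_group M
  for R :: "('r, 'c) ring_scheme" (structure) and M :: "('r, 'm, 'd) module_scheme" (structure) +
  assumes smult_closed:
      "\<lbrakk>a \<in> carrier R; x \<in> carrier M\<rbrakk> \<Longrightarrow> a \<odot>\<^bsub>M\<^esub> x \<in> carrier M"
    and smult_l_distr:
      "\<lbrakk>a \<in> carrier R; b \<in> carrier R; x \<in> carrier M\<rbrakk>
        \<Longrightarrow> (a \<oplus>\<^bsub>R\<^esub> b) \<odot>\<^bsub>M\<^esub> x = a \<odot>\<^bsub>M\<^esub> x \<oplus>\<^bsub>M\<^esub> b \<odot>\<^bsub>M\<^esub> x"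
    and smult_r_distr:
      "\<lbrakk>a \<in> carrier R; x \<in> carrier M; y \<in> carrier M\<rbrakk>
        \<Longrightarrow> a \<odot>\<^bsub>M\<^esub> (x \<oplus>\<^bsub>M\<^esub> y) = a \<odot>\<^bsub>M\<^esub> x \<oplus>\<^bsub>M\<^esub> a \<odot>\<^bsub>M\<^esub> y"
    and smult_assoc1:
      "\<lbrakk>a \<in> carrier R; b \<in> carrier R; x \<in> carrier M\<rbrakk>
        \<Longrightarrow> (a \<otimes>\<^bsub>R\<^esub> b) \<odot>\<^bsub>M\<^esub> x = a \<odot>\<^bsub>M\<^esub> (b \<odot>\<^bsub>M\<^esub> x)"
    and smult_one:
      "x \<in> carrier M \<Longrightarrow> \<one>\<^bsub>R\<^esub> \<odot>\<^bsub>M\<^esub> x = x"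

lemma left_module_iff_module: "left_module R M \<longleftrightarrow> module R M" if "cring R"
  using that
  by (auto simp: left_module_def left_module_axioms_def Module.module_def
      Module.module_axioms_def cring.axioms)

text \<open>
  \<open>\<iota>\<close> is the structure map of \<open>R\<close> as an algebra over the coefficient ring (a ring homomorphism
  into the centre of \<open>R\<close>). Arrows are extensional functions on the carrier of the source.
  All modules of the category have their elements in the type \<open>'m\<close>, which serves as a universe.
\<close>

definition module_category ::
    "'m itself \<Rightarrow> ('r, 'c) ring_scheme \<Rightarrow> ('k \<Rightarrow> 'r) \<Rightarrow> ('k, ('r, 'm) module, 'm \<Rightarrow> 'm) lin_cat"
  where
  "module_category ty R \<iota> =
    \<lparr>Obj = {M. left_module R M},
     Hom = (\<lambda>M N. module_hom R M N \<inter> extensional (carrier M)),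
     Ident = (\<lambda>M. \<lambda>x \<in> carrier M. x),
     Comp = (\<lambda>L M N g f. compose (carrier L) g f),
     Hadd = (\<lambda>M N f g. \<lambda>x \<in> carrier M. f x \<oplus>\<^bsub>N\<^esub> g x),
     Hzero = (\<lambda>M N. \<lambda>x \<in> carrier M. \<zero>\<^bsub>N\<^esub>),
     Hsmult = (\<lambda>M N c f. \<lambda>x \<in> carrier M. \<iota> c \<odot>\<^bsub>N\<^esub> f x)\<rparr>"

definition fd_vector_spaces ::
    "'f::field itself \<Rightarrow> 'v itself \<Rightarrow> (('f, 'v) module, 'v \<Rightarrow> 'v) cat" where
  "fd_vector_spaces tf tv =
    \<lparr>Obj = {V. vectorspace class_ring V \<and> vectorspace.fin_dim class_ring V},
     Hom = (\<lambda>V W. module_hom class_ring V W \<inter> extensional (carrier V)),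
     Ident = (\<lambda>V. \<lambda>x \<in> carrier V. x),
     Comp = (\<lambda>U V W g f. compose (carrier U) g f)\<rparr>"


section \<open>Group rings and general linear groups\<close>

definition group_ring :: "('k, 'c) ring_scheme \<Rightarrow> ('g, 'd) monoid_scheme \<Rightarrow> ('g \<Rightarrow> 'k) ring" where
  "group_ring K G =
    \<lparr>carrier = {a \<in> carrier G \<rightarrow>\<^sub>E carrier K. finite {g \<in> carrier G. a g \<noteq> \<zero>\<^bsub>K\<^esub>}},
     mult = (\<lambda>a b. \<lambda>g \<in> carrier G.
       \<Oplus>\<^bsub>K\<^esub> h \<in> {h \<in> carrier G. a h \<noteq> \<zero>\<^bsub>K\<^esub>}. a h \<otimes>\<^bsub>K\<^esub> b (inv\<^bsub>G\<^esub> h \<otimes>\<^bsub>G\<^esub> g)),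
     one = (\<lambda>g \<in> carrier G. if g = \<one>\<^bsub>G\<^esub> then \<one>\<^bsub>K\<^esub> else \<zero>\<^bsub>K\<^esub>),
     zero = (\<lambda>g \<in> carrier G. \<zero>\<^bsub>K\<^esub>),
     add = (\<lambda>a b. \<lambda>g \<in> carrier G. a g \<oplus>\<^bsub>K\<^esub> b g)\<rparr>"

definition group_ring_of_scalar ::
    "('k, 'c) ring_scheme \<Rightarrow> ('g, 'd) monoid_scheme \<Rightarrow> 'k \<Rightarrow> 'g \<Rightarrow> 'k" where
  "group_ring_of_scalar K G c = (\<lambda>g \<in> carrier G. if g = \<one>\<^bsub>G\<^esub> then c else \<zero>\<^bsub>K\<^esub>)"

definition GL :: "'f::field itself \<Rightarrow> nat \<Rightarrow> 'f mat monoid" where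
  "GL tf n = units_of (ring_mat tf n ())"


section \<open>The two categories\<close>

definition Rep ::
    "'f::field itself \<Rightarrow> 'v itself \<Rightarrow> 'm itself \<Rightarrow> 'k ring \<Rightarrow>
     ('k, (('f, 'v) module, 'v \<Rightarrow> 'v, ('k, 'm) module, 'm \<Rightarrow> 'm) fctr,
      ('f, 'v) module \<Rightarrow> 'm \<Rightarrow> 'm) lin_cat" where
  "Rep tf tv tm K = functor_category (fd_vector_spaces tf tv) (module_category tm K (\<lambda>c. c))"

definition GL_modules ::
    "'f::field itself \<Rightarrow> 'm itself \<Rightarrow> 'k ring \<Rightarrow> nat \<Rightarrow>
     ('k, ('f mat \<Rightarrow> 'k, 'm) module, 'm \<Rightarrow> 'm) lin_cat" where
  "GL_modules tf tm K n =
    module_category tm (group_ring K (GL tf n)) (group_ring_of_scalar K (GL tf n))"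

end

theory Submission
  imports Defs "HOL-Algebra.Sylow" "HOL-Algebra.Multiplicative_Group"
begin

text \<open>
  A choice of bases identifies the finite dimensional vector spaces with the category whose objects are
  the numbers \<open>n\<close> and whose arrows are the matrices. A representation is then a sequence of \<open>K\<close>-modules
  \<open>V n\<close> on which the matrices of all formats act. Let \<open>Prim n\<close> consist of the elements of \<open>V n\<close> that are
  killed by all matrices with fewer than \<open>n\<close> rows. The group \<open>GL n\<close> acts on it, and the equivalence sends
  the representation to the sequence of these \<open>K[GL n]\<close>-modules.

  The reason why nothing is lost is a theorem of Kovacs. Because the order \<open>q\<close> of the field is a unit of
  \<open>K\<close>, the monoid ring of the \<open>n \<times> n\<close> matrices contains an element \<open>\<epsilon> n\<close> that is \<open>1\<close> modulo
  singular matrices and whose products, on either side, with matrices that factor through a smaller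
  dimension vanish. It is found with integral coefficients, up to a power of \<open>q\<close>
  (\<open>ex_kovacs_element\<close>): an element that kills the matrices of rank less than \<open>r\<close> is corrected so that
  it kills those of rank \<open>r\<close> as well (\<open>kill_next_rank\<close>), and a left killer obtained in this way is also
  a right killer by comparison with its transpose.

  Let \<open>E n\<close> be the operator of \<open>\<epsilon> n\<close> on \<open>V n\<close>. It is a projection onto \<open>Prim n\<close>, and \<open>x - E n x\<close> is a
  combination of elements \<open>j s x\<close>, where \<open>s x\<close> lives in a smaller dimension. By induction, a representation is
  generated by its subsets \<open>Prim n\<close> (\<open>generated_by_Prim\<close>), and an element \<open>x\<close> is zero as soon as all
  elements \<open>E m (t x)\<close> are (\<open>zero_if_E_app_zero\<close>). The first fact makes the functor faithful. For
  fullness, given equivariant maps \<open>\<theta> n\<close> on the sets \<open>Prim n\<close>, relate \<open>x\<close> to \<open>y\<close> if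
  \<open>E m (t y) = \<theta> m (E m (t x))\<close> for all \<open>t\<close>; the second fact shows that this relation is single
  valued, the first one that it is total, and it is visibly compatible with all operations
  (\<open>extension_transformation\<close>). Essential surjectivity is explicit: from \<open>GL n\<close>-modules \<open>U n\<close> one forms,
  in dimension \<open>d\<close>, the families of equivariant functions from the surjective \<open>n \<times> d\<close> matrices to \<open>U n\<close>
  for all \<open>n\<close>, extended by zero to the other matrices (\<open>prim_functor_ess_surj\<close>).

  The remaining parts are formal. A functor that is bijective on arrows and essentially surjective has a
  quasi-inverse; such functors compose, are preserved by forming functor categories, and carry the
  abelian structure back from the target to the source. It thus suffices that the modules over a
  group ring form an abelian category and that products of abelian categories are abelian. All modules
  have their elements in a fixed infinite type. This is harmless because the constructions involved,
  direct sums of two modules and the families above, embed into that type again.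
\<close>

(* Keeps module, module_hom, mult and smult for structures with an explicit carrier. *)

hide_const (open) Modules.module_hom Modules.module Multiset.mult Polynomial.smult
hide_fact (open) Modules.module_hom_def

section \<open>Matrices over a field\<close>

text \<open>
  Associativity and distributivity with side conditions on dimensions, which the simplifier can
  discharge, in place of carrier memberships with undetermined middle dimension.
\<close>

lemma mat_assoc:
  "\<lbrakk>dim_col A = dim_row B; dim_col B = dim_row C\<rbrakk> \<Longrightarrow> (A * B) * C = A * (B * C)"
  for A B C :: "'a :: semiring_0 mat"
  by (rule assoc_mult_mat[of _ "dim_row A" "dim_col A" _ "dim_col B" _ "dim_col C"]) auto

lemma mat_add_distrib:
  "\<lbrakk>dim_col A = dim_row C; dim_row A = dim_row B; dim_col A = dim_col B\<rbrakk>
    \<Longrightarrow> (A + B) * C = A * C + B * C" for A B C :: "'a :: semiring_0 mat"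
  by (rule add_mult_distrib_mat[of _ "dim_row A" "dim_col A" _ _ "dim_col C"]) auto

lemma mat_diff_distrib:
  "\<lbrakk>dim_col A = dim_row C; dim_row A = dim_row B; dim_col A = dim_col B\<rbrakk>
    \<Longrightarrow> (A - B) * C = A * C - B * C" for A B C :: "'a :: ring mat"
  by (rule minus_mult_distrib_mat[of _ "dim_row A" "dim_col A" _ _ "dim_col C"]) auto

lemma mat_mult_diff_distrib:
  "\<lbrakk>dim_col A = dim_row B; dim_row B = dim_row C; dim_col B = dim_col C\<rbrakk>
    \<Longrightarrow> A * (B - C) = A * B - A * C" for A B C :: "'a :: ring mat"
  by (rule mult_minus_distrib_mat[of _ "dim_row A" "dim_col A" _ "dim_col B"]) auto

lemma mat_one_left: "dim_row A = n \<Longrightarrow> 1\<^sub>m n * A = A" for A :: "'a :: semiring_1 mat"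
  by (rule left_mult_one_mat) auto

lemma mat_one_right: "dim_col A = n \<Longrightarrow> A * 1\<^sub>m n = A" for A :: "'a :: semiring_1 mat"
  by (rule right_mult_one_mat) auto

lemma index_mult_mat_sum:
  assumes "A \<in> carrier_mat n k" "B \<in> carrier_mat k m" "i < n" "j < m"
  shows "(A * B) $$ (i, j) = (\<Sum>l<k. A $$ (i, l) * B $$ (l, j))"
  using assms by (auto simp: scalar_prod_def lessThan_atLeast0 intro!: sum.cong)

text \<open>
  Rank factorization through a split epimorphism and a split monomorphism. A matrix with entry
  \<open>a \<noteq> 0\<close> at \<open>(p, q)\<close> is the rank-one matrix \<open>(column q) (row p) / a\<close> plus a matrix
  \<open>B\<close> whose row \<open>p\<close> and column \<open>q\<close> vanish; the factors of \<open>B\<close> are enlarged by one column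
  and one row, and the vanishing of row \<open>p\<close> and column \<open>q\<close> makes the one-sided inverses extend.
\<close>

lemma rank_factorization:
  fixes A :: "'a :: field mat"
  assumes "A \<in> carrier_mat n m"
  shows "\<exists>r j s j' s'. j \<in> carrier_mat n r \<and> s \<in> carrier_mat r m \<and> j' \<in> carrier_mat r n \<and>
    s' \<in> carrier_mat m r \<and> A = j * s \<and> j' * j = 1\<^sub>m r \<and> s * s' = 1\<^sub>m r"
  using assms
proof (induction "card {i. i < n \<and> (\<exists>c<m. A $$ (i, c) \<noteq> 0)}" arbitrary: A rule: less_induct)
  case less
  note A = less.prems
  show ?case
  proof (cases "\<exists>p<n. \<exists>q<m. A $$ (p, q) \<noteq> 0")
    case False
    then have "A = 0\<^sub>m n 0 * 0\<^sub>m 0 m" using A by (intro eq_matI) (auto simp: scalar_prod_def)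
    then show ?thesis
      by (intro exI[of _ 0] exI[of _ "0\<^sub>m n 0"] exI[of _ "0\<^sub>m 0 m"] exI[of _ "0\<^sub>m 0 n"]
          exI[of _ "0\<^sub>m m 0"]) (auto intro!: eq_matI)
  next
    case True
    then obtain p q where p: "p < n" and q: "q < m" and a0: "A $$ (p, q) \<noteq> 0" by blast
    define a where "a = A $$ (p, q)"
    have a: "a \<noteq> 0" using a0 by (simp add: a_def)
    define B where "B = mat n m (\<lambda>(i, c). A $$ (i, c) - A $$ (i, q) * A $$ (p, c) / a)"
    have B: "B \<in> carrier_mat n m" by (simp add: B_def)
    have Bi: "B $$ (i, c) = A $$ (i, c) - A $$ (i, q) * A $$ (p, c) / a" if "i < n" "c < m" for i c
      using that by (simp add: B_def)
    have Bp: "B $$ (p, c) = 0" if "c < m" for c using that p a by (simp add: Bi a_def)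
    have Bq: "B $$ (i, q) = 0" if "i < n" for i using that q a by (simp add: Bi a_def)
    have "card {i. i < n \<and> (\<exists>c<m. B $$ (i, c) \<noteq> 0)} < card {i. i < n \<and> (\<exists>c<m. A $$ (i, c) \<noteq> 0)}"
    proof (rule psubset_card_mono)
      show "{i. i < n \<and> (\<exists>c<m. B $$ (i, c) \<noteq> 0)} \<subset> {i. i < n \<and> (\<exists>c<m. A $$ (i, c) \<noteq> 0)}"
      proof
        show "{i. i < n \<and> (\<exists>c<m. B $$ (i, c) \<noteq> 0)} \<subseteq> {i. i < n \<and> (\<exists>c<m. A $$ (i, c) \<noteq> 0)}"
        proof clarify
          fix i c assume "i < n" "c < m" "B $$ (i, c) \<noteq> 0"
          then have "A $$ (i, c) \<noteq> 0 \<or> A $$ (i, q) \<noteq> 0" by (auto simp: Bi)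
          then show "\<exists>c<m. A $$ (i, c) \<noteq> 0" using q \<open>c < m\<close> by blast
        qed
        have "p \<in> {i. i < n \<and> (\<exists>c<m. A $$ (i, c) \<noteq> 0)}" using p q a0 by blast
        moreover have "p \<notin> {i. i < n \<and> (\<exists>c<m. B $$ (i, c) \<noteq> 0)}" using Bp by auto
        ultimately show "{i. i < n \<and> (\<exists>c<m. B $$ (i, c) \<noteq> 0)} \<noteq> {i. i < n \<and> (\<exists>c<m. A $$ (i, c) \<noteq> 0)}"
          by blast
      qed
    qed simp
    from less.hyps[OF this B] obtain r j s j' s' where
      j: "j \<in> carrier_mat n r" and s: "s \<in> carrier_mat r m" and j': "j' \<in> carrier_mat r n"
      and s': "s' \<in> carrier_mat m r" and Bjs: "B = j * s" and j'j: "j' * j = 1\<^sub>m r"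
      and ss': "s * s' = 1\<^sub>m r" by blast
    have "j = B * s'" using j s s' by (simp add: Bjs mat_assoc ss' mat_one_right)
    then have jp: "j $$ (p, l) = 0" if "l < r" for l
      using that index_mult_mat_sum[OF B s' p] Bp by simp
    have "s = j' * B" using j s j'
      by (simp add: Bjs mat_assoc[symmetric] j'j mat_one_left)
    then have sq: "s $$ (l, q) = 0" if "l < r" for l
      using that index_mult_mat_sum[OF j' B _ q] Bq by simp
    have jsi: "(\<Sum>l<r. j $$ (i, l) * s $$ (l, c)) = B $$ (i, c)" if "i < n" "c < m" for i c
      using index_mult_mat_sum[OF j s that] Bjs by simp
    have j'ji: "(\<Sum>l<n. j' $$ (i, l) * j $$ (l, c)) = (if i = c then 1 else 0)" if "i < r" "c < r" for i c
      using index_mult_mat_sum[OF j' j that] j'j that by simp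
    have ss'i: "(\<Sum>l<m. s $$ (i, l) * s' $$ (l, c)) = (if i = c then 1 else 0)" if "i < r" "c < r" for i c
      using index_mult_mat_sum[OF s s' that] ss' that by simp
    define J where "J = mat n (Suc r) (\<lambda>(i, l). if l = r then A $$ (i, q) / a else j $$ (i, l))"
    define S where "S = mat (Suc r) m (\<lambda>(l, c). if l = r then A $$ (p, c) else s $$ (l, c))"
    define X where "X l = (\<Sum>i<n. j' $$ (l, i) * A $$ (i, q)) / a" for l
    define Y where "Y l = (\<Sum>c<m. A $$ (p, c) * s' $$ (c, l)) / a" for l
    define J' where "J' = mat (Suc r) n (\<lambda>(l, i). if l = r then (if i = p then 1 else 0)
      else j' $$ (l, i) - (if i = p then X l else 0))"
    define S' where "S' = mat m (Suc r) (\<lambda>(c, l). if l = r then (if c = q then 1 / a else 0)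
      else s' $$ (c, l) - (if c = q then Y l else 0))"
    have carr: "J \<in> carrier_mat n (Suc r)" "S \<in> carrier_mat (Suc r) m"
      "J' \<in> carrier_mat (Suc r) n" "S' \<in> carrier_mat m (Suc r)"
      by (simp_all add: J_def S_def J'_def S'_def)
    have "A = J * S"
    proof (rule eq_matI)
      fix i c assume "i < dim_row (J * S)" "c < dim_col (J * S)"
      then have ic: "i < n" "c < m" using carr by auto
      have "(J * S) $$ (i, c) = (\<Sum>l<r. j $$ (i, l) * s $$ (l, c)) + A $$ (i, q) * A $$ (p, c) / a"
        unfolding index_mult_mat_sum[OF carr(1,2) ic] using ic by (simp add: J_def S_def)
      then show "A $$ (i, c) = (J * S) $$ (i, c)" using ic by (simp add: jsi Bi)
    qed (use A carr in auto)
    moreover have "J' * J = 1\<^sub>m (Suc r)"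
    proof (rule eq_matI)
      fix l c assume "l < dim_row (1\<^sub>m (Suc r) :: 'a mat)" "c < dim_col (1\<^sub>m (Suc r) :: 'a mat)"
      then have lc: "l < Suc r" "c < Suc r" by auto
      have eq: "(J' * J) $$ (l, c) = (\<Sum>i<n. J' $$ (l, i) * J $$ (i, c))"
        by (rule index_mult_mat_sum[OF carr(3,1) lc])
      consider "l = r" "c = r" | "l = r" "c < r" | "l < r" "c = r" | "l < r" "c < r" using lc by linarith
      then show "(J' * J) $$ (l, c) = 1\<^sub>m (Suc r) $$ (l, c)"
      proof cases
        case 1
        then have "(\<Sum>i<n. J' $$ (l, i) * J $$ (i, c)) = (\<Sum>i<n. if i = p then 1 else 0)"
          using a by (intro sum.cong) (auto simp: J'_def J_def a_def)
        then show ?thesis unfolding eq using p 1 by simp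
      next
        case 2
        then show ?thesis unfolding eq using p a
          by (simp add: J'_def J_def if_distrib[of "\<lambda>x. x * _"] sum.delta jp cong: if_cong)
      next
        case 3
        have "(\<Sum>i<n. J' $$ (l, i) * J $$ (i, c)) =
           (\<Sum>i<n. j' $$ (l, i) * A $$ (i, q) / a - (if i = p then X l * (A $$ (i, q) / a) else 0))"
          using 3 by (intro sum.cong) (auto simp: J'_def J_def algebra_simps diff_divide_distrib)
        also have "\<dots> = X l - X l * (A $$ (p, q) / a)"
          using p by (simp add: sum_subtractf X_def sum_divide_distrib)
        finally show ?thesis unfolding eq using 3 a by (simp add: a_def)
      next
        case 4
        have "(\<Sum>i<n. J' $$ (l, i) * J $$ (i, c)) =
           (\<Sum>i<n. j' $$ (l, i) * j $$ (i, c) - (if i = p then X l * j $$ (p, c) else 0))"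
          using 4 by (intro sum.cong) (auto simp: J'_def J_def algebra_simps)
        also have "\<dots> = (if l = c then 1 else 0)"
          using p 4 by (simp add: sum_subtractf j'ji jp)
        finally show ?thesis unfolding eq using 4 by simp
      qed
    qed (use carr in auto)
    moreover have "S * S' = 1\<^sub>m (Suc r)"
    proof (rule eq_matI)
      fix l c assume "l < dim_row (1\<^sub>m (Suc r) :: 'a mat)" "c < dim_col (1\<^sub>m (Suc r) :: 'a mat)"
      then have lc: "l < Suc r" "c < Suc r" by auto
      have eq: "(S * S') $$ (l, c) = (\<Sum>i<m. S $$ (l, i) * S' $$ (i, c))"
        by (rule index_mult_mat_sum[OF carr(2,4) lc])
      consider "l = r" "c = r" | "l = r" "c < r" | "l < r" "c = r" | "l < r" "c < r" using lc by linarith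
      then show "(S * S') $$ (l, c) = 1\<^sub>m (Suc r) $$ (l, c)"
      proof cases
        case 1
        then have "(\<Sum>i<m. S $$ (l, i) * S' $$ (i, c)) = (\<Sum>i<m. if i = q then 1 else 0)"
          using a by (intro sum.cong) (auto simp: S'_def S_def a_def)
        then show ?thesis unfolding eq using q 1 by simp
      next
        case 3
        then show ?thesis unfolding eq using q a
          by (simp add: S'_def S_def if_distrib[of "\<lambda>x. _ * x"] sum.delta sq cong: if_cong)
      next
        case 2
        have "(\<Sum>i<m. S $$ (l, i) * S' $$ (i, c)) =
           (\<Sum>i<m. A $$ (p, i) * s' $$ (i, c) - (if i = q then A $$ (p, q) * Y c else 0))"
          using 2 by (intro sum.cong) (auto simp: S'_def S_def algebra_simps)
        also have "\<dots> = a * Y c - A $$ (p, q) * Y c"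
          using q a by (simp add: sum_subtractf Y_def)
        finally show ?thesis unfolding eq using 2 a by (simp add: a_def)
      next
        case 4
        have "(\<Sum>i<m. S $$ (l, i) * S' $$ (i, c)) =
           (\<Sum>i<m. s $$ (l, i) * s' $$ (i, c) - (if i = q then s $$ (l, q) * Y c else 0))"
          using 4 by (intro sum.cong) (auto simp: S'_def S_def algebra_simps)
        also have "\<dots> = (if l = c then 1 else 0)"
          using q 4 by (simp add: sum_subtractf ss'i sq)
        finally show ?thesis unfolding eq using 4 by simp
      qed
    qed (use carr in auto)
    ultimately show ?thesis using carr by blast
  qed
qed

lemma finite_carrier_mat: "finite (carrier_mat n m :: 'a :: finite mat set)"
proof -
  have "carrier_mat n m \<subseteq> (\<lambda>f. mat n m f) ` (\<Pi>\<^sub>E x \<in> {..<n} \<times> {..<m}. (UNIV :: 'a set))"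
  proof
    fix A :: "'a mat" assume A: "A \<in> carrier_mat n m"
    then have "A = mat n m (restrict (\<lambda>x. A $$ x) ({..<n} \<times> {..<m}))" by (intro eq_matI) auto
    moreover have "restrict (\<lambda>x. A $$ x) ({..<n} \<times> {..<m}) \<in> (\<Pi>\<^sub>E x \<in> {..<n} \<times> {..<m}. (UNIV :: 'a set))"
      by auto
    ultimately show "A \<in> (\<lambda>f. mat n m f) ` (\<Pi>\<^sub>E x \<in> {..<n} \<times> {..<m}. (UNIV :: 'a set))"
      by (rule image_eqI)
  qed
  moreover have "finite (\<Pi>\<^sub>E x \<in> {..<n} \<times> {..<m}. (UNIV :: 'a set))" by (intro finite_PiE) auto
  ultimately show ?thesis by (meson finite_imageI finite_subset)
qed

lemma card_carrier_mat: "card (carrier_mat n m :: 'a :: finite mat set) = card (UNIV :: 'a set) ^ (n * m)"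
proof -
  have "bij_betw (\<lambda>f. mat n m f) (\<Pi>\<^sub>E x \<in> {..<n} \<times> {..<m}. (UNIV :: 'a set)) (carrier_mat n m)"
  proof (rule bij_betwI[where g = "\<lambda>A. restrict (\<lambda>x. A $$ x) ({..<n} \<times> {..<m})"])
    fix f assume "f \<in> (\<Pi>\<^sub>E x \<in> {..<n} \<times> {..<m}. (UNIV :: 'a set))"
    then show "restrict (\<lambda>x. mat n m f $$ x) ({..<n} \<times> {..<m}) = f"
      by (intro ext) (auto simp: restrict_def PiE_def extensional_def, (metis lessThan_iff)+)
  qed (auto intro!: eq_matI)
  from bij_betw_same_card[OF this] show ?thesis by (simp add: card_PiE)
qed

text \<open>
  Over a finite field the comparison of dimensions is a count: right multiplication by \<open>A\<close> embeds
  the row vectors of length \<open>n\<close> into those of length \<open>m\<close>.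
\<close>

lemma dim_le_of_right_inverse:
  fixes A :: "'a :: {finite, field} mat"
  assumes A: "A \<in> carrier_mat n m" and B: "B \<in> carrier_mat m n" and AB: "A * B = 1\<^sub>m n"
  shows "n \<le> m"
proof -
  have "inj_on (\<lambda>v. v * A) (carrier_mat 1 n)"
  proof (rule inj_on_inverseI)
    fix v :: "'a mat" assume "v \<in> carrier_mat 1 n"
    then show "v * A * B = v" using A B AB by (simp add: mat_assoc mat_one_right)
  qed
  moreover have "(\<lambda>v. v * A) ` carrier_mat 1 n \<subseteq> carrier_mat 1 m" using A by auto
  ultimately have "card (carrier_mat 1 n :: 'a mat set) \<le> card (carrier_mat 1 m :: 'a mat set)"
    by (rule card_inj_on_le) (rule finite_carrier_mat)
  moreover have "1 < card (UNIV :: 'a set)"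
    using card_mono[of UNIV "{0, 1 :: 'a}"] by simp
  ultimately show ?thesis by (simp add: card_carrier_mat)
qed

text \<open>
  In the rank factorization the rank is at most \<open>n\<close>, and if it is \<open>n\<close>, then \<open>j\<close> is invertible, so that \<open>A\<close> is
  right invertible along with \<open>s\<close>. Being singular is used throughout in the form of this factorization.
\<close>

lemma not_right_invertible_factors:
  fixes A :: "'a :: {finite, field} mat"
  assumes A: "A \<in> carrier_mat n m" and no: "\<And>B. B \<in> carrier_mat m n \<Longrightarrow> A * B \<noteq> 1\<^sub>m n"
  obtains r j s where "r < n" "j \<in> carrier_mat n r" "s \<in> carrier_mat r m" "A = j * s"
proof -
  obtain r j s j' s' where j: "j \<in> carrier_mat n r" and s: "s \<in> carrier_mat r m"
    and j': "j' \<in> carrier_mat r n" and s': "s' \<in> carrier_mat m r" and eq: "A = j * s"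
    and j'j: "j' * j = 1\<^sub>m r" and ss': "s * s' = 1\<^sub>m r"
    using rank_factorization[OF A] by blast
  have "r \<le> n" using dim_le_of_right_inverse[OF j' j j'j] .
  moreover have "r \<noteq> n"
  proof
    assume r: "r = n"
    then have "j * j' = 1\<^sub>m n" using mat_mult_left_right_inverse[of j' n j] j j' j'j by simp
    then have "A * (s' * j') = 1\<^sub>m n" using j s j' s' ss' r
      by (simp add: eq mat_assoc mat_assoc[of s s' j', symmetric] mat_one_left)
    with no[of "s' * j'"] s' j' r show False by simp
  qed
  ultimately show ?thesis using that[of r j s] j s eq by linarith
qed

lemma not_left_invertible_factors:
  fixes A :: "'a :: {finite, field} mat"
  assumes A: "A \<in> carrier_mat n m" and no: "\<And>B. B \<in> carrier_mat m n \<Longrightarrow> B * A \<noteq> 1\<^sub>m m"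
  obtains r j s where "r < m" "j \<in> carrier_mat n r" "s \<in> carrier_mat r m" "A = j * s"
proof -
  have "transpose_mat A * B \<noteq> 1\<^sub>m m" if B: "B \<in> carrier_mat n m" for B
  proof
    assume "transpose_mat A * B = 1\<^sub>m m"
    then have "transpose_mat B * A = 1\<^sub>m m"
      using A B by (metis transpose_mult transpose_one transpose_transpose transpose_carrier_mat)
    with no[of "transpose_mat B"] B show False by simp
  qed
  from A have "transpose_mat A \<in> carrier_mat m n" by simp
  from not_right_invertible_factors[OF this \<open>\<And>B. B \<in> carrier_mat n m \<Longrightarrow> transpose_mat A * B \<noteq> 1\<^sub>m m\<close>]
  obtain r j s where "r < m" and j: "j \<in> carrier_mat m r" and s: "s \<in> carrier_mat r n"
    and "transpose_mat A = j * s"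
    by blast
  from \<open>transpose_mat A = j * s\<close> j s have "A = transpose_mat s * transpose_mat j" by (metis transpose_mult transpose_transpose)
  with that[OF \<open>r < m\<close>, of "transpose_mat s" "transpose_mat j"] j s show ?thesis by simp
qed

text \<open>
  A finite vector space over \<open>\<int>/p\<close> has \<open>p\<close>-power order: a Sylow subgroup for another prime would
  contain a nonzero element killed both by \<open>p\<close> and by a power of that prime.
\<close>

lemma prime_divisor_card_eq_CHAR:
  assumes l: "prime l" and dvd: "l dvd card (UNIV :: 'a :: {finite, field} set)"
  shows "l = CHAR('a)"
proof (rule ccontr)
  assume neq: "l \<noteq> CHAR('a)"
  have p: "prime CHAR('a)" using prime_CHAR_semidom finite_imp_CHAR_pos[where ?'a = 'a] by auto
  define G where "G = \<lparr>carrier = (UNIV :: 'a set), monoid.mult = (+), one = (0 :: 'a)\<rparr>"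
  interpret G: group G
  proof (rule groupI)
    fix x assume x: "x \<in> carrier G"
    show "\<exists>y\<in>carrier G. y \<otimes>\<^bsub>G\<^esub> x = \<one>\<^bsub>G\<^esub>"
      by (intro bexI[of _ "-x"]) (auto simp: G_def)
  qed (auto simp: G_def add_ac)
  obtain k where k: "card (UNIV :: 'a set) = l ^ 1 * k" using dvd by (auto elim: dvdE)
  have "\<exists>H. subgroup H G \<and> card H = l ^ 1"
    by (rule sylow_thm[OF l G.is_group, of 1 k]) (use k in \<open>auto simp: G_def Coset.order_def\<close>)
  then obtain H where H: "subgroup H G" and cH: "card H = l" by auto
  interpret H: group "G\<lparr>carrier := H\<rparr>" by (rule G.subgroup_imp_group[OF H])
  have pow: "x [^]\<^bsub>G\<^esub> (m :: nat) = of_nat m * x" for x m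
    by (induction m) (auto simp: G_def nat_pow_def algebra_simps)
  have "x = 0" if x: "x \<in> H" for x
  proof -
    have "x [^]\<^bsub>G\<lparr>carrier := H\<rparr>\<^esub> Coset.order (G\<lparr>carrier := H\<rparr>) = \<one>\<^bsub>G\<lparr>carrier := H\<rparr>\<^esub>"
      by (rule H.pow_order_eq_1) (use x in simp)
    then have "x [^]\<^bsub>G\<^esub> l = \<one>\<^bsub>G\<^esub>"
      using cH by (simp add: Coset.order_def nat_pow_def)
    then have lx: "of_nat l * x = 0" by (simp add: pow) (simp add: G_def)
    have "\<not> CHAR('a) dvd l" using neq l p by (metis primes_dvd_imp_eq)
    then have "of_nat l \<noteq> (0 :: 'a)" by (simp add: of_nat_eq_0_iff_char_dvd)
    with lx show "x = 0" by simp
  qed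
  then have "H \<subseteq> {0}" by auto
  then have "card H \<le> 1" using card_mono[of "{0 :: 'a}" H] by simp
  with cH l show False using prime_gt_1_nat[of l] by simp
qed

section \<open>The Kovacs idempotent\<close>

text \<open>
  A function \<open>e\<close> on \<open>n \<times> n\<close> matrices stands for the element \<open>\<Sum>c. e c [c]\<close> of the integral
  monoid ring. Its product with a matrix \<open>j\<close> vanishes iff the sums below vanish for all functions \<open>f\<close>
  (take indicator functions); in this form no convolution product is needed.
\<close>

definition kills_left :: "nat \<Rightarrow> ('f :: {finite, field} mat \<Rightarrow> int) \<Rightarrow> nat \<Rightarrow> bool" where
  "kills_left n e r \<longleftrightarrow> (\<forall>j \<in> carrier_mat n r. \<forall>f :: 'f mat \<Rightarrow> int.
     (\<Sum>c \<in> carrier_mat n n. e c * f (c * j)) = 0)"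

definition kills_right :: "nat \<Rightarrow> ('f :: {finite, field} mat \<Rightarrow> int) \<Rightarrow> nat \<Rightarrow> bool" where
  "kills_right n e r \<longleftrightarrow> (\<forall>s \<in> carrier_mat r n. \<forall>f :: 'f mat \<Rightarrow> int.
     (\<Sum>c \<in> carrier_mat n n. e c * f (s * c)) = 0)"

text \<open>
  \<open>e\<close> is \<open>N [1]\<close> plus a combination of singular matrices, with \<open>N\<close> a power of the order of the
  field.
\<close>

definition unipotent_mod_singular :: "nat \<Rightarrow> int \<Rightarrow> ('f :: {finite, field} mat \<Rightarrow> int) \<Rightarrow> bool" where
  "unipotent_mod_singular n N e \<longleftrightarrow> (\<exists>a. N = int (card (UNIV :: 'f set)) ^ a) \<and> e (1\<^sub>m n) = N \<and>
     (\<forall>g \<in> carrier_mat n n. \<forall>h \<in> carrier_mat n n. g * h = 1\<^sub>m n \<longrightarrow> g \<noteq> 1\<^sub>m n \<longrightarrow> e g = 0)"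

lemma sum_delta_mat:
  assumes "finite A" "\<And>x. x \<in> A \<Longrightarrow> x \<noteq> a \<Longrightarrow> h x = 0" "a \<in> A"
  shows "sum h A = (h a :: int)"
  using assms by (subst sum.remove[of A a]) auto

lemma sum_pushforward:
  fixes F w :: "_ \<Rightarrow> int"
  assumes "finite A" "\<And>x. x \<in> X \<Longrightarrow> D x \<in> A"
  shows "(\<Sum>c \<in> A. (\<Sum>x \<in> X. if D x = c then w x else 0) * F c) = (\<Sum>x \<in> X. w x * F (D x))"
proof -
  have "(\<Sum>c \<in> A. (\<Sum>x \<in> X. if D x = c then w x else 0) * F c) =
    (\<Sum>c \<in> A. \<Sum>x \<in> X. if D x = c then w x * F (D x) else 0)"
    by (auto simp: sum_distrib_right intro!: sum.cong)
  also have "\<dots> = (\<Sum>x \<in> X. \<Sum>c \<in> A. if D x = c then w x * F (D x) else 0)" by (rule sum.swap)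
  also have "\<dots> = (\<Sum>x \<in> X. w x * F (D x))" using assms by (intro sum.cong) simp_all
  finally show ?thesis .
qed

text \<open>
  Let \<open>j\<close> be a split monomorphism with retraction \<open>j'\<close> and let the image of \<open>i\<close> not be contained in
  that of \<open>j\<close>. The matrices \<open>b\<close> with given \<open>b j = \<beta>\<close> are \<open>\<beta> j' + z\<close> with \<open>z j = 0\<close>, and the
  products \<open>z i\<close> include all \<open>v \<rho>\<close> for some row \<open>\<rho> \<noteq> 0\<close>. So the sum over these \<open>b\<close> depends only on
  the restriction of \<open>\<beta> j' i\<close> to the hyperplane \<open>\<rho> = 0\<close>, so that \<open>e\<close> kills it.
\<close>

lemma sum_over_lifts_eq_0:
  fixes e :: "'f :: {finite, field} mat \<Rightarrow> int"
  assumes e: "\<And>k. k < r \<Longrightarrow> kills_left r e k"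
    and j: "j \<in> carrier_mat n r" and j': "j' \<in> carrier_mat r n" and j'j: "j' * j = 1\<^sub>m r"
    and i: "i \<in> carrier_mat n r" and ne: "i - j * (j' * i) \<noteq> 0\<^sub>m n r"
  shows "(\<Sum>b \<in> carrier_mat r n. e (b * j) * h (b * i)) = 0"
proof -
  define Z :: "'f mat set" where "Z = {z \<in> carrier_mat r n. z * j = 0\<^sub>m r r}"
  have Z0: "\<beta> * j' + z \<in> carrier_mat r n" "(\<beta> * j' + z) * j = \<beta>"
    if "\<beta> \<in> carrier_mat r r" "z \<in> Z" for \<beta> z
    using that j j' j'j by (auto simp: Z_def mat_add_distrib mat_assoc mat_one_right)
  define H where "H \<beta> = (\<Sum>z \<in> Z. h ((\<beta> * j' + z) * i))" for \<beta>
  have "(\<Sum>b \<in> carrier_mat r n. e (b * j) * h (b * i)) =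
    (\<Sum>(\<beta>, z) \<in> carrier_mat r r \<times> Z. e \<beta> * h ((\<beta> * j' + z) * i))"
  proof (rule sum.reindex_bij_witness[of _ "\<lambda>(\<beta>, z). \<beta> * j' + z" "\<lambda>b. (b * j, b - b * j * j')"])
    fix b :: "'f mat" assume b: "b \<in> carrier_mat r n"
    show "(case (b * j, b - b * j * j') of (\<beta>, z) \<Rightarrow> \<beta> * j' + z) = b"
      using b j j' by (auto intro!: eq_matI)
    then show "(case (b * j, b - b * j * j') of (\<beta>, z) \<Rightarrow> e \<beta> * h ((\<beta> * j' + z) * i)) =
      e (b * j) * h (b * i)" by simp
    have "(b - b * j * j') * j = 0\<^sub>m r r"
      using b j j' j'j by (simp add: mat_diff_distrib mat_assoc mat_one_right)
    then show "(b * j, b - b * j * j') \<in> carrier_mat r r \<times> Z" using b j j' by (auto simp: Z_def)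
  next
    fix x :: "'f mat \<times> 'f mat" assume "x \<in> carrier_mat r r \<times> Z"
    then obtain \<beta> z where x: "x = (\<beta>, z)" and b: "\<beta> \<in> carrier_mat r r" and z: "z \<in> Z" by auto
    show "(case x of (\<beta>, z) \<Rightarrow> \<beta> * j' + z) \<in> carrier_mat r n" using Z0[OF b z] x by simp
    have "\<beta> * j' + z - \<beta> * j' = z" using b z j' by (auto simp: Z_def intro!: eq_matI)
    then show "((case x of (\<beta>, z) \<Rightarrow> \<beta> * j' + z) * j,
        (case x of (\<beta>, z) \<Rightarrow> \<beta> * j' + z) - (case x of (\<beta>, z) \<Rightarrow> \<beta> * j' + z) * j * j') = x"
      using Z0[OF b z] x by simp
  qed
  also have "\<dots> = (\<Sum>\<beta> \<in> carrier_mat r r. e \<beta> * H \<beta>)"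
    by (simp add: sum.cartesian_product[symmetric] H_def sum_distrib_left)
  also have "\<dots> = 0"
  proof -
    define i2 where "i2 = i - j * (j' * i)"
    have i2: "i2 \<in> carrier_mat n r" unfolding i2_def using i j j' by (intro carrier_matI) auto
    have "\<exists>p<n. \<exists>t<r. i2 $$ (p, t) \<noteq> 0"
    proof (rule ccontr)
      assume "\<not> ?thesis"
      then have "i2 = 0\<^sub>m n r" using i2 by (intro eq_matI) auto
      with ne show False by (simp add: i2_def)
    qed
    then obtain p t where p: "p < n" and t: "t < r" and a: "i2 $$ (p, t) \<noteq> 0" by blast
    define \<rho> where "\<rho> = mat 1 r (\<lambda>(_, c). i2 $$ (p, c))"
    define E where "E = mat r 1 (\<lambda>(l, _). if l = t then 1 / i2 $$ (p, t) else 0)"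
    define R where "R = mat 1 n (\<lambda>(_, c). if c = p then 1 else (0 :: 'f))"
    have carr: "\<rho> \<in> carrier_mat 1 r" "E \<in> carrier_mat r 1" "R \<in> carrier_mat 1 n"
      by (simp_all add: \<rho>_def E_def R_def)
    have \<rho>E: "\<rho> * E = 1\<^sub>m 1"
      using t a carr by (intro eq_matI) (auto simp: scalar_prod_def \<rho>_def E_def if_distrib cong: if_cong)
    have Ri2: "R * i2 = \<rho>"
      using p i2 carr by (intro eq_matI)
        (auto simp: scalar_prod_def \<rho>_def R_def if_distrib[of "\<lambda>x. x * _"] cong: if_cong)
    \<comment> \<open>\<open>T\<close> is \<open>j' i\<close> after the projection along \<open>E\<close> onto the hyperplane \<open>\<rho> = 0\<close>; it is singular, as \<open>T E = 0\<close>\<close>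
    define T where "T = j' * i - (j' * i) * E * \<rho>"
    have T: "T \<in> carrier_mat r r" unfolding T_def using j' i carr by (intro carrier_matI) auto
    have TE: "T * E = 0\<^sub>m r 1"
      using j' i carr \<rho>E by (simp add: T_def mat_diff_distrib mat_assoc mat_one_right)
    have "B * T \<noteq> 1\<^sub>m r" if B: "B \<in> carrier_mat r r" for B
    proof
      assume "B * T = 1\<^sub>m r"
      then have "E = B * (T * E)" using B T carr by (simp add: mat_assoc[symmetric] mat_one_left)
      then have "\<rho> * E = 0\<^sub>m 1 1" using B carr by (simp add: TE)
      with \<rho>E have "(1\<^sub>m 1 :: 'f mat) $$ (0, 0) = 0\<^sub>m 1 1 $$ (0, 0)" by simp
      then show False by simp
    qed
    then obtain k j1 s1 where k: "k < r" and j1: "j1 \<in> carrier_mat r k" and s1: "s1 \<in> carrier_mat k r"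
      and Tjs: "T = j1 * s1" using not_left_invertible_factors[OF T] by blast
    \<comment> \<open>\<open>H \<beta>\<close> depends on \<open>\<beta> T\<close> only: the difference \<open>v \<rho>\<close> of the products with \<open>j' i\<close> is absorbed by translating \<open>z\<close> by \<open>z0\<close>\<close>
    have shift: "H \<beta> = H \<beta>'"
      if b: "\<beta> \<in> carrier_mat r r" and b': "\<beta>' \<in> carrier_mat r r" and eq: "\<beta> * T = \<beta>' * T" for \<beta> \<beta>'
    proof -
      define v where "v = \<beta> * (j' * i) * E - \<beta>' * (j' * i) * E"
      have v: "v \<in> carrier_mat r 1" unfolding v_def using b b' j' i carr by (intro carrier_matI) auto
      define z0 where "z0 = v * R - v * R * j * j'"
      have z0c: "z0 \<in> carrier_mat r n"
        unfolding z0_def using v carr j j' by (intro carrier_matI) auto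
      have "z0 * j = 0\<^sub>m r r" using v carr j j' j'j
        by (simp add: z0_def mat_diff_distrib mat_assoc mat_one_right)
      with z0c have z0: "z0 \<in> Z" by (simp add: Z_def)
      have "z0 * i = v * R * i2" using v carr j j' i
        by (simp add: z0_def i2_def mat_diff_distrib mat_mult_diff_distrib mat_assoc)
      also have "\<dots> = v * \<rho>" using v carr i2 Ri2 by (simp add: mat_assoc)
      also have "\<dots> = \<beta> * (j' * i) * E * \<rho> - \<beta>' * (j' * i) * E * \<rho>"
        using b b' j' i carr by (simp add: v_def mat_diff_distrib)
      finally have z0i: "z0 * i = \<beta> * (j' * i) * E * \<rho> - \<beta>' * (j' * i) * E * \<rho>" .
      have "\<beta> * (j' * i) - \<beta> * (j' * i) * E * \<rho> = \<beta>' * (j' * i) - \<beta>' * (j' * i) * E * \<rho>"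
        using eq b b' j' i carr by (simp add: T_def mat_mult_diff_distrib mat_assoc)
      moreover define X1 X2 Y1 Y2 where "X1 = \<beta> * (j' * i)" "X2 = \<beta>' * (j' * i)"
        "Y1 = \<beta> * (j' * i) * E * \<rho>" "Y2 = \<beta>' * (j' * i) * E * \<rho>"
      ultimately have *: "X1 - Y1 = X2 - Y2" by simp
      have dims: "X1 \<in> carrier_mat r r" "X2 \<in> carrier_mat r r" "Y1 \<in> carrier_mat r r" "Y2 \<in> carrier_mat r r"
        unfolding X1_X2_Y1_Y2_def using b b' j' i carr by (auto intro!: carrier_matI)
      have "X1 = X2 + (Y1 - Y2)"
      proof (rule eq_matI)
        fix u w assume uw: "u < dim_row (X2 + (Y1 - Y2))" "w < dim_col (X2 + (Y1 - Y2))"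
        have "(X1 - Y1) $$ (u, w) = (X2 - Y2) $$ (u, w)" using * by simp
        then show "X1 $$ (u, w) = (X2 + (Y1 - Y2)) $$ (u, w)" using uw dims by (auto simp: algebra_simps)
      qed (use dims in auto)
      then have key: "\<beta> * (j' * i) = \<beta>' * (j' * i) + z0 * i" by (simp add: z0i X1_X2_Y1_Y2_def)
      have "(\<Sum>z \<in> Z. h ((\<beta> * j' + z) * i)) = (\<Sum>z \<in> Z. h ((\<beta>' * j' + z) * i))"
      proof (rule sum.reindex_bij_witness[of _ "\<lambda>z. z - z0" "\<lambda>z. z0 + z"])
        fix z assume z: "z \<in> Z"
        show "z0 + z - z0 = z" "z0 + (z - z0) = z" using z z0 by (auto simp: Z_def intro!: eq_matI)
        show "z0 + z \<in> Z" "z - z0 \<in> Z" using z z0 j by (auto simp: Z_def mat_add_distrib mat_diff_distrib)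
        have zc: "z \<in> carrier_mat r n" using z by (simp add: Z_def)
        have "(\<beta>' * j' + (z0 + z)) * i = \<beta>' * (j' * i) + (z0 * i + z * i)"
          using zc z0c b' j' i by (simp add: mat_add_distrib mat_assoc)
        also have "\<dots> = \<beta> * (j' * i) + z * i"
          using zc z0c b' j' i assoc_add_mat[of "\<beta>' * (j' * i)" r r "z0 * i" "z * i"]
          by (simp add: key)
        also have "\<dots> = (\<beta> * j' + z) * i" using zc b j' i by (simp add: mat_add_distrib mat_assoc)
        finally show "h ((\<beta>' * j' + (z0 + z)) * i) = h ((\<beta> * j' + z) * i)" by simp
      qed
      then show ?thesis by (simp add: H_def)
    qed
    \<comment> \<open>A choice of \<open>\<beta>\<close> for given \<open>\<beta> T\<close> turns \<open>H\<close> into a function of \<open>\<beta> T\<close>.\<close>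
    define f where "f y = H (SOME \<beta>. \<beta> \<in> carrier_mat r r \<and> \<beta> * T = y)" for y
    have f: "f (\<beta> * T) = H \<beta>" if "\<beta> \<in> carrier_mat r r" for \<beta>
    proof -
      have "(SOME \<gamma>. \<gamma> \<in> carrier_mat r r \<and> \<gamma> * T = \<beta> * T) \<in> carrier_mat r r \<and>
        (SOME \<gamma>. \<gamma> \<in> carrier_mat r r \<and> \<gamma> * T = \<beta> * T) * T = \<beta> * T" by (rule someI) (use that in simp)
      then show ?thesis unfolding f_def using shift that by blast
    qed
    have "(\<Sum>\<beta> \<in> carrier_mat r r. e \<beta> * H \<beta>) = (\<Sum>\<beta> \<in> carrier_mat r r. e \<beta> * f (\<beta> * j1 * s1))"
      using j1 s1 by (intro sum.cong) (auto simp: mat_assoc Tjs[symmetric] f)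
    also have "\<dots> = 0"
      using e[OF k] j1 unfolding kills_left_def by (elim ballE[of _ _ j1] allE[of _ "\<lambda>x. f (x * s1)"]) auto
    finally show ?thesis .
  qed
  finally show ?thesis .
qed

lemma kills_left_comp:
  assumes "kills_left n e k" "j \<in> carrier_mat n k" "s \<in> carrier_mat k m"
  shows "(\<Sum>c \<in> carrier_mat n n. e c * f (c * (j * s))) = 0"
proof -
  have "(\<Sum>c \<in> carrier_mat n n. e c * f (c * (j * s))) = (\<Sum>c \<in> carrier_mat n n. e c * f (c * j * s))"
    using assms by (intro sum.cong) (auto simp: mat_assoc)
  also have "\<dots> = 0" using assms(1,2) unfolding kills_left_def by (elim ballE[of _ _ j] allE[of _ "\<lambda>x. f (x * s)"]) auto
  finally show ?thesis .
qed

text \<open>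
  The fibre of \<open>b \<mapsto> b j\<close> over \<open>\<beta>\<close> is the translate by \<open>\<beta> j'\<close> of the solutions of \<open>z j = 0\<close>. All
  fibres have the same size, which is found by counting all \<open>r \<times> n\<close> matrices.
\<close>

lemma sum_over_fibres:
  fixes j :: "'f :: {finite, field} mat"
  assumes j: "j \<in> carrier_mat n r" and j': "j' \<in> carrier_mat r n" and j'j: "j' * j = 1\<^sub>m r"
  shows "(\<Sum>b \<in> carrier_mat r n. F (b * j)) =
    int (card (UNIV :: 'f set)) ^ (r * (n - r)) * (\<Sum>\<beta> \<in> carrier_mat r r. F \<beta>)"
proof -
  define Z :: "'f mat set" where "Z = {z \<in> carrier_mat r n. z * j = 0\<^sub>m r r}"
  have finZ: "finite Z" unfolding Z_def by (simp add: finite_carrier_mat)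
  have gen: "(\<Sum>b \<in> carrier_mat r n. F (b * j)) = int (card Z) * (\<Sum>\<beta> \<in> carrier_mat r r. F \<beta>)" for F :: "_ \<Rightarrow> int"
  proof -
    have "(\<Sum>b \<in> carrier_mat r n. F (b * j)) = (\<Sum>\<beta> \<in> carrier_mat r r. \<Sum>b \<in> {b \<in> carrier_mat r n. b * j = \<beta>}. F (b * j))"
      using j by (intro sum.group[symmetric] finite_carrier_mat) auto
    also have "\<dots> = (\<Sum>\<beta> \<in> carrier_mat r r. int (card Z) * F \<beta>)"
    proof (rule sum.cong[OF refl])
      fix \<beta> :: "'f mat" assume b: "\<beta> \<in> carrier_mat r r"
      have "card {b \<in> carrier_mat r n. b * j = \<beta>} = card Z"
      proof (rule bij_betw_same_card[OF bij_betw_byWitness[where f' = "\<lambda>z. \<beta> * j' + z"]])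
        show "\<forall>x \<in> {b \<in> carrier_mat r n. b * j = \<beta>}. \<beta> * j' + (x - \<beta> * j') = x"
          using b j' by (auto intro!: eq_matI)
        show "\<forall>z \<in> Z. \<beta> * j' + z - \<beta> * j' = z" using b j' by (auto simp: Z_def intro!: eq_matI)
        show "(\<lambda>x. x - \<beta> * j') ` {b \<in> carrier_mat r n. b * j = \<beta>} \<subseteq> Z"
        proof
          fix y assume "y \<in> (\<lambda>x. x - \<beta> * j') ` {b \<in> carrier_mat r n. b * j = \<beta>}"
          then obtain x where x: "x \<in> carrier_mat r n" and xj: "x * j = \<beta>" and y: "y = x - \<beta> * j'" by blast
          have "y * j = x * j - \<beta>" using x b j j' j'j
            by (simp add: y mat_diff_distrib mat_assoc mat_one_right)
          moreover have "y \<in> carrier_mat r n" unfolding y using x b j' by (intro carrier_matI) auto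
          ultimately show "y \<in> Z" using b by (simp add: Z_def xj)
        qed
        show "(\<lambda>z. \<beta> * j' + z) ` Z \<subseteq> {b \<in> carrier_mat r n. b * j = \<beta>}"
          using b j j' j'j by (auto simp: Z_def mat_add_distrib mat_assoc mat_one_right)
      qed
      then show "(\<Sum>b \<in> {b \<in> carrier_mat r n. b * j = \<beta>}. F (b * j)) = int (card Z) * F \<beta>" by simp
    qed
    finally show ?thesis by (simp add: sum_distrib_left)
  qed
  have "r \<le> n" using dim_le_of_right_inverse[OF j' j j'j] .
  then have "r * n = r * (n - r) + r * r" by (metis add_mult_distrib2 le_add_diff_inverse2)
  then have "int (card (UNIV :: 'f set)) ^ (r * (n - r)) * int (card (UNIV :: 'f set)) ^ (r * r) =
      int (card Z) * int (card (UNIV :: 'f set)) ^ (r * r)"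
    using gen[of "\<lambda>_. 1"] by (simp add: card_carrier_mat power_add)
  moreover have "card (UNIV :: 'f set) \<noteq> 0" by simp
  ultimately show ?thesis using gen by simp
qed

text \<open>
  One step of the construction. The element \<open>e1\<close> is \<open>e0 (N - \<Sum>j b. er (b j) [j b])\<close>, where \<open>j\<close>
  runs over one injective matrix for each subspace of dimension \<open>r\<close> and \<open>b\<close> over all \<open>r \<times> n\<close>
  matrices. Applied to an injective \<open>i\<close> with the same image as a representative \<open>j\<close>, only the terms for
  this \<open>j\<close> survive (\<open>sum_over_lifts_eq_0\<close>); by \<open>sum_over_fibres\<close> they sum to \<open>N [i]\<close> modulo matrices of rank less than
  \<open>r\<close>, which \<open>e0\<close> kills.
\<close>

lemma kill_next_rank:
  fixes er e0 :: "'f :: {finite, field} mat \<Rightarrow> int"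
  assumes rn: "r < n" and er: "unipotent_mod_singular r Nr er" "\<And>k. k < r \<Longrightarrow> kills_left r er k"
    and e0: "unipotent_mod_singular n N0 e0" "\<And>k. k < r \<Longrightarrow> kills_left n e0 k"
  shows "\<exists>N1 e1 :: 'f mat \<Rightarrow> int. unipotent_mod_singular n N1 e1 \<and> (\<forall>k \<le> r. kills_left n e1 k)"
proof -
  define q where "q = int (card (UNIV :: 'f set))"
  define Inj :: "'f mat set" where "Inj = {i \<in> carrier_mat n r. \<exists>i' \<in> carrier_mat r n. i' * i = 1\<^sub>m r}"
  define rep where "rep i = (SOME j. j \<in> Inj \<and> (\<exists>g \<in> carrier_mat r r. i = j * g))" for i
  define J where "J = rep ` Inj"
  have rep: "rep i \<in> Inj \<and> (\<exists>g \<in> carrier_mat r r. i = rep i * g)" if "i \<in> Inj" for i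
  proof -
    have "i = i * 1\<^sub>m r" using that by (auto simp: Inj_def mat_one_right)
    then have "i \<in> Inj \<and> (\<exists>g \<in> carrier_mat r r. i = i * g)" using that one_carrier_mat by blast
    then show ?thesis unfolding rep_def by (rule someI)
  qed
  have finJ: "finite J" unfolding J_def Inj_def by (simp add: finite_carrier_mat)
  have JI: "j \<in> Inj" if "j \<in> J" for j using that rep unfolding J_def by blast
  have Jc: "j \<in> carrier_mat n r" if "j \<in> J" for j using JI[OF that] by (simp add: Inj_def)
  \<comment> \<open>\<open>rep\<close> depends on the image of its argument only, as \<open>g\<close> is invertible\<close>
  have rep_eq: "rep i = rep (i * g)" if i: "i \<in> Inj" and g: "g \<in> carrier_mat r r" and ig: "i * g \<in> Inj" for i g
  proof -
    from ig obtain i' where i': "i' \<in> carrier_mat r n" "i' * (i * g) = 1\<^sub>m r" unfolding Inj_def by blast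
    have ic: "i \<in> carrier_mat n r" using i by (simp add: Inj_def)
    have "(i' * i) * g = 1\<^sub>m r" using i' ic g by (simp add: mat_assoc)
    then have gi: "g * (i' * i) = 1\<^sub>m r" using mat_mult_left_right_inverse[of "i' * i" r g] i' ic g by simp
    have iff: "(\<exists>h \<in> carrier_mat r r. i = j * h) \<longleftrightarrow> (\<exists>h \<in> carrier_mat r r. i * g = j * h)" if "j \<in> Inj" for j
    proof
      assume "\<exists>h \<in> carrier_mat r r. i = j * h"
      then obtain h where "h \<in> carrier_mat r r" "i = j * h" by blast
      then show "\<exists>h \<in> carrier_mat r r. i * g = j * h" using that g
        by (intro bexI[of _ "h * g"]) (auto simp: Inj_def mat_assoc)
    next
      assume "\<exists>h \<in> carrier_mat r r. i * g = j * h"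
      then obtain h where h: "h \<in> carrier_mat r r" "i * g = j * h" by blast
      have jc: "j \<in> carrier_mat n r" using that by (simp add: Inj_def)
      have "i = i * (g * (i' * i))" using ic by (simp add: gi mat_one_right)
      also have "\<dots> = i * g * (i' * i)" using ic g i' by (simp add: mat_assoc)
      also have "\<dots> = j * (h * (i' * i))" using h jc ic i' by (simp add: mat_assoc)
      finally have "i = j * (h * (i' * i))" .
      moreover have "h * (i' * i) \<in> carrier_mat r r" using h ic i' by simp
      ultimately show "\<exists>h \<in> carrier_mat r r. i = j * h" by blast
    qed
    have "(\<lambda>j. j \<in> Inj \<and> (\<exists>h \<in> carrier_mat r r. i = j * h)) =
        (\<lambda>j. j \<in> Inj \<and> (\<exists>h \<in> carrier_mat r r. i * g = j * h))"
      using iff by (intro ext) blast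
    then show ?thesis unfolding rep_def by (rule arg_cong)
  qed
  define N1 where "N1 = N0 * (q ^ (r * (n - r)) * Nr)"
  \<comment> \<open>\<open>w\<close> and \<open>D\<close> list the coefficients and the matrices of \<open>e0 \<Sum>j b. er (b j) [j b]\<close>\<close>
  define X where "X = J \<times> (carrier_mat r n :: 'f mat set) \<times> (carrier_mat n n :: 'f mat set)"
  define D :: "'f mat \<times> 'f mat \<times> 'f mat \<Rightarrow> 'f mat" where "D = (\<lambda>(j, b, d). d * (j * b))"
  define w where "w = (\<lambda>(j, b, d). e0 d * er (b * j))"
  define e1 where "e1 c = q ^ (r * (n - r)) * Nr * e0 c - (\<Sum>x \<in> X. if D x = c then w x else 0)" for c
  have e1_inv: "e1 g = q ^ (r * (n - r)) * Nr * e0 g"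
    if g: "g \<in> carrier_mat n n" and h: "h \<in> carrier_mat n n" and gh: "g * h = 1\<^sub>m n" for g h
  proof -
    have "d * (j * b) \<noteq> g" if d: "d \<in> carrier_mat n n" and j: "j \<in> J" and b: "b \<in> carrier_mat r n" for d j b
    proof
      assume "d * (j * b) = g"
      then have "(d * j) * (b * h) = 1\<^sub>m n" using gh d Jc[OF j] b h by (auto simp: mat_assoc)
      then have "n \<le> r" using dim_le_of_right_inverse[of "d * j" n r "b * h"] d Jc[OF j] b h by auto
      then show False using rn by simp
    qed
    then have "D x \<noteq> g" if "x \<in> X" for x using that by (auto simp: X_def D_def)
    then show ?thesis by (simp add: e1_def)
  qed
  have "\<exists>a. N0 = q ^ a" "\<exists>a. Nr = q ^ a"
    using e0(1) er(1) by (simp_all only: unipotent_mod_singular_def q_def)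
  then obtain a0 ar where a: "N0 = q ^ a0" "Nr = q ^ ar" by blast
  have "N1 = q ^ (a0 + (r * (n - r) + ar))" by (simp add: N1_def a power_add)
  moreover have "e1 (1\<^sub>m n) = N1"
    using e1_inv[of "1\<^sub>m n" "1\<^sub>m n"] e0(1) by (simp add: unipotent_mod_singular_def N1_def)
  moreover have "e1 g = 0" if "g \<in> carrier_mat n n" "h \<in> carrier_mat n n" "g * h = 1\<^sub>m n" "g \<noteq> 1\<^sub>m n" for g h
    using e1_inv[OF that(1-3)] e0(1) that by (auto simp: unipotent_mod_singular_def)
  ultimately have uni: "unipotent_mod_singular n N1 e1"
    unfolding unipotent_mod_singular_def q_def by blast
  have kill: "(\<Sum>c \<in> carrier_mat n n. e1 c * f (c * i)) = 0"
    if k: "k \<le> r" and i: "i \<in> carrier_mat n k" for k i and f :: "'f mat \<Rightarrow> int"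
  proof -
    define F where "F x = (\<Sum>d \<in> carrier_mat n n. e0 d * f (d * x))" for x
    have F0: "F (y * s) = 0" if "y \<in> carrier_mat n l" "s \<in> carrier_mat l m" "l < r" for y s l m
      unfolding F_def using kills_left_comp[OF e0(2)] that by blast
    have "(\<Sum>c \<in> carrier_mat n n. e1 c * f (c * i)) = q ^ (r * (n - r)) * Nr * F i -
      (\<Sum>c \<in> carrier_mat n n. (\<Sum>x \<in> X. if D x = c then w x else 0) * f (c * i))"
      by (simp add: e1_def left_diff_distrib sum_subtractf F_def sum_distrib_left mult.assoc)
    moreover have "(\<Sum>c \<in> carrier_mat n n. (\<Sum>x \<in> X. if D x = c then w x else 0) * f (c * i)) =
      (\<Sum>x \<in> X. w x * f (D x * i))"
      by (rule sum_pushforward[OF finite_carrier_mat]) (auto simp: X_def D_def Jc)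
    moreover have "\<dots> = (\<Sum>j \<in> J. \<Sum>b \<in> carrier_mat r n. er (b * j) * F (j * (b * i)))"
    proof -
      have "(\<Sum>x \<in> X. w x * f (D x * i)) =
        (\<Sum>(j, b, d) \<in> X. er (b * j) * (e0 d * f (d * (j * (b * i)))))"
        using i by (intro sum.cong) (auto simp: X_def w_def D_def mult_ac mat_assoc dest!: Jc)
      then show ?thesis by (simp add: X_def F_def sum.cartesian_product[symmetric] sum_distrib_left)
    qed
    ultimately have split: "(\<Sum>c \<in> carrier_mat n n. e1 c * f (c * i)) =
      q ^ (r * (n - r)) * Nr * F i - (\<Sum>j \<in> J. \<Sum>b \<in> carrier_mat r n. er (b * j) * F (j * (b * i)))"
      by (simp only:)
    show ?thesis
    \<comment> \<open>if \<open>i\<close> is not injective of rank \<open>r\<close>, then it factors through a smaller dimension and \<open>e0\<close> kills every term\<close>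
    proof (cases "\<exists>i' \<in> carrier_mat k n. i' * i = 1\<^sub>m k \<and> k = r")
      case False
      have "\<exists>l x s. l < r \<and> x \<in> carrier_mat n l \<and> s \<in> carrier_mat l k \<and> i = x * s"
      proof (cases "k = r")
        case True
        then have "\<And>B. B \<in> carrier_mat k n \<Longrightarrow> B * i \<noteq> 1\<^sub>m k" using False by blast
        from not_left_invertible_factors[OF i this] True show ?thesis by metis
      next
        case False
        with k i show ?thesis by (intro exI[of _ k] exI[of _ i] exI[of _ "1\<^sub>m k"]) auto
      qed
      then obtain l x s where l: "l < r" and x: "x \<in> carrier_mat n l" and s: "s \<in> carrier_mat l k" and i_eq: "i = x * s"
        by blast
      have "F (j * (b * i)) = 0" if "j \<in> J" "b \<in> carrier_mat r n" for j b
        using F0[of "j * (b * x)" l s k] Jc[OF that(1)] that(2) x s l by (simp add: i_eq mat_assoc)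
      moreover have "F i = 0" using F0[OF x s l] by (simp add: i_eq)
      ultimately show ?thesis by (simp add: split)
    next
      case True
      then have iI: "i \<in> Inj" and kr: "k = r" using i unfolding Inj_def by blast+
      then have ic: "i \<in> carrier_mat n r" using i by simp
      define j0 where "j0 = rep i"
      obtain g where j0: "j0 \<in> Inj" and g: "g \<in> carrier_mat r r" and ig: "i = j0 * g"
        using rep[OF iI] unfolding j0_def by blast
      have j0J: "j0 \<in> J" using iI by (simp add: J_def j0_def)
      obtain j0' where j0': "j0' \<in> carrier_mat r n" "j0' * j0 = 1\<^sub>m r" and j0c: "j0 \<in> carrier_mat n r"
        using j0 unfolding Inj_def by blast
      have other: "(\<Sum>b \<in> carrier_mat r n. er (b * j) * F (j * (b * i))) = 0" if j: "j \<in> J" and ne: "j \<noteq> j0" for j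
      proof -
        obtain j' where j': "j' \<in> carrier_mat r n" "j' * j = 1\<^sub>m r" using JI[OF j] unfolding Inj_def by blast
        have "i - j * (j' * i) \<noteq> 0\<^sub>m n r"
        proof
          assume z: "i - j * (j' * i) = 0\<^sub>m n r"
          have "i = j * (j' * i)"
          proof (rule eq_matI)
            fix u w assume uw: "u < dim_row (j * (j' * i))" "w < dim_col (j * (j' * i))"
            have "(i - j * (j' * i)) $$ (u, w) = 0\<^sub>m n r $$ (u, w)" using z by simp
            then show "i $$ (u, w) = (j * (j' * i)) $$ (u, w)" using uw ic Jc[OF j] by auto
          qed (use ic Jc[OF j] in auto)
          then have "rep i = rep j" using rep_eq[OF JI[OF j], of "j' * i"] j' ic iI by simp
          moreover have "rep j = j"
          proof -
            obtain x where x: "x \<in> Inj" "j = rep x" using j unfolding J_def by blast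
            obtain h where h: "h \<in> carrier_mat r r" "x = j * h" using rep[OF x(1)] unfolding x(2) by blast
            then show ?thesis using rep_eq[OF JI[OF j] h(1)] x by simp
          qed
          ultimately show False using ne by (simp add: j0_def)
        qed
        from sum_over_lifts_eq_0[where h = "\<lambda>x. F (j * x)", OF er(2) Jc[OF j] j' ic this] show ?thesis .
      qed
      have "(\<Sum>j \<in> J. \<Sum>b \<in> carrier_mat r n. er (b * j) * F (j * (b * i))) =
          (\<Sum>b \<in> carrier_mat r n. er (b * j0) * F (j0 * (b * i)))"
        by (rule sum_delta_mat[OF finJ other j0J])
      also have "\<dots> = (\<Sum>b \<in> carrier_mat r n. er (b * j0) * F (j0 * (b * j0 * g)))"
        using j0c g by (intro sum.cong) (auto simp: ig mat_assoc)
      also have "\<dots> = q ^ (r * (n - r)) * (\<Sum>\<beta> \<in> carrier_mat r r. er \<beta> * F (j0 * (\<beta> * g)))"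
        unfolding q_def by (rule sum_over_fibres[OF j0c j0'])
      finally have "(\<Sum>j \<in> J. \<Sum>b \<in> carrier_mat r n. er (b * j) * F (j * (b * i))) =
        q ^ (r * (n - r)) * (\<Sum>\<beta> \<in> carrier_mat r r. er \<beta> * F (j0 * (\<beta> * g)))" .
      moreover have "(\<Sum>\<beta> \<in> carrier_mat r r. er \<beta> * F (j0 * (\<beta> * g))) = er (1\<^sub>m r) * F (j0 * (1\<^sub>m r * g))"
      proof (rule sum_delta_mat)
        fix \<beta> :: "'f mat" assume b: "\<beta> \<in> carrier_mat r r" and ne: "\<beta> \<noteq> 1\<^sub>m r"
        show "er \<beta> * F (j0 * (\<beta> * g)) = 0"
        proof (cases "\<exists>h \<in> carrier_mat r r. \<beta> * h = 1\<^sub>m r")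
          case True
          then show ?thesis using er(1) b ne by (auto simp: unipotent_mod_singular_def)
        next
          case False
          then obtain l x s where "l < r" "x \<in> carrier_mat r l" "s \<in> carrier_mat l r" "\<beta> = x * s"
            using not_right_invertible_factors[OF b] by blast
          then show ?thesis using F0[of "j0 * x" l "s * g" r] j0c g by (simp add: mat_assoc)
        qed
      qed (simp_all add: finite_carrier_mat)
      moreover have "er (1\<^sub>m r) * F (j0 * (1\<^sub>m r * g)) = Nr * F i"
        using er(1) g by (simp add: unipotent_mod_singular_def mat_one_left ig)
      ultimately show ?thesis by (simp add: split)
    qed
  qed
  show ?thesis using uni kill unfolding kills_left_def by blast
qed

text \<open>
  The outer induction supplies the left killer of size \<open>r\<close> that the step from rank \<open>r\<close> to the next one
  uses, the inner one goes through the ranks below \<open>n\<close>.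
\<close>

lemma ex_left_killer:
  "\<exists>N (e :: 'f :: {finite, field} mat \<Rightarrow> int). unipotent_mod_singular n N e \<and> (\<forall>k < n. kills_left n e k)"
proof (induction n rule: less_induct)
  case (less n)
  have "\<exists>N (e :: 'f mat \<Rightarrow> int). unipotent_mod_singular n N e \<and> (\<forall>k < r. kills_left n e k)" if "r \<le> n" for r
    using that
  proof (induction r)
    case 0
    define e :: "'f mat \<Rightarrow> int" where "e c = (if c = 1\<^sub>m n then 1 else 0)" for c
    have "unipotent_mod_singular n 1 e"
      unfolding unipotent_mod_singular_def by (auto simp: e_def intro!: exI[of _ 0])
    then show ?case by blast
  next
    case (Suc r)
    then obtain N0 N and e0 e :: "'f mat \<Rightarrow> int" where
      "unipotent_mod_singular n N0 e0" "\<forall>k < r. kills_left n e0 k"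
      "unipotent_mod_singular r N e" "\<forall>k < r. kills_left r e k"
      using less[of r] by auto
    from kill_next_rank[of r n N e N0 e0] this Suc.prems show ?case by (auto simp: less_Suc_eq_le)
  qed
  then show ?case by blast
qed

text \<open>
  Transposition turns a left killer \<open>x = N + s\<close> into a right killer \<open>y = N' + t\<close>, with \<open>s\<close> and \<open>t\<close>
  supported on singular matrices. As \<open>x t = 0 = s y\<close>, the product \<open>x y\<close> equals both
  \<open>N' x\<close> and \<open>N y\<close>, which is therefore a killer on both sides.
\<close>

theorem ex_kovacs_element:
  "\<exists>N (e :: 'f :: {finite, field} mat \<Rightarrow> int). unipotent_mod_singular n N e \<and>
     (\<forall>k < n. kills_left n e k \<and> kills_right n e k)"
proof -
  obtain N and x :: "'f mat \<Rightarrow> int" where x: "unipotent_mod_singular n N x" "\<forall>k < n. kills_left n x k"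
    using ex_left_killer by blast
  define y where "y c = x (transpose_mat c)" for c
  have T: "bij_betw transpose_mat (carrier_mat n n) (carrier_mat n n :: 'f mat set)"
    by (rule bij_betwI[where g = transpose_mat]) auto
  have y: "(\<Sum>c \<in> carrier_mat n n. y c * f (s * c)) = 0"
    if k: "k < n" and s: "s \<in> carrier_mat k n" for k s and f :: "'f mat \<Rightarrow> int"
  proof -
    have "(\<Sum>c \<in> carrier_mat n n. y c * f (s * c)) =
      (\<Sum>c \<in> carrier_mat n n. x (transpose_mat c) * f (transpose_mat (transpose_mat c * transpose_mat s)))"
      using s by (intro sum.cong) (auto simp: y_def transpose_mult[of _ n n _ k])
    also have "\<dots> = (\<Sum>c \<in> carrier_mat n n. x c * f (transpose_mat (c * transpose_mat s)))"
      by (rule sum.reindex_bij_betw[OF T])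
    also have "\<dots> = 0" using x(2) k s unfolding kills_left_def
      by (elim allE[of _ k] impE ballE[of _ _ "transpose_mat s"] allE[of _ "\<lambda>c. f (transpose_mat c)"]) auto
    finally show ?thesis .
  qed
  have y_inv: "y g = 0" if "g \<in> carrier_mat n n" "h \<in> carrier_mat n n" "g * h = 1\<^sub>m n" "g \<noteq> 1\<^sub>m n" for g h
  proof -
    have "h * g = 1\<^sub>m n" using mat_mult_left_right_inverse that by blast
    then have "transpose_mat g * transpose_mat h = 1\<^sub>m n" using that
      by (metis transpose_mult transpose_one)
    moreover have "transpose_mat g \<noteq> 1\<^sub>m n" using that(4) by (metis transpose_one transpose_transpose)
    ultimately show ?thesis using x(1) that(1,2)
      unfolding unipotent_mod_singular_def y_def by (metis transpose_carrier_mat)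
  qed
  have y1: "y (1\<^sub>m n) = N" using x(1) by (simp add: y_def unipotent_mod_singular_def)
  have xy: "(\<Sum>c \<in> carrier_mat n n. \<Sum>d \<in> carrier_mat n n. x c * y d * f (c * d)) = N * (\<Sum>c \<in> carrier_mat n n. x c * f c)"
    for f :: "'f mat \<Rightarrow> int"
  proof -
    have "(\<Sum>c \<in> carrier_mat n n. \<Sum>d \<in> carrier_mat n n. x c * y d * f (c * d)) =
      (\<Sum>d \<in> carrier_mat n n. y d * (\<Sum>c \<in> carrier_mat n n. x c * f (c * d)))"
      by (subst sum.swap) (simp add: sum_distrib_left mult_ac)
    also have "\<dots> = y (1\<^sub>m n) * (\<Sum>c \<in> carrier_mat n n. x c * f (c * 1\<^sub>m n))"
    proof (rule sum_delta_mat)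
      fix d :: "'f mat" assume d: "d \<in> carrier_mat n n" and ne: "d \<noteq> 1\<^sub>m n"
      show "y d * (\<Sum>c \<in> carrier_mat n n. x c * f (c * d)) = 0"
      proof (cases "\<exists>h \<in> carrier_mat n n. d * h = 1\<^sub>m n")
        case True
        then show ?thesis using y_inv d ne by auto
      next
        case False
        then obtain l u s where "l < n" "u \<in> carrier_mat n l" "s \<in> carrier_mat l n" "d = u * s"
          using not_right_invertible_factors[OF d] by blast
        then show ?thesis using kills_left_comp[of n x l u s n f] x(2) by auto
      qed
    qed (simp_all add: finite_carrier_mat)
    finally show ?thesis by (simp add: y1 right_mult_one_mat)
  qed
  have yx: "(\<Sum>c \<in> carrier_mat n n. \<Sum>d \<in> carrier_mat n n. x c * y d * f (c * d)) = N * (\<Sum>d \<in> carrier_mat n n. y d * f d)"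
    for f :: "'f mat \<Rightarrow> int"
  proof -
    have "(\<Sum>c \<in> carrier_mat n n. \<Sum>d \<in> carrier_mat n n. x c * y d * f (c * d)) =
      (\<Sum>c \<in> carrier_mat n n. x c * (\<Sum>d \<in> carrier_mat n n. y d * f (c * d)))"
      by (simp add: sum_distrib_left mult_ac)
    also have "\<dots> = x (1\<^sub>m n) * (\<Sum>d \<in> carrier_mat n n. y d * f (1\<^sub>m n * d))"
    proof (rule sum_delta_mat)
      fix c :: "'f mat" assume c: "c \<in> carrier_mat n n" and ne: "c \<noteq> 1\<^sub>m n"
      show "x c * (\<Sum>d \<in> carrier_mat n n. y d * f (c * d)) = 0"
      proof (cases "\<exists>h \<in> carrier_mat n n. c * h = 1\<^sub>m n")
        case True
        then show ?thesis using x(1) c ne by (auto simp: unipotent_mod_singular_def)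
      next
        case False
        then obtain l u s where l: "l < n" and u: "u \<in> carrier_mat n l" and s: "s \<in> carrier_mat l n" and eq: "c = u * s"
          using not_right_invertible_factors[OF c] by blast
        have "(\<Sum>d \<in> carrier_mat n n. y d * f (c * d)) = (\<Sum>d \<in> carrier_mat n n. y d * f (u * (s * d)))"
          using u s by (intro sum.cong) (auto simp: eq mat_assoc)
        also have "\<dots> = 0" by (rule y[OF l s])
        finally show ?thesis by simp
      qed
    qed (simp_all add: finite_carrier_mat)
    also have "\<dots> = N * (\<Sum>d \<in> carrier_mat n n. y d * f d)"
      using x(1) by (auto simp: unipotent_mod_singular_def left_mult_one_mat intro!: sum.cong)
    finally show ?thesis .
  qed
  have N: "N \<noteq> 0" using x(1) by (auto simp: unipotent_mod_singular_def)
  have eq: "(\<Sum>c \<in> carrier_mat n n. x c * f c) = (\<Sum>c \<in> carrier_mat n n. y c * f c)" for f :: "'f mat \<Rightarrow> int"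
    using xy[of f] yx[of f] N by simp
  have "kills_right n x k" if "k < n" for k
    unfolding kills_right_def using eq y[OF that] by simp
  with x show ?thesis by blast
qed

section \<open>Equivalences of categories\<close>

context category
begin

lemma Comp_assoc':
  "\<lbrakk>W \<in> Obj C; X \<in> Obj C; Y \<in> Obj C; Z \<in> Obj C; f \<in> Hom C W X; g \<in> Hom C X Y; h \<in> Hom C Y Z\<rbrakk>
    \<Longrightarrow> Comp C W X Z (Comp C X Y Z h g) f = Comp C W Y Z h (Comp C W X Y g f)"
  using Comp_assoc by simp

lemma is_isoE:
  assumes "is_iso C X Y f"
  obtains g where "f \<in> Hom C X Y" "g \<in> Hom C Y X" "Comp C X Y X g f = Ident C X"
    "Comp C Y X Y f g = Ident C Y"
  using assms unfolding is_iso_def by blast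

lemma is_iso_Comp:
  assumes X: "X \<in> Obj C" and Y: "Y \<in> Obj C" and Z: "Z \<in> Obj C"
    and f: "is_iso C X Y f" and g: "is_iso C Y Z g"
  shows "is_iso C X Z (Comp C X Y Z g f)"
proof -
  obtain f' where f': "f \<in> Hom C X Y" "f' \<in> Hom C Y X" "Comp C X Y X f' f = Ident C X"
    "Comp C Y X Y f f' = Ident C Y" using f by (rule is_isoE)
  obtain g' where g': "g \<in> Hom C Y Z" "g' \<in> Hom C Z Y" "Comp C Y Z Y g' g = Ident C Y"
    "Comp C Z Y Z g g' = Ident C Z" using g by (rule is_isoE)
  have a: "Comp C X Z X (Comp C Z Y X f' g') (Comp C X Y Z g f) = Ident C X"
  proof -
    have "Comp C X Z X (Comp C Z Y X f' g') (Comp C X Y Z g f) =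
      Comp C X Y X f' (Comp C X Z Y g' (Comp C X Y Z g f))"
      using X Y Z f' g' by (simp add: Comp_assoc' Comp_closed)
    also have "Comp C X Z Y g' (Comp C X Y Z g f) = f"
      using X Y Z f' g' by (simp add: Comp_assoc Comp_Ident_left)
    finally show ?thesis using f' by simp
  qed
  have b: "Comp C Z X Z (Comp C X Y Z g f) (Comp C Z Y X f' g') = Ident C Z"
  proof -
    have "Comp C Z X Z (Comp C X Y Z g f) (Comp C Z Y X f' g') =
      Comp C Z Y Z g (Comp C Z X Y f (Comp C Z Y X f' g'))"
      using X Y Z f' g' by (simp add: Comp_assoc' Comp_closed)
    also have "Comp C Z X Y f (Comp C Z Y X f' g') = g'"
      using X Y Z f' g' by (simp add: Comp_assoc Comp_Ident_left)
    finally show ?thesis using g' by simp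
  qed
  show ?thesis unfolding is_iso_def
    using a b X Y Z f' g' Comp_closed[of X Y Z f g] Comp_closed[of Z Y X g' f'] by blast
qed

end

lemma is_functorD:
  assumes "is_functor C D F"
  shows "X \<in> Obj C \<Longrightarrow> omap F X \<in> Obj D"
    and "\<lbrakk>X \<in> Obj C; Y \<in> Obj C; f \<in> Hom C X Y\<rbrakk> \<Longrightarrow> amap F X Y f \<in> Hom D (omap F X) (omap F Y)"
    and "X \<in> Obj C \<Longrightarrow> amap F X X (Ident C X) = Ident D (omap F X)"
    and "\<lbrakk>X \<in> Obj C; Y \<in> Obj C; Z \<in> Obj C; f \<in> Hom C X Y; g \<in> Hom C Y Z\<rbrakk> \<Longrightarrow>
      amap F X Z (Comp C X Y Z g f)
      = Comp D (omap F X) (omap F Y) (omap F Z) (amap F Y Z g) (amap F X Y f)"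
  using assms unfolding is_functor_def by blast+

lemma is_functor_iso:
  assumes F: "is_functor C D F" and X: "X \<in> Obj C" and Y: "Y \<in> Obj C" and f: "is_iso C X Y f"
  shows "is_iso D (omap F X) (omap F Y) (amap F X Y f)"
proof -
  obtain g where g: "f \<in> Hom C X Y" "g \<in> Hom C Y X" "Comp C X Y X g f = Ident C X"
    "Comp C Y X Y f g = Ident C Y" using f unfolding is_iso_def by blast
  show ?thesis unfolding is_iso_def
  proof (intro conjI bexI[of _ "amap F Y X g"])
    show "amap F X Y f \<in> Hom D (omap F X) (omap F Y)" "amap F Y X g \<in> Hom D (omap F Y) (omap F X)"
      using is_functorD(2)[OF F] X Y g by blast+
    show "Comp D (omap F X) (omap F Y) (omap F X) (amap F Y X g) (amap F X Y f) = Ident D (omap F X)"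
      using is_functorD(4)[OF F X Y X g(1,2)] is_functorD(3)[OF F X] g by simp
    show "Comp D (omap F Y) (omap F X) (omap F Y) (amap F X Y f) (amap F Y X g) = Ident D (omap F Y)"
      using is_functorD(4)[OF F Y X Y g(2,1)] is_functorD(3)[OF F Y] g by simp
  qed
qed

lemma comp_functor_sel:
  "omap (comp_functor G F) X = omap G (omap F X)"
  "amap (comp_functor G F) X Y f = amap G (omap F X) (omap F Y) (amap F X Y f)"
  by (simp_all add: comp_functor_def)

lemma id_functor_sel: "omap id_functor X = X" "amap id_functor X Y f = f"
  by (simp_all add: id_functor_def)

lemma is_functor_comp:
  assumes "is_functor C D F" "is_functor D E G"
  shows "is_functor C E (comp_functor G F)"
  using assms by (simp add: is_functor_def comp_functor_sel)

lemma is_linear_functor_comp: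
  assumes "is_linear_functor K C D F" "is_linear_functor K D E G"
  shows "is_linear_functor K C E (comp_functor G F)"
proof -
  have "amap (comp_functor G F) X Y = (\<lambda>f. amap G (omap F X) (omap F Y) (amap F X Y f))" for X Y
    by (intro ext) (simp add: comp_functor_sel)
  moreover have "omap F X \<in> Obj D" if "X \<in> Obj C" for X
    using is_functorD(1) assms(1) that unfolding is_linear_functor_def by metis
  ultimately show ?thesis
    using assms is_functor_comp[of C D F E G]
    by (simp add: is_linear_functor_def comp_functor_sel module_hom_def Pi_def)
qed

text \<open>
  These properties are easier to establish than an equivalence in the sense of a pair of functors, and
  they compose.
\<close>

definition weak_equivalence ::
    "('o, 'a, 'y) cat_scheme \<Rightarrow> ('p, 'b, 'z) cat_scheme \<Rightarrow> ('o, 'a, 'p, 'b) fctr \<Rightarrow> bool" where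
  "weak_equivalence C D F \<longleftrightarrow> is_functor C D F \<and>
     (\<forall>X \<in> Obj C. \<forall>Y \<in> Obj C. bij_betw (amap F X Y) (Hom C X Y) (Hom D (omap F X) (omap F Y))) \<and>
     (\<forall>Z \<in> Obj D. \<exists>X \<in> Obj C. \<exists>f. is_iso D (omap F X) Z f)"

lemma weak_equivalence_comp:
  assumes F: "weak_equivalence C D F" and G: "weak_equivalence D E G" and E: "category E"
  shows "weak_equivalence C E (comp_functor G F)"
proof -
  interpret E: category E by fact
  have fF: "is_functor C D F" and fG: "is_functor D E G" using F G by (simp_all add: weak_equivalence_def)
  have "\<exists>X \<in> Obj C. \<exists>f. is_iso E (omap G (omap F X)) Z f" if Z: "Z \<in> Obj E" for Z
  proof -
    obtain Y g where Y: "Y \<in> Obj D" and g: "is_iso E (omap G Y) Z g"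
      using G Z unfolding weak_equivalence_def by blast
    obtain X f where X: "X \<in> Obj C" and f: "is_iso D (omap F X) Y f"
      using F Y unfolding weak_equivalence_def by blast
    have FX: "omap F X \<in> Obj D" using is_functorD(1)[OF fF X] .
    have "is_iso E (omap G (omap F X)) (omap G Y) (amap G (omap F X) Y f)"
      by (rule is_functor_iso[OF fG FX Y f])
    from E.is_iso_Comp[OF _ _ Z this g] is_functorD(1)[OF fG] FX Y X show ?thesis by blast
  qed
  moreover have "bij_betw (\<lambda>f. amap G (omap F X) (omap F Y) (amap F X Y f)) (Hom C X Y)
      (Hom E (omap G (omap F X)) (omap G (omap F Y)))" if "X \<in> Obj C" "Y \<in> Obj C" for X Y
  proof -
    have "bij_betw (amap F X Y) (Hom C X Y) (Hom D (omap F X) (omap F Y))"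
      "bij_betw (amap G (omap F X) (omap F Y)) (Hom D (omap F X) (omap F Y)) (Hom E (omap G (omap F X)) (omap G (omap F Y)))"
      using F G that is_functorD(1)[OF fF] by (simp_all add: weak_equivalence_def)
    from bij_betw_trans[OF this] show ?thesis by (simp add: comp_def)
  qed
  moreover have "(amap (comp_functor G F) X Y) = (\<lambda>f. amap G (omap F X) (omap F Y) (amap F X Y f))" for X Y
    by (intro ext) (simp add: comp_functor_sel)
  ultimately show ?thesis
    using is_functor_comp[OF fF fG] by (simp add: weak_equivalence_def comp_functor_sel)
qed

locale weakly_equivalent_categories = C: category C + D: category D
  for C :: "('o, 'a, 'y) cat_scheme" and D :: "('p, 'b, 'z) cat_scheme" +
  fixes F :: "('o, 'a, 'p, 'b) fctr"
  assumes weak_equivalence: "weak_equivalence C D F"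
begin

lemma F_functor: "is_functor C D F"
  using weak_equivalence by (simp add: weak_equivalence_def)

lemmas F_rules = is_functorD[OF F_functor]

lemma amap_inject:
  assumes "X \<in> Obj C" "Y \<in> Obj C" "f \<in> Hom C X Y" "g \<in> Hom C X Y" "amap F X Y f = amap F X Y g"
  shows "f = g"
  using assms weak_equivalence unfolding weak_equivalence_def by (metis bij_betw_def inj_onD)

definition lift where "lift X Y g = the_inv_into (Hom C X Y) (amap F X Y) g"

lemma lift:
  assumes "X \<in> Obj C" "Y \<in> Obj C" "g \<in> Hom D (omap F X) (omap F Y)"
  shows "lift X Y g \<in> Hom C X Y" "amap F X Y (lift X Y g) = g"
proof -
  have b: "bij_betw (amap F X Y) (Hom C X Y) (Hom D (omap F X) (omap F Y))"
    using assms weak_equivalence unfolding weak_equivalence_def by blast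
  show "amap F X Y (lift X Y g) = g"
    unfolding lift_def by (rule f_the_inv_into_f_bij_betw[OF b]) (use assms(3) in simp)
  show "lift X Y g \<in> Hom C X Y"
    unfolding lift_def using bij_betw_the_inv_into[OF b] assms(3) by (metis bij_betwE)
qed

lemma ex_preimage:
  assumes "Z \<in> Obj D"
  obtains X f f' where "X \<in> Obj C" "f \<in> Hom D (omap F X) Z" "f' \<in> Hom D Z (omap F X)"
    "Comp D (omap F X) Z (omap F X) f' f = Ident D (omap F X)"
    "Comp D Z (omap F X) Z f f' = Ident D Z"
  using weak_equivalence assms unfolding weak_equivalence_def is_iso_def by blast

text \<open>
  An object of \<open>C\<close> over each object of \<open>D\<close>, with an isomorphism and its inverse. They are the object map and the
  counit of a quasi-inverse.
\<close>

definition pre where "pre Z = (SOME X. X \<in> Obj C \<and> (\<exists>f. is_iso D (omap F X) Z f))"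

definition counit where "counit Z = (SOME f. is_iso D (omap F (pre Z)) Z f)"

definition counit' where
  "counit' Z = (SOME f'. f' \<in> Hom D Z (omap F (pre Z)) \<and>
     Comp D (omap F (pre Z)) Z (omap F (pre Z)) f' (counit Z) = Ident D (omap F (pre Z)) \<and>
     Comp D Z (omap F (pre Z)) Z (counit Z) f' = Ident D Z)"

lemma counit:
  assumes Z: "Z \<in> Obj D"
  shows "pre Z \<in> Obj C" "counit Z \<in> Hom D (omap F (pre Z)) Z" "counit' Z \<in> Hom D Z (omap F (pre Z))"
    "Comp D (omap F (pre Z)) Z (omap F (pre Z)) (counit' Z) (counit Z) = Ident D (omap F (pre Z))"
    "Comp D Z (omap F (pre Z)) Z (counit Z) (counit' Z) = Ident D Z"
proof -
  have 1: "pre Z \<in> Obj C \<and> (\<exists>f. is_iso D (omap F (pre Z)) Z f)"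
    unfolding pre_def by (rule someI_ex) (use weak_equivalence Z in \<open>unfold weak_equivalence_def, blast\<close>)
  then have 2: "is_iso D (omap F (pre Z)) Z (counit Z)"
    unfolding counit_def by (blast intro: someI_ex)
  then have 3: "counit' Z \<in> Hom D Z (omap F (pre Z)) \<and>
     Comp D (omap F (pre Z)) Z (omap F (pre Z)) (counit' Z) (counit Z) = Ident D (omap F (pre Z)) \<and>
     Comp D Z (omap F (pre Z)) Z (counit Z) (counit' Z) = Ident D Z"
    unfolding counit'_def is_iso_def by - (rule someI_ex, blast)
  show "pre Z \<in> Obj C" "counit Z \<in> Hom D (omap F (pre Z)) Z" "counit' Z \<in> Hom D Z (omap F (pre Z))"
    "Comp D (omap F (pre Z)) Z (omap F (pre Z)) (counit' Z) (counit Z) = Ident D (omap F (pre Z))"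
    "Comp D Z (omap F (pre Z)) Z (counit Z) (counit' Z) = Ident D Z"
    using 1 2 3 by (simp_all add: is_iso_def)
qed

lemma omap_pre: "Z \<in> Obj D \<Longrightarrow> omap F (pre Z) \<in> Obj D"
  using counit(1) F_rules(1) by blast

definition conjugate where
  "conjugate Z W h = Comp D (omap F (pre Z)) W (omap F (pre W)) (counit' W) (Comp D (omap F (pre Z)) Z W h (counit Z))"

lemma conjugate_closed:
  "\<lbrakk>Z \<in> Obj D; W \<in> Obj D; h \<in> Hom D Z W\<rbrakk> \<Longrightarrow> conjugate Z W h \<in> Hom D (omap F (pre Z)) (omap F (pre W))"
  unfolding conjugate_def using counit omap_pre by (intro D.Comp_closed)

lemma counit_conjugate:
  assumes "Z \<in> Obj D" "W \<in> Obj D" "h \<in> Hom D Z W"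
  shows "Comp D (omap F (pre Z)) (omap F (pre W)) W (counit W) (conjugate Z W h) =
    Comp D (omap F (pre Z)) Z W h (counit Z)"
proof -
  have h: "Comp D (omap F (pre Z)) Z W h (counit Z) \<in> Hom D (omap F (pre Z)) W"
    using assms counit omap_pre by (intro D.Comp_closed)
  show ?thesis unfolding conjugate_def
    using assms counit omap_pre h
      D.Comp_assoc[of "omap F (pre Z)" W "omap F (pre W)" W _ "counit' W" "counit W"]
    by (simp add: D.Comp_Ident_left)
qed

lemma conjugate_unique:
  assumes "Z \<in> Obj D" "W \<in> Obj D" "h \<in> Hom D Z W" "k \<in> Hom D (omap F (pre Z)) (omap F (pre W))"
    and "Comp D (omap F (pre Z)) (omap F (pre W)) W (counit W) k = Comp D (omap F (pre Z)) Z W h (counit Z)"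
  shows "k = conjugate Z W h"
  unfolding conjugate_def assms(5)[symmetric]
  using assms counit omap_pre D.Comp_assoc[of "omap F (pre Z)" "omap F (pre W)" W "omap F (pre W)" k "counit W" "counit' W"]
  by (simp add: D.Comp_Ident_left)

lemma conjugate_Ident: "Z \<in> Obj D \<Longrightarrow> conjugate Z Z (Ident D Z) = Ident D (omap F (pre Z))"
  by (rule conjugate_unique[symmetric]) (simp_all add: counit omap_pre D.Ident_closed D.Comp_Ident_left D.Comp_Ident_right)

lemma conjugate_Comp:
  assumes Z: "Z \<in> Obj D" and W: "W \<in> Obj D" and V: "V \<in> Obj D" and h: "h \<in> Hom D Z W" and k: "k \<in> Hom D W V"
  shows "conjugate Z V (Comp D Z W V k h) =
    Comp D (omap F (pre Z)) (omap F (pre W)) (omap F (pre V)) (conjugate W V k) (conjugate Z W h)"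
proof (rule conjugate_unique[symmetric])
  note [simp] = Z W V counit omap_pre conjugate_closed h k
  have "Comp D (omap F (pre Z)) (omap F (pre V)) V (counit V)
      (Comp D (omap F (pre Z)) (omap F (pre W)) (omap F (pre V)) (conjugate W V k) (conjugate Z W h)) =
    Comp D (omap F (pre Z)) (omap F (pre W)) V
      (Comp D (omap F (pre W)) (omap F (pre V)) V (counit V) (conjugate W V k)) (conjugate Z W h)"
    by (simp add: D.Comp_assoc)
  also have "\<dots> = Comp D (omap F (pre Z)) W V k
      (Comp D (omap F (pre Z)) (omap F (pre W)) W (counit W) (conjugate Z W h))"
    by (simp add: counit_conjugate D.Comp_assoc')
  also have "\<dots> = Comp D (omap F (pre Z)) Z V (Comp D Z W V k h) (counit Z)"
    by (simp add: counit_conjugate D.Comp_assoc)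
  finally show "Comp D (omap F (pre Z)) (omap F (pre V)) V (counit V)
      (Comp D (omap F (pre Z)) (omap F (pre W)) (omap F (pre V)) (conjugate W V k) (conjugate Z W h)) =
    Comp D (omap F (pre Z)) Z V (Comp D Z W V k h) (counit Z)" .
qed (use assms in \<open>simp_all add: D.Comp_closed conjugate_closed omap_pre\<close>)

definition quasi_inverse :: "('p, 'b, 'o, 'a) fctr" where
  "quasi_inverse = \<lparr>omap = pre, amap = (\<lambda>Z W h. lift (pre Z) (pre W) (conjugate Z W h))\<rparr>"

lemma quasi_inverse_sel:
  "omap quasi_inverse Z = pre Z" "amap quasi_inverse Z W h = lift (pre Z) (pre W) (conjugate Z W h)"
  by (simp_all add: quasi_inverse_def)

lemma amap_quasi_inverse:
  assumes "Z \<in> Obj D" "W \<in> Obj D" "h \<in> Hom D Z W"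
  shows "amap quasi_inverse Z W h \<in> Hom C (pre Z) (pre W)"
    "amap F (pre Z) (pre W) (amap quasi_inverse Z W h) = conjugate Z W h"
  unfolding quasi_inverse_sel using assms counit(1) conjugate_closed by (auto intro!: lift)

lemma quasi_inverse_functor: "is_functor D C quasi_inverse"
  unfolding is_functor_def
proof (intro conjI ballI)
  fix Z assume Z: "Z \<in> Obj D"
  note * = amap_quasi_inverse[OF Z Z D.Ident_closed[OF Z]]
  show "amap quasi_inverse Z Z (Ident D Z) = Ident C (omap quasi_inverse Z)"
    unfolding quasi_inverse_sel(1)
    by (rule amap_inject[of "pre Z" "pre Z"])
      (use Z * counit(1)[OF Z] in \<open>simp_all add: F_rules conjugate_Ident C.Ident_closed\<close>)
next
  fix Z W V h k assume Z: "Z \<in> Obj D" and W: "W \<in> Obj D" and V: "V \<in> Obj D"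
    and h: "h \<in> Hom D Z W" and k: "k \<in> Hom D W V"
  note 1 = amap_quasi_inverse[OF Z W h] and 2 = amap_quasi_inverse[OF W V k]
  note 3 = amap_quasi_inverse[OF Z V D.Comp_closed[OF Z W V h k]]
  note p = counit(1)[OF Z] counit(1)[OF W] counit(1)[OF V]
  have c: "Comp C (pre Z) (pre W) (pre V) (amap quasi_inverse W V k) (amap quasi_inverse Z W h) \<in> Hom C (pre Z) (pre V)"
    by (rule C.Comp_closed[OF p 1(1) 2(1)])
  show "amap quasi_inverse Z V (Comp D Z W V k h) =
    Comp C (omap quasi_inverse Z) (omap quasi_inverse W) (omap quasi_inverse V)
      (amap quasi_inverse W V k) (amap quasi_inverse Z W h)"
    unfolding quasi_inverse_sel(1)
  proof (rule amap_inject[OF p(1,3) 3(1) c])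
    show "amap F (pre Z) (pre V) (amap quasi_inverse Z V (Comp D Z W V k h)) =
      amap F (pre Z) (pre V) (Comp C (pre Z) (pre W) (pre V) (amap quasi_inverse W V k) (amap quasi_inverse Z W h))"
      unfolding 3(2) F_rules(4)[OF p 1(1) 2(1)] 1(2) 2(2) by (rule conjugate_Comp[OF Z W V h k])
  qed
qed (auto simp: quasi_inverse_sel(1) counit amap_quasi_inverse)

lemma quasi_inverse_counit: "naturally_isomorphic D D (comp_functor F quasi_inverse) id_functor"
  unfolding naturally_isomorphic_def
proof (intro bexI ballI)
  show "restrict counit (Obj D) \<in> nat_trans D D (comp_functor F quasi_inverse) id_functor"
    by (auto simp: nat_trans_def comp_functor_sel id_functor_sel quasi_inverse_sel(1) counit
        amap_quasi_inverse counit_conjugate)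
  show "is_iso D (omap (comp_functor F quasi_inverse) X) (omap id_functor X) (restrict counit (Obj D) X)"
    if "X \<in> Obj D" for X
    using that counit[OF that] by (auto simp: is_iso_def comp_functor_sel id_functor_sel quasi_inverse_sel(1))
qed

lemma quasi_inverse_unit: "naturally_isomorphic C C id_functor (comp_functor quasi_inverse F)"
  unfolding naturally_isomorphic_def
proof (intro bexI ballI)
  define \<eta> where "\<eta> = (\<lambda>X \<in> Obj C. lift X (pre (omap F X)) (counit' (omap F X)))"
  have ob: "pre (omap F X) \<in> Obj C" "omap F X \<in> Obj D" "omap F (pre (omap F X)) \<in> Obj D" if "X \<in> Obj C" for X
    using that counit(1) F_rules(1) by blast+
  have \<eta>: "\<eta> X \<in> Hom C X (pre (omap F X))" "amap F X (pre (omap F X)) (\<eta> X) = counit' (omap F X)"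
    if "X \<in> Obj C" for X
    using that lift[OF that ob(1)[OF that], of "counit' (omap F X)"] counit(3)[of "omap F X"] F_rules(1)[OF that]
    by (simp_all add: \<eta>_def)
  show "\<eta> \<in> nat_trans C C id_functor (comp_functor quasi_inverse F)"
    unfolding nat_trans_def comp_functor_sel id_functor_sel quasi_inverse_sel(1)
  proof (intro CollectI conjI ballI)
    show "\<eta> \<in> (\<Pi>\<^sub>E X \<in> Obj C. Hom C X (pre (omap F X)))" using \<eta>(1) by (auto simp: \<eta>_def)
    fix X Y f assume X: "X \<in> Obj C" and Y: "Y \<in> Obj C" and f: "f \<in> Hom C X Y"
    let ?FX = "omap F X" and ?FY = "omap F Y" and ?Q = "amap quasi_inverse (omap F X) (omap F Y) (amap F X Y f)"
    have Ff: "amap F X Y f \<in> Hom D ?FX ?FY" using F_rules(2)[OF X Y f] .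
    note Q = amap_quasi_inverse[OF ob(2)[OF X] ob(2)[OF Y] Ff]
    have 1: "Comp C X Y (pre ?FY) (\<eta> Y) f \<in> Hom C X (pre ?FY)"
      using X Y f \<eta> ob by (intro C.Comp_closed)
    have 2: "Comp C X (pre ?FX) (pre ?FY) ?Q (\<eta> X) \<in> Hom C X (pre ?FY)"
      using X Y Q \<eta> ob by (intro C.Comp_closed)
    show "Comp C X Y (pre ?FY) (\<eta> Y) f = Comp C X (pre ?FX) (pre ?FY) ?Q (\<eta> X)"
    proof (rule amap_inject[OF X ob(1)[OF Y] 1 2])
      note c = counit[OF ob(2)[OF X]] and c' = counit[OF ob(2)[OF Y]]
      have "amap F X (pre ?FY) (Comp C X (pre ?FX) (pre ?FY) ?Q (\<eta> X)) =
        Comp D ?FX (omap F (pre ?FX)) (omap F (pre ?FY)) (conjugate ?FX ?FY (amap F X Y f)) (counit' ?FX)"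
        using X Y ob Q \<eta> by (simp add: F_rules)
      also have "\<dots> = Comp D ?FX ?FY (omap F (pre ?FY)) (counit' ?FY)
        (Comp D ?FX ?FX ?FY (amap F X Y f) (Comp D ?FX (omap F (pre ?FX)) ?FX (counit ?FX) (counit' ?FX)))"
        unfolding conjugate_def using X Y ob c(1-3) c'(1-3) Ff by (simp add: D.Comp_assoc' D.Comp_closed)
      also have "\<dots> = Comp D ?FX ?FY (omap F (pre ?FY)) (counit' ?FY) (amap F X Y f)"
        using c ob X Y Ff by (simp add: D.Comp_Ident_right)
      also have "\<dots> = amap F X (pre ?FY) (Comp C X Y (pre ?FY) (\<eta> Y) f)"
        using X Y ob f \<eta> by (simp add: F_rules)
      finally show "amap F X (pre ?FY) (Comp C X Y (pre ?FY) (\<eta> Y) f) =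
        amap F X (pre ?FY) (Comp C X (pre ?FX) (pre ?FY) ?Q (\<eta> X))" by simp
    qed
  qed
  fix X assume X: "X \<in> Obj C"
  note c = counit[OF ob(2)[OF X]]
  define \<theta> where "\<theta> = lift (pre (omap F X)) X (counit (omap F X))"
  have \<theta>: "\<theta> \<in> Hom C (pre (omap F X)) X" "amap F (pre (omap F X)) X \<theta> = counit (omap F X)"
    unfolding \<theta>_def using lift[OF ob(1)[OF X] X c(2)] by blast+
  have "Comp C X (pre (omap F X)) X \<theta> (\<eta> X) = Ident C X"
    by (rule amap_inject[OF X X])
      (use X ob[OF X] \<theta> \<eta>[OF X] c in \<open>simp_all add: C.Comp_closed C.Ident_closed F_rules\<close>)
  moreover have "Comp C (pre (omap F X)) X (pre (omap F X)) (\<eta> X) \<theta> = Ident C (pre (omap F X))"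
    by (rule amap_inject[OF ob(1)[OF X] ob(1)[OF X]])
      (use X ob[OF X] \<theta> \<eta>[OF X] c in \<open>simp_all add: C.Comp_closed C.Ident_closed F_rules\<close>)
  ultimately show "is_iso C (omap id_functor X) (omap (comp_functor quasi_inverse F) X) (\<eta> X)"
    unfolding is_iso_def id_functor_sel comp_functor_sel quasi_inverse_sel(1)
    using \<theta>(1) \<eta>(1)[OF X] by blast
qed

end

lemma hom_module_sel:
  "carrier (hom_module C X Y) = Hom C X Y" "add (hom_module C X Y) = Hadd C X Y"
  "zero (hom_module C X Y) = Hzero C X Y" "smult (hom_module C X Y) = Hsmult C X Y"
  by (simp_all add: hom_module_def)

context linear_category
begin

lemma Hadd_closed:
  "\<lbrakk>X \<in> Obj C; Y \<in> Obj C; f \<in> Hom C X Y; g \<in> Hom C X Y\<rbrakk> \<Longrightarrow> Hadd C X Y f g \<in> Hom C X Y"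
  using abelian_monoid.a_closed[of "hom_module C X Y" f g] hom_module[of X Y]
  by (simp add: hom_module_sel Module.module_def abelian_group_def)

lemma Hzero_closed: "\<lbrakk>X \<in> Obj C; Y \<in> Obj C\<rbrakk> \<Longrightarrow> Hzero C X Y \<in> Hom C X Y"
  using abelian_monoid.zero_closed[of "hom_module C X Y"] hom_module[of X Y]
  by (simp add: hom_module_sel Module.module_def abelian_group_def)

lemma Hsmult_closed:
  "\<lbrakk>X \<in> Obj C; Y \<in> Obj C; c \<in> carrier K; f \<in> Hom C X Y\<rbrakk> \<Longrightarrow> Hsmult C X Y c f \<in> Hom C X Y"
  using module.smult_closed[OF hom_module, of X Y c f] by (simp add: hom_module_sel)

lemma Hsmult_zero:
  "\<lbrakk>X \<in> Obj C; Y \<in> Obj C; f \<in> Hom C X Y\<rbrakk> \<Longrightarrow> Hsmult C X Y \<zero>\<^bsub>K\<^esub> f = Hzero C X Y"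
  using module.smult_l_null[OF hom_module, of X Y f] by (simp add: hom_module_sel)

lemma Comp_Hzero_right:
  "\<lbrakk>X \<in> Obj C; Y \<in> Obj C; Z \<in> Obj C; g \<in> Hom C Y Z\<rbrakk> \<Longrightarrow> Comp C X Y Z g (Hzero C X Y) = Hzero C X Z"
  using Comp_Hsmult_right[of X Y Z "\<zero>\<^bsub>K\<^esub>" "Hzero C X Y" g]
  by (simp add: Hsmult_zero Hzero_closed Comp_closed)

lemma Comp_Hzero_left:
  "\<lbrakk>X \<in> Obj C; Y \<in> Obj C; Z \<in> Obj C; f \<in> Hom C X Y\<rbrakk> \<Longrightarrow> Comp C X Y Z (Hzero C Y Z) f = Hzero C X Z"
  using Comp_Hsmult_left[of X Y Z "\<zero>\<^bsub>K\<^esub>" f "Hzero C Y Z"]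
  by (simp add: Hsmult_zero Hzero_closed Comp_closed)

end

lemma is_linear_functorD:
  assumes "is_linear_functor K C D F" "X \<in> Obj C" "Y \<in> Obj C"
  shows "\<lbrakk>f \<in> Hom C X Y; g \<in> Hom C X Y\<rbrakk> \<Longrightarrow>
      amap F X Y (Hadd C X Y f g) = Hadd D (omap F X) (omap F Y) (amap F X Y f) (amap F X Y g)"
    and "\<lbrakk>c \<in> carrier K; f \<in> Hom C X Y\<rbrakk> \<Longrightarrow>
      amap F X Y (Hsmult C X Y c f) = Hsmult D (omap F X) (omap F Y) c (amap F X Y f)"
  using assms by (simp_all add: is_linear_functor_def module_hom_def hom_module_sel)

locale weakly_equivalent_linear_categories =
  C: linear_category K C + D: linear_category K D + weakly_equivalent_categories C D F
  for K :: "'k ring" and C :: "('k, 'o, 'a, 'y) lin_cat_scheme" and D :: "('k, 'p, 'b, 'z) lin_cat_scheme"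
    and F :: "('o, 'a, 'p, 'b) fctr" +
  assumes linear: "is_linear_functor K C D F"
begin

lemmas F_linear = is_linear_functorD[OF linear]

lemma amap_Hzero: "\<lbrakk>X \<in> Obj C; Y \<in> Obj C\<rbrakk> \<Longrightarrow> amap F X Y (Hzero C X Y) = Hzero D (omap F X) (omap F Y)"
  using F_linear(2)[of X Y "\<zero>\<^bsub>K\<^esub>" "Hzero C X Y"] F_rules
  by (simp add: C.Hsmult_zero D.Hsmult_zero C.Hzero_closed)

lemma quasi_inverse_linear: "is_linear_functor K D C quasi_inverse"
  unfolding is_linear_functor_def
proof (intro conjI ballI)
  show "is_functor D C quasi_inverse" by (rule quasi_inverse_functor)
  fix X Y assume X: "X \<in> Obj D" and Y: "Y \<in> Obj D"
  note p = counit(1)[OF X] counit(1)[OF Y]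
  note p' = omap_pre[OF X] omap_pre[OF Y] counit(2,3)[OF X] counit(2,3)[OF Y]
  note Q = amap_quasi_inverse[OF X Y]
  have "amap quasi_inverse X Y (Hadd D X Y f g) =
      Hadd C (pre X) (pre Y) (amap quasi_inverse X Y f) (amap quasi_inverse X Y g)"
    if f: "f \<in> Hom D X Y" and g: "g \<in> Hom D X Y" for f g
  proof (rule amap_inject[OF p])
    show "amap F (pre X) (pre Y) (amap quasi_inverse X Y (Hadd D X Y f g)) =
      amap F (pre X) (pre Y) (Hadd C (pre X) (pre Y) (amap quasi_inverse X Y f) (amap quasi_inverse X Y g))"
      using f g p p' X Y unfolding Q(2)[OF D.Hadd_closed[OF X Y f g]]
      by (simp add: F_linear Q conjugate_def D.Comp_Hadd_left D.Comp_Hadd_right D.Hadd_closed D.Comp_closed)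
  qed (use f g p X Y Q in \<open>simp_all add: C.Hadd_closed D.Hadd_closed\<close>)
  moreover have "amap quasi_inverse X Y (Hsmult D X Y c f) = Hsmult C (pre X) (pre Y) c (amap quasi_inverse X Y f)"
    if f: "f \<in> Hom D X Y" and c: "c \<in> carrier K" for f c
  proof (rule amap_inject[OF p])
    show "amap F (pre X) (pre Y) (amap quasi_inverse X Y (Hsmult D X Y c f)) =
      amap F (pre X) (pre Y) (Hsmult C (pre X) (pre Y) c (amap quasi_inverse X Y f))"
      using f c p p' X Y unfolding Q(2)[OF D.Hsmult_closed[OF X Y c f]]
      by (simp add: F_linear Q conjugate_def D.Comp_Hsmult_left D.Comp_Hsmult_right D.Hsmult_closed D.Comp_closed)
  qed (use f c p X Y Q in \<open>simp_all add: C.Hsmult_closed D.Hsmult_closed\<close>)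
  ultimately show "amap quasi_inverse X Y \<in> module_hom K (hom_module D X Y)
      (hom_module C (omap quasi_inverse X) (omap quasi_inverse Y))"
    using Q(1) by (simp add: module_hom_def hom_module_sel quasi_inverse_sel(1))
qed

theorem linear_equivalence: "linear_equivalence K C D F quasi_inverse"
  unfolding linear_equivalence_def
  using linear quasi_inverse_linear quasi_inverse_unit quasi_inverse_counit by blast

end

section \<open>Transfer of abelianness along an equivalence\<close>

definition op_cat :: "('k, 'o, 'a, 'z) lin_cat_scheme \<Rightarrow> ('k, 'o, 'a) lin_cat" where
  "op_cat C = \<lparr>Obj = Obj C, Hom = (\<lambda>X Y. Hom C Y X), Ident = Ident C,
     Comp = (\<lambda>X Y Z g f. Comp C Z Y X f g), Hadd = (\<lambda>X Y. Hadd C Y X),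
     Hzero = (\<lambda>X Y. Hzero C Y X), Hsmult = (\<lambda>X Y. Hsmult C Y X)\<rparr>"

definition op_functor :: "('o, 'a, 'p, 'b) fctr \<Rightarrow> ('o, 'a, 'p, 'b) fctr" where
  "op_functor F = \<lparr>omap = omap F, amap = (\<lambda>X Y. amap F Y X)\<rparr>"

lemma op_cat_sel:
  "Obj (op_cat C) = Obj C" "Hom (op_cat C) X Y = Hom C Y X" "Ident (op_cat C) X = Ident C X"
  "Comp (op_cat C) X Y Z g f = Comp C Z Y X f g" "Hadd (op_cat C) X Y = Hadd C Y X"
  "Hzero (op_cat C) X Y = Hzero C Y X" "Hsmult (op_cat C) X Y = Hsmult C Y X"
  "hom_module (op_cat C) X Y = hom_module C Y X"
  "omap (op_functor F) X = omap F X" "amap (op_functor F) X Y = amap F Y X"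
  by (simp_all add: op_cat_def op_functor_def hom_module_def)

lemma is_cokernel_op: "is_cokernel C X Y f Q c \<longleftrightarrow> is_kernel (op_cat C) Y X f Q c"
  by (simp add: is_cokernel_def is_kernel_def op_cat_sel)

lemma is_kernel_op: "is_kernel C X Y f Q c \<longleftrightarrow> is_cokernel (op_cat C) Y X f Q c"
  by (simp add: is_cokernel_def is_kernel_def op_cat_sel)

lemma is_epi_op: "is_epi C X Y f \<longleftrightarrow> is_mono (op_cat C) Y X f"
  by (simp add: is_epi_def is_mono_def op_cat_sel)

lemma linear_category_op:
  assumes "linear_category K C"
  shows "linear_category K (op_cat C)"
proof -
  interpret C: linear_category K C by fact
  have K: "cring K" using assms by (simp add: linear_category_def)
  have "category (op_cat C)"
    by (rule category.intro)
      (simp_all add: op_cat_sel C.Ident_closed C.Comp_closed C.Comp_Ident_left C.Comp_Ident_right C.Comp_assoc)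
  moreover have "linear_category_axioms K (op_cat C)"
    by (rule linear_category_axioms.intro)
      (simp_all add: op_cat_sel C.hom_module C.Comp_Hadd_left C.Comp_Hadd_right C.Comp_Hsmult_left C.Comp_Hsmult_right)
  ultimately show ?thesis using K by (intro linear_category.intro)
qed

lemma is_iso_op: "is_iso (op_cat C) X Y = is_iso C Y X"
  by (intro ext) (auto simp: is_iso_def op_cat_sel)

lemma weakly_equivalent_linear_categories_op:
  assumes "weakly_equivalent_linear_categories K C D F"
  shows "weakly_equivalent_linear_categories K (op_cat C) (op_cat D) (op_functor F)"
proof -
  interpret weakly_equivalent_linear_categories K C D F by fact
  interpret C': linear_category K "op_cat C" by (rule linear_category_op) unfold_locales
  interpret D': linear_category K "op_cat D" by (rule linear_category_op) unfold_locales
  have iso: "\<exists>X \<in> Obj C. \<exists>f. is_iso D Z (omap F X) f" if Z: "Z \<in> Obj D" for Z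
  proof -
    from ex_preimage[OF Z] obtain X f f' where "X \<in> Obj C" "f \<in> Hom D (omap F X) Z" "f' \<in> Hom D Z (omap F X)"
      "Comp D (omap F X) Z (omap F X) f' f = Ident D (omap F X)" "Comp D Z (omap F X) Z f f' = Ident D Z" .
    then show ?thesis unfolding is_iso_def by blast
  qed
  have fop: "is_functor (op_cat C) (op_cat D) (op_functor F)"
    unfolding is_functor_def by (auto simp: op_cat_sel F_rules)
  moreover have "bij_betw (amap F X Y) (Hom C X Y) (Hom D (omap F X) (omap F Y))"
    if "X \<in> Obj C" "Y \<in> Obj C" for X Y
    using weak_equivalence that by (simp add: weak_equivalence_def)
  ultimately have "weak_equivalence (op_cat C) (op_cat D) (op_functor F)"
    unfolding weak_equivalence_def by (simp add: op_cat_sel is_iso_op iso)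
  moreover have "is_linear_functor K (op_cat C) (op_cat D) (op_functor F)"
    using fop linear by (simp add: is_linear_functor_def op_cat_sel)
  ultimately show ?thesis by unfold_locales
qed

lemma (in linear_category) is_kernel_precomp_iso:
  assumes X: "X \<in> Obj C" and Y: "Y \<in> Obj C" and f: "f \<in> Hom C X Y" and N: "N \<in> Obj C"
    and k: "is_kernel C X Y f N' k" and \<phi>: "is_iso C N N' \<phi>"
  shows "is_kernel C X Y f N (Comp C N N' X k \<phi>)"
proof -
  obtain \<psi> where iso: "\<phi> \<in> Hom C N N'" "\<psi> \<in> Hom C N' N" "Comp C N N' N \<psi> \<phi> = Ident C N"
    "Comp C N' N N' \<phi> \<psi> = Ident C N'" using \<phi> by (rule is_isoE)
  have k1: "N' \<in> Obj C" "k \<in> Hom C N' X" "Comp C N' X Y f k = Hzero C N' Y"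
    and k2: "\<And>W g. \<lbrakk>W \<in> Obj C; g \<in> Hom C W X; Comp C W X Y f g = Hzero C W Y\<rbrakk> \<Longrightarrow>
      \<exists>!u. u \<in> Hom C W N' \<and> Comp C W N' X k u = g"
    using k unfolding is_kernel_def by blast+
  show ?thesis unfolding is_kernel_def
  proof (intro conjI ballI impI N)
    show "Comp C N N' X k \<phi> \<in> Hom C N X" using X N k1 iso by (intro Comp_closed)
    have "Comp C N X Y f (Comp C N N' X k \<phi>) = Comp C N N' Y (Comp C N' X Y f k) \<phi>"
      using X Y N k1 f iso by (simp add: Comp_assoc)
    then show "Comp C N X Y f (Comp C N N' X k \<phi>) = Hzero C N Y"
      using X Y N k1 f iso by (simp add: Comp_Hzero_left)
    fix W g assume W: "W \<in> Obj C" and g: "g \<in> Hom C W X" and fg: "Comp C W X Y f g = Hzero C W Y"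
    from k2[OF this] obtain u where u: "u \<in> Hom C W N'" "Comp C W N' X k u = g"
      and uu: "\<And>v. v \<in> Hom C W N' \<Longrightarrow> Comp C W N' X k v = g \<Longrightarrow> v = u" by blast
    show "\<exists>!u. u \<in> Hom C W N \<and> Comp C W N X (Comp C N N' X k \<phi>) u = g"
    proof (rule ex1I[of _ "Comp C W N' N \<psi> u"])
      have "Comp C W N N' \<phi> (Comp C W N' N \<psi> u) = u"
        using W N k1 iso u by (simp add: Comp_assoc Comp_Ident_left)
      then show "Comp C W N' N \<psi> u \<in> Hom C W N \<and> Comp C W N X (Comp C N N' X k \<phi>) (Comp C W N' N \<psi> u) = g"
        using W X N k1 iso u by (simp add: Comp_assoc' Comp_closed)
      fix v assume v: "v \<in> Hom C W N \<and> Comp C W N X (Comp C N N' X k \<phi>) v = g"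
      then have v1: "v \<in> Hom C W N" and "Comp C W N X (Comp C N N' X k \<phi>) v = g" by blast+
      then have "Comp C W N N' \<phi> v = u"
        using W X N k1 iso by (intro uu) (simp_all add: Comp_assoc' Comp_closed)
      then show "v = Comp C W N' N \<psi> u"
        using v1 W N k1 iso by (auto simp: Comp_assoc Comp_Ident_left)
    qed
  qed
qed

lemma (in linear_category) is_kernel_postcomp_iso:
  assumes X: "X \<in> Obj C" and Y: "Y \<in> Obj C" and f: "f \<in> Hom C X Y" and Z: "Z \<in> Obj C"
    and k: "is_kernel C X Y f N k" and \<phi>: "is_iso C Y Z \<phi>"
  shows "is_kernel C X Z (Comp C X Y Z \<phi> f) N k"
proof -
  obtain \<psi> where iso: "\<phi> \<in> Hom C Y Z" "\<psi> \<in> Hom C Z Y" "Comp C Y Z Y \<psi> \<phi> = Ident C Y"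
    "Comp C Z Y Z \<phi> \<psi> = Ident C Z" using \<phi> by (rule is_isoE)
  have "Comp C W X Z (Comp C X Y Z \<phi> f) g = Hzero C W Z \<longleftrightarrow> Comp C W X Y f g = Hzero C W Y"
    if W: "W \<in> Obj C" and g: "g \<in> Hom C W X" for W g
  proof
    assume "Comp C W X Z (Comp C X Y Z \<phi> f) g = Hzero C W Z"
    then have "Comp C W Z Y \<psi> (Comp C W Y Z \<phi> (Comp C W X Y f g)) = Hzero C W Y"
      using W X Y Z f g iso by (simp add: Comp_assoc Comp_Hzero_right)
    then show "Comp C W X Y f g = Hzero C W Y"
      using W X Y Z f g iso Comp_assoc[of W Y Z Y "Comp C W X Y f g" \<phi> \<psi>]
      by (simp add: Comp_closed Comp_Ident_left)
  next
    assume "Comp C W X Y f g = Hzero C W Y"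
    then show "Comp C W X Z (Comp C X Y Z \<phi> f) g = Hzero C W Z"
      using W X Y Z f g iso by (simp add: Comp_assoc' Comp_Hzero_right)
  qed
  with k show ?thesis unfolding is_kernel_def by simp
qed

context weakly_equivalent_linear_categories
begin

lemma preserves_mono:
  assumes X: "X \<in> Obj C" and Y: "Y \<in> Obj C" and f: "is_mono C X Y f"
  shows "is_mono D (omap F X) (omap F Y) (amap F X Y f)"
  unfolding is_mono_def
proof (intro conjI ballI impI)
  have fh: "f \<in> Hom C X Y" using f by (simp add: is_mono_def)
  then show Ff: "amap F X Y f \<in> Hom D (omap F X) (omap F Y)" using F_rules(2)[OF X Y] by blast
  fix W g h assume W: "W \<in> Obj D" and g: "g \<in> Hom D W (omap F X)" and h: "h \<in> Hom D W (omap F X)"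
    and eq: "Comp D W (omap F X) (omap F Y) (amap F X Y f) g = Comp D W (omap F X) (omap F Y) (amap F X Y f) h"
  obtain V \<phi> \<psi> where V: "V \<in> Obj C" and \<phi>: "\<phi> \<in> Hom D (omap F V) W" and \<psi>: "\<psi> \<in> Hom D W (omap F V)"
    and inv: "Comp D (omap F V) W (omap F V) \<psi> \<phi> = Ident D (omap F V)" "Comp D W (omap F V) W \<phi> \<psi> = Ident D W"
    by (rule ex_preimage[OF W])
  note O = F_rules(1)[OF V] F_rules(1)[OF X] F_rules(1)[OF Y] W
  define lf where "lf g = lift V X (Comp D (omap F V) W (omap F X) g \<phi>)" for g
  have lf: "lf g \<in> Hom C V X" "amap F V X (lf g) = Comp D (omap F V) W (omap F X) g \<phi>"
    if "g \<in> Hom D W (omap F X)" for g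
    unfolding lf_def using lift[OF V X D.Comp_closed[OF O(1,4,2) \<phi> that]] by blast+
  have "amap F V Y (Comp C V X Y f (lf g)) = amap F V Y (Comp C V X Y f (lf h))"
    using V X Y fh lf[OF g] lf[OF h] O Ff g h \<phi> eq
    by (simp add: F_rules D.Comp_assoc)
  then have "Comp C V X Y f (lf g) = Comp C V X Y f (lf h)"
    using V X Y fh lf[OF g] lf[OF h] by (intro amap_inject[OF V Y]) (simp_all add: C.Comp_closed)
  then have "lf g = lf h" using f V lf(1)[OF g] lf(1)[OF h] unfolding is_mono_def by blast
  then have "Comp D (omap F V) W (omap F X) g \<phi> = Comp D (omap F V) W (omap F X) h \<phi>"
    using lf(2)[OF g] lf(2)[OF h] by simp
  then have "Comp D W W (omap F X) g (Comp D W (omap F V) W \<phi> \<psi>) = Comp D W W (omap F X) h (Comp D W (omap F V) W \<phi> \<psi>)"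
    using O \<phi> \<psi> g h by (simp add: D.Comp_assoc)
  then show "g = h" using O g h inv by (simp add: D.Comp_Ident_right)
qed

text \<open>
  An arrow of \<open>D\<close> into \<open>F N\<close> from an image \<open>F W\<close> is the image of a unique arrow, so that the universal
  property in \<open>D\<close>, tested on such objects only, is the one in \<open>C\<close>.
\<close>

lemma reflects_kernel:
  assumes X: "X \<in> Obj C" and Y: "Y \<in> Obj C" and f: "f \<in> Hom C X Y" and N: "N \<in> Obj C" and k: "k \<in> Hom C N X"
    and ker: "is_kernel D (omap F X) (omap F Y) (amap F X Y f) (omap F N) (amap F N X k)"
  shows "is_kernel C X Y f N k"
  unfolding is_kernel_def
proof (intro conjI ballI impI N k)
  show "Comp C N X Y f k = Hzero C N Y"
    using ker X Y f N k
    by (intro amap_inject[OF N Y]) (simp_all add: C.Comp_closed C.Hzero_closed amap_Hzero F_rules is_kernel_def)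
  fix W g assume W: "W \<in> Obj C" and g: "g \<in> Hom C W X" and fg: "Comp C W X Y f g = Hzero C W Y"
  have "Comp D (omap F W) (omap F X) (omap F Y) (amap F X Y f) (amap F W X g) = Hzero D (omap F W) (omap F Y)"
    using arg_cong[OF fg, of "amap F W Y"] W X Y f g by (simp add: F_rules amap_Hzero)
  then have ex: "\<exists>!u. u \<in> Hom D (omap F W) (omap F N) \<and>
      Comp D (omap F W) (omap F N) (omap F X) (amap F N X k) u = amap F W X g"
    using ker F_rules(1)[OF W] F_rules(2)[OF W X g] unfolding is_kernel_def by blast
  have iff: "Comp C W N X k u = g \<longleftrightarrow>
      Comp D (omap F W) (omap F N) (omap F X) (amap F N X k) (amap F W N u) = amap F W X g"
    if "u \<in> Hom C W N" for u
    using that W N X k g amap_inject[OF W X C.Comp_closed[OF W N X that k] g] by (auto simp: F_rules)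
  from ex obtain u where u: "u \<in> Hom D (omap F W) (omap F N)"
      "Comp D (omap F W) (omap F N) (omap F X) (amap F N X k) u = amap F W X g"
    and uu: "\<And>v. v \<in> Hom D (omap F W) (omap F N) \<Longrightarrow>
      Comp D (omap F W) (omap F N) (omap F X) (amap F N X k) v = amap F W X g \<Longrightarrow> v = u" by blast
  show "\<exists>!u. u \<in> Hom C W N \<and> Comp C W N X k u = g"
  proof (rule ex1I[of _ "lift W N u"])
    show "lift W N u \<in> Hom C W N \<and> Comp C W N X k (lift W N u) = g"
      using lift[OF W N u(1)] iff u by simp
    fix v assume v: "v \<in> Hom C W N \<and> Comp C W N X k v = g"
    then have "amap F W N v = u" using iff F_rules(2)[OF W N] by (intro uu) auto
    then show "v = lift W N u" using lift[OF W N u(1)] v by (intro amap_inject[OF W N]) auto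
  qed
qed

text \<open>
  A kernel object in \<open>D\<close> is replaced by an isomorphic object in the image of \<open>F\<close>; then its arrow is an
  image as well.
\<close>

lemma transfer_kernel:
  assumes D: "linear_abelian_category K D" and X: "X \<in> Obj C" and Y: "Y \<in> Obj C" and f: "f \<in> Hom C X Y"
  shows "\<exists>N k. is_kernel C X Y f N k"
proof -
  interpret D: linear_abelian_category K D by fact
  obtain N' k' where k': "is_kernel D (omap F X) (omap F Y) (amap F X Y f) N' k'"
    using D.ex_kernel[OF F_rules(1)[OF X] F_rules(1)[OF Y] F_rules(2)[OF X Y f]] by blast
  then have N': "N' \<in> Obj D" "k' \<in> Hom D N' (omap F X)" by (simp_all add: is_kernel_def)
  obtain N \<phi> where N: "N \<in> Obj C" and \<phi>: "is_iso D (omap F N) N' \<phi>"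
    using weak_equivalence N' unfolding weak_equivalence_def by blast
  define k where "k = lift N X (Comp D (omap F N) N' (omap F X) k' \<phi>)"
  have "Comp D (omap F N) N' (omap F X) k' \<phi> \<in> Hom D (omap F N) (omap F X)"
    using \<phi> F_rules(1) N X N' by (intro D.Comp_closed) (auto simp: is_iso_def)
  note k = lift[OF N X this, folded k_def]
  have "is_kernel C X Y f N k"
    by (rule reflects_kernel[OF X Y f N k(1)])
      (use D.is_kernel_precomp_iso[OF F_rules(1)[OF X] F_rules(1)[OF Y] F_rules(2)[OF X Y f] F_rules(1)[OF N] k' \<phi>]
        k(2) in simp)
  then show ?thesis by blast
qed

lemma transfer_mono_normal:
  assumes D: "linear_abelian_category K D" and X: "X \<in> Obj C" and Y: "Y \<in> Obj C" and f: "is_mono C X Y f"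
  shows "\<exists>Z g. Z \<in> Obj C \<and> g \<in> Hom C Y Z \<and> is_kernel C Y Z g X f"
proof -
  interpret D: linear_abelian_category K D by fact
  obtain Z' g' where Z': "Z' \<in> Obj D" and g': "g' \<in> Hom D (omap F Y) Z'"
    and ker: "is_kernel D (omap F Y) Z' g' (omap F X) (amap F X Y f)"
    using D.mono_normal[OF F_rules(1)[OF X] F_rules(1)[OF Y] preserves_mono[OF X Y f]] by blast
  obtain Z \<phi> \<psi> where Z: "Z \<in> Obj C" and iso: "\<phi> \<in> Hom D (omap F Z) Z'" "\<psi> \<in> Hom D Z' (omap F Z)"
    "Comp D (omap F Z) Z' (omap F Z) \<psi> \<phi> = Ident D (omap F Z)" "Comp D Z' (omap F Z) Z' \<phi> \<psi> = Ident D Z'"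
    by (rule ex_preimage[OF Z'])
  have \<psi>: "is_iso D Z' (omap F Z) \<psi>" using iso unfolding is_iso_def by blast
  define g where "g = lift Y Z (Comp D (omap F Y) Z' (omap F Z) \<psi> g')"
  have "Comp D (omap F Y) Z' (omap F Z) \<psi> g' \<in> Hom D (omap F Y) (omap F Z)"
    using F_rules(1) Z Y Z' g' iso by (intro D.Comp_closed) auto
  note g = lift[OF Y Z this, folded g_def]
  have "is_kernel C Y Z g X f"
    by (rule reflects_kernel[OF Y Z g(1) X])
      (use f D.is_kernel_postcomp_iso[OF F_rules(1)[OF Y] Z' g' F_rules(1)[OF Z] ker \<psi>] g(2)
        in \<open>simp_all add: is_mono_def\<close>)
  with Z g show ?thesis by blast
qed

lemma transfer_zero_object:
  assumes "is_zero_object D Z"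
  shows "\<exists>X. is_zero_object C X"
proof -
  have Z: "Z \<in> Obj D" using assms by (simp add: is_zero_object_def)
  obtain X \<phi> \<psi> where X: "X \<in> Obj C" and iso: "\<phi> \<in> Hom D (omap F X) Z" "\<psi> \<in> Hom D Z (omap F X)"
    "Comp D (omap F X) Z (omap F X) \<psi> \<phi> = Ident D (omap F X)" "Comp D Z (omap F X) Z \<phi> \<psi> = Ident D Z"
    by (rule ex_preimage[OF Z])
  have "(\<exists>!f. f \<in> Hom C Y X) \<and> (\<exists>!f. f \<in> Hom C X Y)" if Y: "Y \<in> Obj C" for Y
  proof -
    note O = F_rules(1)[OF X] F_rules(1)[OF Y] Z
    have u1: "f = g" if fg: "f \<in> Hom D (omap F Y) Z" "g \<in> Hom D (omap F Y) Z" for f g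
      using assms O(2) fg unfolding is_zero_object_def by blast
    have u2: "f = g" if fg: "f \<in> Hom D Z (omap F Y)" "g \<in> Hom D Z (omap F Y)" for f g
      using assms O(2) fg unfolding is_zero_object_def by blast
    have id: "Comp D (omap F X) Z (omap F X) \<psi> \<phi> = Ident D (omap F X)" by (rule iso(3))
    have "f = g" if fg: "f \<in> Hom C Y X" "g \<in> Hom C Y X" for f g
    proof (rule amap_inject[OF Y X fg])
      have Fg: "amap F Y X f \<in> Hom D (omap F Y) (omap F X)" "amap F Y X g \<in> Hom D (omap F Y) (omap F X)"
        using F_rules(2)[OF Y X] fg by blast+
      have "Comp D (omap F Y) (omap F X) Z \<phi> (amap F Y X f) = Comp D (omap F Y) (omap F X) Z \<phi> (amap F Y X g)"
        by (rule u1) (use O iso Fg in \<open>simp_all add: D.Comp_closed\<close>)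
      then have "Comp D (omap F Y) (omap F X) (omap F X) (Ident D (omap F X)) (amap F Y X f) =
        Comp D (omap F Y) (omap F X) (omap F X) (Ident D (omap F X)) (amap F Y X g)"
        unfolding id[symmetric] using O iso(1,2) Fg by (simp add: D.Comp_assoc')
      then show "amap F Y X f = amap F Y X g" using O Fg by (simp add: D.Comp_Ident_left)
    qed
    moreover have "f = g" if fg: "f \<in> Hom C X Y" "g \<in> Hom C X Y" for f g
    proof (rule amap_inject[OF X Y fg])
      have Fg: "amap F X Y f \<in> Hom D (omap F X) (omap F Y)" "amap F X Y g \<in> Hom D (omap F X) (omap F Y)"
        using F_rules(2)[OF X Y] fg by blast+
      have "Comp D Z (omap F X) (omap F Y) (amap F X Y f) \<psi> = Comp D Z (omap F X) (omap F Y) (amap F X Y g) \<psi>"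
        by (rule u2) (use O iso Fg in \<open>simp_all add: D.Comp_closed\<close>)
      then have "Comp D (omap F X) (omap F X) (omap F Y) (amap F X Y f) (Ident D (omap F X)) =
        Comp D (omap F X) (omap F X) (omap F Y) (amap F X Y g) (Ident D (omap F X))"
        unfolding id[symmetric] using O iso(1,2) Fg by (simp add: D.Comp_assoc)
      then show "amap F X Y f = amap F X Y g" using O Fg by (simp add: D.Comp_Ident_right)
    qed
    ultimately show ?thesis using C.Hzero_closed[OF X Y] C.Hzero_closed[OF Y X] by blast
  qed
  with X show ?thesis unfolding is_zero_object_def by blast
qed

lemma transfer_biproduct:
  assumes D: "linear_abelian_category K D" and X: "X \<in> Obj C" and Y: "Y \<in> Obj C"
  shows "\<exists>B i j p q. is_biproduct C X Y B i j p q"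
proof -
  interpret D: linear_abelian_category K D by fact
  note OX = F_rules(1)[OF X] and OY = F_rules(1)[OF Y]
  obtain B' i' j' p' q' where b: "is_biproduct D (omap F X) (omap F Y) B' i' j' p' q'"
    using D.ex_biproduct[OF OX OY] by blast
  have B': "B' \<in> Obj D" "i' \<in> Hom D (omap F X) B'" "j' \<in> Hom D (omap F Y) B'"
    "p' \<in> Hom D B' (omap F X)" "q' \<in> Hom D B' (omap F Y)" using b unfolding is_biproduct_def by blast+
  obtain B \<phi> \<psi> where B: "B \<in> Obj C" and iso: "\<phi> \<in> Hom D (omap F B) B'" "\<psi> \<in> Hom D B' (omap F B)"
    "Comp D (omap F B) B' (omap F B) \<psi> \<phi> = Ident D (omap F B)" "Comp D B' (omap F B) B' \<phi> \<psi> = Ident D B'"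
    by (rule ex_preimage[OF B'(1)])
  note OB = F_rules(1)[OF B]
  \<comment> \<open>the biproduct in \<open>D\<close> is moved along \<open>\<phi>\<close> to \<open>F B\<close>; inserting \<open>\<phi> \<psi> = 1\<close> keeps all its equations\<close>
  have c: "Comp D V (omap F B) U (Comp D (omap F B) B' U r \<phi>) (Comp D V B' (omap F B) \<psi> s) = Comp D V B' U r s"
    if "U \<in> Obj D" "V \<in> Obj D" "r \<in> Hom D B' U" "s \<in> Hom D V B'" for U V r s
  proof -
    have "Comp D V (omap F B) B' \<phi> (Comp D V B' (omap F B) \<psi> s) = s"
      using that B' OB iso by (simp add: D.Comp_assoc D.Comp_Ident_left)
    then show ?thesis using that B' OB iso by (simp add: D.Comp_assoc' D.Comp_closed)
  qed
  have c2: "Comp D (omap F B) V (omap F B) (Comp D V B' (omap F B) \<psi> s) (Comp D (omap F B) B' V r \<phi>) =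
      Comp D (omap F B) B' (omap F B) \<psi> (Comp D (omap F B) B' B' (Comp D B' V B' s r) \<phi>)"
    if "V \<in> Obj D" "r \<in> Hom D B' V" "s \<in> Hom D V B'" for V r s
    using that B' OB iso by (simp add: D.Comp_assoc' D.Comp_closed)
  define i j p q where "i = lift X B (Comp D (omap F X) B' (omap F B) \<psi> i')"
    and "j = lift Y B (Comp D (omap F Y) B' (omap F B) \<psi> j')"
    and "p = lift B X (Comp D (omap F B) B' (omap F X) p' \<phi>)"
    and "q = lift B Y (Comp D (omap F B) B' (omap F Y) q' \<phi>)"
  have i: "i \<in> Hom C X B" "amap F X B i = Comp D (omap F X) B' (omap F B) \<psi> i'"
    unfolding i_def by (rule lift[OF X B D.Comp_closed[OF OX B'(1) OB B'(2) iso(2)]])+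
  have j: "j \<in> Hom C Y B" "amap F Y B j = Comp D (omap F Y) B' (omap F B) \<psi> j'"
    unfolding j_def by (rule lift[OF Y B D.Comp_closed[OF OY B'(1) OB B'(3) iso(2)]])+
  have p: "p \<in> Hom C B X" "amap F B X p = Comp D (omap F B) B' (omap F X) p' \<phi>"
    unfolding p_def by (rule lift[OF B X D.Comp_closed[OF OB B'(1) OX iso(1) B'(4)]])+
  have q: "q \<in> Hom C B Y" "amap F B Y q = Comp D (omap F B) B' (omap F Y) q' \<phi>"
    unfolding q_def by (rule lift[OF B Y D.Comp_closed[OF OB B'(1) OY iso(1) B'(5)]])+
  have "is_biproduct C X Y B i j p q" unfolding is_biproduct_def
  proof (intro conjI B i(1) j(1) p(1) q(1))
    show "Comp C X B X p i = Ident C X"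
      by (rule amap_inject[OF X X])
        (use b X B i p B' OX in \<open>simp_all add: C.Comp_closed C.Ident_closed F_rules c is_biproduct_def\<close>)
    show "Comp C Y B Y q j = Ident C Y"
      by (rule amap_inject[OF Y Y])
        (use b Y B j q B' OY in \<open>simp_all add: C.Comp_closed C.Ident_closed F_rules c is_biproduct_def\<close>)
    show "Comp C Y B X p j = Hzero C Y X"
      by (rule amap_inject[OF Y X])
        (use b X Y B j p B' OX OY in \<open>simp_all add: C.Comp_closed C.Hzero_closed F_rules c is_biproduct_def amap_Hzero\<close>)
    show "Comp C X B Y q i = Hzero C X Y"
      by (rule amap_inject[OF X Y])
        (use b X Y B i q B' OX OY in \<open>simp_all add: C.Comp_closed C.Hzero_closed F_rules c is_biproduct_def amap_Hzero\<close>)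
    show "Hadd C B B (Comp C B X B i p) (Comp C B Y B j q) = Ident C B"
    proof (rule amap_inject[OF B B])
      let ?ip = "Comp D B' (omap F X) B' i' p'" and ?jq = "Comp D B' (omap F Y) B' j' q'"
      have cl: "?ip \<in> Hom D B' B'" "?jq \<in> Hom D B' B'"
        by (rule D.Comp_closed[OF B'(1) OX B'(1) B'(4,2)], rule D.Comp_closed[OF B'(1) OY B'(1) B'(5,3)])
      have "amap F B B (Hadd C B B (Comp C B X B i p) (Comp C B Y B j q)) =
        Hadd D (omap F B) (omap F B)
          (Comp D (omap F B) B' (omap F B) \<psi> (Comp D (omap F B) B' B' ?ip \<phi>))
          (Comp D (omap F B) B' (omap F B) \<psi> (Comp D (omap F B) B' B' ?jq \<phi>))"
        using X Y B i j p q OX OY B' by (simp add: F_linear C.Comp_closed F_rules c2)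
      also have "\<dots> = Comp D (omap F B) B' (omap F B) \<psi> (Comp D (omap F B) B' B' (Hadd D B' B' ?ip ?jq) \<phi>)"
        using B' OB iso cl by (simp add: D.Comp_Hadd_left D.Comp_Hadd_right D.Comp_closed)
      also have "\<dots> = Comp D (omap F B) B' (omap F B) \<psi> (Comp D (omap F B) B' B' (Ident D B') \<phi>)"
        using b by (simp add: is_biproduct_def)
      also have "\<dots> = amap F B B (Ident C B)"
        using B B' OB iso by (simp add: D.Comp_Ident_left F_rules)
      finally show "amap F B B (Hadd C B B (Comp C B X B i p) (Comp C B Y B j q)) = amap F B B (Ident C B)" .
    qed (use X Y B i j p q in \<open>simp_all add: C.Hadd_closed C.Comp_closed C.Ident_closed\<close>)
  qed
  then show ?thesis by blast
qed

end

lemma linear_abelian_category_op: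
  assumes "linear_abelian_category K C"
  shows "linear_abelian_category K (op_cat C)"
proof -
  interpret C: linear_abelian_category K C by fact
  interpret linear_category K "op_cat C" by (rule linear_category_op) unfold_locales
  show ?thesis
  proof unfold_locales
    show "\<exists>Z. is_zero_object (op_cat C) Z"
    proof -
      obtain Z where Z: "is_zero_object C Z" using C.ex_zero_object by blast
      then have "is_zero_object (op_cat C) Z" by (simp add: is_zero_object_def op_cat_sel)
      then show ?thesis by blast
    qed
    fix X Y assume X: "X \<in> Obj (op_cat C)" and Y: "Y \<in> Obj (op_cat C)"
    then have XY: "X \<in> Obj C" "Y \<in> Obj C" by (simp_all add: op_cat_sel)
    obtain B i j p q where "is_biproduct C X Y B i j p q" using C.ex_biproduct[OF XY] by blast
    then have "is_biproduct (op_cat C) X Y B p q i j"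
      unfolding is_biproduct_def op_cat_sel by blast
    then show "\<exists>B i j p q. is_biproduct (op_cat C) X Y B i j p q" by blast
    show "\<exists>N k. is_kernel (op_cat C) X Y f N k" if "f \<in> Hom (op_cat C) X Y" for f
      using C.ex_cokernel[OF XY(2,1)] that by (simp add: is_cokernel_op op_cat_sel)
    show "\<exists>N k. is_cokernel (op_cat C) X Y f N k" if "f \<in> Hom (op_cat C) X Y" for f
      using C.ex_kernel[OF XY(2,1)] that by (simp add: is_kernel_op op_cat_sel)
    show "\<exists>Z g. Z \<in> Obj (op_cat C) \<and> g \<in> Hom (op_cat C) Y Z \<and> is_kernel (op_cat C) Y Z g X f"
      if "is_mono (op_cat C) X Y f" for f
      using C.epi_normal[OF XY(2,1)] that by (simp add: is_cokernel_op is_epi_op op_cat_sel)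
    show "\<exists>W g. W \<in> Obj (op_cat C) \<and> g \<in> Hom (op_cat C) W X \<and> is_cokernel (op_cat C) W X g Y f"
      if "is_epi (op_cat C) X Y f" for f
      using C.mono_normal[OF XY(2,1)] that by (simp add: is_kernel_op is_epi_def is_mono_def op_cat_sel)
  qed
qed

text \<open>
  The transfer of kernels and of the normality of monomorphisms, applied to the opposite categories, gives
  cokernels and the normality of epimorphisms.
\<close>

theorem (in weakly_equivalent_linear_categories) transfer_abelian:
  assumes D: "linear_abelian_category K D"
  shows "linear_abelian_category K C"
proof -
  interpret D: linear_abelian_category K D by fact
  have op: "weakly_equivalent_linear_categories K (op_cat C) (op_cat D) (op_functor F)"
    by (rule weakly_equivalent_linear_categories_op) unfold_locales
  note Dop = linear_abelian_category_op[OF D]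
  show ?thesis
  proof unfold_locales
    show "\<exists>Z. is_zero_object C Z" using D.ex_zero_object transfer_zero_object by blast
    fix X Y assume X: "X \<in> Obj C" and Y: "Y \<in> Obj C"
    show "\<exists>B i j p q. is_biproduct C X Y B i j p q" by (rule transfer_biproduct[OF D X Y])
    show "\<exists>N k. is_kernel C X Y f N k" if "f \<in> Hom C X Y" for f
      by (rule transfer_kernel[OF D X Y that])
    show "\<exists>Q c. is_cokernel C X Y f Q c" if "f \<in> Hom C X Y" for f
      unfolding is_cokernel_op
      by (rule weakly_equivalent_linear_categories.transfer_kernel[OF op Dop])
        (use X Y that in \<open>simp_all add: op_cat_sel\<close>)
    show "\<exists>Z g. Z \<in> Obj C \<and> g \<in> Hom C Y Z \<and> is_kernel C Y Z g X f" if "is_mono C X Y f" for f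
      by (rule transfer_mono_normal[OF D X Y that])
    show "\<exists>W g. W \<in> Obj C \<and> g \<in> Hom C W X \<and> is_cokernel C W X g Y f" if "is_epi C X Y f" for f
      using weakly_equivalent_linear_categories.transfer_mono_normal[OF op Dop, of Y X f] X Y that
      by (simp add: is_cokernel_op is_epi_op op_cat_sel)
  qed
qed

section \<open>Functor categories and products\<close>

lemma functor_category_sel:
  "Obj (functor_category C D) = {F. is_functor C D F}"
  "Hom (functor_category C D) = nat_trans C D"
  "Ident (functor_category C D) F = (\<lambda>X \<in> Obj C. Ident D (omap F X))"
  "Comp (functor_category C D) F G H \<beta> \<alpha> =
    (\<lambda>X \<in> Obj C. Comp D (omap F X) (omap G X) (omap H X) (\<beta> X) (\<alpha> X))"
  "Hadd (functor_category C D) F G \<alpha> \<beta> = (\<lambda>X \<in> Obj C. Hadd D (omap F X) (omap G X) (\<alpha> X) (\<beta> X))"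
  "Hzero (functor_category C D) F G = (\<lambda>X \<in> Obj C. Hzero D (omap F X) (omap G X))"
  "Hsmult (functor_category C D) F G c \<alpha> = (\<lambda>X \<in> Obj C. Hsmult D (omap F X) (omap G X) c (\<alpha> X))"
  by (simp_all add: functor_category_def)

lemma nat_transD:
  assumes "\<eta> \<in> nat_trans C D F G"
  shows "X \<in> Obj C \<Longrightarrow> \<eta> X \<in> Hom D (omap F X) (omap G X)"
    and "\<lbrakk>X \<in> Obj C; Y \<in> Obj C; f \<in> Hom C X Y\<rbrakk> \<Longrightarrow>
      Comp D (omap F X) (omap F Y) (omap G Y) (\<eta> Y) (amap F X Y f)
      = Comp D (omap F X) (omap G X) (omap G Y) (amap G X Y f) (\<eta> X)"
    and "\<eta> \<in> extensional (Obj C)"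
  using assms by (auto simp: nat_trans_def PiE_def)

lemma nat_transI:
  assumes "\<And>X. X \<in> Obj C \<Longrightarrow> \<eta> X \<in> Hom D (omap F X) (omap G X)" "\<eta> \<in> extensional (Obj C)"
    and "\<And>X Y f. \<lbrakk>X \<in> Obj C; Y \<in> Obj C; f \<in> Hom C X Y\<rbrakk> \<Longrightarrow>
      Comp D (omap F X) (omap F Y) (omap G Y) (\<eta> Y) (amap F X Y f)
      = Comp D (omap F X) (omap G X) (omap G Y) (amap G X Y f) (\<eta> X)"
  shows "\<eta> \<in> nat_trans C D F G"
  using assms by (auto simp: nat_trans_def PiE_def)

lemma left_module_axiomsI:
  fixes R :: "('r, 'c) ring_scheme" and M :: "('r, 'm, 'd) module_scheme"
  assumes R: "ring R"
    and "\<And>x y. \<lbrakk>x \<in> carrier M; y \<in> carrier M\<rbrakk> \<Longrightarrow> x \<oplus>\<^bsub>M\<^esub> y \<in> carrier M"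
    and "\<zero>\<^bsub>M\<^esub> \<in> carrier M"
    and "\<And>x y z. \<lbrakk>x \<in> carrier M; y \<in> carrier M; z \<in> carrier M\<rbrakk> \<Longrightarrow> (x \<oplus>\<^bsub>M\<^esub> y) \<oplus>\<^bsub>M\<^esub> z = x \<oplus>\<^bsub>M\<^esub> (y \<oplus>\<^bsub>M\<^esub> z)"
    and "\<And>x y. \<lbrakk>x \<in> carrier M; y \<in> carrier M\<rbrakk> \<Longrightarrow> x \<oplus>\<^bsub>M\<^esub> y = y \<oplus>\<^bsub>M\<^esub> x"
    and "\<And>x. x \<in> carrier M \<Longrightarrow> \<zero>\<^bsub>M\<^esub> \<oplus>\<^bsub>M\<^esub> x = x"
    and "\<And>x. x \<in> carrier M \<Longrightarrow> \<exists>y \<in> carrier M. y \<oplus>\<^bsub>M\<^esub> x = \<zero>\<^bsub>M\<^esub>"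
    and "\<And>a x. \<lbrakk>a \<in> carrier R; x \<in> carrier M\<rbrakk> \<Longrightarrow> a \<odot>\<^bsub>M\<^esub> x \<in> carrier M"
    and "\<And>a b x. \<lbrakk>a \<in> carrier R; b \<in> carrier R; x \<in> carrier M\<rbrakk> \<Longrightarrow> (a \<oplus>\<^bsub>R\<^esub> b) \<odot>\<^bsub>M\<^esub> x = a \<odot>\<^bsub>M\<^esub> x \<oplus>\<^bsub>M\<^esub> b \<odot>\<^bsub>M\<^esub> x"
    and "\<And>a x y. \<lbrakk>a \<in> carrier R; x \<in> carrier M; y \<in> carrier M\<rbrakk> \<Longrightarrow> a \<odot>\<^bsub>M\<^esub> (x \<oplus>\<^bsub>M\<^esub> y) = a \<odot>\<^bsub>M\<^esub> x \<oplus>\<^bsub>M\<^esub> a \<odot>\<^bsub>M\<^esub> y"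
    and "\<And>a b x. \<lbrakk>a \<in> carrier R; b \<in> carrier R; x \<in> carrier M\<rbrakk> \<Longrightarrow> (a \<otimes>\<^bsub>R\<^esub> b) \<odot>\<^bsub>M\<^esub> x = a \<odot>\<^bsub>M\<^esub> (b \<odot>\<^bsub>M\<^esub> x)"
    and "\<And>x. x \<in> carrier M \<Longrightarrow> \<one>\<^bsub>R\<^esub> \<odot>\<^bsub>M\<^esub> x = x"
  shows "left_module R M"
proof -
  have "abelian_group M" by (rule abelian_groupI) (fact assms)+
  moreover have "left_module_axioms R M" by (rule left_module_axioms.intro) (fact assms)+
  ultimately show ?thesis using R by (intro left_module.intro)
qed

lemma left_module_rules:
  fixes R :: "('r, 'c) ring_scheme" and M :: "('r, 'm, 'd) module_scheme"
  assumes "left_module R M"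
  shows "\<And>x y. \<lbrakk>x \<in> carrier M; y \<in> carrier M\<rbrakk> \<Longrightarrow> x \<oplus>\<^bsub>M\<^esub> y \<in> carrier M"
    and "\<zero>\<^bsub>M\<^esub> \<in> carrier M"
    and "\<And>x y z. \<lbrakk>x \<in> carrier M; y \<in> carrier M; z \<in> carrier M\<rbrakk> \<Longrightarrow> (x \<oplus>\<^bsub>M\<^esub> y) \<oplus>\<^bsub>M\<^esub> z = x \<oplus>\<^bsub>M\<^esub> (y \<oplus>\<^bsub>M\<^esub> z)"
    and "\<And>x y. \<lbrakk>x \<in> carrier M; y \<in> carrier M\<rbrakk> \<Longrightarrow> x \<oplus>\<^bsub>M\<^esub> y = y \<oplus>\<^bsub>M\<^esub> x"
    and "\<And>x. x \<in> carrier M \<Longrightarrow> \<zero>\<^bsub>M\<^esub> \<oplus>\<^bsub>M\<^esub> x = x"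
    and "\<And>x. x \<in> carrier M \<Longrightarrow> \<exists>y \<in> carrier M. y \<oplus>\<^bsub>M\<^esub> x = \<zero>\<^bsub>M\<^esub>"
    and "\<And>a x. \<lbrakk>a \<in> carrier R; x \<in> carrier M\<rbrakk> \<Longrightarrow> a \<odot>\<^bsub>M\<^esub> x \<in> carrier M"
    and "\<And>a b x. \<lbrakk>a \<in> carrier R; b \<in> carrier R; x \<in> carrier M\<rbrakk> \<Longrightarrow> (a \<oplus>\<^bsub>R\<^esub> b) \<odot>\<^bsub>M\<^esub> x = a \<odot>\<^bsub>M\<^esub> x \<oplus>\<^bsub>M\<^esub> b \<odot>\<^bsub>M\<^esub> x"
    and "\<And>a x y. \<lbrakk>a \<in> carrier R; x \<in> carrier M; y \<in> carrier M\<rbrakk> \<Longrightarrow> a \<odot>\<^bsub>M\<^esub> (x \<oplus>\<^bsub>M\<^esub> y) = a \<odot>\<^bsub>M\<^esub> x \<oplus>\<^bsub>M\<^esub> a \<odot>\<^bsub>M\<^esub> y"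
    and "\<And>a b x. \<lbrakk>a \<in> carrier R; b \<in> carrier R; x \<in> carrier M\<rbrakk> \<Longrightarrow> (a \<otimes>\<^bsub>R\<^esub> b) \<odot>\<^bsub>M\<^esub> x = a \<odot>\<^bsub>M\<^esub> (b \<odot>\<^bsub>M\<^esub> x)"
    and "\<And>x. x \<in> carrier M \<Longrightarrow> \<one>\<^bsub>R\<^esub> \<odot>\<^bsub>M\<^esub> x = x"
proof -
  interpret left_module R M by fact
  show "\<And>x y. \<lbrakk>x \<in> carrier M; y \<in> carrier M\<rbrakk> \<Longrightarrow> x \<oplus>\<^bsub>M\<^esub> y \<in> carrier M"
    "\<zero>\<^bsub>M\<^esub> \<in> carrier M"
    "\<And>x y z. \<lbrakk>x \<in> carrier M; y \<in> carrier M; z \<in> carrier M\<rbrakk> \<Longrightarrow> (x \<oplus>\<^bsub>M\<^esub> y) \<oplus>\<^bsub>M\<^esub> z = x \<oplus>\<^bsub>M\<^esub> (y \<oplus>\<^bsub>M\<^esub> z)"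
    "\<And>x y. \<lbrakk>x \<in> carrier M; y \<in> carrier M\<rbrakk> \<Longrightarrow> x \<oplus>\<^bsub>M\<^esub> y = y \<oplus>\<^bsub>M\<^esub> x"
    "\<And>x. x \<in> carrier M \<Longrightarrow> \<zero>\<^bsub>M\<^esub> \<oplus>\<^bsub>M\<^esub> x = x"
    by (simp_all add: M.a_assoc) (simp add: M.a_comm)
  show "\<And>x. x \<in> carrier M \<Longrightarrow> \<exists>y \<in> carrier M. y \<oplus>\<^bsub>M\<^esub> x = \<zero>\<^bsub>M\<^esub>"
    using M.a_inv_closed M.l_neg by blast
qed (use assms in \<open>simp_all add: left_module_def left_module_axioms_def\<close>)

lemma left_module_of_module: "module K M \<Longrightarrow> left_module K M"
  using left_module_iff_module Module.module_def by blast

lemma module_of_left_module: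
  fixes K :: "('k, 'c) ring_scheme" and M :: "('k, 'm, 'd) module_scheme"
  shows "\<lbrakk>cring K; left_module K M\<rbrakk> \<Longrightarrow> module K M"
  using left_module_iff_module by blast

lemmas module_axiomsI = module_of_left_module[OF _ left_module_axiomsI[OF cring.axioms(1)]]

lemmas module_rules = left_module_rules[OF left_module_of_module]

lemmas hom_module_rules = module_rules[of _ "hom_module _ _ _", unfolded hom_module_sel]

lemma linear_category_functor_category:
  fixes C :: "('o, 'a, 'y) cat_scheme" and D :: "('k, 'p, 'b, 'z) lin_cat_scheme"
  assumes C: "category C" and D: "linear_category K D"
  shows "linear_category K (functor_category C D)"
proof -
  interpret C: category C by fact
  interpret D: linear_category K D by fact
  have K: "cring K" using D by (simp add: linear_category_def)
  let ?E = "functor_category C D"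
  note sel = functor_category_sel
  have ob: "omap F X \<in> Obj D" if "is_functor C D F" "X \<in> Obj C" for F X
    using is_functorD(1)[OF that] .
  note ar = is_functorD(2)
  have comp: "Comp ?E F G H \<beta> \<alpha> \<in> nat_trans C D F H"
    if F: "is_functor C D F" and G: "is_functor C D G" and H: "is_functor C D H"
      and \<alpha>: "\<alpha> \<in> nat_trans C D F G" and \<beta>: "\<beta> \<in> nat_trans C D G H" for F G H \<alpha> \<beta>
    unfolding sel
  proof (rule nat_transI)
    fix X Y f assume X: "X \<in> Obj C" and Y: "Y \<in> Obj C" and f: "f \<in> Hom C X Y"
    note O = ob[OF F X] ob[OF F Y] ob[OF G X] ob[OF G Y] ob[OF H X] ob[OF H Y]
    note A = ar[OF F X Y f] ar[OF G X Y f] ar[OF H X Y f]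
      nat_transD(1)[OF \<alpha> X] nat_transD(1)[OF \<alpha> Y] nat_transD(1)[OF \<beta> X] nat_transD(1)[OF \<beta> Y]
    have "Comp D (omap F X) (omap F Y) (omap H Y) (Comp D (omap F Y) (omap G Y) (omap H Y) (\<beta> Y) (\<alpha> Y)) (amap F X Y f) =
      Comp D (omap F X) (omap G Y) (omap H Y) (\<beta> Y) (Comp D (omap F X) (omap G X) (omap G Y) (amap G X Y f) (\<alpha> X))"
      using O A nat_transD(2)[OF \<alpha> X Y f] by (simp add: D.Comp_assoc')
    also have "\<dots> = Comp D (omap F X) (omap G X) (omap H Y)
        (Comp D (omap G X) (omap H X) (omap H Y) (amap H X Y f) (\<beta> X)) (\<alpha> X)"
      using O A nat_transD(2)[OF \<beta> X Y f] by (simp add: D.Comp_assoc)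
    also have "\<dots> = Comp D (omap F X) (omap H X) (omap H Y) (amap H X Y f)
        (Comp D (omap F X) (omap G X) (omap H X) (\<beta> X) (\<alpha> X))"
      using O A by (simp add: D.Comp_assoc')
    finally show "Comp D (omap F X) (omap F Y) (omap H Y)
        ((\<lambda>X \<in> Obj C. Comp D (omap F X) (omap G X) (omap H X) (\<beta> X) (\<alpha> X)) Y) (amap F X Y f) =
      Comp D (omap F X) (omap H X) (omap H Y) (amap H X Y f)
        ((\<lambda>X \<in> Obj C. Comp D (omap F X) (omap G X) (omap H X) (\<beta> X) (\<alpha> X)) X)"
      using X Y by simp
  qed (use that nat_transD(1)[OF \<alpha>] nat_transD(1)[OF \<beta>] ob in \<open>auto simp: D.Comp_closed\<close>)
  have cat: "category ?E"
  proof (rule category.intro)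
    show "Ident ?E F \<in> Hom ?E F F" if "F \<in> Obj ?E" for F
    proof -
      have F: "is_functor C D F" using that by (simp add: sel)
      show ?thesis
        unfolding sel by (rule nat_transI)
          (simp_all add: ob[OF F] ar[OF F] D.Ident_closed D.Comp_Ident_left D.Comp_Ident_right)
    qed
    show "Comp ?E F G H \<beta> \<alpha> \<in> Hom ?E F H"
      if "F \<in> Obj ?E" "G \<in> Obj ?E" "H \<in> Obj ?E" "\<alpha> \<in> Hom ?E F G" "\<beta> \<in> Hom ?E G H" for F G H \<alpha> \<beta>
      using comp that by (simp add: sel)
    show "Comp ?E F G G (Ident ?E G) \<alpha> = \<alpha>" if "F \<in> Obj ?E" "G \<in> Obj ?E" "\<alpha> \<in> Hom ?E F G" for F G \<alpha>
      using that nat_transD[of \<alpha> C D F G] ob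
      by (intro extensionalityI[of _ "Obj C"]) (auto simp: sel D.Comp_Ident_left)
    show "Comp ?E F F G \<alpha> (Ident ?E F) = \<alpha>" if "F \<in> Obj ?E" "G \<in> Obj ?E" "\<alpha> \<in> Hom ?E F G" for F G \<alpha>
      using that nat_transD[of \<alpha> C D F G] ob
      by (intro extensionalityI[of _ "Obj C"]) (auto simp: sel D.Comp_Ident_right)
    show "Comp ?E F H I \<gamma> (Comp ?E F G H \<beta> \<alpha>) = Comp ?E F G I (Comp ?E G H I \<gamma> \<beta>) \<alpha>"
      if "F \<in> Obj ?E" "G \<in> Obj ?E" "H \<in> Obj ?E" "I \<in> Obj ?E"
        "\<alpha> \<in> Hom ?E F G" "\<beta> \<in> Hom ?E G H" "\<gamma> \<in> Hom ?E H I" for F G H I \<alpha> \<beta> \<gamma>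
      using that nat_transD(1)[of \<alpha> C D F G] nat_transD(1)[of \<beta> C D G H] nat_transD(1)[of \<gamma> C D H I] ob
      by (auto simp: sel D.Comp_assoc intro!: restrict_ext)
  qed
  have add: "Hadd ?E F G \<alpha> \<beta> \<in> nat_trans C D F G"
    if F: "is_functor C D F" and G: "is_functor C D G" and \<alpha>: "\<alpha> \<in> nat_trans C D F G" and \<beta>: "\<beta> \<in> nat_trans C D F G"
    for F G \<alpha> \<beta>
    unfolding sel by (rule nat_transI) (use F G \<alpha> \<beta> in
      \<open>simp_all add: nat_transD[OF \<alpha>] nat_transD[OF \<beta>] ob ar D.Hadd_closed D.Comp_Hadd_left D.Comp_Hadd_right\<close>)
  have zero: "Hzero ?E F G \<in> nat_trans C D F G" if F: "is_functor C D F" and G: "is_functor C D G" for F G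
    unfolding sel by (rule nat_transI) (use F G in
      \<open>simp_all add: ob ar D.Hzero_closed D.Comp_Hzero_left D.Comp_Hzero_right\<close>)
  have smult: "Hsmult ?E F G c \<alpha> \<in> nat_trans C D F G"
    if F: "is_functor C D F" and G: "is_functor C D G" and c: "c \<in> carrier K" and \<alpha>: "\<alpha> \<in> nat_trans C D F G"
    for F G c \<alpha>
    unfolding sel by (rule nat_transI) (use F G c \<alpha> in
      \<open>simp_all add: nat_transD[OF \<alpha>] ob ar D.Hsmult_closed D.Comp_Hsmult_left D.Comp_Hsmult_right\<close>)
  have mod: "module K (hom_module ?E F G)" if F: "is_functor C D F" and G: "is_functor C D G" for F G
  proof (rule module_axiomsI[OF K K], unfold hom_module_sel functor_category_sel(2))
    note R = hom_module_rules[OF D.hom_module[OF ob[OF F] ob[OF G]]]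
    note T = nat_transD(1)[of _ C D F G]
    show "Hadd ?E F G \<alpha> \<beta> \<in> nat_trans C D F G" if "\<alpha> \<in> nat_trans C D F G" "\<beta> \<in> nat_trans C D F G" for \<alpha> \<beta>
      using add[OF F G that] .
    show "Hzero ?E F G \<in> nat_trans C D F G" using zero[OF F G] .
    show "Hsmult ?E F G c \<alpha> \<in> nat_trans C D F G" if "c \<in> carrier K" "\<alpha> \<in> nat_trans C D F G" for c \<alpha>
      using smult[OF F G that] .
    show "Hadd ?E F G (Hadd ?E F G \<alpha> \<beta>) \<gamma> = Hadd ?E F G \<alpha> (Hadd ?E F G \<beta> \<gamma>)"
      if "\<alpha> \<in> nat_trans C D F G" "\<beta> \<in> nat_trans C D F G" "\<gamma> \<in> nat_trans C D F G" for \<alpha> \<beta> \<gamma>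
      unfolding sel by (intro restrict_ext) (simp add: R(3) T that)
    show "Hadd ?E F G \<alpha> \<beta> = Hadd ?E F G \<beta> \<alpha>"
      if "\<alpha> \<in> nat_trans C D F G" "\<beta> \<in> nat_trans C D F G" for \<alpha> \<beta>
      unfolding sel by (intro restrict_ext R(4)) (simp_all add: T that)
    show "Hadd ?E F G (Hzero ?E F G) \<alpha> = \<alpha>" if "\<alpha> \<in> nat_trans C D F G" for \<alpha>
      using nat_transD(3)[OF that] unfolding sel by (intro extensionalityI[of _ "Obj C"]) (simp_all add: R(5) T that)
    show "\<exists>\<beta> \<in> nat_trans C D F G. Hadd ?E F G \<beta> \<alpha> = Hzero ?E F G" if \<alpha>: "\<alpha> \<in> nat_trans C D F G" for \<alpha>
    proof (intro bexI)
      have m1: "\<ominus>\<^bsub>K\<^esub> \<one>\<^bsub>K\<^esub> \<in> carrier K" using K by (simp add: cring_def ring.ring_simprules)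
      then show "Hsmult ?E F G (\<ominus>\<^bsub>K\<^esub> \<one>\<^bsub>K\<^esub>) \<alpha> \<in> nat_trans C D F G" using smult[OF F G] \<alpha> by simp
      have *: "\<ominus>\<^bsub>K\<^esub> \<one>\<^bsub>K\<^esub> \<oplus>\<^bsub>K\<^esub> \<one>\<^bsub>K\<^esub> = \<zero>\<^bsub>K\<^esub>" using K by (simp add: cring_def ring.ring_simprules)
      have o: "\<one>\<^bsub>K\<^esub> \<in> carrier K" using K by (simp add: cring_def ring.ring_simprules)
      have "Hadd D (omap F X) (omap G X) (Hsmult D (omap F X) (omap G X) (\<ominus>\<^bsub>K\<^esub> \<one>\<^bsub>K\<^esub>) (\<alpha> X)) (\<alpha> X) =
        Hzero D (omap F X) (omap G X)" if X: "X \<in> Obj C" for X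
        using R(8)[OF X X m1 o T[OF \<alpha> X]] R(11)[OF X X T[OF \<alpha> X]] D.Hsmult_zero[OF ob[OF F X] ob[OF G X] T[OF \<alpha> X]]
        by (simp add: *)
      then show "Hadd ?E F G (Hsmult ?E F G (\<ominus>\<^bsub>K\<^esub> \<one>\<^bsub>K\<^esub>) \<alpha>) \<alpha> = Hzero ?E F G"
        unfolding sel by (intro restrict_ext) simp
    qed
    show "Hsmult ?E F G (a \<oplus>\<^bsub>K\<^esub> b) \<alpha> = Hadd ?E F G (Hsmult ?E F G a \<alpha>) (Hsmult ?E F G b \<alpha>)"
      if "a \<in> carrier K" "b \<in> carrier K" "\<alpha> \<in> nat_trans C D F G" for a b \<alpha>
      unfolding sel by (intro restrict_ext) (simp add: R(8) T that)
    show "Hsmult ?E F G a (Hadd ?E F G \<alpha> \<beta>) = Hadd ?E F G (Hsmult ?E F G a \<alpha>) (Hsmult ?E F G a \<beta>)"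
      if "a \<in> carrier K" "\<alpha> \<in> nat_trans C D F G" "\<beta> \<in> nat_trans C D F G" for a \<alpha> \<beta>
      unfolding sel by (intro restrict_ext) (simp add: R(9) T that)
    show "Hsmult ?E F G (a \<otimes>\<^bsub>K\<^esub> b) \<alpha> = Hsmult ?E F G a (Hsmult ?E F G b \<alpha>)"
      if "a \<in> carrier K" "b \<in> carrier K" "\<alpha> \<in> nat_trans C D F G" for a b \<alpha>
      unfolding sel by (intro restrict_ext) (simp add: R(10) T that)
    show "Hsmult ?E F G \<one>\<^bsub>K\<^esub> \<alpha> = \<alpha>" if "\<alpha> \<in> nat_trans C D F G" for \<alpha>
      using nat_transD(3)[OF that] unfolding sel by (intro extensionalityI[of _ "Obj C"]) (simp_all add: R(11) T that)
  qed
  have "linear_category_axioms K ?E"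
  proof (rule linear_category_axioms.intro)
    show "module K (hom_module ?E F G)" if "F \<in> Obj ?E" "G \<in> Obj ?E" for F G
      using mod that by (simp add: sel)
    note T = nat_transD(1)
    show "Comp ?E F G H (Hadd ?E G H \<beta> \<beta>') \<alpha> = Hadd ?E F H (Comp ?E F G H \<beta> \<alpha>) (Comp ?E F G H \<beta>' \<alpha>)"
      if "F \<in> Obj ?E" "G \<in> Obj ?E" "H \<in> Obj ?E" "\<alpha> \<in> Hom ?E F G" "\<beta> \<in> Hom ?E G H" "\<beta>' \<in> Hom ?E G H"
      for F G H \<alpha> \<beta> \<beta>'
      using that T[of \<alpha> C D F G] T[of \<beta> C D G H] T[of \<beta>' C D G H]
      by (simp add: sel ob D.Comp_Hadd_left cong: restrict_cong)
    show "Comp ?E F G H \<beta> (Hadd ?E F G \<alpha> \<alpha>') = Hadd ?E F H (Comp ?E F G H \<beta> \<alpha>) (Comp ?E F G H \<beta> \<alpha>')"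
      if "F \<in> Obj ?E" "G \<in> Obj ?E" "H \<in> Obj ?E" "\<alpha> \<in> Hom ?E F G" "\<alpha>' \<in> Hom ?E F G" "\<beta> \<in> Hom ?E G H"
      for F G H \<alpha> \<alpha>' \<beta>
      using that T[of \<alpha> C D F G] T[of \<alpha>' C D F G] T[of \<beta> C D G H]
      by (simp add: sel ob D.Comp_Hadd_right cong: restrict_cong)
    show "Comp ?E F G H (Hsmult ?E G H c \<beta>) \<alpha> = Hsmult ?E F H c (Comp ?E F G H \<beta> \<alpha>)"
      if "F \<in> Obj ?E" "G \<in> Obj ?E" "H \<in> Obj ?E" "c \<in> carrier K" "\<alpha> \<in> Hom ?E F G" "\<beta> \<in> Hom ?E G H"
      for F G H c \<alpha> \<beta>
      using that T[of \<alpha> C D F G] T[of \<beta> C D G H]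
      by (simp add: sel ob D.Comp_Hsmult_left cong: restrict_cong)
    show "Comp ?E F G H \<beta> (Hsmult ?E F G c \<alpha>) = Hsmult ?E F H c (Comp ?E F G H \<beta> \<alpha>)"
      if "F \<in> Obj ?E" "G \<in> Obj ?E" "H \<in> Obj ?E" "c \<in> carrier K" "\<alpha> \<in> Hom ?E F G" "\<beta> \<in> Hom ?E G H"
      for F G H c \<alpha> \<beta>
      using that T[of \<alpha> C D F G] T[of \<beta> C D G H]
      by (simp add: sel ob D.Comp_Hsmult_right cong: restrict_cong)
  qed
  with K cat show ?thesis by (intro linear_category.intro)
qed

text \<open>
  The componentwise inverses are natural, by conjugating the naturality squares.
\<close>

lemma nat_trans_inverse:
  assumes C: "category C" and D: "category D" and F: "is_functor C D F" and G: "is_functor C D G"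
    and \<eta>: "\<eta> \<in> nat_trans C D F G" and iso: "\<And>X. X \<in> Obj C \<Longrightarrow> is_iso D (omap F X) (omap G X) (\<eta> X)"
  obtains \<zeta> where "\<zeta> \<in> nat_trans C D G F"
    "\<And>X. X \<in> Obj C \<Longrightarrow> Comp D (omap F X) (omap G X) (omap F X) (\<zeta> X) (\<eta> X) = Ident D (omap F X)"
    "\<And>X. X \<in> Obj C \<Longrightarrow> Comp D (omap G X) (omap F X) (omap G X) (\<eta> X) (\<zeta> X) = Ident D (omap G X)"
proof -
  interpret C: category C by fact
  interpret D: category D by fact
  define P where "P X z \<longleftrightarrow> z \<in> Hom D (omap G X) (omap F X) \<and>
    Comp D (omap F X) (omap G X) (omap F X) z (\<eta> X) = Ident D (omap F X) \<and>
    Comp D (omap G X) (omap F X) (omap G X) (\<eta> X) z = Ident D (omap G X)" for X z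
  define \<zeta> where "\<zeta> = (\<lambda>X \<in> Obj C. SOME z. P X z)"
  have "P X (\<zeta> X)" if X: "X \<in> Obj C" for X
  proof -
    have "\<exists>z. P X z" using iso[OF X] unfolding is_iso_def P_def by blast
    then have "P X (SOME z. P X z)" by (rule someI_ex)
    then show ?thesis using X by (simp add: \<zeta>_def)
  qed
  then have \<zeta>: "\<And>X. X \<in> Obj C \<Longrightarrow> \<zeta> X \<in> Hom D (omap G X) (omap F X)"
    "\<And>X. X \<in> Obj C \<Longrightarrow> Comp D (omap F X) (omap G X) (omap F X) (\<zeta> X) (\<eta> X) = Ident D (omap F X)"
    "\<And>X. X \<in> Obj C \<Longrightarrow> Comp D (omap G X) (omap F X) (omap G X) (\<eta> X) (\<zeta> X) = Ident D (omap G X)"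
    unfolding P_def by blast+
  have "\<zeta> \<in> nat_trans C D G F"
  proof (rule nat_transI)
    fix X Y f assume X: "X \<in> Obj C" and Y: "Y \<in> Obj C" and f: "f \<in> Hom C X Y"
    note O = is_functorD(1)[OF F X] is_functorD(1)[OF F Y] is_functorD(1)[OF G X] is_functorD(1)[OF G Y]
    note A = is_functorD(2)[OF F X Y f] is_functorD(2)[OF G X Y f] nat_transD(1)[OF \<eta> X] nat_transD(1)[OF \<eta> Y]
      \<zeta>(1)[OF X] \<zeta>(1)[OF Y]
    have "Comp D (omap G X) (omap G Y) (omap F Y) (\<zeta> Y) (amap G X Y f) =
      Comp D (omap G X) (omap G Y) (omap F Y) (\<zeta> Y) (Comp D (omap G X) (omap G X) (omap G Y) (amap G X Y f)
        (Comp D (omap G X) (omap F X) (omap G X) (\<eta> X) (\<zeta> X)))"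
      using O A \<zeta>(3)[OF X] by (simp add: D.Comp_Ident_right)
    also have "\<dots> = Comp D (omap G X) (omap G Y) (omap F Y) (\<zeta> Y) (Comp D (omap G X) (omap F X) (omap G Y)
        (Comp D (omap F X) (omap G X) (omap G Y) (amap G X Y f) (\<eta> X)) (\<zeta> X))"
      using O A by (simp add: D.Comp_assoc')
    also have "\<dots> = Comp D (omap G X) (omap G Y) (omap F Y) (\<zeta> Y) (Comp D (omap G X) (omap F X) (omap G Y)
        (Comp D (omap F X) (omap F Y) (omap G Y) (\<eta> Y) (amap F X Y f)) (\<zeta> X))"
      using nat_transD(2)[OF \<eta> X Y f] by simp
    also have "\<dots> = Comp D (omap G X) (omap F Y) (omap F Y) (Comp D (omap F Y) (omap G Y) (omap F Y) (\<zeta> Y) (\<eta> Y))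
        (Comp D (omap G X) (omap F X) (omap F Y) (amap F X Y f) (\<zeta> X))"
      using O A by (simp add: D.Comp_assoc' D.Comp_closed)
    also have "\<dots> = Comp D (omap G X) (omap F X) (omap F Y) (amap F X Y f) (\<zeta> X)"
      using O A \<zeta>(2)[OF Y] by (simp add: D.Comp_Ident_left D.Comp_closed)
    finally show "Comp D (omap G X) (omap G Y) (omap F Y) (\<zeta> Y) (amap G X Y f) =
      Comp D (omap G X) (omap F X) (omap F Y) (amap F X Y f) (\<zeta> X)" .
  qed (use \<zeta>(1) in \<open>auto simp: \<zeta>_def\<close>)
  with that \<zeta>(2,3) show ?thesis by blast
qed

text \<open>
  Precomposition with a weak equivalence \<open>F\<close> is a weak equivalence of functor categories. A
  transformation between \<open>G F\<close> and \<open>H F\<close> extends to one between \<open>G\<close> and \<open>H\<close> by conjugation with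
  the isomorphisms \<open>F (pre Z) \<cong> Z\<close>; a functor extends by composition with a quasi-inverse of \<open>F\<close>.
\<close>

definition precomposition ::
    "('o, 'a, 'y) cat_scheme \<Rightarrow> ('o, 'a, 'p, 'b) fctr \<Rightarrow>
     (('p, 'b, 'q, 'c) fctr, 'p \<Rightarrow> 'c, ('o, 'a, 'q, 'c) fctr, 'o \<Rightarrow> 'c) fctr" where
  "precomposition C F = \<lparr>omap = (\<lambda>G. comp_functor G F), amap = (\<lambda>G H \<alpha>. \<lambda>X \<in> Obj C. \<alpha> (omap F X))\<rparr>"

lemma precomposition_sel:
  "omap (precomposition C F) G = comp_functor G F"
  "amap (precomposition C F) G H = (\<lambda>\<alpha>. \<lambda>X \<in> Obj C. \<alpha> (omap F X))"
  by (simp_all add: precomposition_def)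

context weakly_equivalent_categories
begin

lemma precomposition_arrow:
  assumes "\<alpha> \<in> nat_trans D T G H"
  shows "(\<lambda>X \<in> Obj C. \<alpha> (omap F X)) \<in> nat_trans C T (comp_functor G F) (comp_functor H F)"
  by (rule nat_transI) (use assms in \<open>auto simp: comp_functor_sel F_rules nat_transD\<close>)

lemma precomposition_functor:
  "is_functor (functor_category D T) (functor_category C T) (precomposition C F)"
  unfolding is_functor_def functor_category_sel precomposition_sel
  using is_functor_comp[OF F_functor] precomposition_arrow
  by (auto simp: comp_functor_sel F_rules intro!: restrict_ext)

text \<open>The value at \<open>Z\<close> of a transformation from \<open>G\<close> to \<open>H\<close> that is \<open>b\<close> at \<open>F (pre Z)\<close>.\<close>

definition extend where
  "extend T G H b Z =
    Comp T (omap G Z) (omap H (omap F (pre Z))) (omap H Z) (amap H (omap F (pre Z)) Z (counit Z))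
      (Comp T (omap G Z) (omap G (omap F (pre Z))) (omap H (omap F (pre Z))) b
        (amap G Z (omap F (pre Z)) (counit' Z)))"

text \<open>
  Naturality at \<open>counit Z\<close>: a transformation on \<open>D\<close> is determined by its restriction to \<open>C\<close>.
\<close>

lemma extend_natural:
  assumes T: "category T" and G: "is_functor D T G" and H: "is_functor D T H" and \<alpha>: "\<alpha> \<in> nat_trans D T G H"
    and Z: "Z \<in> Obj D"
  shows "\<alpha> Z = extend T G H (\<alpha> (omap F (pre Z))) Z"
proof -
  interpret T: category T by fact
  let ?P = "omap F (pre Z)"
  note c = counit[OF Z] and P = omap_pre[OF Z]
  note Gr = is_functorD[OF G] and Hr = is_functorD[OF H]
  note O = Gr(1)[OF Z] Gr(1)[OF P] Hr(1)[OF Z] Hr(1)[OF P]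
  note A = Gr(2)[OF Z P c(3)] Gr(2)[OF P Z c(2)] Hr(2)[OF P Z c(2)] nat_transD(1)[OF \<alpha> Z] nat_transD(1)[OF \<alpha> P]
  have "extend T G H (\<alpha> ?P) Z = Comp T (omap G Z) (omap G ?P) (omap H Z)
      (Comp T (omap G ?P) (omap H ?P) (omap H Z) (amap H ?P Z (counit Z)) (\<alpha> ?P)) (amap G Z ?P (counit' Z))"
    unfolding extend_def using O A by (simp add: T.Comp_assoc)
  also have "\<dots> = Comp T (omap G Z) (omap G ?P) (omap H Z)
      (Comp T (omap G ?P) (omap G Z) (omap H Z) (\<alpha> Z) (amap G ?P Z (counit Z))) (amap G Z ?P (counit' Z))"
    using nat_transD(2)[OF \<alpha> P Z c(2)] by simp
  also have "\<dots> = Comp T (omap G Z) (omap G Z) (omap H Z) (\<alpha> Z) (amap G Z Z (Comp D Z ?P Z (counit Z) (counit' Z)))"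
    using O A Gr(4)[OF Z P Z c(3,2)] by (simp add: T.Comp_assoc')
  also have "\<dots> = \<alpha> Z" using O A c(5) Gr(3)[OF Z] by (simp add: T.Comp_Ident_right)
  finally show ?thesis by simp
qed

lemma extend_closed:
  assumes T: "category T" and G: "is_functor D T G" and H: "is_functor D T H"
    and b: "b \<in> Hom T (omap G (omap F (pre Z))) (omap H (omap F (pre Z)))" and Z: "Z \<in> Obj D"
  shows "extend T G H b Z \<in> Hom T (omap G Z) (omap H Z)"
  unfolding extend_def using assms counit[OF Z] omap_pre[OF Z]
  by (intro category.Comp_closed[OF T]) (auto simp: is_functorD)

text \<open>
  For naturality, an arrow \<open>h\<close> of \<open>D\<close> is conjugated into one between values of \<open>F\<close>, which is the image
  of an arrow of \<open>C\<close> because \<open>F\<close> is full, and there \<open>\<beta>\<close> is natural.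
\<close>

lemma extend_nat_trans:
  assumes T: "category T" and G: "is_functor D T G" and H: "is_functor D T H"
    and \<beta>: "\<beta> \<in> nat_trans C T (comp_functor G F) (comp_functor H F)"
  shows "(\<lambda>Z \<in> Obj D. extend T G H (\<beta> (pre Z)) Z) \<in> nat_trans D T G H" (is "?\<alpha> \<in> _")
    and "(\<lambda>X \<in> Obj C. (\<lambda>Z \<in> Obj D. extend T G H (\<beta> (pre Z)) Z) (omap F X)) = \<beta>"
proof -
  interpret T: category T by fact
  note Gr = is_functorD[OF G] and Hr = is_functorD[OF H]
  have b: "\<beta> X \<in> Hom T (omap G (omap F X)) (omap H (omap F X))" if "X \<in> Obj C" for X
    using nat_transD(1)[OF \<beta> that] by (simp add: comp_functor_sel)
  have bn: "Comp T (omap G (omap F X)) (omap G (omap F Y)) (omap H (omap F Y)) (\<beta> Y) (amap G (omap F X) (omap F Y) (amap F X Y f)) =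
      Comp T (omap G (omap F X)) (omap H (omap F X)) (omap H (omap F Y)) (amap H (omap F X) (omap F Y) (amap F X Y f)) (\<beta> X)"
    if "X \<in> Obj C" "Y \<in> Obj C" "f \<in> Hom C X Y" for X Y f
    using nat_transD(2)[OF \<beta> that] by (simp add: comp_functor_sel)
  show "?\<alpha> \<in> nat_trans D T G H"
  proof (rule nat_transI)
    show "?\<alpha> Z \<in> Hom T (omap G Z) (omap H Z)" if "Z \<in> Obj D" for Z
      using extend_closed[OF T G H b that] counit(1)[OF that] that by simp
    show "?\<alpha> \<in> extensional (Obj D)" by simp
    fix Z W h assume Z: "Z \<in> Obj D" and W: "W \<in> Obj D" and h: "h \<in> Hom D Z W"
    let ?Z = "omap F (pre Z)" and ?W = "omap F (pre W)"
    define k where "k = lift (pre Z) (pre W) (conjugate Z W h)"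
    note k = lift[OF counit(1)[OF Z] counit(1)[OF W] conjugate_closed[OF Z W h], folded k_def]
    note cZ = counit[OF Z] and cW = counit[OF W] and pZ = omap_pre[OF Z] and pW = omap_pre[OF W]
    note Fk = conjugate_closed[OF Z W h]
    have e1: "Comp D Z ?Z ?W (conjugate Z W h) (counit' Z) = Comp D Z W ?W (counit' W) h"
      unfolding conjugate_def using Z W h cZ(2,3,5) cW(2,3) pZ pW
      by (simp add: D.Comp_assoc' D.Comp_closed D.Comp_Ident_right)
    note O = Gr(1)[OF Z] Gr(1)[OF W] Gr(1)[OF pZ] Gr(1)[OF pW] Hr(1)[OF Z] Hr(1)[OF W] Hr(1)[OF pZ] Hr(1)[OF pW]
    note A = Gr(2)[OF Z W h] Hr(2)[OF Z W h] Gr(2)[OF pZ pW Fk] Hr(2)[OF pZ pW Fk]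
      Gr(2)[OF Z pZ cZ(3)] Gr(2)[OF W pW cW(3)] Hr(2)[OF pZ Z cZ(2)] Hr(2)[OF pW W cW(2)]
      b[OF cZ(1)] b[OF cW(1)]
    have "Comp T (omap G Z) (omap G W) (omap H W) (extend T G H (\<beta> (pre W)) W) (amap G Z W h) =
      Comp T (omap G Z) (omap H ?W) (omap H W) (amap H ?W W (counit W))
        (Comp T (omap G Z) (omap G ?W) (omap H ?W) (\<beta> (pre W))
          (Comp T (omap G Z) (omap G W) (omap G ?W) (amap G W ?W (counit' W)) (amap G Z W h)))"
      unfolding extend_def using O A by (simp add: T.Comp_assoc' T.Comp_closed)
    also have "\<dots> = Comp T (omap G Z) (omap H ?W) (omap H W) (amap H ?W W (counit W))
        (Comp T (omap G Z) (omap G ?W) (omap H ?W) (\<beta> (pre W))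
          (Comp T (omap G Z) (omap G ?Z) (omap G ?W) (amap G ?Z ?W (conjugate Z W h)) (amap G Z ?Z (counit' Z))))"
      unfolding Gr(4)[OF Z W pW h cW(3), symmetric] Gr(4)[OF Z pZ pW cZ(3) Fk, symmetric] e1 ..
    also have "\<dots> = Comp T (omap G Z) (omap H ?W) (omap H W) (amap H ?W W (counit W))
        (Comp T (omap G Z) (omap G ?Z) (omap H ?W)
          (Comp T (omap G ?Z) (omap G ?W) (omap H ?W) (\<beta> (pre W)) (amap G ?Z ?W (conjugate Z W h))) (amap G Z ?Z (counit' Z)))"
      using O A by (simp add: T.Comp_assoc)
    also have "\<dots> = Comp T (omap G Z) (omap H ?W) (omap H W) (amap H ?W W (counit W))
        (Comp T (omap G Z) (omap G ?Z) (omap H ?W)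
          (Comp T (omap G ?Z) (omap H ?Z) (omap H ?W) (amap H ?Z ?W (conjugate Z W h)) (\<beta> (pre Z))) (amap G Z ?Z (counit' Z)))"
      using bn[OF cZ(1) cW(1) k(1)] unfolding k(2) by simp
    also have "\<dots> = Comp T (omap G Z) (omap H ?Z) (omap H W)
        (Comp T (omap H ?Z) (omap H ?W) (omap H W) (amap H ?W W (counit W)) (amap H ?Z ?W (conjugate Z W h)))
        (Comp T (omap G Z) (omap G ?Z) (omap H ?Z) (\<beta> (pre Z)) (amap G Z ?Z (counit' Z)))"
      using O A by (simp add: T.Comp_assoc' T.Comp_closed)
    also have "\<dots> = Comp T (omap G Z) (omap H ?Z) (omap H W)
        (Comp T (omap H ?Z) (omap H Z) (omap H W) (amap H Z W h) (amap H ?Z Z (counit Z)))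
        (Comp T (omap G Z) (omap G ?Z) (omap H ?Z) (\<beta> (pre Z)) (amap G Z ?Z (counit' Z)))"
      unfolding Hr(4)[OF pZ pW W Fk cW(2), symmetric] Hr(4)[OF pZ Z W cZ(2) h, symmetric] counit_conjugate[OF Z W h] ..
    also have "\<dots> = Comp T (omap G Z) (omap H Z) (omap H W) (amap H Z W h) (extend T G H (\<beta> (pre Z)) Z)"
      unfolding extend_def using O A by (simp add: T.Comp_assoc' T.Comp_closed)
    finally show "Comp T (omap G Z) (omap G W) (omap H W) (?\<alpha> W) (amap G Z W h) =
      Comp T (omap G Z) (omap H Z) (omap H W) (amap H Z W h) (?\<alpha> Z)" using Z W by simp
  qed
  have "extend T G H (\<beta> (pre (omap F X))) (omap F X) = \<beta> X" if X: "X \<in> Obj C" for X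
  proof -
    let ?Z = "omap F X" and ?P = "omap F (pre (omap F X))"
    note Z = F_rules(1)[OF X]
    note c = counit[OF Z] and P = omap_pre[OF Z]
    define v where "v = lift (pre ?Z) X (counit ?Z)"
    note v = lift[OF c(1) X c(2), folded v_def]
    note O = Gr(1)[OF Z] Gr(1)[OF P] Hr(1)[OF Z] Hr(1)[OF P]
    note A = Gr(2)[OF Z P c(3)] Gr(2)[OF P Z c(2)] Hr(2)[OF P Z c(2)] b[OF X] b[OF c(1)]
    have "extend T G H (\<beta> (pre ?Z)) ?Z = Comp T (omap G ?Z) (omap G ?P) (omap H ?Z)
        (Comp T (omap G ?P) (omap H ?P) (omap H ?Z) (amap H ?P ?Z (counit ?Z)) (\<beta> (pre ?Z))) (amap G ?Z ?P (counit' ?Z))"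
      unfolding extend_def using O A by (simp add: T.Comp_assoc)
    also have "\<dots> = Comp T (omap G ?Z) (omap G ?P) (omap H ?Z)
        (Comp T (omap G ?P) (omap G ?Z) (omap H ?Z) (\<beta> X) (amap G ?P ?Z (counit ?Z))) (amap G ?Z ?P (counit' ?Z))"
      using bn[OF c(1) X v(1)] unfolding v(2) by simp
    also have "\<dots> = Comp T (omap G ?Z) (omap G ?Z) (omap H ?Z) (\<beta> X) (amap G ?Z ?Z (Comp D ?Z ?P ?Z (counit ?Z) (counit' ?Z)))"
      using O A Gr(4)[OF Z P Z c(3,2)] by (simp add: T.Comp_assoc')
    also have "\<dots> = \<beta> X" using O A c(5) Gr(3)[OF Z] by (simp add: T.Comp_Ident_right)
    finally show ?thesis .
  qed
  then show "(\<lambda>X \<in> Obj C. ?\<alpha> (omap F X)) = \<beta>"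
    using nat_transD(3)[OF \<beta>] F_rules(1) by (intro extensionalityI[of _ "Obj C"]) auto
qed

lemma precomposition_weak_equivalence:
  assumes T: "category T"
  shows "weak_equivalence (functor_category D T) (functor_category C T) (precomposition C F)"
  unfolding weak_equivalence_def
proof (intro conjI ballI)
  show "is_functor (functor_category D T) (functor_category C T) (precomposition C F)"
    by (rule precomposition_functor)
next
  fix G H assume "G \<in> Obj (functor_category D T)" "H \<in> Obj (functor_category D T)"
  then have G: "is_functor D T G" and H: "is_functor D T H" by (simp_all add: functor_category_sel)
  show "bij_betw (amap (precomposition C F) G H) (Hom (functor_category D T) G H)
      (Hom (functor_category C T) (omap (precomposition C F) G) (omap (precomposition C F) H))"
    unfolding functor_category_sel precomposition_sel
  proof (rule bij_betw_byWitness[where f' = "\<lambda>\<beta>. \<lambda>Z \<in> Obj D. extend T G H (\<beta> (pre Z)) Z"])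
    show "\<forall>\<alpha> \<in> nat_trans D T G H. (\<lambda>Z \<in> Obj D. extend T G H ((\<lambda>X \<in> Obj C. \<alpha> (omap F X)) (pre Z)) Z) = \<alpha>"
    proof
      fix \<alpha> assume \<alpha>: "\<alpha> \<in> nat_trans D T G H"
      show "(\<lambda>Z \<in> Obj D. extend T G H ((\<lambda>X \<in> Obj C. \<alpha> (omap F X)) (pre Z)) Z) = \<alpha>"
        using nat_transD(3)[OF \<alpha>] extend_natural[OF T G H \<alpha>] counit(1)
        by (intro extensionalityI[of _ "Obj D"]) auto
    qed
  qed (use extend_nat_trans[OF T G H] precomposition_arrow in blast)+
next
  interpret T: category T by fact
  fix L assume "L \<in> Obj (functor_category C T)"
  then have L: "is_functor C T L" by (simp add: functor_category_sel)
  have G: "is_functor D T (comp_functor L quasi_inverse)"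
    by (rule is_functor_comp[OF quasi_inverse_functor L])
  let ?GF = "comp_functor (comp_functor L quasi_inverse) F"
  have GF: "is_functor C T ?GF" by (rule is_functor_comp[OF F_functor G])
  obtain \<eta> where \<eta>: "\<eta> \<in> nat_trans C C id_functor (comp_functor quasi_inverse F)"
    and iso': "\<forall>X \<in> Obj C. is_iso C X (pre (omap F X)) (\<eta> X)"
    using quasi_inverse_unit
    unfolding naturally_isomorphic_def id_functor_sel comp_functor_sel quasi_inverse_sel(1) by blast
  have QF: "is_functor C C (comp_functor quasi_inverse F)" by (rule is_functor_comp[OF F_functor quasi_inverse_functor])
  have ob: "pre (omap F X) \<in> Obj C" if "X \<in> Obj C" for X using counit(1) F_rules(1) that by blast
  define \<theta> where "\<theta> = (\<lambda>X \<in> Obj C. amap L X (pre (omap F X)) (\<eta> X))"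
  have h: "\<eta> X \<in> Hom C X (pre (omap F X))" if "X \<in> Obj C" for X
    using nat_transD(1)[OF \<eta> that] by (simp add: comp_functor_sel id_functor_sel quasi_inverse_sel(1))
  have \<theta>: "\<theta> \<in> nat_trans C T L ?GF"
  proof (rule nat_transI)
    show "\<theta> X \<in> Hom T (omap L X) (omap ?GF X)" if "X \<in> Obj C" for X
      using that is_functorD(2)[OF L that ob[OF that] h[OF that]]
      by (simp add: \<theta>_def comp_functor_sel quasi_inverse_sel(1))
    show "\<theta> \<in> extensional (Obj C)" by (simp add: \<theta>_def)
    fix X Y f assume X: "X \<in> Obj C" and Y: "Y \<in> Obj C" and f: "f \<in> Hom C X Y"
    have Q: "amap quasi_inverse (omap F X) (omap F Y) (amap F X Y f) \<in> Hom C (pre (omap F X)) (pre (omap F Y))"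
      using is_functorD(2)[OF QF X Y f] by (simp add: comp_functor_sel quasi_inverse_sel(1))
    have "amap L X (pre (omap F Y)) (Comp C X Y (pre (omap F Y)) (\<eta> Y) f) =
      amap L X (pre (omap F Y)) (Comp C X (pre (omap F X)) (pre (omap F Y))
        (amap quasi_inverse (omap F X) (omap F Y) (amap F X Y f)) (\<eta> X))"
      using nat_transD(2)[OF \<eta> X Y f] by (simp add: comp_functor_sel id_functor_sel quasi_inverse_sel(1))
    then show "Comp T (omap L X) (omap L Y) (omap ?GF Y) (\<theta> Y) (amap L X Y f) =
      Comp T (omap L X) (omap ?GF X) (omap ?GF Y) (amap ?GF X Y f) (\<theta> X)"
      using is_functorD(4)[OF L X Y ob[OF Y] f h[OF Y]] is_functorD(4)[OF L X ob[OF X] ob[OF Y] h[OF X] Q] X Y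
      by (simp add: \<theta>_def comp_functor_sel quasi_inverse_sel(1))
  qed
  have "is_iso T (omap L X) (omap ?GF X) (\<theta> X)" if X: "X \<in> Obj C" for X
    using is_functor_iso[OF L X ob[OF X]] bspec[OF iso' X] X
    by (simp add: \<theta>_def comp_functor_sel id_functor_sel quasi_inverse_sel(1))
  then obtain \<zeta> where \<zeta>: "\<zeta> \<in> nat_trans C T ?GF L"
    "\<And>X. X \<in> Obj C \<Longrightarrow> Comp T (omap L X) (omap ?GF X) (omap L X) (\<zeta> X) (\<theta> X) = Ident T (omap L X)"
    "\<And>X. X \<in> Obj C \<Longrightarrow> Comp T (omap ?GF X) (omap L X) (omap ?GF X) (\<theta> X) (\<zeta> X) = Ident T (omap ?GF X)"
    using nat_trans_inverse[OF C.category_axioms T L GF \<theta>] by metis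
  then have "is_iso (functor_category C T) ?GF L \<zeta>"
    unfolding is_iso_def functor_category_sel using \<theta> by (auto intro!: bexI[of _ \<theta>] restrict_ext)
  then show "\<exists>G \<in> Obj (functor_category D T). \<exists>f. is_iso (functor_category C T) (omap (precomposition C F) G) L f"
    using G by (auto simp: functor_category_sel precomposition_sel)
qed

lemma precomposition_linear:
  "is_linear_functor K (functor_category D T) (functor_category C T) (precomposition C F)"
  unfolding is_linear_functor_def module_hom_def hom_module_sel
  using precomposition_functor[of T] precomposition_arrow F_rules(1)
  by (auto simp: functor_category_sel precomposition_sel comp_functor_sel intro!: restrict_ext)

end

lemma product_category_sel:
  "Obj (product_category C) = {X. \<forall>i. X i \<in> Obj (C i)}"
  "Hom (product_category C) X Y = {f. \<forall>i. f i \<in> Hom (C i) (X i) (Y i)}"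
  "Ident (product_category C) X = (\<lambda>i. Ident (C i) (X i))"
  "Comp (product_category C) X Y Z g f = (\<lambda>i. Comp (C i) (X i) (Y i) (Z i) (g i) (f i))"
  "Hadd (product_category C) X Y f g = (\<lambda>i. Hadd (C i) (X i) (Y i) (f i) (g i))"
  "Hzero (product_category C) X Y = (\<lambda>i. Hzero (C i) (X i) (Y i))"
  "Hsmult (product_category C) X Y c f = (\<lambda>i. Hsmult (C i) (X i) (Y i) c (f i))"
  by (simp_all add: product_category_def)

lemma linear_category_product:
  assumes "\<And>i. linear_category K (C i)"
  shows "linear_category K (product_category C)"
proof -
  interpret L: linear_category K "C i" for i by (rule assms)
  have K: "cring K" using assms by (simp add: linear_category_def)
  let ?P = "product_category C"
  note sel = product_category_sel
  have "category ?P"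
    by (rule category.intro)
      (simp_all add: sel fun_eq_iff L.Ident_closed L.Comp_closed L.Comp_Ident_left L.Comp_Ident_right L.Comp_assoc)
  moreover have "linear_category_axioms K ?P"
  proof (rule linear_category_axioms.intro)
    fix X Y assume "X \<in> Obj ?P" "Y \<in> Obj ?P"
    then have X: "X i \<in> Obj (C i)" and Y: "Y i \<in> Obj (C i)" for i by (simp_all add: sel)
    note R = hom_module_rules[OF L.hom_module[OF X Y]]
    show "module K (hom_module ?P X Y)"
    proof (rule module_axiomsI[OF K K], unfold hom_module_sel sel mem_Collect_eq)
      fix f assume f: "\<forall>i. f i \<in> Hom (C i) (X i) (Y i)"
      from f have "\<forall>i. \<exists>g. g \<in> Hom (C i) (X i) (Y i) \<and> Hadd (C i) (X i) (Y i) g (f i) = Hzero (C i) (X i) (Y i)"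
        using R(6) by blast
      then obtain g where "\<forall>i. g i \<in> Hom (C i) (X i) (Y i) \<and> Hadd (C i) (X i) (Y i) (g i) (f i) = Hzero (C i) (X i) (Y i)"
        by metis
      then show "\<exists>g\<in>{f. \<forall>i. f i \<in> Hom (C i) (X i) (Y i)}.
          (\<lambda>i. Hadd (C i) (X i) (Y i) (g i) (f i)) = (\<lambda>i. Hzero (C i) (X i) (Y i))"
        by (intro bexI[of _ g]) auto
    next
      fix f g assume "\<forall>i. f i \<in> Hom (C i) (X i) (Y i)" "\<forall>i. g i \<in> Hom (C i) (X i) (Y i)"
      then show "(\<lambda>i. Hadd (C i) (X i) (Y i) (f i) (g i)) = (\<lambda>i. Hadd (C i) (X i) (Y i) (g i) (f i))"
        by (intro ext R(4)) auto
    qed (simp_all add: R(1,2,3,5,7,8,9,10,11))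
  qed (simp_all add: sel fun_eq_iff L.Comp_Hadd_left L.Comp_Hadd_right L.Comp_Hsmult_left L.Comp_Hsmult_right)
  ultimately show ?thesis using K by (intro linear_category.intro)
qed

lemma product_ex1:
  assumes "\<And>i. \<exists>!u. u \<in> A i \<and> P i u"
  shows "\<exists>!u. u \<in> {u. \<forall>i. u i \<in> A i} \<and> (\<forall>i. P i (u i))"
proof -
  define v where "v i = (THE u. u \<in> A i \<and> P i u)" for i
  have v: "v i \<in> A i \<and> P i (v i)" for i unfolding v_def by (rule theI'[OF assms])
  have "u = v" if "\<forall>i. u i \<in> A i" "\<forall>i. P i (u i)" for u
    using that v assms by (intro ext) blast
  with v show ?thesis by (intro ex1I[of _ v]) auto
qed

text \<open>
  All constructions are made componentwise. A monomorphism of the product has monomorphic components: to test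
  component \<open>i\<close>, replace component \<open>i\<close> of an identity by the test arrow. The same holds for epimorphisms.
\<close>

lemma linear_abelian_category_product:
  assumes ab: "\<And>i. linear_abelian_category K (C i)"
  shows "linear_abelian_category K (product_category C)"
proof -
  interpret L: linear_abelian_category K "C i" for i by (rule ab)
  have lin: "linear_category K (product_category C)"
    by (rule linear_category_product) (rule linear_abelian_category.axioms(1)[OF ab])
  let ?P = "product_category C"
  note sel = product_category_sel
  have ker: "is_kernel ?P X Y f N k"
    if "\<And>i. is_kernel (C i) (X i) (Y i) (f i) (N i) (k i)" for X Y f N k
    unfolding is_kernel_def
  proof (intro conjI ballI impI)
    show "N \<in> Obj ?P" "k \<in> Hom ?P N X" "Comp ?P N X Y f k = Hzero ?P N Y"
      using that by (simp_all add: is_kernel_def sel)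
    fix W g assume "W \<in> Obj ?P" "g \<in> Hom ?P W X" "Comp ?P W X Y f g = Hzero ?P W Y"
    then have W: "W i \<in> Obj (C i)" "g i \<in> Hom (C i) (W i) (X i)"
        "Comp (C i) (W i) (X i) (Y i) (f i) (g i) = Hzero (C i) (W i) (Y i)" for i
      by (simp_all add: sel fun_eq_iff)
    then have "\<exists>!u. u \<in> Hom (C i) (W i) (N i) \<and> Comp (C i) (W i) (N i) (X i) (k i) u = g i" for i
      using that[of i] unfolding is_kernel_def by blast
    from product_ex1[of "\<lambda>i. Hom (C i) (W i) (N i)" "\<lambda>i u. Comp (C i) (W i) (N i) (X i) (k i) u = g i", OF this]
    show "\<exists>!u. u \<in> Hom ?P W N \<and> Comp ?P W N X k u = g" by (simp add: sel fun_eq_iff)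
  qed
  have coker: "is_cokernel ?P X Y f N k"
    if "\<And>i. is_cokernel (C i) (X i) (Y i) (f i) (N i) (k i)" for X Y f N k
    unfolding is_cokernel_def
  proof (intro conjI ballI impI)
    show "N \<in> Obj ?P" "k \<in> Hom ?P Y N" "Comp ?P X Y N k f = Hzero ?P X N"
      using that by (simp_all add: is_cokernel_def sel)
    fix W g assume "W \<in> Obj ?P" "g \<in> Hom ?P Y W" "Comp ?P X Y W g f = Hzero ?P X W"
    then have W: "W i \<in> Obj (C i)" "g i \<in> Hom (C i) (Y i) (W i)"
        "Comp (C i) (X i) (Y i) (W i) (g i) (f i) = Hzero (C i) (X i) (W i)" for i
      by (simp_all add: sel fun_eq_iff)
    then have "\<exists>!u. u \<in> Hom (C i) (N i) (W i) \<and> Comp (C i) (Y i) (N i) (W i) u (k i) = g i" for i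
      using that[of i] unfolding is_cokernel_def by blast
    from product_ex1[of "\<lambda>i. Hom (C i) (N i) (W i)" "\<lambda>i u. Comp (C i) (Y i) (N i) (W i) u (k i) = g i", OF this]
    show "\<exists>!u. u \<in> Hom ?P N W \<and> Comp ?P Y N W u k = g" by (simp add: sel fun_eq_iff)
  qed
  have mono: "is_mono (C i) (X i) (Y i) (f i)"
    if f: "is_mono ?P X Y f" and X: "X \<in> Obj ?P" and Y: "Y \<in> Obj ?P" for X Y f i
    unfolding is_mono_def
  proof (intro conjI ballI impI)
    show "f i \<in> Hom (C i) (X i) (Y i)" using f by (simp add: is_mono_def sel)
    fix W g h assume W: "W \<in> Obj (C i)" and g: "g \<in> Hom (C i) W (X i)" and h: "h \<in> Hom (C i) W (X i)"
      and eq: "Comp (C i) W (X i) (Y i) (f i) g = Comp (C i) W (X i) (Y i) (f i) h"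
    define I where "I = (\<lambda>j. Ident (C j) (X j))"
    have "X(i := W) \<in> Obj ?P" using X W by (simp add: sel)
    moreover have "I(i := g) \<in> Hom ?P (X(i := W)) X" "I(i := h) \<in> Hom ?P (X(i := W)) X"
      using X g h by (simp_all add: sel I_def L.Ident_closed)
    moreover have "Comp ?P (X(i := W)) X Y f (I(i := g)) = Comp ?P (X(i := W)) X Y f (I(i := h))"
      using eq by (simp add: sel fun_eq_iff)
    ultimately have "I(i := g) = I(i := h)" using f unfolding is_mono_def by blast
    then show "g = h" by (metis fun_upd_same)
  qed
  have epi: "is_epi (C i) (X i) (Y i) (f i)"
    if f: "is_epi ?P X Y f" and X: "X \<in> Obj ?P" and Y: "Y \<in> Obj ?P" for X Y f i
    unfolding is_epi_def
  proof (intro conjI ballI impI)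
    show "f i \<in> Hom (C i) (X i) (Y i)" using f by (simp add: is_epi_def sel)
    fix W g h assume W: "W \<in> Obj (C i)" and g: "g \<in> Hom (C i) (Y i) W" and h: "h \<in> Hom (C i) (Y i) W"
      and eq: "Comp (C i) (X i) (Y i) W g (f i) = Comp (C i) (X i) (Y i) W h (f i)"
    define I where "I = (\<lambda>j. Ident (C j) (Y j))"
    have "Y(i := W) \<in> Obj ?P" using Y W by (simp add: sel)
    moreover have "I(i := g) \<in> Hom ?P Y (Y(i := W))" "I(i := h) \<in> Hom ?P Y (Y(i := W))"
      using Y g h by (simp_all add: sel I_def L.Ident_closed)
    moreover have "Comp ?P X Y (Y(i := W)) (I(i := g)) f = Comp ?P X Y (Y(i := W)) (I(i := h)) f"
      using eq by (simp add: sel fun_eq_iff)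
    ultimately have "I(i := g) = I(i := h)" using f unfolding is_epi_def by blast
    then show "g = h" by (metis fun_upd_same)
  qed
  have "linear_abelian_category_axioms ?P"
  proof (rule linear_abelian_category_axioms.intro)
    have "\<forall>i. \<exists>Z. is_zero_object (C i) Z" using L.ex_zero_object by blast
    then obtain Z where "\<forall>i. is_zero_object (C i) (Z i)" by metis
    then have Z: "Z i \<in> Obj (C i)" "\<And>X. X \<in> Obj (C i) \<Longrightarrow> (\<exists>!f. f \<in> Hom (C i) X (Z i)) \<and> (\<exists>!f. f \<in> Hom (C i) (Z i) X)" for i
      by (simp_all add: is_zero_object_def)
    have "is_zero_object ?P Z" unfolding is_zero_object_def
    proof (intro conjI ballI)
      show "Z \<in> Obj ?P" using Z by (simp add: sel)
      fix X assume "X \<in> Obj ?P"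
      then have X: "X i \<in> Obj (C i)" for i by (simp add: sel)
      show "\<exists>!f. f \<in> Hom ?P X Z"
        using product_ex1[of "\<lambda>i. Hom (C i) (X i) (Z i)" "\<lambda>_ _. True"] Z(2)[OF X] by (simp add: sel)
      show "\<exists>!f. f \<in> Hom ?P Z X"
        using product_ex1[of "\<lambda>i. Hom (C i) (Z i) (X i)" "\<lambda>_ _. True"] Z(2)[OF X] by (simp add: sel)
    qed
    then show "\<exists>Z. is_zero_object ?P Z" by blast
  next
    fix X Y assume X: "X \<in> Obj ?P" and Y: "Y \<in> Obj ?P"
    then have X': "X i \<in> Obj (C i)" and Y': "Y i \<in> Obj (C i)" for i by (simp_all add: sel)
    have "\<forall>i. \<exists>b. case b of (B, k, j, p, q) \<Rightarrow> is_biproduct (C i) (X i) (Y i) B k j p q"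
      using L.ex_biproduct[OF X' Y'] by (simp add: split_paired_Ex)
    then obtain b where b: "\<forall>i. case b i of (B, k, j, p, q) \<Rightarrow> is_biproduct (C i) (X i) (Y i) B k j p q"
      by metis
    have "is_biproduct ?P X Y (\<lambda>i. fst (b i)) (\<lambda>i. fst (snd (b i))) (\<lambda>i. fst (snd (snd (b i))))
        (\<lambda>i. fst (snd (snd (snd (b i))))) (\<lambda>i. snd (snd (snd (snd (b i)))))"
      using b by (simp add: is_biproduct_def sel case_prod_unfold)
    then show "\<exists>B i j p q. is_biproduct ?P X Y B i j p q" by blast
    {
      fix f assume "f \<in> Hom ?P X Y"
      then have f: "f i \<in> Hom (C i) (X i) (Y i)" for i by (simp add: sel)
      have "\<forall>i. \<exists>N k. is_kernel (C i) (X i) (Y i) (f i) N k" using L.ex_kernel[OF X' Y' f] by blast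
      then obtain N k where "\<forall>i. is_kernel (C i) (X i) (Y i) (f i) (N i) (k i)" by metis
      then show "\<exists>N k. is_kernel ?P X Y f N k" using ker by blast
      have "\<forall>i. \<exists>N k. is_cokernel (C i) (X i) (Y i) (f i) N k" using L.ex_cokernel[OF X' Y' f] by blast
      then obtain N k where "\<forall>i. is_cokernel (C i) (X i) (Y i) (f i) (N i) (k i)" by metis
      then show "\<exists>N k. is_cokernel ?P X Y f N k" using coker by blast
    }
    {
      fix f assume f: "is_mono ?P X Y f"
      have "\<forall>i. \<exists>Z g. Z \<in> Obj (C i) \<and> g \<in> Hom (C i) (Y i) Z \<and> is_kernel (C i) (Y i) Z g (X i) (f i)"
        using L.mono_normal[OF X' Y' mono[OF f X Y]] by blast
      then obtain Z g where *: "\<forall>i. Z i \<in> Obj (C i) \<and> g i \<in> Hom (C i) (Y i) (Z i) \<and> is_kernel (C i) (Y i) (Z i) (g i) (X i) (f i)"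
        by metis
      then have "Z \<in> Obj ?P \<and> g \<in> Hom ?P Y Z \<and> is_kernel ?P Y Z g X f" using ker by (simp add: sel)
      then show "\<exists>Z g. Z \<in> Obj ?P \<and> g \<in> Hom ?P Y Z \<and> is_kernel ?P Y Z g X f" by blast
    }
    {
      fix f assume f: "is_epi ?P X Y f"
      have "\<forall>i. \<exists>Z g. Z \<in> Obj (C i) \<and> g \<in> Hom (C i) Z (X i) \<and> is_cokernel (C i) Z (X i) g (Y i) (f i)"
        using L.epi_normal[OF X' Y' epi[OF f X Y]] by blast
      then obtain Z g where *: "\<forall>i. Z i \<in> Obj (C i) \<and> g i \<in> Hom (C i) (Z i) (X i) \<and> is_cokernel (C i) (Z i) (X i) (g i) (Y i) (f i)"
        by metis
      then have "Z \<in> Obj ?P \<and> g \<in> Hom ?P Z X \<and> is_cokernel ?P Z X g Y f" using coker by (simp add: sel)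
      then show "\<exists>W g. W \<in> Obj ?P \<and> g \<in> Hom ?P W X \<and> is_cokernel ?P W X g Y f" by blast
    }
  qed
  with lin show ?thesis by (rule linear_abelian_category.intro)
qed

section \<open>Categories of modules\<close>

context left_module
begin

lemma smult_zero_left: "x \<in> carrier M \<Longrightarrow> \<zero>\<^bsub>R\<^esub> \<odot>\<^bsub>M\<^esub> x = \<zero>\<^bsub>M\<^esub>"
  using smult_l_distr[of "\<zero>\<^bsub>R\<^esub>" "\<zero>\<^bsub>R\<^esub>" x] smult_closed[of "\<zero>\<^bsub>R\<^esub>" x]
  by (simp add: M.add.l_cancel_one')

lemma smult_zero_right: "a \<in> carrier R \<Longrightarrow> a \<odot>\<^bsub>M\<^esub> \<zero>\<^bsub>M\<^esub> = \<zero>\<^bsub>M\<^esub>"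
  using smult_r_distr[of a "\<zero>\<^bsub>M\<^esub>" "\<zero>\<^bsub>M\<^esub>"] smult_closed[of a "\<zero>\<^bsub>M\<^esub>"]
  by (simp add: M.add.l_cancel_one')

lemma smult_minus_one: "x \<in> carrier M \<Longrightarrow> (\<ominus>\<^bsub>R\<^esub> \<one>\<^bsub>R\<^esub>) \<odot>\<^bsub>M\<^esub> x = \<ominus>\<^bsub>M\<^esub> x"
  using smult_l_distr[of "\<ominus>\<^bsub>R\<^esub> \<one>\<^bsub>R\<^esub>" "\<one>\<^bsub>R\<^esub>" x] smult_closed[of "\<ominus>\<^bsub>R\<^esub> \<one>\<^bsub>R\<^esub>" x]
  by (simp add: smult_one smult_zero_left R.l_neg M.minus_equality)

end

text \<open>
  The target of a surjection that respects the operations is a module. This covers the quotients,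
  realized on representatives, and the transport of a module along an injection into another type.
\<close>

lemma left_module_image:
  fixes R :: "('r, 'c) ring_scheme" and M :: "('r, 'x, 'd) module_scheme" and N :: "('r, 'm, 'e) module_scheme"
  assumes M: "left_module R M" and surj: "q ` carrier M = carrier N" and zero: "\<zero>\<^bsub>N\<^esub> = q \<zero>\<^bsub>M\<^esub>"
    and add: "\<And>x y. \<lbrakk>x \<in> carrier M; y \<in> carrier M\<rbrakk> \<Longrightarrow> q x \<oplus>\<^bsub>N\<^esub> q y = q (x \<oplus>\<^bsub>M\<^esub> y)"
    and smult: "\<And>a x. \<lbrakk>a \<in> carrier R; x \<in> carrier M\<rbrakk> \<Longrightarrow> a \<odot>\<^bsub>N\<^esub> q x = q (a \<odot>\<^bsub>M\<^esub> x)"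
  shows "left_module R N"
proof -
  interpret M: left_module R M by fact
  note rules = left_module_rules[OF M]
  have R: "ring R" ..
  show ?thesis
  proof (rule left_module_axiomsI[OF R], unfold surj[symmetric])
    fix x assume "x \<in> q ` carrier M"
    then obtain x' where x': "x' \<in> carrier M" "x = q x'" by blast
    obtain y' where "y' \<in> carrier M" "y' \<oplus>\<^bsub>M\<^esub> x' = \<zero>\<^bsub>M\<^esub>" using rules(6)[OF x'(1)] by blast
    then show "\<exists>y \<in> q ` carrier M. y \<oplus>\<^bsub>N\<^esub> x = \<zero>\<^bsub>N\<^esub>"
      using x' by (intro bexI[of _ "q y'"]) (simp_all add: add zero)
  next
    fix x y assume "x \<in> q ` carrier M" "y \<in> q ` carrier M"
    then show "x \<oplus>\<^bsub>N\<^esub> y = y \<oplus>\<^bsub>N\<^esub> x" by (elim imageE) (simp add: add rules(4))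
  next
    fix a b x assume "a \<in> carrier R" "b \<in> carrier R" "x \<in> q ` carrier M"
    then show "(a \<otimes>\<^bsub>R\<^esub> b) \<odot>\<^bsub>N\<^esub> x = a \<odot>\<^bsub>N\<^esub> (b \<odot>\<^bsub>N\<^esub> x)"
      by (elim imageE) (simp add: smult rules(7,10))
    show "(a \<oplus>\<^bsub>R\<^esub> b) \<odot>\<^bsub>N\<^esub> x = a \<odot>\<^bsub>N\<^esub> x \<oplus>\<^bsub>N\<^esub> b \<odot>\<^bsub>N\<^esub> x"
      using \<open>a \<in> carrier R\<close> \<open>b \<in> carrier R\<close> \<open>x \<in> q ` carrier M\<close>
      by (elim imageE) (simp add: smult add rules(7,8))
  qed (auto simp: zero add smult rules(1,2,3,5,7,8,9,10,11))
qed

definition transport_module :: "('x \<Rightarrow> 'm) \<Rightarrow> ('r, 'x, 'd) module_scheme \<Rightarrow> ('r, 'm) module" where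
  "transport_module e M = \<lparr>carrier = e ` carrier M, mult = undefined, one = undefined, zero = e \<zero>\<^bsub>M\<^esub>,
     add = (\<lambda>x y. e (the_inv_into (carrier M) e x \<oplus>\<^bsub>M\<^esub> the_inv_into (carrier M) e y)),
     smult = (\<lambda>a x. e (a \<odot>\<^bsub>M\<^esub> the_inv_into (carrier M) e x))\<rparr>"

lemma transport_module_sel:
  assumes "inj_on e (carrier M)"
  shows "carrier (transport_module e M) = e ` carrier M"
    and "\<zero>\<^bsub>transport_module e M\<^esub> = e \<zero>\<^bsub>M\<^esub>"
    and "\<lbrakk>x \<in> carrier M; y \<in> carrier M\<rbrakk> \<Longrightarrow> e x \<oplus>\<^bsub>transport_module e M\<^esub> e y = e (x \<oplus>\<^bsub>M\<^esub> y)"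
    and "x \<in> carrier M \<Longrightarrow> a \<odot>\<^bsub>transport_module e M\<^esub> e x = e (a \<odot>\<^bsub>M\<^esub> x)"
  using assms by (simp_all add: transport_module_def the_inv_into_f_f)

lemma left_module_transport:
  assumes "left_module R M" "inj_on e (carrier M)"
  shows "left_module R (transport_module e M)"
  by (rule left_module_image[where q = e, OF assms(1)]) (simp_all add: transport_module_sel[OF assms(2)])

lemma left_module_sub:
  fixes R :: "('r, 'c) ring_scheme" and M :: "('r, 'm, 'd) module_scheme"
  assumes M: "left_module R M" and sub: "S \<subseteq> carrier M" and zero: "\<zero>\<^bsub>M\<^esub> \<in> S"
    and add: "\<And>x y. \<lbrakk>x \<in> S; y \<in> S\<rbrakk> \<Longrightarrow> x \<oplus>\<^bsub>M\<^esub> y \<in> S"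
    and smult: "\<And>a x. \<lbrakk>a \<in> carrier R; x \<in> S\<rbrakk> \<Longrightarrow> a \<odot>\<^bsub>M\<^esub> x \<in> S"
  shows "left_module R (M\<lparr>carrier := S\<rparr>)"
proof -
  interpret M: left_module R M by fact
  note rules = left_module_rules[OF M]
  have R: "ring R" ..
  have in_M: "x \<in> carrier M" if "x \<in> S" for x using sub that by blast
  show ?thesis
  proof (rule left_module_axiomsI[OF R])
    fix x assume "x \<in> carrier (M\<lparr>carrier := S\<rparr>)"
    then have x: "x \<in> S" by simp
    have "\<ominus>\<^bsub>M\<^esub> x \<in> S" using smult[of "\<ominus>\<^bsub>R\<^esub> \<one>\<^bsub>R\<^esub>" x] x M.smult_minus_one[OF in_M[OF x]] by simp
    then show "\<exists>y \<in> carrier (M\<lparr>carrier := S\<rparr>). y \<oplus>\<^bsub>M\<lparr>carrier := S\<rparr>\<^esub> x = \<zero>\<^bsub>M\<lparr>carrier := S\<rparr>\<^esub>"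
      using M.l_neg[OF in_M[OF x]] by auto
  next
    fix x y assume "x \<in> carrier (M\<lparr>carrier := S\<rparr>)" "y \<in> carrier (M\<lparr>carrier := S\<rparr>)"
    then show "x \<oplus>\<^bsub>M\<lparr>carrier := S\<rparr>\<^esub> y = y \<oplus>\<^bsub>M\<lparr>carrier := S\<rparr>\<^esub> x"
      using rules(4)[OF in_M in_M] by simp
  qed (use in_M zero add smult in \<open>simp_all add: rules(3,5,8,9,10,11)\<close>)
qed

abbreviation mhom where "mhom R M N \<equiv> module_hom R M N \<inter> extensional (carrier M)"

lemma mhomI:
  assumes "\<And>x. x \<in> carrier M \<Longrightarrow> f x \<in> carrier N"
    and "\<And>x y. \<lbrakk>x \<in> carrier M; y \<in> carrier M\<rbrakk> \<Longrightarrow> f (x \<oplus>\<^bsub>M\<^esub> y) = f x \<oplus>\<^bsub>N\<^esub> f y"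
    and "\<And>a x. \<lbrakk>a \<in> carrier R; x \<in> carrier M\<rbrakk> \<Longrightarrow> f (a \<odot>\<^bsub>M\<^esub> x) = a \<odot>\<^bsub>N\<^esub> f x"
    and "f \<in> extensional (carrier M)"
  shows "f \<in> mhom R M N"
  using assms by (simp add: module_hom_def)

lemma mhom_restrictI:
  assumes M: "left_module R M" and "\<And>x. x \<in> carrier M \<Longrightarrow> f x \<in> carrier N"
    and "\<And>x y. \<lbrakk>x \<in> carrier M; y \<in> carrier M\<rbrakk> \<Longrightarrow> f (x \<oplus>\<^bsub>M\<^esub> y) = f x \<oplus>\<^bsub>N\<^esub> f y"
    and "\<And>a x. \<lbrakk>a \<in> carrier R; x \<in> carrier M\<rbrakk> \<Longrightarrow> f (a \<odot>\<^bsub>M\<^esub> x) = a \<odot>\<^bsub>N\<^esub> f x"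
  shows "restrict f (carrier M) \<in> mhom R M N"
  by (rule mhomI) (use assms in \<open>simp_all add: left_module_rules[OF M]\<close>)

lemma mhomD:
  assumes "f \<in> mhom R M N"
  shows "x \<in> carrier M \<Longrightarrow> f x \<in> carrier N"
    and "\<lbrakk>x \<in> carrier M; y \<in> carrier M\<rbrakk> \<Longrightarrow> f (x \<oplus>\<^bsub>M\<^esub> y) = f x \<oplus>\<^bsub>N\<^esub> f y"
    and "\<lbrakk>a \<in> carrier R; x \<in> carrier M\<rbrakk> \<Longrightarrow> f (a \<odot>\<^bsub>M\<^esub> x) = a \<odot>\<^bsub>N\<^esub> f x"
    and "f \<in> extensional (carrier M)"
  using assms by (auto simp: module_hom_def)

lemma mhom_eqI:
  assumes "f \<in> mhom R M N" "g \<in> mhom R M N'" "\<And>x. x \<in> carrier M \<Longrightarrow> f x = g x"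
  shows "f = g"
  using mhomD(4)[OF assms(1)] mhomD(4)[OF assms(2)] assms(3) by (rule extensionalityI)

lemma mhom_zero:
  assumes M: "left_module R M" and N: "left_module R N" and f: "f \<in> mhom R M N"
  shows "f \<zero>\<^bsub>M\<^esub> = \<zero>\<^bsub>N\<^esub>"
proof -
  interpret M: left_module R M by fact
  interpret N: left_module R N by fact
  show ?thesis using mhomD(3)[OF f, of "\<zero>\<^bsub>R\<^esub>" "\<zero>\<^bsub>M\<^esub>"] mhomD(1)[OF f, of "\<zero>\<^bsub>M\<^esub>"]
    by (simp add: M.smult_zero_left N.smult_zero_left)
qed

lemma mhom_minus:
  assumes M: "left_module R M" and N: "left_module R N" and f: "f \<in> mhom R M N"
    and x: "x \<in> carrier M" and y: "y \<in> carrier M"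
  shows "f (x \<ominus>\<^bsub>M\<^esub> y) = f x \<ominus>\<^bsub>N\<^esub> f y"
proof -
  interpret M: left_module R M by fact
  interpret N: left_module R N by fact
  have "f (\<ominus>\<^bsub>M\<^esub> y) = \<ominus>\<^bsub>N\<^esub> f y"
    using mhomD(3)[OF f, of "\<ominus>\<^bsub>R\<^esub> \<one>\<^bsub>R\<^esub>" y] y mhomD(1)[OF f y]
    by (simp add: M.smult_minus_one N.smult_minus_one)
  then show ?thesis using mhomD(2)[OF f x, of "\<ominus>\<^bsub>M\<^esub> y"] y by (simp add: M.minus_eq N.minus_eq)
qed

lemma mhom_inj_onI:
  assumes M: "left_module R M" and N: "left_module R N" and f: "f \<in> mhom R M N"
    and ker: "\<And>x. \<lbrakk>x \<in> carrier M; f x = \<zero>\<^bsub>N\<^esub>\<rbrakk> \<Longrightarrow> x = \<zero>\<^bsub>M\<^esub>"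
  shows "inj_on f (carrier M)"
proof (rule inj_onI)
  interpret M: left_module R M by fact
  interpret N: left_module R N by fact
  fix x y assume x: "x \<in> carrier M" and y: "y \<in> carrier M" and eq: "f x = f y"
  then have "f (x \<ominus>\<^bsub>M\<^esub> y) = \<zero>\<^bsub>N\<^esub>"
    using mhom_minus[OF M N f x y] mhomD(1)[OF f y] by (simp add: N.minus_eq N.r_neg)
  then have "x \<ominus>\<^bsub>M\<^esub> y = \<zero>\<^bsub>M\<^esub>" using ker x y by simp
  then show "x = y" using x y by simp
qed

lemma mhom_compose:
  assumes "left_module R L" "f \<in> mhom R L M" "g \<in> mhom R M N"
  shows "compose (carrier L) g f \<in> mhom R L N"
  by (rule mhomI)
    (simp_all add: compose_def left_module_rules[OF assms(1)] mhomD[OF assms(2)] mhomD[OF assms(3)])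

lemma module_category_sel:
  "Obj (module_category ty R \<iota>) = {M. left_module R M}"
  "Hom (module_category ty R \<iota>) M N = mhom R M N"
  "Ident (module_category ty R \<iota>) M = (\<lambda>x \<in> carrier M. x)"
  "Comp (module_category ty R \<iota>) L M N g f = compose (carrier L) g f"
  "Hadd (module_category ty R \<iota>) M N f g = (\<lambda>x \<in> carrier M. f x \<oplus>\<^bsub>N\<^esub> g x)"
  "Hzero (module_category ty R \<iota>) M N = (\<lambda>x \<in> carrier M. \<zero>\<^bsub>N\<^esub>)"
  "Hsmult (module_category ty R \<iota>) M N c f = (\<lambda>x \<in> carrier M. \<iota> c \<odot>\<^bsub>N\<^esub> f x)"
  by (simp_all add: module_category_def)

text \<open>
  The square of an infinite set has the cardinality of the set. This makes an infinite type a universe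
  for modules that is closed under direct sums.
\<close>

lemma ex_inj_pair:
  assumes "infinite (UNIV :: 'm set)"
  obtains e :: "'m \<times> 'm \<Rightarrow> 'm" where "inj e"
proof -
  have "(card_of ((UNIV :: 'm set) \<times> (UNIV :: 'm set)), card_of (UNIV :: 'm set)) \<in> ordIso"
    by (rule card_of_Times_same_infinite[OF assms])
  then obtain e :: "'m \<times> 'm \<Rightarrow> 'm" where "bij_betw e (UNIV \<times> UNIV) UNIV"
    using card_of_ordIso[of "(UNIV :: 'm set) \<times> (UNIV :: 'm set)" "UNIV :: 'm set"] by blast
  then have "inj e" by (simp add: bij_betw_def)
  then show ?thesis by (rule that)
qed

locale central_ring_hom = K: cring K + R: ring R
  for K :: "'k ring" and R :: "('r, 'c) ring_scheme" and \<iota> :: "'k \<Rightarrow> 'r" +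
  assumes ring_hom: "\<iota> \<in> Ring.ring_hom K R"
    and central: "\<lbrakk>c \<in> carrier K; a \<in> carrier R\<rbrakk> \<Longrightarrow> \<iota> c \<otimes>\<^bsub>R\<^esub> a = a \<otimes>\<^bsub>R\<^esub> \<iota> c"
begin

lemma \<iota>_closed: "c \<in> carrier K \<Longrightarrow> \<iota> c \<in> carrier R"
  using ring_hom_closed[OF ring_hom] .

lemma smult_\<iota>_comm:
  assumes M: "left_module R M" and "c \<in> carrier K" "a \<in> carrier R" "x \<in> carrier M"
  shows "\<iota> c \<odot>\<^bsub>M\<^esub> (a \<odot>\<^bsub>M\<^esub> x) = a \<odot>\<^bsub>M\<^esub> (\<iota> c \<odot>\<^bsub>M\<^esub> x)"
  using left_module_rules(10)[OF M] \<iota>_closed central assms by metis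

lemma linear_category_module_category:
  "linear_category K (module_category TYPE('m) R \<iota>)" (is "linear_category K ?C")
proof -
  note sel = module_category_sel
  have cat: "category ?C"
  proof (rule category.intro)
    show "Ident ?C M \<in> Hom ?C M M" if "M \<in> Obj ?C" for M
      unfolding sel by (rule mhom_restrictI) (use that in \<open>simp_all add: sel\<close>)
    show "Comp ?C L M N g f \<in> Hom ?C L N"
      if "L \<in> Obj ?C" "M \<in> Obj ?C" "N \<in> Obj ?C" "f \<in> Hom ?C L M" "g \<in> Hom ?C M N" for L M N f g
      using that mhom_compose[of R L f M g N] unfolding sel mem_Collect_eq by blast
    show "Comp ?C L M M (Ident ?C M) f = f" if "L \<in> Obj ?C" "M \<in> Obj ?C" "f \<in> Hom ?C L M" for L M f
    proof -
      have f: "f \<in> mhom R L M" using that(3) by (simp only: sel)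
      show ?thesis unfolding sel
        by (rule extensionalityI[of _ "carrier L"]) (simp_all add: compose_def mhomD[OF f])
    qed
    show "Comp ?C L L M f (Ident ?C L) = f" if "L \<in> Obj ?C" "M \<in> Obj ?C" "f \<in> Hom ?C L M" for L M f
    proof -
      have f: "f \<in> mhom R L M" using that(3) by (simp only: sel)
      show ?thesis unfolding sel
        by (rule extensionalityI[of _ "carrier L"]) (simp_all add: compose_def mhomD[OF f])
    qed
    show "Comp ?C L N P h (Comp ?C L M N g f) = Comp ?C L M P (Comp ?C M N P h g) f"
      if "f \<in> Hom ?C L M" for L M N P f g h
    proof -
      have f: "f \<in> mhom R L M" using that by (simp only: sel)
      show ?thesis unfolding sel
        by (rule extensionalityI[of _ "carrier L"]) (simp_all add: compose_def mhomD[OF f])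
    qed
  qed
  have lin: "linear_category_axioms K ?C"
  proof (rule linear_category_axioms.intro)
    fix M N assume "M \<in> Obj ?C" "N \<in> Obj ?C"
    then have M: "left_module R M" and N: "left_module R N" by (simp_all add: sel)
    interpret N: left_module R N by (rule N)
    note Nr = left_module_rules[OF N] and Mr = left_module_rules[OF M]
    have four: "(a \<oplus>\<^bsub>N\<^esub> b) \<oplus>\<^bsub>N\<^esub> (c \<oplus>\<^bsub>N\<^esub> d) = (a \<oplus>\<^bsub>N\<^esub> c) \<oplus>\<^bsub>N\<^esub> (b \<oplus>\<^bsub>N\<^esub> d)"
      if "a \<in> carrier N" "b \<in> carrier N" "c \<in> carrier N" "d \<in> carrier N" for a b c d
      using that by (simp add: N.a_ac)
    have smc: "(\<lambda>x \<in> carrier M. \<iota> c \<odot>\<^bsub>N\<^esub> f x) \<in> mhom R M N" if c: "c \<in> carrier K" and f: "f \<in> mhom R M N" for c f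
      by (rule mhom_restrictI[OF M])
        (simp_all add: mhomD[OF f] \<iota>_closed[OF c] Nr(7,9) smult_\<iota>_comm[OF N c])
    show "module K (hom_module ?C M N)"
    proof (rule module_axiomsI[OF K.cring_axioms K.cring_axioms], unfold hom_module_sel sel)
      show "(\<lambda>x \<in> carrier M. f x \<oplus>\<^bsub>N\<^esub> g x) \<in> mhom R M N" if f: "f \<in> mhom R M N" and g: "g \<in> mhom R M N" for f g
        by (rule mhom_restrictI[OF M]) (simp_all add: mhomD[OF f] mhomD[OF g] Nr(1,9) four)
      show "(\<lambda>x \<in> carrier M. \<zero>\<^bsub>N\<^esub>) \<in> mhom R M N"
        by (rule mhom_restrictI[OF M]) (simp_all add: N.smult_zero_right)
      show "(\<lambda>x \<in> carrier M. \<iota> c \<odot>\<^bsub>N\<^esub> f x) \<in> mhom R M N" if "c \<in> carrier K" "f \<in> mhom R M N" for c f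
        using smc[OF that] .
      show "(\<lambda>x \<in> carrier M. (\<lambda>x \<in> carrier M. f x \<oplus>\<^bsub>N\<^esub> g x) x \<oplus>\<^bsub>N\<^esub> h x) =
          (\<lambda>x \<in> carrier M. f x \<oplus>\<^bsub>N\<^esub> (\<lambda>x \<in> carrier M. g x \<oplus>\<^bsub>N\<^esub> h x) x)"
        if "f \<in> mhom R M N" "g \<in> mhom R M N" "h \<in> mhom R M N" for f g h
        by (rule restrict_ext) (simp add: Nr(3) mhomD(1)[OF that(1)] mhomD(1)[OF that(2)] mhomD(1)[OF that(3)])
      show "(\<lambda>x \<in> carrier M. f x \<oplus>\<^bsub>N\<^esub> g x) = (\<lambda>x \<in> carrier M. g x \<oplus>\<^bsub>N\<^esub> f x)"
        if "f \<in> mhom R M N" "g \<in> mhom R M N" for f g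
        by (rule restrict_ext) (rule Nr(4)[OF mhomD(1)[OF that(1)] mhomD(1)[OF that(2)]])
      show "(\<lambda>x \<in> carrier M. (\<lambda>x \<in> carrier M. \<zero>\<^bsub>N\<^esub>) x \<oplus>\<^bsub>N\<^esub> f x) = f" if "f \<in> mhom R M N" for f
        using mhomD(4)[OF that] by (intro extensionalityI[of _ "carrier M"]) (simp_all add: mhomD(1)[OF that])
      show "\<exists>g \<in> mhom R M N. (\<lambda>x \<in> carrier M. g x \<oplus>\<^bsub>N\<^esub> f x) = (\<lambda>x \<in> carrier M. \<zero>\<^bsub>N\<^esub>)"
        if f: "f \<in> mhom R M N" for f
      proof (rule bexI[OF _ smc[OF K.a_inv_closed[OF K.one_closed] f]], rule restrict_ext)
        fix x assume x: "x \<in> carrier M"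
        have "\<iota> (\<ominus>\<^bsub>K\<^esub> \<one>\<^bsub>K\<^esub>) \<oplus>\<^bsub>R\<^esub> \<one>\<^bsub>R\<^esub> = \<iota> (\<ominus>\<^bsub>K\<^esub> \<one>\<^bsub>K\<^esub> \<oplus>\<^bsub>K\<^esub> \<one>\<^bsub>K\<^esub>)"
          using ring_hom_add[OF ring_hom] ring_hom_one[OF ring_hom] by simp
        also have "\<dots> = \<zero>\<^bsub>R\<^esub>" using ring_hom_zero[OF ring_hom] K.ring_axioms R.ring_axioms by (simp add: K.l_neg)
        finally show "(\<lambda>x \<in> carrier M. \<iota> (\<ominus>\<^bsub>K\<^esub> \<one>\<^bsub>K\<^esub>) \<odot>\<^bsub>N\<^esub> f x) x \<oplus>\<^bsub>N\<^esub> f x = \<zero>\<^bsub>N\<^esub>"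
          using x N.smult_l_distr[of "\<iota> (\<ominus>\<^bsub>K\<^esub> \<one>\<^bsub>K\<^esub>)" "\<one>\<^bsub>R\<^esub>" "f x"] mhomD(1)[OF f x]
          by (simp add: \<iota>_closed N.smult_one N.smult_zero_left)
      qed
      show "(\<lambda>x \<in> carrier M. \<iota> (a \<oplus>\<^bsub>K\<^esub> b) \<odot>\<^bsub>N\<^esub> f x) =
          (\<lambda>x \<in> carrier M. (\<lambda>x \<in> carrier M. \<iota> a \<odot>\<^bsub>N\<^esub> f x) x \<oplus>\<^bsub>N\<^esub> (\<lambda>x \<in> carrier M. \<iota> b \<odot>\<^bsub>N\<^esub> f x) x)"
        if "a \<in> carrier K" "b \<in> carrier K" "f \<in> mhom R M N" for a b f
        by (rule restrict_ext) (simp add: ring_hom_add[OF ring_hom] that \<iota>_closed Nr(8) mhomD(1)[OF that(3)])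
      show "(\<lambda>x \<in> carrier M. \<iota> a \<odot>\<^bsub>N\<^esub> (\<lambda>x \<in> carrier M. f x \<oplus>\<^bsub>N\<^esub> g x) x) =
          (\<lambda>x \<in> carrier M. (\<lambda>x \<in> carrier M. \<iota> a \<odot>\<^bsub>N\<^esub> f x) x \<oplus>\<^bsub>N\<^esub> (\<lambda>x \<in> carrier M. \<iota> a \<odot>\<^bsub>N\<^esub> g x) x)"
        if "a \<in> carrier K" "f \<in> mhom R M N" "g \<in> mhom R M N" for a f g
        by (rule restrict_ext) (simp add: that \<iota>_closed Nr(9) mhomD(1)[OF that(2)] mhomD(1)[OF that(3)])
      show "(\<lambda>x \<in> carrier M. \<iota> (a \<otimes>\<^bsub>K\<^esub> b) \<odot>\<^bsub>N\<^esub> f x) =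
          (\<lambda>x \<in> carrier M. \<iota> a \<odot>\<^bsub>N\<^esub> (\<lambda>x \<in> carrier M. \<iota> b \<odot>\<^bsub>N\<^esub> f x) x)"
        if "a \<in> carrier K" "b \<in> carrier K" "f \<in> mhom R M N" for a b f
        by (rule restrict_ext) (simp add: ring_hom_mult[OF ring_hom] that \<iota>_closed Nr(10) mhomD(1)[OF that(3)])
      show "(\<lambda>x \<in> carrier M. \<iota> \<one>\<^bsub>K\<^esub> \<odot>\<^bsub>N\<^esub> f x) = f" if "f \<in> mhom R M N" for f
        using mhomD(4)[OF that]
        by (intro extensionalityI[of _ "carrier M"]) (simp_all add: mhomD(1)[OF that] ring_hom_one[OF ring_hom] N.smult_one)
    qed
  next
    show "Comp ?C L M N (Hadd ?C M N g g') f = Hadd ?C L N (Comp ?C L M N g f) (Comp ?C L M N g' f)"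
      if "f \<in> Hom ?C L M" for L M N f g g'
    proof -
      have f: "f \<in> mhom R L M" using that by (simp only: sel)
      show ?thesis unfolding sel compose_def by (rule restrict_ext) (simp add: mhomD[OF f])
    qed
    show "Comp ?C L M N g (Hadd ?C L M f f') = Hadd ?C L N (Comp ?C L M N g f) (Comp ?C L M N g f')"
      if "f \<in> Hom ?C L M" "f' \<in> Hom ?C L M" "g \<in> Hom ?C M N" for L M N f f' g
    proof -
      have f: "f \<in> mhom R L M" "f' \<in> mhom R L M" "g \<in> mhom R M N" using that by (simp_all only: sel)
      show ?thesis unfolding sel compose_def
        by (rule restrict_ext) (simp add: mhomD[OF f(1)] mhomD[OF f(2)] mhomD[OF f(3)])
    qed
    show "Comp ?C L M N (Hsmult ?C M N c g) f = Hsmult ?C L N c (Comp ?C L M N g f)"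
      if "f \<in> Hom ?C L M" for L M N c f g
    proof -
      have f: "f \<in> mhom R L M" using that by (simp only: sel)
      show ?thesis unfolding sel compose_def by (rule restrict_ext) (simp add: mhomD[OF f])
    qed
    show "Comp ?C L M N g (Hsmult ?C L M c f) = Hsmult ?C L N c (Comp ?C L M N g f)"
      if "c \<in> carrier K" "f \<in> Hom ?C L M" "g \<in> Hom ?C M N" for L M N c f g
    proof -
      have f: "f \<in> mhom R L M" "g \<in> mhom R M N" using that by (simp_all only: sel)
      show ?thesis unfolding sel compose_def
        by (rule restrict_ext) (simp add: mhomD[OF f(1)] mhomD[OF f(2)] \<iota>_closed[OF that(1)])
    qed
  qed
  have "cring K" ..
  with cat lin show ?thesis by (intro linear_category.intro)
qed

end

context central_ring_hom
begin

lemma kernel_object: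
  fixes M N :: "('r, 'm) module"
  assumes M: "left_module R M" and N: "left_module R N" and f: "f \<in> mhom R M N"
  defines "S \<equiv> {x \<in> carrier M. f x = \<zero>\<^bsub>N\<^esub>}"
  shows "left_module R (M\<lparr>carrier := S\<rparr>)" "(\<lambda>x \<in> S. x) \<in> mhom R (M\<lparr>carrier := S\<rparr>) M"
    "is_kernel (module_category TYPE('m) R \<iota>) M N f (M\<lparr>carrier := S\<rparr>) (\<lambda>x \<in> S. x)"
proof -
  interpret M: left_module R M by fact
  interpret N: left_module R N by fact
  note f0 = mhom_zero[OF M N f]
  show 1: "left_module R (M\<lparr>carrier := S\<rparr>)"
    by (rule left_module_sub[OF M])
      (auto simp: S_def f0 mhomD[OF f] left_module_rules[OF M] N.smult_zero_right)
  have S: "carrier (M\<lparr>carrier := S\<rparr>) = S" by simp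
  show 2: "(\<lambda>x \<in> S. x) \<in> mhom R (M\<lparr>carrier := S\<rparr>) M"
    using mhom_restrictI[OF 1, of "\<lambda>x. x" M] by (simp add: S_def)
  show "is_kernel (module_category TYPE('m) R \<iota>) M N f (M\<lparr>carrier := S\<rparr>) (\<lambda>x \<in> S. x)"
    unfolding is_kernel_def module_category_sel
  proof (intro conjI ballI impI)
    show "M\<lparr>carrier := S\<rparr> \<in> {M. left_module R M}" using 1 by simp
    show "(\<lambda>x \<in> S. x) \<in> mhom R (M\<lparr>carrier := S\<rparr>) M" by (rule 2)
    show "compose (carrier (M\<lparr>carrier := S\<rparr>)) f (\<lambda>x \<in> S. x) = (\<lambda>x \<in> carrier (M\<lparr>carrier := S\<rparr>). \<zero>\<^bsub>N\<^esub>)"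
      unfolding S compose_def by (rule restrict_ext) (simp add: S_def)
    fix W :: "('r, 'm) module" and g
    assume W: "W \<in> {M. left_module R M}" and g: "g \<in> mhom R W M"
      and fg: "compose (carrier W) f g = (\<lambda>x \<in> carrier W. \<zero>\<^bsub>N\<^esub>)"
    have gS: "g x \<in> S" if "x \<in> carrier W" for x
      using fun_cong[OF fg, of x] that mhomD(1)[OF g] by (simp add: S_def compose_def)
    show "\<exists>!u. u \<in> mhom R W (M\<lparr>carrier := S\<rparr>) \<and> compose (carrier W) (\<lambda>x \<in> S. x) u = g"
    proof (rule ex1I[of _ g])
      have "g \<in> mhom R W (M\<lparr>carrier := S\<rparr>)" by (rule mhomI) (simp_all add: gS mhomD[OF g])
      moreover have "compose (carrier W) (\<lambda>x \<in> S. x) g = g"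
        by (rule extensionalityI[of _ "carrier W"]) (simp_all add: compose_def gS mhomD[OF g])
      ultimately show "g \<in> mhom R W (M\<lparr>carrier := S\<rparr>) \<and> compose (carrier W) (\<lambda>x \<in> S. x) g = g" by blast
      fix u assume "u \<in> mhom R W (M\<lparr>carrier := S\<rparr>) \<and> compose (carrier W) (\<lambda>x \<in> S. x) u = g"
      then have u: "u \<in> mhom R W (M\<lparr>carrier := S\<rparr>)" and eq: "compose (carrier W) (\<lambda>x \<in> S. x) u = g" by blast+
      show "u = g"
      proof (rule mhom_eqI[OF u g])
        fix x assume x: "x \<in> carrier W"
        have "u x \<in> S" using mhomD(1)[OF u x] by simp
        then show "u x = g x" using fun_cong[OF eq, of x] x by (simp add: compose_def)
      qed
    qed
  qed
qed

text \<open>The quotient of \<open>N\<close> by the image of \<open>f\<close>, on a system of representatives of the cosets.\<close>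

lemma cokernel_object:
  fixes M N :: "('r, 'm) module"
  assumes M: "left_module R M" and N: "left_module R N" and f: "f \<in> mhom R M N"
  obtains Q :: "('r, 'm) module" and c where "left_module R Q" "c \<in> mhom R N Q"
    "is_cokernel (module_category TYPE('m) R \<iota>) M N f Q c"
    "\<And>y. \<lbrakk>y \<in> carrier N; c y = \<zero>\<^bsub>Q\<^esub>\<rbrakk> \<Longrightarrow> y \<in> f ` carrier M"
proof -
  interpret M: left_module R M by fact
  interpret N: left_module R N by fact
  note Mr = left_module_rules[OF M] and Nr = left_module_rules[OF N]
  note f0 = mhom_zero[OF M N f]
  \<comment> \<open>two elements are related if they differ by an element of the image of \<open>f\<close>\<close>
  define rel where "rel x y \<longleftrightarrow> x \<in> carrier N \<and> y \<in> carrier N \<and> (\<exists>m \<in> carrier M. y = x \<oplus>\<^bsub>N\<^esub> f m)" for x y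
  have rel_refl: "rel x x" if "x \<in> carrier N" for x
    using that f0 unfolding rel_def by (intro conjI bexI[of _ "\<zero>\<^bsub>M\<^esub>"]) simp_all
  have rel_sym: "rel y x" if "rel x y" for x y
  proof -
    from that obtain m where m: "m \<in> carrier M" "y = x \<oplus>\<^bsub>N\<^esub> f m" and x: "x \<in> carrier N" "y \<in> carrier N"
      by (auto simp: rel_def)
    have "f (\<ominus>\<^bsub>M\<^esub> m) = \<ominus>\<^bsub>N\<^esub> f m"
      using mhomD(3)[OF f, of "\<ominus>\<^bsub>R\<^esub> \<one>\<^bsub>R\<^esub>" m] m(1) mhomD(1)[OF f m(1)] by (simp add: M.smult_minus_one N.smult_minus_one)
    then have "x = y \<oplus>\<^bsub>N\<^esub> f (\<ominus>\<^bsub>M\<^esub> m)" using m x mhomD(1)[OF f m(1)] by (simp add: N.a_assoc N.r_neg)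
    then show ?thesis using x m(1) unfolding rel_def by blast
  qed
  have rel_add: "rel (x \<oplus>\<^bsub>N\<^esub> x') (y \<oplus>\<^bsub>N\<^esub> y')" if xy: "rel x y" and xy': "rel x' y'" for x y x' y'
  proof -
    obtain m m' where m: "m \<in> carrier M" "y = x \<oplus>\<^bsub>N\<^esub> f m" "m' \<in> carrier M" "y' = x' \<oplus>\<^bsub>N\<^esub> f m'"
      using xy xy' unfolding rel_def by blast
    have x: "x \<in> carrier N" "x' \<in> carrier N" using xy xy' unfolding rel_def by blast+
    have "y \<oplus>\<^bsub>N\<^esub> y' = (x \<oplus>\<^bsub>N\<^esub> x') \<oplus>\<^bsub>N\<^esub> f (m \<oplus>\<^bsub>M\<^esub> m')"
      using m x mhomD(1)[OF f m(1)] mhomD(1)[OF f m(3)] mhomD(2)[OF f m(1,3)] by (simp add: N.a_ac)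
    then show ?thesis using xy xy' m Mr(1)[OF m(1,3)] Nr(1) unfolding rel_def by blast
  qed
  have rel_smult: "rel (a \<odot>\<^bsub>N\<^esub> x) (a \<odot>\<^bsub>N\<^esub> y)" if a: "a \<in> carrier R" and xy: "rel x y" for a x y
  proof -
    obtain m where m: "m \<in> carrier M" "y = x \<oplus>\<^bsub>N\<^esub> f m" using xy unfolding rel_def by blast
    have x: "x \<in> carrier N" using xy unfolding rel_def by blast
    have "a \<odot>\<^bsub>N\<^esub> y = a \<odot>\<^bsub>N\<^esub> x \<oplus>\<^bsub>N\<^esub> f (a \<odot>\<^bsub>M\<^esub> m)"
      using m x a mhomD(1)[OF f m(1)] mhomD(3)[OF f a m(1)] by (simp add: Nr(9))
    then show ?thesis using xy m a Mr(7)[OF a m(1)] Nr(7)[OF a] unfolding rel_def by blast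
  qed
  have rel_trans: "rel x z" if xy: "rel x y" and yz: "rel y z" for x y z
  proof -
    obtain m m' where m: "m \<in> carrier M" "y = x \<oplus>\<^bsub>N\<^esub> f m" "m' \<in> carrier M" "z = y \<oplus>\<^bsub>N\<^esub> f m'"
      using xy yz unfolding rel_def by blast
    have x: "x \<in> carrier N" using xy unfolding rel_def by blast
    have "z = x \<oplus>\<^bsub>N\<^esub> f (m \<oplus>\<^bsub>M\<^esub> m')"
      using m x mhomD(1)[OF f m(1)] mhomD(1)[OF f m(3)] mhomD(2)[OF f m(1,3)] by (simp add: N.a_assoc)
    then show ?thesis using xy yz Mr(1)[OF m(1,3)] unfolding rel_def by blast
  qed
  define c where "c x = (SOME y. rel x y)" for x
  have c: "rel x (c x)" if "x \<in> carrier N" for x unfolding c_def by (rule someI) (rule rel_refl[OF that])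
  have c_eq: "c x = c y" if "rel x y" for x y
  proof -
    have "rel x = rel y" using rel_trans rel_sym that by (intro ext) blast
    then show ?thesis by (simp add: c_def)
  qed
  have cN: "c x \<in> carrier N" if "x \<in> carrier N" for x using c[OF that] by (simp add: rel_def)
  define Q :: "('r, 'm) module" where "Q = \<lparr>carrier = c ` carrier N, mult = undefined, one = undefined,
    zero = c \<zero>\<^bsub>N\<^esub>, add = (\<lambda>x y. c (x \<oplus>\<^bsub>N\<^esub> y)), smult = (\<lambda>a x. c (a \<odot>\<^bsub>N\<^esub> x))\<rparr>"
  have Qa: "c x \<oplus>\<^bsub>Q\<^esub> c y = c (x \<oplus>\<^bsub>N\<^esub> y)" if "x \<in> carrier N" "y \<in> carrier N" for x y
    using c_eq[OF rel_add[OF c[OF that(1)] c[OF that(2)]]] by (simp add: Q_def)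
  have Qs: "a \<odot>\<^bsub>Q\<^esub> c x = c (a \<odot>\<^bsub>N\<^esub> x)" if "a \<in> carrier R" "x \<in> carrier N" for a x
    using c_eq[OF rel_smult[OF that(1) c[OF that(2)]]] by (simp add: Q_def)
  have Qc: "carrier Q = c ` carrier N" and Qz: "\<zero>\<^bsub>Q\<^esub> = c \<zero>\<^bsub>N\<^esub>" by (simp_all add: Q_def)
  have Q: "left_module R Q"
    by (rule left_module_image[where q = c, OF N]) (simp_all add: Qc Qz Qa Qs)
  interpret Q: left_module R Q by (rule Q)
  define p where "p = restrict c (carrier N)"
  have p: "p \<in> mhom R N Q" unfolding p_def by (rule mhom_restrictI[OF N]) (simp_all add: Qc Qa Qs)
  have px: "p x = c x" if "x \<in> carrier N" for x using that by (simp add: p_def)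
  have ker: "y \<in> f ` carrier M" if y: "y \<in> carrier N" "p y = \<zero>\<^bsub>Q\<^esub>" for y
  proof -
    have "c \<zero>\<^bsub>N\<^esub> = c y" using y px by (simp add: Qz)
    then have "rel \<zero>\<^bsub>N\<^esub> y" using rel_trans[OF c[OF Nr(2)]] rel_sym[OF c[OF y(1)]] by simp
    then obtain m where "m \<in> carrier M" "y = \<zero>\<^bsub>N\<^esub> \<oplus>\<^bsub>N\<^esub> f m" unfolding rel_def by blast
    then show ?thesis using mhomD(1)[OF f] by (intro image_eqI[of _ _ m]) simp_all
  qed
  have pf: "p (f m) = \<zero>\<^bsub>Q\<^esub>" if m: "m \<in> carrier M" for m
  proof -
    have "rel \<zero>\<^bsub>N\<^esub> (f m)" unfolding rel_def using m mhomD(1)[OF f m] by (intro conjI bexI[of _ m]) simp_all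
    from c_eq[OF this] show ?thesis using mhomD(1)[OF f m] by (simp add: px Qz)
  qed
  have "is_cokernel (module_category TYPE('m) R \<iota>) M N f Q p"
    unfolding is_cokernel_def module_category_sel
  proof (intro conjI ballI impI)
    show "Q \<in> {M. left_module R M}" using Q by simp
    show "p \<in> mhom R N Q" by (rule p)
    show "compose (carrier M) p f = (\<lambda>x \<in> carrier M. \<zero>\<^bsub>Q\<^esub>)"
      unfolding compose_def by (rule restrict_ext) (rule pf)
    fix Z :: "('r, 'm) module" and g
    assume "Z \<in> {M. left_module R M}" and g: "g \<in> mhom R N Z"
      and gf: "compose (carrier M) g f = (\<lambda>x \<in> carrier M. \<zero>\<^bsub>Z\<^esub>)"
    then have Z: "left_module R Z" by simp
    interpret Z: left_module R Z by (rule Z)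
    have g_rel: "g x = g y" if xy: "rel x y" for x y
    proof -
      obtain m where m: "m \<in> carrier M" "y = x \<oplus>\<^bsub>N\<^esub> f m" using xy unfolding rel_def by blast
      have x: "x \<in> carrier N" using xy unfolding rel_def by blast
      have "g (f m) = \<zero>\<^bsub>Z\<^esub>" using fun_cong[OF gf, of m] m by (simp add: compose_def)
      then show ?thesis using m x mhomD(2)[OF g x mhomD(1)[OF f m(1)]] mhomD(1)[OF g x] by simp
    qed
    have gc: "g (c x) = g x" if "x \<in> carrier N" for x using g_rel[OF c[OF that]] by simp
    define u where "u = restrict g (carrier Q)"
    have u_c: "u (c x) = g x" if "x \<in> carrier N" for x using that by (simp add: u_def Qc gc)
    have u: "u \<in> mhom R Q Z"
    proof (rule mhomI)
      fix x y assume "x \<in> carrier Q" "y \<in> carrier Q"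
      then obtain x' y' where xy: "x' \<in> carrier N" "x = c x'" "y' \<in> carrier N" "y = c y'"
        unfolding Qc by blast
      then show "u (x \<oplus>\<^bsub>Q\<^esub> y) = u x \<oplus>\<^bsub>Z\<^esub> u y" by (simp add: Qa u_c mhomD(2)[OF g])
    next
      fix a x assume a: "a \<in> carrier R" and "x \<in> carrier Q"
      then obtain x' where "x' \<in> carrier N" "x = c x'" unfolding Qc by blast
      with a show "u (a \<odot>\<^bsub>Q\<^esub> x) = a \<odot>\<^bsub>Z\<^esub> u x" by (simp add: Qs u_c mhomD(3)[OF g] Nr(7))
    next
      fix x assume "x \<in> carrier Q"
      then obtain x' where "x' \<in> carrier N" "x = c x'" unfolding Qc by blast
      then show "u x \<in> carrier Z" by (simp add: u_c mhomD(1)[OF g])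
    qed (simp add: u_def)
    show "\<exists>!u. u \<in> mhom R Q Z \<and> compose (carrier N) u p = g"
    proof (rule ex1I[of _ u])
      have "compose (carrier N) u p = g"
        by (rule extensionalityI[of _ "carrier N"]) (simp_all add: compose_def px u_c mhomD(4)[OF g])
      with u show "u \<in> mhom R Q Z \<and> compose (carrier N) u p = g" by blast
      fix v assume "v \<in> mhom R Q Z \<and> compose (carrier N) v p = g"
      then have v: "v \<in> mhom R Q Z" and vp: "compose (carrier N) v p = g" by blast+
      show "v = u"
      proof (rule mhom_eqI[OF v u])
        fix x assume "x \<in> carrier Q"
        then obtain x' where x': "x' \<in> carrier N" "x = c x'" unfolding Qc by blast
        then show "v x = u x" using fun_cong[OF vp, of x'] by (simp add: compose_def px u_c)
      qed
    qed
  qed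
  from that[OF Q p this ker] show ?thesis .
qed

text \<open>
  The inclusion of the kernel and the zero map into \<open>M\<close> have the same composite with \<open>f\<close>.
\<close>

lemma mono_inj:
  fixes M N :: "('r, 'm) module"
  assumes M: "left_module R M" and N: "left_module R N" and f: "is_mono (module_category TYPE('m) R \<iota>) M N f"
  shows "inj_on f (carrier M)"
proof -
  have fh: "f \<in> mhom R M N" using f by (simp only: is_mono_def module_category_sel)
  define S where "S = {x \<in> carrier M. f x = \<zero>\<^bsub>N\<^esub>}"
  note k = kernel_object[OF M N fh, folded S_def]
  interpret M: left_module R M by fact
  interpret N: left_module R N by fact
  have z: "(\<lambda>x \<in> S. \<zero>\<^bsub>M\<^esub>) \<in> mhom R (M\<lparr>carrier := S\<rparr>) M"
    using mhom_restrictI[OF k(1), of "\<lambda>x. \<zero>\<^bsub>M\<^esub>" M] by (simp add: M.smult_zero_right)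
  have "compose S f (\<lambda>x \<in> S. x) = compose S f (\<lambda>x \<in> S. \<zero>\<^bsub>M\<^esub>)"
    unfolding compose_def by (rule restrict_ext) (simp add: S_def mhom_zero[OF M N fh])
  then have eq: "(\<lambda>x \<in> S. x) = (\<lambda>x \<in> S. \<zero>\<^bsub>M\<^esub>)"
    using f k(1,2) z unfolding is_mono_def module_category_sel by simp
  have "x = \<zero>\<^bsub>M\<^esub>" if "x \<in> S" for x using that fun_cong[OF eq, of x] by simp
  then show ?thesis by (intro mhom_inj_onI[OF M N fh]) (simp add: S_def)
qed

text \<open>
  The projection to the cokernel and the zero map have the same composite with \<open>f\<close>.
\<close>

lemma epi_surj:
  fixes M N :: "('r, 'm) module"
  assumes M: "left_module R M" and N: "left_module R N" and f: "is_epi (module_category TYPE('m) R \<iota>) M N f"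
  shows "f ` carrier M = carrier N"
proof -
  have fh: "f \<in> mhom R M N" using f by (simp only: is_epi_def module_category_sel)
  obtain Q c where Q: "left_module R Q" and c: "c \<in> mhom R N Q"
    and coker: "is_cokernel (module_category TYPE('m) R \<iota>) M N f Q c"
    and ker: "\<And>y. \<lbrakk>y \<in> carrier N; c y = \<zero>\<^bsub>Q\<^esub>\<rbrakk> \<Longrightarrow> y \<in> f ` carrier M"
    using cokernel_object[OF M N fh] by blast
  interpret Q: left_module R Q by (rule Q)
  have z: "(\<lambda>x \<in> carrier N. \<zero>\<^bsub>Q\<^esub>) \<in> mhom R N Q"
    by (rule mhom_restrictI[OF N]) (simp_all add: Q.smult_zero_right)
  have "compose (carrier M) c f = (\<lambda>x \<in> carrier M. \<zero>\<^bsub>Q\<^esub>)"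
    using coker by (simp add: is_cokernel_def module_category_sel)
  also have "\<dots> = compose (carrier M) (\<lambda>x \<in> carrier N. \<zero>\<^bsub>Q\<^esub>) f"
    unfolding compose_def by (rule restrict_ext) (simp add: mhomD(1)[OF fh])
  finally have "c = (\<lambda>x \<in> carrier N. \<zero>\<^bsub>Q\<^esub>)"
    using f Q c z unfolding is_epi_def module_category_sel by blast
  then have "carrier N \<subseteq> f ` carrier M" using ker by auto
  then show ?thesis using mhomD(1)[OF fh] by blast
qed

lemma inj_is_kernel:
  fixes M N Q :: "('r, 'm) module"
  assumes M: "left_module R M" and N: "left_module R N" and f: "f \<in> mhom R M N" and inj: "inj_on f (carrier M)"
    and Q: "left_module R Q" and c: "c \<in> mhom R N Q"
    and cf: "\<And>x. x \<in> carrier M \<Longrightarrow> c (f x) = \<zero>\<^bsub>Q\<^esub>"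
    and ker: "\<And>y. \<lbrakk>y \<in> carrier N; c y = \<zero>\<^bsub>Q\<^esub>\<rbrakk> \<Longrightarrow> y \<in> f ` carrier M"
  shows "is_kernel (module_category TYPE('m) R \<iota>) N Q c M f"
  unfolding is_kernel_def module_category_sel
proof (intro conjI ballI impI)
  interpret M: left_module R M by fact
  show "M \<in> {M. left_module R M}" using M by simp
  show "f \<in> mhom R M N" by fact
  show "compose (carrier M) c f = (\<lambda>x \<in> carrier M. \<zero>\<^bsub>Q\<^esub>)"
    unfolding compose_def by (rule restrict_ext) (rule cf)
  fix W :: "('r, 'm) module" and g
  assume "W \<in> {M. left_module R M}" and g: "g \<in> mhom R W N"
    and cg: "compose (carrier W) c g = (\<lambda>x \<in> carrier W. \<zero>\<^bsub>Q\<^esub>)"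
  then have W: "left_module R W" by simp
  have gi: "g x \<in> f ` carrier M" if "x \<in> carrier W" for x
    using fun_cong[OF cg, of x] that mhomD(1)[OF g that] by (intro ker) (simp_all add: compose_def)
  define u where "u = (\<lambda>x \<in> carrier W. the_inv_into (carrier M) f (g x))"
  have u1: "u x \<in> carrier M" "f (u x) = g x" if "x \<in> carrier W" for x
    using gi[OF that] that the_inv_into_into[OF inj gi[OF that]] f_the_inv_into_f[OF inj gi[OF that]]
    by (simp_all add: u_def)
  have u_eq: "u x = m" if "x \<in> carrier W" "m \<in> carrier M" "f m = g x" for x m
    using inj_onD[OF inj, of "u x" m] u1 that by simp
  have u: "u \<in> mhom R W M"
    by (rule mhomI)
      (auto simp: u1 left_module_rules[OF M] left_module_rules[OF W] mhomD[OF f] mhomD[OF g] intro!: u_eq, simp add: u_def)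
  show "\<exists>!u. u \<in> mhom R W M \<and> compose (carrier W) f u = g"
  proof (rule ex1I[of _ u])
    have "compose (carrier W) f u = g"
      by (rule extensionalityI[of _ "carrier W"]) (simp_all add: compose_def u1 mhomD(4)[OF g])
    with u show "u \<in> mhom R W M \<and> compose (carrier W) f u = g" by blast
    fix v assume "v \<in> mhom R W M \<and> compose (carrier W) f v = g"
    then have v: "v \<in> mhom R W M" and fv: "compose (carrier W) f v = g" by blast+
    show "v = u"
    proof (rule mhom_eqI[OF v u])
      fix x assume x: "x \<in> carrier W"
      show "v x = u x"
        using fun_cong[OF fv, of x] x mhomD(1)[OF v x] by (intro u_eq[symmetric]) (simp_all add: compose_def)
    qed
  qed
qed

lemma surj_is_cokernel:
  fixes M N W :: "('r, 'm) module"
  assumes M: "left_module R M" and N: "left_module R N" and f: "f \<in> mhom R M N" and surj: "f ` carrier M = carrier N"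
    and W: "left_module R W" and k: "k \<in> mhom R W M"
    and fk: "\<And>x. x \<in> carrier W \<Longrightarrow> f (k x) = \<zero>\<^bsub>N\<^esub>"
    and ker: "\<And>y. \<lbrakk>y \<in> carrier M; f y = \<zero>\<^bsub>N\<^esub>\<rbrakk> \<Longrightarrow> y \<in> k ` carrier W"
  shows "is_cokernel (module_category TYPE('m) R \<iota>) W M k N f"
  unfolding is_cokernel_def module_category_sel
proof (intro conjI ballI impI)
  interpret M: left_module R M by fact
  interpret N: left_module R N by fact
  show "N \<in> {M. left_module R M}" using N by simp
  show "f \<in> mhom R M N" by fact
  show "compose (carrier W) f k = (\<lambda>x \<in> carrier W. \<zero>\<^bsub>N\<^esub>)"
    unfolding compose_def by (rule restrict_ext) (rule fk)
  fix Z :: "('r, 'm) module" and g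
  assume "Z \<in> {M. left_module R M}" and g: "g \<in> mhom R M Z"
    and gk: "compose (carrier W) g k = (\<lambda>x \<in> carrier W. \<zero>\<^bsub>Z\<^esub>)"
  then have Z: "left_module R Z" by simp
  interpret Z: left_module R Z by (rule Z)
  have gf: "g x = g y" if x: "x \<in> carrier M" and y: "y \<in> carrier M" and eq: "f x = f y" for x y
  proof -
    have "f (x \<ominus>\<^bsub>M\<^esub> y) = \<zero>\<^bsub>N\<^esub>" using mhom_minus[OF M N f x y] eq mhomD(1)[OF f y] by (simp add: N.minus_eq N.r_neg)
    then obtain w where w: "w \<in> carrier W" "x \<ominus>\<^bsub>M\<^esub> y = k w" using ker[of "x \<ominus>\<^bsub>M\<^esub> y"] x y by blast
    then have "g (x \<ominus>\<^bsub>M\<^esub> y) = \<zero>\<^bsub>Z\<^esub>" using fun_cong[OF gk, of w] by (simp add: compose_def)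
    then show ?thesis using mhom_minus[OF M Z g x y] mhomD(1)[OF g x] mhomD(1)[OF g y] by simp
  qed
  define u where "u = (\<lambda>y \<in> carrier N. g (SOME x. x \<in> carrier M \<and> f x = y))"
  have uf: "u (f x) = g x" if x: "x \<in> carrier M" for x
  proof -
    have "(SOME x'. x' \<in> carrier M \<and> f x' = f x) \<in> carrier M \<and> f (SOME x'. x' \<in> carrier M \<and> f x' = f x) = f x"
      by (rule someI[of _ x]) (simp add: x)
    then show ?thesis using gf[OF _ x] mhomD(1)[OF f x] by (simp add: u_def)
  qed
  have u: "u \<in> mhom R N Z"
  proof (rule mhomI)
    fix x y assume "x \<in> carrier N" "y \<in> carrier N"
    then obtain x' y' where xy: "x' \<in> carrier M" "x = f x'" "y' \<in> carrier M" "y = f y'" unfolding surj[symmetric] by blast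
    then show "u (x \<oplus>\<^bsub>N\<^esub> y) = u x \<oplus>\<^bsub>Z\<^esub> u y"
      using uf[of "x' \<oplus>\<^bsub>M\<^esub> y'"] by (simp add: uf mhomD(2)[OF g] mhomD(2)[OF f])
  next
    fix a x assume a: "a \<in> carrier R" and "x \<in> carrier N"
    then obtain x' where "x' \<in> carrier M" "x = f x'" unfolding surj[symmetric] by blast
    with a show "u (a \<odot>\<^bsub>N\<^esub> x) = a \<odot>\<^bsub>Z\<^esub> u x"
      using uf[of "a \<odot>\<^bsub>M\<^esub> x'"] left_module_rules(7)[OF M a] by (simp add: uf mhomD(3)[OF g] mhomD(3)[OF f])
  next
    fix x assume "x \<in> carrier N"
    then obtain x' where "x' \<in> carrier M" "x = f x'" unfolding surj[symmetric] by blast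
    then show "u x \<in> carrier Z" by (simp add: uf mhomD(1)[OF g])
  qed (simp add: u_def)
  show "\<exists>!u. u \<in> mhom R N Z \<and> compose (carrier M) u f = g"
  proof (rule ex1I[of _ u])
    have "compose (carrier M) u f = g"
      by (rule extensionalityI[of _ "carrier M"]) (simp_all add: compose_def uf mhomD(4)[OF g])
    with u show "u \<in> mhom R N Z \<and> compose (carrier M) u f = g" by blast
    fix v assume "v \<in> mhom R N Z \<and> compose (carrier M) v f = g"
    then have v: "v \<in> mhom R N Z" and vf: "compose (carrier M) v f = g" by blast+
    show "v = u"
    proof (rule mhom_eqI[OF v u])
      fix x assume "x \<in> carrier N"
      then obtain x' where "x' \<in> carrier M" "x = f x'" unfolding surj[symmetric] by blast
      then show "v x = u x" using fun_cong[OF vf, of x'] by (simp add: compose_def uf)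
    qed
  qed
qed

text \<open>
  The direct sum on \<open>'m \<times> 'm\<close> is transported into the universe \<open>'m\<close>.
\<close>

lemma biproduct_object:
  fixes M N :: "('r, 'm) module"
  assumes inf: "infinite (UNIV :: 'm set)" and M: "left_module R M" and N: "left_module R N"
  shows "\<exists>B i j p q. is_biproduct (module_category TYPE('m) R \<iota>) M N B i j p q"
proof -
  obtain e :: "'m \<times> 'm \<Rightarrow> 'm" where e: "inj e" using ex_inj_pair[OF inf] .
  interpret M: left_module R M by fact
  interpret N: left_module R N by fact
  note Mr = left_module_rules[OF M] and Nr = left_module_rules[OF N]
  define P :: "('r, 'm \<times> 'm) module" where "P = \<lparr>carrier = carrier M \<times> carrier N, mult = undefined, one = undefined,
    zero = (\<zero>\<^bsub>M\<^esub>, \<zero>\<^bsub>N\<^esub>), add = (\<lambda>(x, y) (x', y'). (x \<oplus>\<^bsub>M\<^esub> x', y \<oplus>\<^bsub>N\<^esub> y')),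
    smult = (\<lambda>a (x, y). (a \<odot>\<^bsub>M\<^esub> x, a \<odot>\<^bsub>N\<^esub> y))\<rparr>"
  have P: "left_module R P"
  proof (rule left_module_axiomsI)
    show "ring R" ..
    fix x assume "x \<in> carrier P"
    then obtain a b where x: "x = (a, b)" "a \<in> carrier M" "b \<in> carrier N" by (auto simp: P_def)
    then show "\<exists>y \<in> carrier P. y \<oplus>\<^bsub>P\<^esub> x = \<zero>\<^bsub>P\<^esub>"
      by (intro bexI[of _ "(\<ominus>\<^bsub>M\<^esub> a, \<ominus>\<^bsub>N\<^esub> b)"]) (simp_all add: P_def M.l_neg N.l_neg)
  next
    fix x y assume "x \<in> carrier P" "y \<in> carrier P"
    then show "x \<oplus>\<^bsub>P\<^esub> y = y \<oplus>\<^bsub>P\<^esub> x" using Mr(4) Nr(4) by (auto simp: P_def)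
  qed (auto simp: P_def Mr(1,2,3,5,7,8,9,10,11) Nr(1,2,3,5,7,8,9,10,11))
  have eP: "inj_on e (carrier P)" using e by (rule inj_on_subset) simp
  define B where "B = transport_module e P"
  note Bsel = transport_module_sel[OF eP, folded B_def]
  have B: "left_module R B" unfolding B_def by (rule left_module_transport[OF P eP])
  have Bc: "carrier B = e ` (carrier M \<times> carrier N)" and Bz: "\<zero>\<^bsub>B\<^esub> = e (\<zero>\<^bsub>M\<^esub>, \<zero>\<^bsub>N\<^esub>)"
    by (simp_all add: Bsel P_def)
  have Ba: "e (x, y) \<oplus>\<^bsub>B\<^esub> e (x', y') = e (x \<oplus>\<^bsub>M\<^esub> x', y \<oplus>\<^bsub>N\<^esub> y')"
    if "x \<in> carrier M" "y \<in> carrier N" "x' \<in> carrier M" "y' \<in> carrier N" for x y x' y'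
    using Bsel(3)[of "(x, y)" "(x', y')"] that by (simp add: P_def)
  have Bs: "a \<odot>\<^bsub>B\<^esub> e (x, y) = e (a \<odot>\<^bsub>M\<^esub> x, a \<odot>\<^bsub>N\<^esub> y)"
    if "x \<in> carrier M" "y \<in> carrier N" for a x y
    using Bsel(4)[of "(x, y)" a] that by (simp add: P_def)
  define d where "d = the_inv e"
  have d: "d (e z) = z" for z using e by (simp add: d_def the_inv_f_f)
  define i j p q where "i = (\<lambda>x \<in> carrier M. e (x, \<zero>\<^bsub>N\<^esub>))" and "j = (\<lambda>y \<in> carrier N. e (\<zero>\<^bsub>M\<^esub>, y))"
    and "p = (\<lambda>z \<in> carrier B. fst (d z))" and "q = (\<lambda>z \<in> carrier B. snd (d z))"
  have i: "i \<in> mhom R M B"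
    unfolding i_def by (rule mhom_restrictI[OF M]) (auto simp: Bc Ba Bs N.smult_zero_right)
  have j: "j \<in> mhom R N B"
    unfolding j_def by (rule mhom_restrictI[OF N]) (auto simp: Bc Ba Bs M.smult_zero_right)
  have p: "p \<in> mhom R B M"
    unfolding p_def by (rule mhom_restrictI[OF B]) (auto simp: Bc Ba Bs d)
  have q: "q \<in> mhom R B N"
    unfolding q_def by (rule mhom_restrictI[OF B]) (auto simp: Bc Ba Bs d)
  have "is_biproduct (module_category TYPE('m) R \<iota>) M N B i j p q"
    unfolding is_biproduct_def module_category_sel
  proof (intro conjI)
    show "B \<in> {M. left_module R M}" using B by simp
    show "compose (carrier M) p i = (\<lambda>x \<in> carrier M. x)" "compose (carrier M) q i = (\<lambda>x \<in> carrier M. \<zero>\<^bsub>N\<^esub>)"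
      unfolding compose_def by (rule restrict_ext, simp add: i_def p_def q_def Bc d)+
    show "compose (carrier N) q j = (\<lambda>x \<in> carrier N. x)" "compose (carrier N) p j = (\<lambda>x \<in> carrier N. \<zero>\<^bsub>M\<^esub>)"
      unfolding compose_def by (rule restrict_ext, simp add: j_def p_def q_def Bc d)+
    show "(\<lambda>x \<in> carrier B. compose (carrier B) i p x \<oplus>\<^bsub>B\<^esub> compose (carrier B) j q x) = (\<lambda>x \<in> carrier B. x)"
    proof (rule restrict_ext)
      fix z assume z: "z \<in> carrier B"
      then obtain x y where "z = e (x, y)" "x \<in> carrier M" "y \<in> carrier N" unfolding Bc by blast
      then show "compose (carrier B) i p z \<oplus>\<^bsub>B\<^esub> compose (carrier B) j q z = z"
        using z by (simp add: compose_def i_def j_def p_def q_def d Ba)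
    qed
  qed (use i j p q in blast)+
  then show ?thesis by blast
qed

text \<open>
  A monomorphism is injective and hence the kernel of its cokernel; an epimorphism is surjective and hence
  the cokernel of its kernel.
\<close>

theorem linear_abelian_module_category:
  assumes inf: "infinite (UNIV :: 'm set)"
  shows "linear_abelian_category K (module_category TYPE('m) R \<iota>)" (is "linear_abelian_category K ?C")
proof -
  note sel = module_category_sel
  have "linear_abelian_category_axioms ?C"
  proof (rule linear_abelian_category_axioms.intro)
    \<comment> \<open>a zero module needs some element of the universe as its zero; the choice is arbitrary\<close>
    define Z :: "('r, 'm) module" where "Z = \<lparr>carrier = {undefined}, mult = undefined, one = undefined,
      zero = undefined, add = (\<lambda>_ _. undefined), smult = (\<lambda>_ _. undefined)\<rparr>"
    have Z: "left_module R Z"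
    proof (rule left_module_axiomsI)
      show "ring R" ..
    qed (simp_all add: Z_def)
    have "is_zero_object ?C Z" unfolding is_zero_object_def
    proof (intro conjI ballI)
      show "Z \<in> Obj ?C" using Z by (simp add: sel)
      fix M assume "M \<in> Obj ?C"
      then have M: "left_module R M" by (simp add: sel)
      interpret M: left_module R M by (rule M)
      have h: "(\<lambda>x \<in> carrier M. undefined) \<in> mhom R M Z" by (rule mhom_restrictI[OF M]) (simp_all add: Z_def)
      have "f = (\<lambda>x \<in> carrier M. undefined)" if f: "f \<in> mhom R M Z" for f
        using mhomD(1)[OF f] by (intro mhom_eqI[OF f h]) (simp add: Z_def)
      with h show "\<exists>!f. f \<in> Hom ?C M Z" unfolding sel by blast
      have h': "(\<lambda>x \<in> carrier Z. \<zero>\<^bsub>M\<^esub>) \<in> mhom R Z M" by (rule mhom_restrictI[OF Z]) (simp_all add: M.smult_zero_right)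
      have "f = (\<lambda>x \<in> carrier Z. \<zero>\<^bsub>M\<^esub>)" if f: "f \<in> mhom R Z M" for f
        using mhom_zero[OF Z M f] by (intro mhom_eqI[OF f h']) (simp add: Z_def)
      with h' show "\<exists>!f. f \<in> Hom ?C Z M" unfolding sel by blast
    qed
    then show "\<exists>Z. is_zero_object ?C Z" by blast
  next
    fix M N assume "M \<in> Obj ?C" "N \<in> Obj ?C"
    then have M: "left_module R M" and N: "left_module R N" by (simp_all add: sel)
    show "\<exists>B i j p q. is_biproduct ?C M N B i j p q" by (rule biproduct_object[OF inf M N])
    show "\<exists>L k. is_kernel ?C M N f L k" if "f \<in> Hom ?C M N" for f
      using kernel_object(3)[OF M N] that unfolding sel by blast
    show "\<exists>Q c. is_cokernel ?C M N f Q c" if "f \<in> Hom ?C M N" for f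
    proof -
      have f: "f \<in> mhom R M N" using that by (simp only: sel)
      from cokernel_object[OF M N f] show ?thesis by blast
    qed
    show "\<exists>Z g. Z \<in> Obj ?C \<and> g \<in> Hom ?C N Z \<and> is_kernel ?C N Z g M f" if mono: "is_mono ?C M N f" for f
    proof -
      have f: "f \<in> mhom R M N" using mono by (simp only: is_mono_def sel)
      obtain Q c where Q: "left_module R Q" and c: "c \<in> mhom R N Q" and coker: "is_cokernel ?C M N f Q c"
        and ker: "\<And>y. \<lbrakk>y \<in> carrier N; c y = \<zero>\<^bsub>Q\<^esub>\<rbrakk> \<Longrightarrow> y \<in> f ` carrier M"
        using cokernel_object[OF M N f] by blast
      have comp: "compose (carrier M) c f = (\<lambda>x \<in> carrier M. \<zero>\<^bsub>Q\<^esub>)"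
        using coker by (simp add: is_cokernel_def sel)
      have cf: "c (f x) = \<zero>\<^bsub>Q\<^esub>" if "x \<in> carrier M" for x
        using fun_cong[OF comp, of x] that by (simp add: compose_def)
      from inj_is_kernel[OF M N f mono_inj[OF M N mono] Q c cf ker] Q c show ?thesis unfolding sel by blast
    qed
    show "\<exists>W g. W \<in> Obj ?C \<and> g \<in> Hom ?C W M \<and> is_cokernel ?C W M g N f" if epi: "is_epi ?C M N f" for f
    proof -
      have f: "f \<in> mhom R M N" using epi by (simp only: is_epi_def sel)
      define S where "S = {x \<in> carrier M. f x = \<zero>\<^bsub>N\<^esub>}"
      note k = kernel_object(1,2)[OF M N f, folded S_def]
      have "is_cokernel ?C (M\<lparr>carrier := S\<rparr>) M (\<lambda>x \<in> S. x) N f"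
        by (rule surj_is_cokernel[OF M N f epi_surj[OF M N epi] k]) (auto simp: S_def)
      with k show ?thesis unfolding sel by blast
    qed
  qed
  with linear_category_module_category show ?thesis by (rule linear_abelian_category.intro)
qed

end

section \<open>Modules over the group ring of a finite group\<close>

lemma (in abelian_monoid) finsum_swap:
  assumes "finite A" "finite B" and f: "\<And>i j. \<lbrakk>i \<in> A; j \<in> B\<rbrakk> \<Longrightarrow> f i j \<in> carrier G"
  shows "(\<Oplus>i \<in> A. \<Oplus>j \<in> B. f i j) = (\<Oplus>j \<in> B. \<Oplus>i \<in> A. f i j)"
  using assms(1) f
proof (induction A rule: finite_induct)
  case empty
  then show ?case by simp
next
  case (insert a A)
  have cl: "f i j \<in> carrier G" if "i \<in> insert a A" "j \<in> B" for i j using insert.prems that by blast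
  have "(\<Oplus>i \<in> insert a A. \<Oplus>j \<in> B. f i j) = (\<Oplus>j \<in> B. f a j) \<oplus> (\<Oplus>i \<in> A. \<Oplus>j \<in> B. f i j)"
    using insert.hyps cl by (intro finsum_insert) (auto intro!: finsum_closed)
  also have "\<dots> = (\<Oplus>j \<in> B. f a j) \<oplus> (\<Oplus>j \<in> B. \<Oplus>i \<in> A. f i j)" using insert.IH cl by simp
  also have "\<dots> = (\<Oplus>j \<in> B. f a j \<oplus> (\<Oplus>i \<in> A. f i j))"
    using cl by (intro finsum_addf[symmetric]) (auto intro!: finsum_closed)
  also have "\<dots> = (\<Oplus>j \<in> B. \<Oplus>i \<in> insert a A. f i j)"
    using insert.hyps cl by (intro finsum_cong') (auto intro!: finsum_closed)
  finally show ?case .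
qed

lemma (in abelian_monoid) finsum_single:
  assumes "finite A" "i \<in> A" "f i \<in> carrier G" "\<And>j. \<lbrakk>j \<in> A; j \<noteq> i\<rbrakk> \<Longrightarrow> f j = \<zero>"
  shows "(\<Oplus>j \<in> A. f j) = f i"
proof -
  have "(\<Oplus>j \<in> A. f j) = (\<Oplus>j \<in> A. if i = j then f i else \<zero>)"
    using assms by (intro finsum_cong') auto
  then show ?thesis using finsum_singleton[of i A "\<lambda>_. f i"] assms by simp
qed

lemma additive_finsum:
  fixes M :: "('m, 'c) ring_scheme" and N :: "('n, 'd) ring_scheme"
  assumes M: "abelian_monoid M" and N: "abelian_monoid N" and h: "\<And>x. x \<in> carrier M \<Longrightarrow> h x \<in> carrier N"
    and add: "\<And>x y. \<lbrakk>x \<in> carrier M; y \<in> carrier M\<rbrakk> \<Longrightarrow> h (x \<oplus>\<^bsub>M\<^esub> y) = h x \<oplus>\<^bsub>N\<^esub> h y" and zero: "h \<zero>\<^bsub>M\<^esub> = \<zero>\<^bsub>N\<^esub>"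
    and "finite A" and f: "\<And>i. i \<in> A \<Longrightarrow> f i \<in> carrier M"
  shows "h (\<Oplus>\<^bsub>M\<^esub>i \<in> A. f i) = (\<Oplus>\<^bsub>N\<^esub>i \<in> A. h (f i))"
  using \<open>finite A\<close> f
proof (induction A rule: finite_induct)
  case empty
  show ?case by (simp add: abelian_monoid.finsum_empty[OF M] abelian_monoid.finsum_empty[OF N] zero)
next
  case (insert a A)
  have "finsum M f A \<in> carrier M" using insert.prems by (intro abelian_monoid.finsum_closed[OF M]) auto
  then show ?case using insert h
    by (simp add: abelian_monoid.finsum_insert[OF M] abelian_monoid.finsum_insert[OF N] add)
qed

locale linear_action = K: cring K + G: group G + M: Module.module K M
  for K :: "'k ring" and G :: "('g, 'd) monoid_scheme" and M :: "('k, 'm, 'e) module_scheme" +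
  fixes act :: "'g \<Rightarrow> 'm \<Rightarrow> 'm"
  assumes finite_G: "finite (carrier G)"
    and act_closed: "\<lbrakk>g \<in> carrier G; x \<in> carrier M\<rbrakk> \<Longrightarrow> act g x \<in> carrier M"
    and act_add: "\<lbrakk>g \<in> carrier G; x \<in> carrier M; y \<in> carrier M\<rbrakk> \<Longrightarrow> act g (x \<oplus>\<^bsub>M\<^esub> y) = act g x \<oplus>\<^bsub>M\<^esub> act g y"
    and act_smult: "\<lbrakk>g \<in> carrier G; c \<in> carrier K; x \<in> carrier M\<rbrakk> \<Longrightarrow> act g (c \<odot>\<^bsub>M\<^esub> x) = c \<odot>\<^bsub>M\<^esub> act g x"
    and act_mult: "\<lbrakk>g \<in> carrier G; h \<in> carrier G; x \<in> carrier M\<rbrakk> \<Longrightarrow> act (g \<otimes>\<^bsub>G\<^esub> h) x = act g (act h x)"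
    and act_one: "x \<in> carrier M \<Longrightarrow> act \<one>\<^bsub>G\<^esub> x = x"
begin

definition ring_smult :: "('g \<Rightarrow> 'k) \<Rightarrow> 'm \<Rightarrow> 'm" where
  "ring_smult a x = (\<Oplus>\<^bsub>M\<^esub>g \<in> carrier G. a g \<odot>\<^bsub>M\<^esub> act g x)"

definition ring_module :: "('g \<Rightarrow> 'k, 'm) module" where
  "ring_module = \<lparr>carrier = carrier M, mult = undefined, one = undefined, zero = \<zero>\<^bsub>M\<^esub>, add = add M,
     smult = ring_smult\<rparr>"

lemma ring_module_sel:
  "carrier ring_module = carrier M" "\<zero>\<^bsub>ring_module\<^esub> = \<zero>\<^bsub>M\<^esub>" "add ring_module = add M"
  "smult ring_module = ring_smult"
  by (simp_all add: ring_module_def)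

lemma act_zero: "g \<in> carrier G \<Longrightarrow> act g \<zero>\<^bsub>M\<^esub> = \<zero>\<^bsub>M\<^esub>"
  using act_smult[of g "\<zero>\<^bsub>K\<^esub>" "\<zero>\<^bsub>M\<^esub>"] act_closed[of g "\<zero>\<^bsub>M\<^esub>"] by simp

abbreviation "coeff_funs \<equiv> (\<Pi>\<^sub>E g \<in> carrier G. carrier K)"

lemma ring_smult_closed: "\<lbrakk>a \<in> coeff_funs; x \<in> carrier M\<rbrakk> \<Longrightarrow> ring_smult a x \<in> carrier M"
  unfolding ring_smult_def by (intro M.finsum_closed) (auto simp: act_closed)

lemma ring_smult_add_right:
  assumes a: "a \<in> coeff_funs" and x: "x \<in> carrier M" and y: "y \<in> carrier M"
  shows "ring_smult a (x \<oplus>\<^bsub>M\<^esub> y) = ring_smult a x \<oplus>\<^bsub>M\<^esub> ring_smult a y"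
proof -
  have "ring_smult a (x \<oplus>\<^bsub>M\<^esub> y) = (\<Oplus>\<^bsub>M\<^esub>g \<in> carrier G. a g \<odot>\<^bsub>M\<^esub> act g x \<oplus>\<^bsub>M\<^esub> a g \<odot>\<^bsub>M\<^esub> act g y)"
    unfolding ring_smult_def
    by (rule M.finsum_cong') (auto simp: act_closed act_add M.smult_r_distr PiE_mem[OF a] x y)
  also have "\<dots> = ring_smult a x \<oplus>\<^bsub>M\<^esub> ring_smult a y"
    unfolding ring_smult_def by (rule M.finsum_addf) (auto simp: act_closed PiE_mem[OF a] x y)
  finally show ?thesis .
qed

lemma ring_smult_add_left:
  assumes a: "a \<in> coeff_funs" and b: "b \<in> coeff_funs" and x: "x \<in> carrier M"
  shows "ring_smult (\<lambda>g \<in> carrier G. a g \<oplus>\<^bsub>K\<^esub> b g) x = ring_smult a x \<oplus>\<^bsub>M\<^esub> ring_smult b x"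
proof -
  have "ring_smult (\<lambda>g \<in> carrier G. a g \<oplus>\<^bsub>K\<^esub> b g) x =
    (\<Oplus>\<^bsub>M\<^esub>g \<in> carrier G. a g \<odot>\<^bsub>M\<^esub> act g x \<oplus>\<^bsub>M\<^esub> b g \<odot>\<^bsub>M\<^esub> act g x)"
    unfolding ring_smult_def
    by (rule M.finsum_cong') (auto simp: act_closed M.smult_l_distr PiE_mem[OF a] PiE_mem[OF b] x)
  also have "\<dots> = ring_smult a x \<oplus>\<^bsub>M\<^esub> ring_smult b x"
    unfolding ring_smult_def by (rule M.finsum_addf) (auto simp: act_closed PiE_mem[OF a] PiE_mem[OF b] x)
  finally show ?thesis .
qed

lemma ring_smult_single:
  assumes g: "g \<in> carrier G" and c: "c \<in> carrier K" and x: "x \<in> carrier M"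
  shows "ring_smult (\<lambda>h \<in> carrier G. if h = g then c else \<zero>\<^bsub>K\<^esub>) x = c \<odot>\<^bsub>M\<^esub> act g x"
proof -
  have "ring_smult (\<lambda>h \<in> carrier G. if h = g then c else \<zero>\<^bsub>K\<^esub>) x =
    (\<lambda>h \<in> carrier G. if h = g then c else \<zero>\<^bsub>K\<^esub>) g \<odot>\<^bsub>M\<^esub> act g x"
    unfolding ring_smult_def
    by (rule M.finsum_single[OF finite_G g]) (use g c x in \<open>simp_all add: act_closed\<close>)
  then show ?thesis using g by simp
qed

text \<open>
  The terms outside the support of \<open>a\<close> vanish, and the group is finite.
\<close>

lemma group_ring_mult:
  assumes a: "a \<in> coeff_funs" and b: "b \<in> coeff_funs" and g: "g \<in> carrier G"
  shows "(a \<otimes>\<^bsub>group_ring K G\<^esub> b) g = (\<Oplus>\<^bsub>K\<^esub>h \<in> carrier G. a h \<otimes>\<^bsub>K\<^esub> b (inv\<^bsub>G\<^esub> h \<otimes>\<^bsub>G\<^esub> g))"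
proof -
  have "(\<Oplus>\<^bsub>K\<^esub>h \<in> {h \<in> carrier G. a h \<noteq> \<zero>\<^bsub>K\<^esub>}. a h \<otimes>\<^bsub>K\<^esub> b (inv\<^bsub>G\<^esub> h \<otimes>\<^bsub>G\<^esub> g)) =
    (\<Oplus>\<^bsub>K\<^esub>h \<in> carrier G. a h \<otimes>\<^bsub>K\<^esub> b (inv\<^bsub>G\<^esub> h \<otimes>\<^bsub>G\<^esub> g))"
    by (rule K.add.finprod_mono_neutral_cong_left)
      (use g finite_G in \<open>auto simp: PiE_mem[OF a] PiE_mem[OF b]\<close>)
  then show ?thesis using g by (simp add: group_ring_def)
qed

lemma group_ring_mult_closed:
  assumes a: "a \<in> coeff_funs" and b: "b \<in> coeff_funs"
  shows "a \<otimes>\<^bsub>group_ring K G\<^esub> b \<in> coeff_funs"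
proof (rule PiE_I)
  show "(a \<otimes>\<^bsub>group_ring K G\<^esub> b) g \<in> carrier K" if "g \<in> carrier G" for g
    unfolding group_ring_mult[OF a b that] using that by (intro K.finsum_closed) (auto simp: PiE_mem[OF a] PiE_mem[OF b])
qed (simp add: group_ring_def)

text \<open>
  The associativity of the extended action is computed once for all actions. For the regular representation
  it becomes the associativity of the group ring itself.
\<close>

lemma ring_smult_mult:
  assumes a: "a \<in> coeff_funs" and b: "b \<in> coeff_funs" and x: "x \<in> carrier M"
  shows "ring_smult (a \<otimes>\<^bsub>group_ring K G\<^esub> b) x = ring_smult a (ring_smult b x)"
proof -
  note am = PiE_mem[OF a] and bm = PiE_mem[OF b]
  have "ring_smult (a \<otimes>\<^bsub>group_ring K G\<^esub> b) x =
    (\<Oplus>\<^bsub>M\<^esub>g \<in> carrier G. \<Oplus>\<^bsub>M\<^esub>h \<in> carrier G. (a h \<otimes>\<^bsub>K\<^esub> b (inv\<^bsub>G\<^esub> h \<otimes>\<^bsub>G\<^esub> g)) \<odot>\<^bsub>M\<^esub> act g x)"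
    unfolding ring_smult_def
  proof (rule M.finsum_cong'[OF refl])
    fix g assume g: "g \<in> carrier G"
    show "(a \<otimes>\<^bsub>group_ring K G\<^esub> b) g \<odot>\<^bsub>M\<^esub> act g x =
      (\<Oplus>\<^bsub>M\<^esub>h \<in> carrier G. (a h \<otimes>\<^bsub>K\<^esub> b (inv\<^bsub>G\<^esub> h \<otimes>\<^bsub>G\<^esub> g)) \<odot>\<^bsub>M\<^esub> act g x)"
      unfolding group_ring_mult[OF a b g]
      by (rule additive_finsum[where h = "\<lambda>c. c \<odot>\<^bsub>M\<^esub> act g x"])
        (use g x in \<open>simp_all add: act_closed am bm finite_G M.smult_l_distr K.abelian_monoid_axioms M.abelian_monoid_axioms\<close>)
  qed (use x in \<open>auto simp: act_closed am bm intro!: M.finsum_closed\<close>)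
  also have "\<dots> = (\<Oplus>\<^bsub>M\<^esub>h \<in> carrier G. \<Oplus>\<^bsub>M\<^esub>g \<in> carrier G. (a h \<otimes>\<^bsub>K\<^esub> b (inv\<^bsub>G\<^esub> h \<otimes>\<^bsub>G\<^esub> g)) \<odot>\<^bsub>M\<^esub> act g x)"
    by (rule M.finsum_swap) (use x in \<open>simp_all add: finite_G act_closed am bm\<close>)
  also have "\<dots> = (\<Oplus>\<^bsub>M\<^esub>h \<in> carrier G. a h \<odot>\<^bsub>M\<^esub> act h (ring_smult b x))"
  proof (rule M.finsum_cong'[OF refl])
    fix h assume h: "h \<in> carrier G"
    have bij: "(\<lambda>k. h \<otimes>\<^bsub>G\<^esub> k) ` carrier G = carrier G" "inj_on (\<lambda>k. h \<otimes>\<^bsub>G\<^esub> k) (carrier G)"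
      using G.surj_const_mult[OF h] G.inj_on_cmult[OF h] by simp_all
    have "(\<Oplus>\<^bsub>M\<^esub>g \<in> carrier G. (a h \<otimes>\<^bsub>K\<^esub> b (inv\<^bsub>G\<^esub> h \<otimes>\<^bsub>G\<^esub> g)) \<odot>\<^bsub>M\<^esub> act g x) =
      (\<Oplus>\<^bsub>M\<^esub>g \<in> (\<lambda>k. h \<otimes>\<^bsub>G\<^esub> k) ` carrier G. (a h \<otimes>\<^bsub>K\<^esub> b (inv\<^bsub>G\<^esub> h \<otimes>\<^bsub>G\<^esub> g)) \<odot>\<^bsub>M\<^esub> act g x)"
      by (simp only: bij(1))
    also have "\<dots> = (\<Oplus>\<^bsub>M\<^esub>k \<in> carrier G. (a h \<otimes>\<^bsub>K\<^esub> b (inv\<^bsub>G\<^esub> h \<otimes>\<^bsub>G\<^esub> (h \<otimes>\<^bsub>G\<^esub> k))) \<odot>\<^bsub>M\<^esub> act (h \<otimes>\<^bsub>G\<^esub> k) x)"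
      by (rule M.finsum_reindex[OF _ bij(2)]) (use h x in \<open>auto simp: act_closed am bm\<close>)
    also have "\<dots> = (\<Oplus>\<^bsub>M\<^esub>k \<in> carrier G. a h \<odot>\<^bsub>M\<^esub> act h (b k \<odot>\<^bsub>M\<^esub> act k x))"
      by (rule M.finsum_cong')
        (use h x in \<open>auto simp: G.m_assoc[symmetric] act_closed act_mult act_smult am bm M.smult_assoc1\<close>)
    also have "\<dots> = a h \<odot>\<^bsub>M\<^esub> act h (ring_smult b x)"
      unfolding ring_smult_def
      by (rule additive_finsum[where h = "\<lambda>y. a h \<odot>\<^bsub>M\<^esub> act h y", symmetric])
        (use h x in \<open>simp_all add: act_closed act_add act_zero am bm finite_G M.smult_r_distr M.abelian_monoid_axioms\<close>)
    finally show "(\<Oplus>\<^bsub>M\<^esub>g \<in> carrier G. (a h \<otimes>\<^bsub>K\<^esub> b (inv\<^bsub>G\<^esub> h \<otimes>\<^bsub>G\<^esub> g)) \<odot>\<^bsub>M\<^esub> act g x) =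
      a h \<odot>\<^bsub>M\<^esub> act h (ring_smult b x)" .
  qed (use x b in \<open>auto simp: act_closed am ring_smult_closed\<close>)
  finally show ?thesis by (simp add: ring_smult_def[of a])
qed

end

locale finite_group_ring = K: cring K + G: group G
  for K :: "'k ring" and G :: "('g, 'd) monoid_scheme" +
  assumes finite_carrier: "finite (carrier G)"
begin

abbreviation "KG \<equiv> group_ring K G"

abbreviation "\<iota> \<equiv> group_ring_of_scalar K G"

definition \<delta> :: "'g \<Rightarrow> 'g \<Rightarrow> 'k" where
  "\<delta> g = (\<lambda>h \<in> carrier G. if h = g then \<one>\<^bsub>K\<^esub> else \<zero>\<^bsub>K\<^esub>)"

lemma KG_sel:
  "carrier KG = (\<Pi>\<^sub>E g \<in> carrier G. carrier K)"
  "a \<oplus>\<^bsub>KG\<^esub> b = (\<lambda>g \<in> carrier G. a g \<oplus>\<^bsub>K\<^esub> b g)"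
  "\<zero>\<^bsub>KG\<^esub> = (\<lambda>g \<in> carrier G. \<zero>\<^bsub>K\<^esub>)" "\<one>\<^bsub>KG\<^esub> = \<delta> \<one>\<^bsub>G\<^esub>"
  using finite_carrier by (simp_all add: group_ring_def \<delta>_def)

lemma \<delta>_closed: "\<delta> g \<in> carrier KG" by (simp add: KG_sel \<delta>_def)

lemma \<iota>_closed: "c \<in> carrier K \<Longrightarrow> \<iota> c \<in> carrier KG" by (simp add: KG_sel group_ring_of_scalar_def)

text \<open>The left regular representation; its extension to the group ring is the product of the group ring.\<close>

definition regular :: "('k, 'g \<Rightarrow> 'k) module" where
  "regular = \<lparr>carrier = carrier KG, mult = undefined, one = undefined, zero = \<zero>\<^bsub>KG\<^esub>, add = add KG,
     smult = (\<lambda>c a. \<lambda>g \<in> carrier G. c \<otimes>\<^bsub>K\<^esub> a g)\<rparr>"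

definition shift :: "'g \<Rightarrow> ('g \<Rightarrow> 'k) \<Rightarrow> 'g \<Rightarrow> 'k" where
  "shift h a = (\<lambda>g \<in> carrier G. a (inv\<^bsub>G\<^esub> h \<otimes>\<^bsub>G\<^esub> g))"

lemma regular_sel:
  "carrier regular = carrier KG" "\<zero>\<^bsub>regular\<^esub> = \<zero>\<^bsub>KG\<^esub>" "add regular = add KG"
  "c \<odot>\<^bsub>regular\<^esub> a = (\<lambda>g \<in> carrier G. c \<otimes>\<^bsub>K\<^esub> a g)"
  by (simp_all add: regular_def)

lemma regular_module: "module K regular"
proof (rule module_axiomsI[OF K.cring_axioms K.cring_axioms], unfold regular_sel KG_sel)
  fix a assume a: "a \<in> (\<Pi>\<^sub>E g \<in> carrier G. carrier K)"
  show "\<exists>b \<in> (\<Pi>\<^sub>E g \<in> carrier G. carrier K). (\<lambda>g \<in> carrier G. b g \<oplus>\<^bsub>K\<^esub> a g) = (\<lambda>g \<in> carrier G. \<zero>\<^bsub>K\<^esub>)"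
    by (intro bexI[of _ "\<lambda>g \<in> carrier G. \<ominus>\<^bsub>K\<^esub> a g"] restrict_ext)
      (simp_all add: PiE_mem[OF a] K.l_neg)
next
  fix a b assume a: "a \<in> (\<Pi>\<^sub>E g \<in> carrier G. carrier K)" and b: "b \<in> (\<Pi>\<^sub>E g \<in> carrier G. carrier K)"
  show "(\<lambda>g \<in> carrier G. a g \<oplus>\<^bsub>K\<^esub> b g) = (\<lambda>g \<in> carrier G. b g \<oplus>\<^bsub>K\<^esub> a g)"
    by (rule restrict_ext) (rule K.a_comm[OF PiE_mem[OF a] PiE_mem[OF b]])
next
  fix a b c assume abc: "a \<in> (\<Pi>\<^sub>E g \<in> carrier G. carrier K)" "b \<in> (\<Pi>\<^sub>E g \<in> carrier G. carrier K)"
    "c \<in> (\<Pi>\<^sub>E g \<in> carrier G. carrier K)"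
  show "(\<lambda>g \<in> carrier G. (\<lambda>g \<in> carrier G. a g \<oplus>\<^bsub>K\<^esub> b g) g \<oplus>\<^bsub>K\<^esub> c g) =
    (\<lambda>g \<in> carrier G. a g \<oplus>\<^bsub>K\<^esub> (\<lambda>g \<in> carrier G. b g \<oplus>\<^bsub>K\<^esub> c g) g)"
    by (intro restrict_ext) (simp add: PiE_mem[OF abc(1)] PiE_mem[OF abc(2)] PiE_mem[OF abc(3)] K.a_assoc)
next
  fix a assume a: "a \<in> (\<Pi>\<^sub>E g \<in> carrier G. carrier K)"
  show "(\<lambda>g \<in> carrier G. (\<lambda>g \<in> carrier G. \<zero>\<^bsub>K\<^esub>) g \<oplus>\<^bsub>K\<^esub> a g) = a"
    "(\<lambda>g \<in> carrier G. \<one>\<^bsub>K\<^esub> \<otimes>\<^bsub>K\<^esub> a g) = a"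
    using a by (intro extensionalityI[of _ "carrier G"]; simp add: PiE_mem[OF a] PiE_def)+
next
  fix c a b assume c: "c \<in> carrier K" and a: "a \<in> (\<Pi>\<^sub>E g \<in> carrier G. carrier K)" and b: "b \<in> (\<Pi>\<^sub>E g \<in> carrier G. carrier K)"
  show "(\<lambda>g \<in> carrier G. c \<otimes>\<^bsub>K\<^esub> (\<lambda>g \<in> carrier G. a g \<oplus>\<^bsub>K\<^esub> b g) g) =
    (\<lambda>g \<in> carrier G. (\<lambda>g \<in> carrier G. c \<otimes>\<^bsub>K\<^esub> a g) g \<oplus>\<^bsub>K\<^esub> (\<lambda>g \<in> carrier G. c \<otimes>\<^bsub>K\<^esub> b g) g)"
    by (intro restrict_ext) (simp add: PiE_mem[OF a] PiE_mem[OF b] c K.r_distr)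
next
  fix c d a assume cd: "c \<in> carrier K" "d \<in> carrier K" and a: "a \<in> (\<Pi>\<^sub>E g \<in> carrier G. carrier K)"
  show "(\<lambda>g \<in> carrier G. (c \<oplus>\<^bsub>K\<^esub> d) \<otimes>\<^bsub>K\<^esub> a g) =
    (\<lambda>g \<in> carrier G. (\<lambda>g \<in> carrier G. c \<otimes>\<^bsub>K\<^esub> a g) g \<oplus>\<^bsub>K\<^esub> (\<lambda>g \<in> carrier G. d \<otimes>\<^bsub>K\<^esub> a g) g)"
    using cd by (intro restrict_ext) (simp add: PiE_mem[OF a] K.l_distr)
  show "(\<lambda>g \<in> carrier G. (c \<otimes>\<^bsub>K\<^esub> d) \<otimes>\<^bsub>K\<^esub> a g) =
    (\<lambda>g \<in> carrier G. c \<otimes>\<^bsub>K\<^esub> (\<lambda>g \<in> carrier G. d \<otimes>\<^bsub>K\<^esub> a g) g)"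
    using cd by (intro restrict_ext) (simp add: PiE_mem[OF a] K.m_assoc)
qed (auto simp: PiE_mem)

lemma regular_action: "linear_action K G regular shift"
proof -
  interpret reg: Module.module K regular by (rule regular_module)
  have "linear_action_axioms K G regular shift"
  proof (rule linear_action_axioms.intro, unfold regular_sel KG_sel)
    show "finite (carrier G)" by (rule finite_carrier)
    fix h assume h: "h \<in> carrier G"
    show "shift h a \<in> (\<Pi>\<^sub>E g \<in> carrier G. carrier K)" if "a \<in> (\<Pi>\<^sub>E g \<in> carrier G. carrier K)" for a
      using h that by (auto simp: shift_def PiE_mem)
    show "shift h (\<lambda>g \<in> carrier G. a g \<oplus>\<^bsub>K\<^esub> b g) = (\<lambda>g \<in> carrier G. shift h a g \<oplus>\<^bsub>K\<^esub> shift h b g)" for a b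
      unfolding shift_def by (rule restrict_ext) (simp add: h)
    show "shift h (\<lambda>g \<in> carrier G. c \<otimes>\<^bsub>K\<^esub> a g) = (\<lambda>g \<in> carrier G. c \<otimes>\<^bsub>K\<^esub> shift h a g)" for c a
      unfolding shift_def by (rule restrict_ext) (simp add: h)
    show "shift (h \<otimes>\<^bsub>G\<^esub> k) a = shift h (shift k a)" if k: "k \<in> carrier G" for k a
      unfolding shift_def by (rule restrict_ext) (simp add: h k G.inv_mult_group G.m_assoc)
  next
    show "shift \<one>\<^bsub>G\<^esub> a = a" if "a \<in> (\<Pi>\<^sub>E g \<in> carrier G. carrier K)" for a
      using that by (intro extensionalityI[of _ "carrier G"]) (auto simp: shift_def PiE_def)
  qed
  then show ?thesis by (intro linear_action.intro K.cring_axioms G.group_axioms regular_module)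
qed

sublocale reg: linear_action K G regular shift by (rule regular_action)

lemma mult_eq_ring_smult:
  assumes a: "a \<in> carrier KG" and b: "b \<in> carrier KG"
  shows "a \<otimes>\<^bsub>KG\<^esub> b = reg.ring_smult a b"
proof (rule extensionalityI[of _ "carrier G"])
  note a' = a[unfolded KG_sel] and b' = b[unfolded KG_sel]
  note am = PiE_mem[OF a'] and bm = PiE_mem[OF b']
  have cl: "a g \<odot>\<^bsub>regular\<^esub> shift g b \<in> carrier regular" if "g \<in> carrier G" for g
    using that am reg.act_closed[of g b] b by (intro reg.M.smult_closed) (auto simp: regular_sel)
  show "a \<otimes>\<^bsub>KG\<^esub> b \<in> extensional (carrier G)" by (simp add: group_ring_def)
  show "reg.ring_smult a b \<in> extensional (carrier G)"
    using reg.ring_smult_closed[OF a', of b] b by (simp add: regular_sel KG_sel PiE_def)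
  fix g assume g: "g \<in> carrier G"
  have "reg.ring_smult a b g = (\<Oplus>\<^bsub>K\<^esub>h \<in> carrier G. (a h \<odot>\<^bsub>regular\<^esub> shift h b) g)"
    unfolding reg.ring_smult_def
    by (rule additive_finsum[where h = "\<lambda>f. f g"])
      (use g cl in \<open>auto simp: regular_sel KG_sel finite_carrier reg.M.abelian_monoid_axioms K.abelian_monoid_axioms\<close>)
  also have "\<dots> = (\<Oplus>\<^bsub>K\<^esub>h \<in> carrier G. a h \<otimes>\<^bsub>K\<^esub> b (inv\<^bsub>G\<^esub> h \<otimes>\<^bsub>G\<^esub> g))"
    using g by (intro K.finsum_cong') (auto simp: regular_sel shift_def am bm)
  finally show "(a \<otimes>\<^bsub>KG\<^esub> b) g = reg.ring_smult a b g" using reg.group_ring_mult[OF a' b' g] by simp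
qed

lemma mult_single_right:
  assumes a: "a \<in> carrier KG" and k: "k \<in> carrier G" and c: "c \<in> carrier K"
  shows "a \<otimes>\<^bsub>KG\<^esub> (\<lambda>h \<in> carrier G. if h = k then c else \<zero>\<^bsub>K\<^esub>) = (\<lambda>g \<in> carrier G. a (g \<otimes>\<^bsub>G\<^esub> inv\<^bsub>G\<^esub> k) \<otimes>\<^bsub>K\<^esub> c)" (is "a \<otimes>\<^bsub>KG\<^esub> ?d = _")
proof (rule extensionalityI[of _ "carrier G"])
  note a' = a[unfolded KG_sel] note am = PiE_mem[OF a']
  have d: "?d \<in> (\<Pi>\<^sub>E g \<in> carrier G. carrier K)" using c by simp
  show "a \<otimes>\<^bsub>KG\<^esub> ?d \<in> extensional (carrier G)" by (simp add: group_ring_def)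
  show "(\<lambda>g \<in> carrier G. a (g \<otimes>\<^bsub>G\<^esub> inv\<^bsub>G\<^esub> k) \<otimes>\<^bsub>K\<^esub> c) \<in> extensional (carrier G)" by simp
  fix g assume g: "g \<in> carrier G"
  have *: "inv\<^bsub>G\<^esub> h \<otimes>\<^bsub>G\<^esub> g = k \<longleftrightarrow> h = g \<otimes>\<^bsub>G\<^esub> inv\<^bsub>G\<^esub> k" if "h \<in> carrier G" for h
    using that g k by (metis G.inv_closed G.inv_solve_left G.inv_solve_right G.m_closed)
  have "(a \<otimes>\<^bsub>KG\<^esub> ?d) g = (\<Oplus>\<^bsub>K\<^esub>h \<in> carrier G. a h \<otimes>\<^bsub>K\<^esub> ?d (inv\<^bsub>G\<^esub> h \<otimes>\<^bsub>G\<^esub> g))"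
    by (rule reg.group_ring_mult[OF a' d g])
  also have "\<dots> = a (g \<otimes>\<^bsub>G\<^esub> inv\<^bsub>G\<^esub> k) \<otimes>\<^bsub>K\<^esub> ?d (inv\<^bsub>G\<^esub> (g \<otimes>\<^bsub>G\<^esub> inv\<^bsub>G\<^esub> k) \<otimes>\<^bsub>G\<^esub> g)"
    by (rule K.finsum_single[OF finite_carrier])
      (use g k c in \<open>auto simp: am *\<close>)
  finally show "(a \<otimes>\<^bsub>KG\<^esub> ?d) g = (\<lambda>g \<in> carrier G. a (g \<otimes>\<^bsub>G\<^esub> inv\<^bsub>G\<^esub> k) \<otimes>\<^bsub>K\<^esub> c) g"
    using g k *[of "g \<otimes>\<^bsub>G\<^esub> inv\<^bsub>G\<^esub> k"] by simp
qed

lemma \<iota>_mult: "\<lbrakk>c \<in> carrier K; a \<in> carrier KG\<rbrakk> \<Longrightarrow> \<iota> c \<otimes>\<^bsub>KG\<^esub> a = (\<lambda>g \<in> carrier G. c \<otimes>\<^bsub>K\<^esub> a g)"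
  using reg.ring_smult_single[of "\<one>\<^bsub>G\<^esub>" c a] reg.act_one[of a]
  by (simp add: mult_eq_ring_smult \<iota>_closed regular_sel) (simp add: group_ring_of_scalar_def)

lemma mult_\<iota>:
  assumes c: "c \<in> carrier K" and a: "a \<in> carrier KG"
  shows "a \<otimes>\<^bsub>KG\<^esub> \<iota> c = (\<lambda>g \<in> carrier G. c \<otimes>\<^bsub>K\<^esub> a g)"
  unfolding group_ring_of_scalar_def mult_single_right[OF a G.one_closed c]
  by (rule restrict_ext) (simp add: PiE_mem[OF a[unfolded KG_sel]] c K.m_comm)

lemma \<iota>_one: "\<iota> \<one>\<^bsub>K\<^esub> = \<one>\<^bsub>KG\<^esub>"
  by (simp add: group_ring_of_scalar_def KG_sel \<delta>_def)

lemma ring_KG: "ring KG"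
proof (rule ringI)
  have reg': "carrier KG = carrier regular" "add KG = add regular" "\<zero>\<^bsub>KG\<^esub> = \<zero>\<^bsub>regular\<^esub>"
    by (simp_all add: regular_sel)
  show "abelian_group KG"
    by (rule abelian_groupI, unfold reg')
      (use module_rules(1-6)[OF regular_module] in \<open>simp_all\<close>)
  have cl: "a \<otimes>\<^bsub>KG\<^esub> b \<in> carrier KG" if "a \<in> carrier KG" "b \<in> carrier KG" for a b
    using reg.group_ring_mult_closed that by (simp add: KG_sel)
  show "monoid KG"
  proof (rule monoidI)
    show "a \<otimes>\<^bsub>KG\<^esub> b \<in> carrier KG" if "a \<in> carrier KG" "b \<in> carrier KG" for a b using cl[OF that] .
    show "\<one>\<^bsub>KG\<^esub> \<in> carrier KG" unfolding KG_sel(4) by (rule \<delta>_closed)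
    show "a \<otimes>\<^bsub>KG\<^esub> b \<otimes>\<^bsub>KG\<^esub> c = a \<otimes>\<^bsub>KG\<^esub> (b \<otimes>\<^bsub>KG\<^esub> c)"
      if abc: "a \<in> carrier KG" "b \<in> carrier KG" "c \<in> carrier KG" for a b c
    proof -
      have "a \<otimes>\<^bsub>KG\<^esub> b \<otimes>\<^bsub>KG\<^esub> c = reg.ring_smult (a \<otimes>\<^bsub>KG\<^esub> b) c"
        by (rule mult_eq_ring_smult[OF cl[OF abc(1,2)] abc(3)])
      also have "\<dots> = reg.ring_smult a (reg.ring_smult b c)"
        by (rule reg.ring_smult_mult) (use abc in \<open>simp_all add: KG_sel(1) regular_sel(1)\<close>)
      also have "\<dots> = a \<otimes>\<^bsub>KG\<^esub> (b \<otimes>\<^bsub>KG\<^esub> c)"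
        using mult_eq_ring_smult[OF abc(2,3)] mult_eq_ring_smult[OF abc(1) cl[OF abc(2,3)]] by simp
      finally show ?thesis .
    qed
    show "\<one>\<^bsub>KG\<^esub> \<otimes>\<^bsub>KG\<^esub> a = a" "a \<otimes>\<^bsub>KG\<^esub> \<one>\<^bsub>KG\<^esub> = a" if a: "a \<in> carrier KG" for a
    proof -
      have "(\<lambda>g \<in> carrier G. \<one>\<^bsub>K\<^esub> \<otimes>\<^bsub>K\<^esub> a g) = a"
        using a module_rules(11)[OF regular_module, of a] by (simp add: regular_sel)
      then show "\<one>\<^bsub>KG\<^esub> \<otimes>\<^bsub>KG\<^esub> a = a" "a \<otimes>\<^bsub>KG\<^esub> \<one>\<^bsub>KG\<^esub> = a"
        using \<iota>_mult[OF K.one_closed a] mult_\<iota>[OF K.one_closed a] by (simp_all add: \<iota>_one)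
    qed
  qed
  have add_cl: "a \<oplus>\<^bsub>KG\<^esub> b \<in> carrier KG" if "a \<in> carrier KG" "b \<in> carrier KG" for a b
    using that module_rules(1)[OF regular_module, of a b] by (simp add: regular_sel)
  show "(a \<oplus>\<^bsub>KG\<^esub> b) \<otimes>\<^bsub>KG\<^esub> c = a \<otimes>\<^bsub>KG\<^esub> c \<oplus>\<^bsub>KG\<^esub> b \<otimes>\<^bsub>KG\<^esub> c"
    if abc: "a \<in> carrier KG" "b \<in> carrier KG" "c \<in> carrier KG" for a b c
    using reg.ring_smult_add_left[of a b c] abc add_cl[OF abc(1,2)] mult_eq_ring_smult
    by (simp add: KG_sel(1,2) regular_sel)
  show "c \<otimes>\<^bsub>KG\<^esub> (a \<oplus>\<^bsub>KG\<^esub> b) = c \<otimes>\<^bsub>KG\<^esub> a \<oplus>\<^bsub>KG\<^esub> c \<otimes>\<^bsub>KG\<^esub> b"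
    if abc: "a \<in> carrier KG" "b \<in> carrier KG" "c \<in> carrier KG" for a b c
    using reg.ring_smult_add_right[of c a b] abc add_cl[OF abc(1,2)] mult_eq_ring_smult
    by (simp add: KG_sel(1) regular_sel)
qed

sublocale KG: central_ring_hom K KG \<iota>
proof -
  have "\<iota> \<in> Ring.ring_hom K KG"
  proof (rule ring_hom_memI)
    show "\<iota> c \<in> carrier KG" if "c \<in> carrier K" for c using \<iota>_closed[OF that] .
    show "\<iota> (c \<otimes>\<^bsub>K\<^esub> d) = \<iota> c \<otimes>\<^bsub>KG\<^esub> \<iota> d" if "c \<in> carrier K" "d \<in> carrier K" for c d
      unfolding \<iota>_mult[OF that(1) \<iota>_closed[OF that(2)]] unfolding group_ring_of_scalar_def
      by (rule restrict_ext) (simp add: that)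
    show "\<iota> (c \<oplus>\<^bsub>K\<^esub> d) = \<iota> c \<oplus>\<^bsub>KG\<^esub> \<iota> d" if "c \<in> carrier K" "d \<in> carrier K" for c d
      unfolding KG_sel group_ring_of_scalar_def by (rule restrict_ext) (simp add: that)
    show "\<iota> \<one>\<^bsub>K\<^esub> = \<one>\<^bsub>KG\<^esub>" by (rule \<iota>_one)
  qed
  moreover have "\<iota> c \<otimes>\<^bsub>KG\<^esub> a = a \<otimes>\<^bsub>KG\<^esub> \<iota> c" if "c \<in> carrier K" "a \<in> carrier KG" for c a
    using \<iota>_mult[OF that] mult_\<iota>[OF that] by simp
  ultimately show "central_ring_hom K KG \<iota>"
    by (intro central_ring_hom.intro central_ring_hom_axioms.intro K.cring_axioms ring_KG)
qed

lemma \<delta>_mult: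
  assumes g: "g \<in> carrier G" and h: "h \<in> carrier G"
  shows "\<delta> g \<otimes>\<^bsub>KG\<^esub> \<delta> h = \<delta> (g \<otimes>\<^bsub>G\<^esub> h)"
proof -
  have "k \<otimes>\<^bsub>G\<^esub> inv\<^bsub>G\<^esub> h = g \<longleftrightarrow> k = g \<otimes>\<^bsub>G\<^esub> h" if "k \<in> carrier G" for k
    using that g h by (metis G.inv_closed G.inv_solve_right G.m_closed)
  then show ?thesis
    using mult_single_right[OF \<delta>_closed[of g] h K.one_closed] g h
    by (simp add: \<delta>_def[symmetric]) (auto simp: \<delta>_def intro!: restrict_ext)
qed

lemma finsum_KG_apply:
  assumes "finite A" and f: "\<And>i. i \<in> A \<Longrightarrow> f i \<in> carrier KG" and g: "g \<in> carrier G"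
  shows "(\<Oplus>\<^bsub>KG\<^esub>i \<in> A. f i) g = (\<Oplus>\<^bsub>K\<^esub>i \<in> A. f i g)"
proof -
  show ?thesis
    by (rule additive_finsum[where h = "\<lambda>a. a g"])
      (use assms in \<open>auto simp: KG_sel KG.R.abelian_monoid_axioms K.abelian_monoid_axioms\<close>)
qed

text \<open>
  A function on the group is the combination of the \<open>\<delta> g\<close> with its values as coefficients. So a module over the
  group ring is determined by the actions of the scalars and of the group.
\<close>

lemma decompose:
  assumes a: "a \<in> carrier KG"
  shows "a = (\<Oplus>\<^bsub>KG\<^esub>g \<in> carrier G. \<iota> (a g) \<otimes>\<^bsub>KG\<^esub> \<delta> g)"
proof (rule extensionalityI[of _ "carrier G"])
  note a' = a[unfolded KG_sel] note am = PiE_mem[OF a']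
  have cl: "\<iota> (a g) \<otimes>\<^bsub>KG\<^esub> \<delta> g \<in> carrier KG" if "g \<in> carrier G" for g
    using am[OF that] \<iota>_closed \<delta>_closed by (intro KG.R.m_closed) auto
  then have "(\<Oplus>\<^bsub>KG\<^esub>g \<in> carrier G. \<iota> (a g) \<otimes>\<^bsub>KG\<^esub> \<delta> g) \<in> carrier KG" by (intro KG.R.finsum_closed) auto
  then show "(\<Oplus>\<^bsub>KG\<^esub>g \<in> carrier G. \<iota> (a g) \<otimes>\<^bsub>KG\<^esub> \<delta> g) \<in> extensional (carrier G)" by (simp add: KG_sel PiE_def)
  show "a \<in> extensional (carrier G)" using a' by (simp add: PiE_def)
  fix h assume h: "h \<in> carrier G"
  have "(\<Oplus>\<^bsub>KG\<^esub>g \<in> carrier G. \<iota> (a g) \<otimes>\<^bsub>KG\<^esub> \<delta> g) h = (\<Oplus>\<^bsub>K\<^esub>g \<in> carrier G. (\<iota> (a g) \<otimes>\<^bsub>KG\<^esub> \<delta> g) h)"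
    by (rule finsum_KG_apply[OF finite_carrier cl h])
  also have "\<dots> = (\<iota> (a h) \<otimes>\<^bsub>KG\<^esub> \<delta> h) h"
    by (rule K.finsum_single[OF finite_carrier h])
      (use h am in \<open>simp_all add: \<iota>_mult[OF _ \<delta>_closed], simp_all add: \<delta>_def\<close>)
  also have "\<dots> = a h" using h am by (simp add: \<iota>_mult[OF _ \<delta>_closed]) (simp add: \<delta>_def)
  finally show "a h = (\<Oplus>\<^bsub>KG\<^esub>g \<in> carrier G. \<iota> (a g) \<otimes>\<^bsub>KG\<^esub> \<delta> g) h" by simp
qed

definition underlying :: "('g \<Rightarrow> 'k, 'm, 'e) module_scheme \<Rightarrow> ('k, 'm) module" where
  "underlying N = \<lparr>carrier = carrier N, mult = undefined, one = undefined, zero = \<zero>\<^bsub>N\<^esub>, add = add N,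
     smult = (\<lambda>c x. \<iota> c \<odot>\<^bsub>N\<^esub> x)\<rparr>"

lemma underlying_sel:
  "carrier (underlying N) = carrier N" "\<zero>\<^bsub>underlying N\<^esub> = \<zero>\<^bsub>N\<^esub>" "add (underlying N) = add N"
  "c \<odot>\<^bsub>underlying N\<^esub> x = \<iota> c \<odot>\<^bsub>N\<^esub> x"
  by (simp_all add: underlying_def)

lemma underlying_action:
  assumes N: "left_module KG N"
  shows "linear_action K G (underlying N) (\<lambda>g x. \<delta> g \<odot>\<^bsub>N\<^esub> x)"
proof -
  note Nr = left_module_rules[OF N]
  interpret N: left_module KG N by (rule N)
  have "module K (underlying N)"
  proof (rule module_axiomsI[OF K.cring_axioms K.cring_axioms], unfold underlying_sel)
    show "\<iota> (c \<oplus>\<^bsub>K\<^esub> d) \<odot>\<^bsub>N\<^esub> x = \<iota> c \<odot>\<^bsub>N\<^esub> x \<oplus>\<^bsub>N\<^esub> \<iota> d \<odot>\<^bsub>N\<^esub> x"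
      if "c \<in> carrier K" "d \<in> carrier K" "x \<in> carrier N" for c d x
      using that ring_hom_add[OF KG.ring_hom] \<iota>_closed by (simp add: Nr(8))
    show "\<iota> (c \<otimes>\<^bsub>K\<^esub> d) \<odot>\<^bsub>N\<^esub> x = \<iota> c \<odot>\<^bsub>N\<^esub> (\<iota> d \<odot>\<^bsub>N\<^esub> x)"
      if "c \<in> carrier K" "d \<in> carrier K" "x \<in> carrier N" for c d x
      using that ring_hom_mult[OF KG.ring_hom] \<iota>_closed by (simp add: Nr(10))
    show "\<iota> \<one>\<^bsub>K\<^esub> \<odot>\<^bsub>N\<^esub> x = x" if "x \<in> carrier N" for x using that by (simp add: \<iota>_one Nr(11))
  qed (use \<iota>_closed in \<open>simp_all add: Nr(1,2,3,5,6,7,9), simp add: Nr(4)\<close>)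
  moreover have "linear_action_axioms K G (underlying N) (\<lambda>g x. \<delta> g \<odot>\<^bsub>N\<^esub> x)"
  proof (rule linear_action_axioms.intro, unfold underlying_sel)
    show "finite (carrier G)" by (rule finite_carrier)
    show "\<delta> g \<odot>\<^bsub>N\<^esub> x \<in> carrier N" if "x \<in> carrier N" for g x using that by (simp add: Nr(7) \<delta>_closed)
    show "\<delta> g \<odot>\<^bsub>N\<^esub> (x \<oplus>\<^bsub>N\<^esub> y) = \<delta> g \<odot>\<^bsub>N\<^esub> x \<oplus>\<^bsub>N\<^esub> \<delta> g \<odot>\<^bsub>N\<^esub> y"
      if "x \<in> carrier N" "y \<in> carrier N" for g x y using that by (simp add: Nr(9) \<delta>_closed)
    show "\<delta> g \<odot>\<^bsub>N\<^esub> (\<iota> c \<odot>\<^bsub>N\<^esub> x) = \<iota> c \<odot>\<^bsub>N\<^esub> (\<delta> g \<odot>\<^bsub>N\<^esub> x)"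
      if "c \<in> carrier K" "x \<in> carrier N" for g c x
      using KG.smult_\<iota>_comm[OF N that(1) \<delta>_closed that(2)] by simp
    show "\<delta> (g \<otimes>\<^bsub>G\<^esub> h) \<odot>\<^bsub>N\<^esub> x = \<delta> g \<odot>\<^bsub>N\<^esub> (\<delta> h \<odot>\<^bsub>N\<^esub> x)"
      if "g \<in> carrier G" "h \<in> carrier G" "x \<in> carrier N" for g h x
      using that Nr(10)[OF \<delta>_closed[of g] \<delta>_closed[of h]] by (simp add: \<delta>_mult)
    show "\<delta> \<one>\<^bsub>G\<^esub> \<odot>\<^bsub>N\<^esub> x = x" if "x \<in> carrier N" for x using that Nr(11) by (simp add: KG_sel)
  qed
  ultimately show ?thesis by (intro linear_action.intro K.cring_axioms G.group_axioms)
qed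

lemma smult_eq_sum:
  assumes N: "left_module KG N" and a: "a \<in> carrier KG" and x: "x \<in> carrier N"
  shows "a \<odot>\<^bsub>N\<^esub> x = (\<Oplus>\<^bsub>N\<^esub>g \<in> carrier G. \<iota> (a g) \<odot>\<^bsub>N\<^esub> (\<delta> g \<odot>\<^bsub>N\<^esub> x))"
proof -
  interpret N: left_module KG N by (rule N)
  note am = PiE_mem[OF a[unfolded KG_sel]]
  have cl: "\<iota> (a g) \<in> carrier KG" if "g \<in> carrier G" for g using am[OF that] \<iota>_closed by blast
  have "a \<odot>\<^bsub>N\<^esub> x = (\<Oplus>\<^bsub>KG\<^esub>g \<in> carrier G. \<iota> (a g) \<otimes>\<^bsub>KG\<^esub> \<delta> g) \<odot>\<^bsub>N\<^esub> x" using decompose[OF a] by simp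
  also have "\<dots> = (\<Oplus>\<^bsub>N\<^esub>g \<in> carrier G. (\<iota> (a g) \<otimes>\<^bsub>KG\<^esub> \<delta> g) \<odot>\<^bsub>N\<^esub> x)"
    by (rule additive_finsum[where h = "\<lambda>a. a \<odot>\<^bsub>N\<^esub> x"])
      (use x cl \<delta>_closed in \<open>simp_all add: N.smult_l_distr N.smult_closed N.smult_zero_left finite_carrier
        KG.R.abelian_monoid_axioms N.M.abelian_monoid_axioms\<close>)
  also have "\<dots> = (\<Oplus>\<^bsub>N\<^esub>g \<in> carrier G. \<iota> (a g) \<odot>\<^bsub>N\<^esub> (\<delta> g \<odot>\<^bsub>N\<^esub> x))"
    by (rule N.M.finsum_cong') (use x cl \<delta>_closed in \<open>auto simp: N.smult_assoc1 N.smult_closed\<close>)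
  finally show ?thesis .
qed

end

context linear_action
begin

sublocale finite_group_ring K G
  by (intro finite_group_ring.intro finite_group_ring_axioms.intro K.cring_axioms G.group_axioms finite_G)

lemma left_module_ring_module: "left_module KG ring_module"
proof (rule left_module_axiomsI, unfold ring_module_sel KG_sel)
  show "ring KG" by (rule ring_KG)
  show "ring_smult (\<delta> \<one>\<^bsub>G\<^esub>) x = x" if "x \<in> carrier M" for x
    using ring_smult_single[OF G.one_closed K.one_closed that] that by (simp add: \<delta>_def act_one)
qed (use module_rules[OF M.module_axioms] in
  \<open>simp_all add: ring_smult_closed ring_smult_add_right ring_smult_add_left ring_smult_mult\<close>)

lemma ring_smult_\<delta>: "\<lbrakk>g \<in> carrier G; x \<in> carrier M\<rbrakk> \<Longrightarrow> ring_smult (\<delta> g) x = act g x"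
  using ring_smult_single[of g "\<one>\<^bsub>K\<^esub>" x] by (simp add: \<delta>_def act_closed)

lemma ring_smult_\<iota>: "\<lbrakk>c \<in> carrier K; x \<in> carrier M\<rbrakk> \<Longrightarrow> ring_smult (\<iota> c) x = c \<odot>\<^bsub>M\<^esub> x"
  using ring_smult_single[of "\<one>\<^bsub>G\<^esub>" c x] by (simp add: group_ring_of_scalar_def act_one)

end

section \<open>Matrices as a skeleton of the finite dimensional vector spaces\<close>

definition mat_category :: "'f :: field itself \<Rightarrow> (nat, 'f mat) cat" where
  "mat_category ty = \<lparr>Obj = UNIV, Hom = (\<lambda>m n. carrier_mat n m), Ident = (\<lambda>n. 1\<^sub>m n),
     Comp = (\<lambda>l m n B A. B * A)\<rparr>"

lemma mat_category_sel:
  "Obj (mat_category ty) = UNIV" "Hom (mat_category ty) m n = carrier_mat n m"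
  "Ident (mat_category ty) n = 1\<^sub>m n" "Comp (mat_category ty) l m n B A = B * A"
  by (simp_all add: mat_category_def)

lemma category_mat_category: "category (mat_category TYPE('f :: field))"
proof (rule category.intro, unfold mat_category_sel)
  show "D * (B * A) = D * B * A" if "A \<in> carrier_mat m l" "B \<in> carrier_mat n m" "D \<in> carrier_mat k n"
    for l m n k and A B D :: "'f mat" using that by (simp add: mat_assoc)
qed auto

lemma fd_sel:
  "Obj (fd_vector_spaces tf tv) = {V. vectorspace class_ring V \<and> vectorspace.fin_dim class_ring V}"
  "Hom (fd_vector_spaces tf tv) V W = mhom class_ring V W"
  "Ident (fd_vector_spaces tf tv) V = (\<lambda>x \<in> carrier V. x)"
  "Comp (fd_vector_spaces tf tv) U V W g f = compose (carrier U) g f"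
  by (simp_all add: fd_vector_spaces_def)

lemma left_module_of_vectorspace: "vectorspace K V \<Longrightarrow> left_module K V"
  by (rule left_module_of_module) (simp add: vectorspace_def)

lemma mhom_bij_inverse:
  assumes M: "left_module R M" and N: "left_module R N" and f: "f \<in> mhom R M N"
    and bij: "bij_betw f (carrier M) (carrier N)"
  obtains g where "g \<in> mhom R N M" "compose (carrier M) g f = (\<lambda>x \<in> carrier M. x)"
    "compose (carrier N) f g = (\<lambda>x \<in> carrier N. x)"
proof -
  define g where "g = restrict (the_inv_into (carrier M) f) (carrier N)"
  have inj: "inj_on f (carrier M)" using bij by (simp add: bij_betw_def)
  have gf: "g (f x) = x" if "x \<in> carrier M" for x
    using that mhomD(1)[OF f that] inj by (simp add: g_def the_inv_into_f_f)
  have fg: "f (g y) = y" "g y \<in> carrier M" if "y \<in> carrier N" for y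
  proof -
    have "y \<in> f ` carrier M" using bij that by (simp add: bij_betw_def)
    then obtain x where y: "y = f x" and x: "x \<in> carrier M" by (rule imageE)
    show "f (g y) = y" "g y \<in> carrier M" unfolding y gf[OF x] using x by blast+
  qed
  have g: "g \<in> mhom R N M"
  proof (rule mhomI)
    show "g (x \<oplus>\<^bsub>N\<^esub> y) = g x \<oplus>\<^bsub>M\<^esub> g y" if "x \<in> carrier N" "y \<in> carrier N" for x y
    proof -
      have "f (g x \<oplus>\<^bsub>M\<^esub> g y) = x \<oplus>\<^bsub>N\<^esub> y"
        using mhomD(2)[OF f fg(2)[OF that(1)] fg(2)[OF that(2)]] fg(1)[OF that(1)] fg(1)[OF that(2)] by simp
      with gf[OF left_module_rules(1)[OF M fg(2)[OF that(1)] fg(2)[OF that(2)]]] show ?thesis by simp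
    qed
    show "g (a \<odot>\<^bsub>N\<^esub> x) = a \<odot>\<^bsub>M\<^esub> g x" if "a \<in> carrier R" "x \<in> carrier N" for a x
    proof -
      have "f (a \<odot>\<^bsub>M\<^esub> g x) = a \<odot>\<^bsub>N\<^esub> x"
        using mhomD(3)[OF f that(1) fg(2)[OF that(2)]] fg(1)[OF that(2)] by simp
      with gf[OF left_module_rules(7)[OF M that(1) fg(2)[OF that(2)]]] show ?thesis by simp
    qed
  qed (simp_all add: fg, simp add: g_def)
  show ?thesis
  proof (rule that[OF g])
    show "compose (carrier M) g f = (\<lambda>x \<in> carrier M. x)"
      unfolding compose_def by (rule restrict_ext) (rule gf)
    show "compose (carrier N) f g = (\<lambda>x \<in> carrier N. x)"
      unfolding compose_def by (rule restrict_ext) (rule fg)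
  qed
qed

lemma category_fd_vector_spaces: "category (fd_vector_spaces TYPE('f :: field) TYPE('v))"
proof (rule category.intro, unfold fd_sel)
  have ident: "(\<lambda>x \<in> carrier V. x) \<in> mhom class_ring V V"
    if "V \<in> {V. vectorspace class_ring V \<and> vectorspace.fin_dim class_ring V}" for V :: "('f, 'v) module"
    using that left_module_of_vectorspace by (intro mhom_restrictI) auto
  show "(\<lambda>x \<in> carrier V. x) \<in> mhom class_ring V V"
    if "V \<in> {V. vectorspace class_ring V \<and> vectorspace.fin_dim class_ring V}" for V :: "('f, 'v) module"
    using ident[OF that] .
  show "compose (carrier U) g f \<in> mhom class_ring U W"
    if "U \<in> {V. vectorspace class_ring V \<and> vectorspace.fin_dim class_ring V}" "f \<in> mhom class_ring U V" "g \<in> mhom class_ring V W"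
    for U V W :: "('f, 'v) module" and f g
    using mhom_compose[OF left_module_of_vectorspace that(2,3)] that(1) by blast
  show "compose (carrier U) (\<lambda>x \<in> carrier V. x) f = f" if f: "f \<in> mhom class_ring U V" for U V :: "('f, 'v) module" and f
    by (rule extensionalityI[of _ "carrier U"]) (simp_all add: compose_def mhomD[OF f])
  show "compose (carrier U) f (\<lambda>x \<in> carrier U. x) = f" if f: "f \<in> mhom class_ring U V" for U V :: "('f, 'v) module" and f
    by (rule extensionalityI[of _ "carrier U"]) (simp_all add: compose_def mhomD[OF f])
  show "compose (carrier U) h (compose (carrier U) g f) = compose (carrier U) (compose (carrier V) h g) f"
    if f: "f \<in> mhom class_ring U V" for U V :: "('f, 'v) module" and f g h
    by (rule extensionalityI[of _ "carrier U"]) (simp_all add: compose_def mhomD[OF f])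
qed

lemma finite_carrier_vec': "finite (carrier_vec n :: 'f :: finite vec set)"
proof -
  have "carrier_vec n \<subseteq> (\<lambda>f. vec n f) ` (\<Pi>\<^sub>E i \<in> {..<n}. (UNIV :: 'f set))"
  proof
    fix v :: "'f vec" assume v: "v \<in> carrier_vec n"
    then have "v = vec n (restrict (\<lambda>i. v $ i) {..<n})" by (intro eq_vecI) auto
    moreover have "restrict (\<lambda>i. v $ i) {..<n} \<in> (\<Pi>\<^sub>E i \<in> {..<n}. (UNIV :: 'f set))" by auto
    ultimately show "v \<in> (\<lambda>f. vec n f) ` (\<Pi>\<^sub>E i \<in> {..<n}. (UNIV :: 'f set))" by (rule image_eqI)
  qed
  moreover have "finite (\<Pi>\<^sub>E i \<in> {..<n}. (UNIV :: 'f set))" by (intro finite_PiE) auto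
  ultimately show ?thesis by (meson finite_imageI finite_subset)
qed

lemma linear_map_eq_mat:
  fixes f :: "'f :: field vec \<Rightarrow> 'f vec"
  assumes cl: "\<And>v. v \<in> carrier_vec m \<Longrightarrow> f v \<in> carrier_vec n"
    and add: "\<And>v w. \<lbrakk>v \<in> carrier_vec m; w \<in> carrier_vec m\<rbrakk> \<Longrightarrow> f (v + w) = f v + f w"
    and smult: "\<And>c v. v \<in> carrier_vec m \<Longrightarrow> f (c \<cdot>\<^sub>v v) = c \<cdot>\<^sub>v f v"
    and v: "v \<in> carrier_vec m"
  shows "mat n m (\<lambda>(i, j). f (unit_vec m j) $ i) *\<^sub>v v = f v"
proof -
  define A where "A = mat n m (\<lambda>(i, j). f (unit_vec m j) $ i)"
  have A: "A \<in> carrier_mat n m" by (simp add: A_def)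
  define w where "w k = vec m (\<lambda>j. if j < k then v $ j else 0)" for k
  have w: "w k \<in> carrier_vec m" for k by (simp add: w_def)
  have unit: "A *\<^sub>v unit_vec m k = f (unit_vec m k)" if "k < m" for k
  proof (rule eq_vecI)
    show "dim_vec (A *\<^sub>v unit_vec m k) = dim_vec (f (unit_vec m k))" using cl[of "unit_vec m k"] A by simp
    fix i assume "i < dim_vec (f (unit_vec m k))"
    then have i: "i < n" using cl[of "unit_vec m k"] by simp
    have "(A *\<^sub>v unit_vec m k) $ i = row A i \<bullet> unit_vec m k" using i A by simp
    also have "\<dots> = row A i $ k" using i A that by (intro scalar_prod_right_unit) auto
    finally show "(A *\<^sub>v unit_vec m k) $ i = f (unit_vec m k) $ i" using i that by (simp add: A_def)
  qed
  have "A *\<^sub>v w k = f (w k)" if "k \<le> m" for k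
    using that
  proof (induction k)
    case 0
    have w0: "w 0 = 0 \<cdot>\<^sub>v w 0" by (intro eq_vecI) (simp_all add: w_def)
    have "A *\<^sub>v w 0 = 0 \<cdot>\<^sub>v (A *\<^sub>v w 0)" using mult_mat_vec[OF A w[of 0], of 0] w0 by simp
    also have "\<dots> = 0 \<cdot>\<^sub>v f (w 0)" using A cl[OF w[of 0]] by (intro eq_vecI) simp_all
    also have "\<dots> = f (w 0)" using smult[OF w[of 0], of 0] w0 by simp
    finally show ?case .
  next
    case (Suc k)
    have eq: "w (Suc k) = w k + v $ k \<cdot>\<^sub>v unit_vec m k"
      using Suc.prems by (intro eq_vecI) (auto simp: w_def less_Suc_eq)
    have "A *\<^sub>v w (Suc k) = A *\<^sub>v w k + v $ k \<cdot>\<^sub>v (A *\<^sub>v unit_vec m k)"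
      unfolding eq using A w by (simp add: mult_add_distrib_mat_vec[of A n m] mult_mat_vec[of A n m])
    also have "\<dots> = f (w (Suc k))"
      unfolding eq using Suc w by (simp add: add smult unit)
    finally show ?case .
  qed
  from this[of m] have "A *\<^sub>v w m = f (w m)" by simp
  moreover have "w m = v" using v by (intro eq_vecI) (simp_all add: w_def)
  ultimately show ?thesis by (simp add: A_def)
qed

text \<open>
  An embedding of the coordinate spaces into the universe \<open>'v\<close>, along which their structure is transported.
  The field being finite, so are these spaces, and any infinite \<open>'v\<close> will do.
\<close>

locale coordinate_embedding =
  fixes e :: "nat \<Rightarrow> 'f :: {finite, field} vec \<Rightarrow> 'v"
  assumes inj: "inj_on (e n) (carrier_vec n)"
begin

definition coords :: "nat \<Rightarrow> 'v \<Rightarrow> 'f vec" where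
  "coords n = the_inv_into (carrier_vec n) (e n)"

definition std_space :: "nat \<Rightarrow> ('f, 'v) module" where
  "std_space n = transport_module (e n) (module_vec TYPE('f) n)"

lemma coords_e: "v \<in> carrier_vec n \<Longrightarrow> coords n (e n v) = v"
  by (simp add: coords_def the_inv_into_f_f[OF inj])

lemma module_vec_module: "module class_ring (module_vec TYPE('f) n)"
proof -
  interpret vec_module "TYPE('f)" n .
  show ?thesis ..
qed

lemma std_space_sel:
  "carrier (std_space n) = e n ` carrier_vec n"
  "\<lbrakk>v \<in> carrier_vec n; w \<in> carrier_vec n\<rbrakk> \<Longrightarrow> e n v \<oplus>\<^bsub>std_space n\<^esub> e n w = e n (v + w)"
  "v \<in> carrier_vec n \<Longrightarrow> c \<odot>\<^bsub>std_space n\<^esub> e n v = e n (c \<cdot>\<^sub>v v)"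
  using transport_module_sel[of "e n" "module_vec TYPE('f) n"] inj
  by (simp_all add: std_space_def module_vec_simps)

lemma std_space_module: "left_module class_ring (std_space n)"
  unfolding std_space_def
  by (rule left_module_transport[OF left_module_of_module[OF module_vec_module]])
    (simp add: module_vec_simps inj)

text \<open>
  The space is finite, hence its own finite generating set.
\<close>

lemma std_space_Obj: "std_space n \<in> Obj (fd_vector_spaces TYPE('f) TYPE('v))"
proof -
  have "cring (class_ring :: 'f ring)" by (rule class_cring.cring_axioms)
  then have "module class_ring (std_space n)" using std_space_module left_module_iff_module by blast
  then have vs: "vectorspace class_ring (std_space n)" using class_field by (intro vectorspace.intro)
  interpret vectorspace "class_ring :: 'f ring" "std_space n" by (rule vs)
  have "finite (carrier (std_space n))" by (simp add: std_space_sel finite_carrier_vec')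
  moreover have "gen_set (carrier (std_space n))" using in_own_span[of "carrier (std_space n)"] span_is_subset2[of "carrier (std_space n)"] by blast
  ultimately have "fin_dim" unfolding fin_dim_def by blast
  with vs show ?thesis by (simp add: fd_sel)
qed

definition realization :: "(nat, 'f mat, ('f, 'v) module, 'v \<Rightarrow> 'v) fctr" where
  "realization = \<lparr>omap = std_space, amap = (\<lambda>m n A. \<lambda>x \<in> carrier (std_space m). e n (A *\<^sub>v coords m x))\<rparr>"

lemma realization_sel:
  "omap realization n = std_space n"
  "amap realization m n A = (\<lambda>x \<in> carrier (std_space m). e n (A *\<^sub>v coords m x))"
  by (simp_all add: realization_def)

lemma amap_realization: "v \<in> carrier_vec m \<Longrightarrow> amap realization m n A (e m v) = e n (A *\<^sub>v v)"
  by (simp add: realization_sel std_space_sel coords_e)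

lemma realization_arrow:
  assumes A: "A \<in> carrier_mat n m"
  shows "amap realization m n A \<in> mhom class_ring (std_space m) (std_space n)"
proof (rule mhomI)
  fix x y assume "x \<in> carrier (std_space m)" "y \<in> carrier (std_space m)"
  then obtain v w where "v \<in> carrier_vec m" "x = e m v" "w \<in> carrier_vec m" "y = e m w"
    unfolding std_space_sel by blast
  then show "amap realization m n A (x \<oplus>\<^bsub>std_space m\<^esub> y) =
      amap realization m n A x \<oplus>\<^bsub>std_space n\<^esub> amap realization m n A y"
    using A by (simp add: std_space_sel amap_realization mult_add_distrib_mat_vec[of A n m])
next
  fix c x assume "x \<in> carrier (std_space m)"
  then obtain v where "v \<in> carrier_vec m" "x = e m v" unfolding std_space_sel by blast
  then show "amap realization m n A (c \<odot>\<^bsub>std_space m\<^esub> x) = c \<odot>\<^bsub>std_space n\<^esub> amap realization m n A x"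
    using A by (simp add: std_space_sel amap_realization mult_mat_vec[of A n m])
next
  fix x assume "x \<in> carrier (std_space m)"
  then obtain v where "v \<in> carrier_vec m" "x = e m v" unfolding std_space_sel by blast
  then show "amap realization m n A x \<in> carrier (std_space n)"
    using A by (simp add: std_space_sel amap_realization)
qed (simp add: realization_sel)

lemma realization_functor: "is_functor (mat_category TYPE('f)) (fd_vector_spaces TYPE('f) TYPE('v)) realization"
  unfolding is_functor_def mat_category_sel
proof (intro conjI ballI)
  fix l m n and A B :: "'f mat" assume A: "A \<in> carrier_mat m l" and B: "B \<in> carrier_mat n m"
  have BA: "B * A \<in> carrier_mat n l" using A B by simp
  show "amap realization l n (B * A) = Comp (fd_vector_spaces TYPE('f) TYPE('v))
      (omap realization l) (omap realization m) (omap realization n) (amap realization m n B) (amap realization l m A)"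
    unfolding fd_sel realization_sel(1)
  proof (rule extensionalityI[of _ "carrier (std_space l)"])
    fix x assume x: "x \<in> carrier (std_space l)"
    then obtain v where "v \<in> carrier_vec l" "x = e l v" unfolding std_space_sel by blast
    then show "amap realization l n (B * A) x =
        compose (carrier (std_space l)) (amap realization m n B) (amap realization l m A) x"
      using x A B by (simp add: compose_def amap_realization assoc_mult_mat_vec[of B n m A l])
  qed (simp_all add: realization_sel)
next
  fix n
  show "amap realization n n (1\<^sub>m n) = Ident (fd_vector_spaces TYPE('f) TYPE('v)) (omap realization n)"
    unfolding fd_sel realization_sel(1)
  proof (rule extensionalityI[of _ "carrier (std_space n)"])
    fix x assume x: "x \<in> carrier (std_space n)"
    then obtain v where "v \<in> carrier_vec n" "x = e n v" unfolding std_space_sel by blast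
    then show "amap realization n n (1\<^sub>m n) x = (\<lambda>x \<in> carrier (std_space n). x) x"
      using x by (simp add: amap_realization)
  qed (simp_all add: realization_sel)
next
  show "omap realization n \<in> Obj (fd_vector_spaces TYPE('f) TYPE('v))" for n
    using std_space_Obj by (simp add: realization_sel)
  show "amap realization m n A \<in> Hom (fd_vector_spaces TYPE('f) TYPE('v)) (omap realization m) (omap realization n)"
    if "A \<in> carrier_mat n m" for m n A
    using realization_arrow[OF that] unfolding fd_sel realization_sel(1) .
qed

lemma realization_bij:
  "bij_betw (amap realization m n) (carrier_mat n m) (mhom class_ring (std_space m) (std_space n))"
proof (rule bij_betw_imageI)
  show "inj_on (amap realization m n) (carrier_mat n m)"
  proof (rule inj_onI)
    fix A B :: "'f mat" assume A: "A \<in> carrier_mat n m" and B: "B \<in> carrier_mat n m"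
      and eq: "amap realization m n A = amap realization m n B"
    have Av: "A *\<^sub>v v = B *\<^sub>v v" if "v \<in> carrier_vec m" for v
    proof -
      have "e n (A *\<^sub>v v) = e n (B *\<^sub>v v)" using fun_cong[OF eq, of "e m v"] that by (simp add: amap_realization)
      then show ?thesis using A B that by (intro inj_onD[OF inj, of n]) auto
    qed
    show "A = B"
    proof (rule eq_matI)
      fix i j assume "i < dim_row B" "j < dim_col B"
      then have ij: "i < n" "j < m" using B by auto
      have "(A *\<^sub>v unit_vec m j) $ i = (B *\<^sub>v unit_vec m j) $ i" using Av[of "unit_vec m j"] by simp
      then show "A $$ (i, j) = B $$ (i, j)" using ij A B by (simp add: scalar_prod_right_unit)
    qed (use A B in auto)
  qed
  show "amap realization m n ` carrier_mat n m = mhom class_ring (std_space m) (std_space n)"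
  proof (intro equalityI subsetI)
    fix f assume "f \<in> amap realization m n ` carrier_mat n m"
    then show "f \<in> mhom class_ring (std_space m) (std_space n)" using realization_arrow by blast
  next
    fix f assume f: "f \<in> mhom class_ring (std_space m) (std_space n)"
    define f' where "f' v = coords n (f (e m v))" for v
    have f': "f' v \<in> carrier_vec n" "e n (f' v) = f (e m v)" if "v \<in> carrier_vec m" for v
    proof -
      have "f (e m v) \<in> carrier (std_space n)" using mhomD(1)[OF f, of "e m v"] that by (simp add: std_space_sel)
      then obtain w where "w \<in> carrier_vec n" "f (e m v) = e n w" unfolding std_space_sel by blast
      then show "f' v \<in> carrier_vec n" "e n (f' v) = f (e m v)" by (simp_all add: f'_def coords_e)
    qed
    define A where "A = mat n m (\<lambda>(i, j). f' (unit_vec m j) $ i)"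
    have A: "A \<in> carrier_mat n m" by (simp add: A_def)
    have Av: "A *\<^sub>v v = f' v" if v: "v \<in> carrier_vec m" for v
      unfolding A_def
    proof (rule linear_map_eq_mat[OF f'(1) _ _ v])
      fix v w :: "'f vec" assume v: "v \<in> carrier_vec m" and w: "w \<in> carrier_vec m"
      have "e n (f' (v + w)) = e n (f' v + f' w)"
        using v w mhomD(2)[OF f, of "e m v" "e m w"] std_space_sel(2)[OF f'(1)[OF v] f'(1)[OF w]]
        by (simp add: f' std_space_sel(1,2))
      then show "f' (v + w) = f' v + f' w" using v w f' by (intro inj_onD[OF inj, of n]) auto
    next
      fix c and v :: "'f vec" assume v: "v \<in> carrier_vec m"
      have "e n (f' (c \<cdot>\<^sub>v v)) = e n (c \<cdot>\<^sub>v f' v)"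
        using v mhomD(3)[OF f, of c "e m v"] std_space_sel(3)[OF f'(1)[OF v], of c]
        by (simp add: f' std_space_sel(1,3))
      then show "f' (c \<cdot>\<^sub>v v) = c \<cdot>\<^sub>v f' v" using v f' by (intro inj_onD[OF inj, of n]) auto
    qed
    have "f = amap realization m n A"
    proof (rule mhom_eqI[OF f realization_arrow[OF A]])
      fix x assume "x \<in> carrier (std_space m)"
      then obtain v where "v \<in> carrier_vec m" "x = e m v" unfolding std_space_sel by blast
      then show "f x = amap realization m n A x" by (simp add: amap_realization Av f')
    qed
    with A show "f \<in> amap realization m n ` carrier_mat n m" by blast
  qed
qed

text \<open>Coordinates with respect to a basis identify a finite dimensional space with a standard one.\<close>

lemma ex_realization:
  assumes "V \<in> Obj (fd_vector_spaces TYPE('f) TYPE('v))"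
  shows "\<exists>n f. is_iso (fd_vector_spaces TYPE('f) TYPE('v)) (std_space n) V f"
proof -
  have vs: "vectorspace class_ring V" and fd: "vectorspace.fin_dim class_ring V"
    using assms by (simp_all add: fd_sel)
  interpret vectorspace "class_ring :: 'f ring" V by (rule vs)
  have Vm: "left_module class_ring V" by (rule left_module_of_vectorspace[OF vs])
  obtain B where B: "finite B" "basis B" using finite_basis_exists[OF fd] by blast
  then have BV: "B \<subseteq> carrier V" by (simp add: basis_def)
  obtain bs where bs: "set bs = B" "distinct bs" using finite_distinct_list[OF B(1)] by blast
  define n where "n = length bs"
  obtain idx where idx: "\<And>b. b \<in> B \<Longrightarrow> idx b < n" "\<And>b. b \<in> B \<Longrightarrow> bs ! idx b = b"
  proof -
    have "\<forall>b. \<exists>i. b \<in> B \<longrightarrow> i < n \<and> bs ! i = b" unfolding bs(1)[symmetric] n_def by (metis in_set_conv_nth)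
    then obtain idx where "\<forall>b. b \<in> B \<longrightarrow> idx b < n \<and> bs ! idx b = b" by metis
    with that show ?thesis by blast
  qed
  have bsB: "bs ! i \<in> B" "idx (bs ! i) = i" if "i < n" for i
  proof -
    show 1: "bs ! i \<in> B" using that bs(1) by (auto simp: n_def)
    show "idx (bs ! i) = i" using idx[OF 1] that bs(2) by (simp add: n_def nth_eq_iff_index_eq)
  qed
  define L where "L v = lincomb (\<lambda>b. v $ idx b) B" for v :: "'f vec"
  have Lcl: "L v \<in> carrier V" for v unfolding L_def by (rule lincomb_closed[OF BV]) simp
  have tcl: "c \<odot>\<^bsub>V\<^esub> b \<in> carrier V" if "b \<in> B" for c b
    using BV that by (intro smult_closed) auto
  have Ladd: "L (v + w) = L v \<oplus>\<^bsub>V\<^esub> L w" if "v \<in> carrier_vec n" "w \<in> carrier_vec n" for v w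
  proof -
    have "L (v + w) = (\<Oplus>\<^bsub>V\<^esub>b \<in> B. (v $ idx b) \<odot>\<^bsub>V\<^esub> b \<oplus>\<^bsub>V\<^esub> (w $ idx b) \<odot>\<^bsub>V\<^esub> b)"
      unfolding L_def lincomb_def
      by (rule finsum_cong') (use that idx(1) BV left_module_rules(8)[OF Vm] tcl in auto)
    also have "\<dots> = L v \<oplus>\<^bsub>V\<^esub> L w" unfolding L_def lincomb_def by (rule finsum_addf) (use tcl in auto)
    finally show ?thesis .
  qed
  have Lsmult: "L (c \<cdot>\<^sub>v v) = c \<odot>\<^bsub>V\<^esub> L v" if "v \<in> carrier_vec n" for c v
  proof -
    have "L (c \<cdot>\<^sub>v v) = (\<Oplus>\<^bsub>V\<^esub>b \<in> B. c \<odot>\<^bsub>V\<^esub> ((v $ idx b) \<odot>\<^bsub>V\<^esub> b))"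
      unfolding L_def lincomb_def
      by (rule finsum_cong') (use that idx(1) BV left_module_rules(10)[OF Vm] left_module_rules(7)[OF Vm] tcl in auto)
    also have "\<dots> = c \<odot>\<^bsub>V\<^esub> L v" unfolding L_def lincomb_def
      by (rule additive_finsum[where h = "\<lambda>x. c \<odot>\<^bsub>V\<^esub> x", symmetric])
        (use tcl B(1) left_module_rules(7,9)[OF Vm] in \<open>auto simp: abelian_monoid_axioms smult_r_null\<close>)
    finally show ?thesis .
  qed
  have uniq: "\<exists>!a. a \<in> B \<rightarrow>\<^sub>E UNIV \<and> lincomb a B = x" if "x \<in> carrier V" for x
    using basis_criterion[OF B(1) BV] B(2) that by simp
  have ab: "lincomb a B = L (vec n (\<lambda>i. a (bs ! i)))" for a
    unfolding L_def lincomb_def by (rule finsum_cong') (use idx tcl in auto)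
  have Lbij: "bij_betw L (carrier_vec n) (carrier V)"
  proof (rule bij_betw_imageI)
    show "inj_on L (carrier_vec n)"
    proof (rule inj_onI)
      fix v w :: "'f vec" assume v: "v \<in> carrier_vec n" and w: "w \<in> carrier_vec n" and eq: "L v = L w"
      have r: "lincomb (\<lambda>b \<in> B. u $ idx b) B = L u" for u :: "'f vec"
        unfolding L_def lincomb_def by (rule finsum_cong') (use tcl in auto)
      have "(\<lambda>b \<in> B. v $ idx b) = (\<lambda>b \<in> B. w $ idx b)"
        using uniq[OF Lcl[of v]] r[of v] r[of w] eq by (metis (no_types, lifting) UNIV_I restrict_PiE_iff)
      then have "v $ idx b = w $ idx b" if "b \<in> B" for b using that by (metis restrict_apply')
      then have "v $ i = w $ i" if "i < n" for i using bsB[OF that] by metis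
      then show "v = w" using v w by (intro eq_vecI) auto
    qed
    show "L ` carrier_vec n = carrier V"
    proof (intro equalityI subsetI)
      fix x assume "x \<in> carrier V"
      then obtain a where "lincomb a B = x" using uniq by blast
      then have "x = L (vec n (\<lambda>i. a (bs ! i)))" by (simp add: ab)
      then show "x \<in> L ` carrier_vec n" by (rule image_eqI) simp
    qed (use Lcl in auto)
  qed
  define f where "f = (\<lambda>x \<in> carrier (std_space n). L (coords n x))"
  have fe: "f (e n v) = L v" if "v \<in> carrier_vec n" for v using that by (simp add: f_def std_space_sel coords_e)
  have f: "f \<in> mhom class_ring (std_space n) V"
  proof (rule mhomI)
    fix x y assume "x \<in> carrier (std_space n)" "y \<in> carrier (std_space n)"
    then obtain v w where "v \<in> carrier_vec n" "x = e n v" "w \<in> carrier_vec n" "y = e n w"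
      unfolding std_space_sel by blast
    then show "f (x \<oplus>\<^bsub>std_space n\<^esub> y) = f x \<oplus>\<^bsub>V\<^esub> f y" by (simp add: std_space_sel fe Ladd)
  next
    fix c x assume "x \<in> carrier (std_space n)"
    then obtain v where "v \<in> carrier_vec n" "x = e n v" unfolding std_space_sel by blast
    then show "f (c \<odot>\<^bsub>std_space n\<^esub> x) = c \<odot>\<^bsub>V\<^esub> f x" by (simp add: std_space_sel fe Lsmult)
  qed (simp_all add: f_def Lcl)
  have "bij_betw f (carrier (std_space n)) (carrier V)"
  proof (rule bij_betw_imageI)
    show "inj_on f (carrier (std_space n))"
      unfolding std_space_sel by (rule inj_onI) (use Lbij fe in \<open>auto simp: bij_betw_def dest: inj_onD\<close>)
    show "f ` carrier (std_space n) = carrier V"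
      unfolding std_space_sel image_image using Lbij fe by (simp add: bij_betw_def cong: image_cong)
  qed
  from mhom_bij_inverse[OF std_space_module Vm f this] obtain g where
    "g \<in> mhom class_ring V (std_space n)" "compose (carrier (std_space n)) g f = (\<lambda>x \<in> carrier (std_space n). x)"
    "compose (carrier V) f g = (\<lambda>x \<in> carrier V. x)" .
  with f have "is_iso (fd_vector_spaces TYPE('f) TYPE('v)) (std_space n) V f"
    unfolding is_iso_def fd_sel by blast
  then show ?thesis by blast
qed

theorem realization_weak_equivalence:
  "weak_equivalence (mat_category TYPE('f)) (fd_vector_spaces TYPE('f) TYPE('v)) realization"
  unfolding weak_equivalence_def using realization_functor
proof (intro conjI ballI)
  show "bij_betw (amap realization m n) (Hom (mat_category TYPE('f)) m n)
    (Hom (fd_vector_spaces TYPE('f) TYPE('v)) (omap realization m) (omap realization n))" for m n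
    using realization_bij unfolding mat_category_sel fd_sel realization_sel(1) .
  show "\<exists>n \<in> Obj (mat_category TYPE('f)). \<exists>f. is_iso (fd_vector_spaces TYPE('f) TYPE('v)) (omap realization n) V f"
    if "V \<in> Obj (fd_vector_spaces TYPE('f) TYPE('v))" for V
    using ex_realization[OF that] by (simp add: mat_category_sel realization_sel(1))
qed

end

lemma ex_coordinate_embedding:
  assumes "infinite (UNIV :: 'v set)"
  shows "\<exists>e :: nat \<Rightarrow> 'f :: {finite, field} vec \<Rightarrow> 'v. coordinate_embedding e"
proof -
  have "\<exists>f :: 'f vec \<Rightarrow> 'v. inj_on f (carrier_vec n)" for n
  proof -
    obtain S :: "'v set" where S: "finite S" "card S = card (carrier_vec n :: 'f vec set)"
      using infinite_arbitrarily_large[OF assms] by blast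
    then obtain f where "bij_betw f (carrier_vec n :: 'f vec set) S"
      using finite_same_card_bij[OF finite_carrier_vec' S(1)] by auto
    then show ?thesis unfolding bij_betw_def by blast
  qed
  then obtain e :: "nat \<Rightarrow> 'f vec \<Rightarrow> 'v" where "\<forall>n. inj_on (e n) (carrier_vec n)" by metis
  then show ?thesis by (auto simp: coordinate_embedding_def)
qed

section \<open>Representations of the category of matrices\<close>

text \<open>
  Coefficients in \<open>K\<close> of an element \<open>\<epsilon> n\<close> of the monoid ring of \<open>n \<times> n\<close> matrices that is \<open>1\<close> plus
  a combination of singular matrices, and whose products with matrices of smaller rank vanish on both
  sides.
\<close>

locale kovacs_elements = K: cring K
  for K :: "'k ring" and \<epsilon> :: "nat \<Rightarrow> 'f :: {finite, field} mat \<Rightarrow> 'k" +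
  assumes \<epsilon>_closed: "\<epsilon> n c \<in> carrier K"
    and \<epsilon>_one: "\<epsilon> n (1\<^sub>m n) = \<one>\<^bsub>K\<^esub>"
    and \<epsilon>_invertible: "\<lbrakk>g \<in> carrier_mat n n; h \<in> carrier_mat n n; g * h = 1\<^sub>m n; g \<noteq> 1\<^sub>m n\<rbrakk> \<Longrightarrow> \<epsilon> n g = \<zero>\<^bsub>K\<^esub>"
    and \<epsilon>_kills_left: "\<lbrakk>r < n; j \<in> carrier_mat n r; d \<in> carrier_mat n r\<rbrakk> \<Longrightarrow>
      (\<Oplus>\<^bsub>K\<^esub>c \<in> carrier_mat n n. if c * j = d then \<epsilon> n c else \<zero>\<^bsub>K\<^esub>) = \<zero>\<^bsub>K\<^esub>"
    and \<epsilon>_kills_right: "\<lbrakk>r < n; s \<in> carrier_mat r n; d \<in> carrier_mat r n\<rbrakk> \<Longrightarrow>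
      (\<Oplus>\<^bsub>K\<^esub>c \<in> carrier_mat n n. if s * c = d then \<epsilon> n c else \<zero>\<^bsub>K\<^esub>) = \<zero>\<^bsub>K\<^esub>"

text \<open>
  For the order of the field, whose only prime divisor is the characteristic, this makes the powers of
  that order invertible in \<open>K\<close>.
\<close>

lemma Units_of_prime_divisors:
  assumes K: "cring K" and p: "[p] \<cdot>\<^bsub>K\<^esub> \<one>\<^bsub>K\<^esub> \<in> Units K"
    and "0 < m" "\<And>l. \<lbrakk>prime l; l dvd m\<rbrakk> \<Longrightarrow> l = p"
  shows "[(m :: nat)] \<cdot>\<^bsub>K\<^esub> \<one>\<^bsub>K\<^esub> \<in> Units K"
  using assms(3,4)
proof (induction m rule: less_induct)
  case (less m)
  interpret K: cring K by (rule K)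
  show ?case
  proof (cases "m = 1")
    case True
    then show ?thesis by (simp add: K.add.nat_pow_eone)
  next
    case False
    then obtain l where l: "prime l" "l dvd m" using prime_factor_nat by blast
    then have lp: "l = p" using less.prems(2) by blast
    then obtain k where k: "m = p * k" using l by (auto elim: dvdE)
    have "1 < p" using l lp prime_gt_1_nat by blast
    then have "k < m" "0 < k" using k less.prems(1) by auto
    then have kU: "[k] \<cdot>\<^bsub>K\<^esub> \<one>\<^bsub>K\<^esub> \<in> Units K"
      by (rule less.IH) (use less.prems(2) k in auto)
    have "[m] \<cdot>\<^bsub>K\<^esub> \<one>\<^bsub>K\<^esub> = ([p] \<cdot>\<^bsub>K\<^esub> \<one>\<^bsub>K\<^esub>) \<otimes>\<^bsub>K\<^esub> ([k] \<cdot>\<^bsub>K\<^esub> \<one>\<^bsub>K\<^esub>)"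
      unfolding k by (simp add: K.add_pow_ldistr K.add.nat_pow_pow mult.commute)
    then show ?thesis using K.Units_m_closed[OF p kU] by simp
  qed
qed

text \<open>
  Divide the integral killer by its coefficient \<open>N\<close> at the identity, a power of the order of the field. The sums
  to be killed are the ones against indicator functions.
\<close>

lemma ex_kovacs_elements:
  fixes K :: "'k ring"
  assumes K: "cring K" and p: "[CHAR('f :: {finite, field})] \<cdot>\<^bsub>K\<^esub> \<one>\<^bsub>K\<^esub> \<in> Units K"
  shows "\<exists>\<epsilon> :: nat \<Rightarrow> 'f mat \<Rightarrow> 'k. kovacs_elements K \<epsilon>"
proof -
  interpret K: cring K by (rule K)
  define z where "z k = [k] \<cdot>\<^bsub>K\<^esub> \<one>\<^bsub>K\<^esub>" for k :: int
  have z_closed: "z k \<in> carrier K" for k by (simp add: z_def)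
  have z_add: "z (k + l) = z k \<oplus>\<^bsub>K\<^esub> z l" for k l by (simp add: z_def K.add.int_pow_mult)
  have z_0: "z 0 = \<zero>\<^bsub>K\<^esub>" using z_add[of 0 0] z_closed[of 0] by simp
  have z_int: "z (int m) = [m] \<cdot>\<^bsub>K\<^esub> \<one>\<^bsub>K\<^esub>" for m by (simp add: z_def add_pow_def int_pow_int)
  have q: "[(card (UNIV :: 'f set) ^ a)] \<cdot>\<^bsub>K\<^esub> \<one>\<^bsub>K\<^esub> \<in> Units K" for a
    by (rule Units_of_prime_divisors[OF K p])
      (use prime_divisor_card_eq_CHAR[where ?'a = 'f] prime_dvd_power in \<open>auto simp: finite_UNIV_card_ge_0\<close>)
  define P :: "nat \<Rightarrow> ('f mat \<Rightarrow> 'k) \<Rightarrow> bool" where "P n e \<longleftrightarrow> (\<forall>c. e c \<in> carrier K) \<and> e (1\<^sub>m n) = \<one>\<^bsub>K\<^esub> \<and>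
    (\<forall>g \<in> carrier_mat n n. \<forall>h \<in> carrier_mat n n. g * h = 1\<^sub>m n \<longrightarrow> g \<noteq> 1\<^sub>m n \<longrightarrow> e g = \<zero>\<^bsub>K\<^esub>) \<and>
    (\<forall>r < n. \<forall>j \<in> carrier_mat n r. \<forall>d. (\<Oplus>\<^bsub>K\<^esub>c \<in> carrier_mat n n. if c * j = d then e c else \<zero>\<^bsub>K\<^esub>) = \<zero>\<^bsub>K\<^esub>) \<and>
    (\<forall>r < n. \<forall>s \<in> carrier_mat r n. \<forall>d. (\<Oplus>\<^bsub>K\<^esub>c \<in> carrier_mat n n. if s * c = d then e c else \<zero>\<^bsub>K\<^esub>) = \<zero>\<^bsub>K\<^esub>)" for n e
  have "\<exists>e. P n e" for n
  proof -
    obtain N and e :: "'f mat \<Rightarrow> int" where e: "unipotent_mod_singular n N e"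
      and kill: "\<forall>k < n. kills_left n e k \<and> kills_right n e k" using ex_kovacs_element by blast
    have e1: "e (1\<^sub>m n) = N" using e by (simp add: unipotent_mod_singular_def)
    have "\<exists>a. N = int (card (UNIV :: 'f set)) ^ a" using e by (simp add: unipotent_mod_singular_def)
    then obtain a where "N = int (card (UNIV :: 'f set) ^ a)" by auto
    then have zN: "z N \<in> Units K" using q[of a] by (simp only: z_int)
    define u where "u = inv\<^bsub>K\<^esub> z N"
    have u: "u \<in> carrier K" "u \<otimes>\<^bsub>K\<^esub> z N = \<one>\<^bsub>K\<^esub>" using zN by (simp_all add: u_def K.Units_l_inv)
    \<comment> \<open>the additive map from the integers to \<open>K\<close> that sends \<open>N\<close> to \<open>1\<close>\<close>
    define h where "h k = u \<otimes>\<^bsub>K\<^esub> z k" for k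
    have h: "h k \<in> carrier K" "h (k + l) = h k \<oplus>\<^bsub>K\<^esub> h l" "h 0 = \<zero>\<^bsub>K\<^esub>" for k l
      by (simp_all add: h_def u z_closed z_add z_0 K.r_distr)
    have h_sum: "h (sum f A) = (\<Oplus>\<^bsub>K\<^esub>c \<in> A. h (f c))" if "finite A" for f and A :: "'f mat set"
      using that by (induction A rule: finite_induct) (auto simp: h)
    have eqk: "(\<Oplus>\<^bsub>K\<^esub>c \<in> carrier_mat n n. if P c then h (e c) else \<zero>\<^bsub>K\<^esub>) = \<zero>\<^bsub>K\<^esub>"
      if "(\<Sum>c \<in> carrier_mat n n. e c * (if P c then 1 else 0)) = 0" for P
    proof -
      have "(\<Oplus>\<^bsub>K\<^esub>c \<in> carrier_mat n n. if P c then h (e c) else \<zero>\<^bsub>K\<^esub>) =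
        (\<Oplus>\<^bsub>K\<^esub>c \<in> carrier_mat n n. h (e c * (if P c then 1 else 0)))"
        by (rule K.finsum_cong') (auto simp: h)
      also have "\<dots> = h (\<Sum>c \<in> carrier_mat n n. e c * (if P c then 1 else 0))"
        by (rule h_sum[symmetric]) (rule finite_carrier_mat)
      finally show ?thesis using that by (simp add: h)
    qed
    have kl: "(\<Oplus>\<^bsub>K\<^esub>c \<in> carrier_mat n n. if c * j = d then h (e c) else \<zero>\<^bsub>K\<^esub>) = \<zero>\<^bsub>K\<^esub>"
      if "r < n" "j \<in> carrier_mat n r" for r j d
    proof (rule eqk)
      have "kills_left n e r" using kill that by blast
      then show "(\<Sum>c \<in> carrier_mat n n. e c * (if c * j = d then 1 else 0)) = 0"
        unfolding kills_left_def using that(2) by (elim ballE[of _ _ j] allE[of _ "\<lambda>x. if x = d then 1 else 0"]) auto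
    qed
    have kr: "(\<Oplus>\<^bsub>K\<^esub>c \<in> carrier_mat n n. if s * c = d then h (e c) else \<zero>\<^bsub>K\<^esub>) = \<zero>\<^bsub>K\<^esub>"
      if "r < n" "s \<in> carrier_mat r n" for r s d
    proof (rule eqk)
      have "kills_right n e r" using kill that by blast
      then show "(\<Sum>c \<in> carrier_mat n n. e c * (if s * c = d then 1 else 0)) = 0"
        unfolding kills_right_def using that(2) by (elim ballE[of _ _ s] allE[of _ "\<lambda>x. if x = d then 1 else 0"]) auto
    qed
    have inv: "h (e g) = \<zero>\<^bsub>K\<^esub>" if "g \<in> carrier_mat n n" "g' \<in> carrier_mat n n" "g * g' = 1\<^sub>m n" "g \<noteq> 1\<^sub>m n" for g g'
    proof -
      have "e g = 0" using e that unfolding unipotent_mod_singular_def by blast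
      then show ?thesis by (simp add: h)
    qed
    have "h (e (1\<^sub>m n)) = \<one>\<^bsub>K\<^esub>" by (simp add: h_def e1 u)
    then have "P n (\<lambda>c. h (e c))" unfolding P_def using h(1) inv kl kr by blast
    then show ?thesis by blast
  qed
  then have "\<exists>\<epsilon>. \<forall>n. P n (\<epsilon> n)" by (intro choice allI)
  then obtain \<epsilon> where P: "\<And>n. P n (\<epsilon> n)" by blast
  note P = P[unfolded P_def]
  have "kovacs_elements_axioms K \<epsilon>"
  proof (rule kovacs_elements_axioms.intro)
    show "\<epsilon> n c \<in> carrier K" for n c using P[of n] by blast
    show "\<epsilon> n (1\<^sub>m n) = \<one>\<^bsub>K\<^esub>" for n using P[of n] by blast
    show "\<epsilon> n g = \<zero>\<^bsub>K\<^esub>" if "g \<in> carrier_mat n n" "h \<in> carrier_mat n n" "g * h = 1\<^sub>m n" "g \<noteq> 1\<^sub>m n" for n g h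
      using P[THEN conjunct2, THEN conjunct2, THEN conjunct1, of n] that by blast
    show "(\<Oplus>\<^bsub>K\<^esub>c \<in> carrier_mat n n. if c * j = d then \<epsilon> n c else \<zero>\<^bsub>K\<^esub>) = \<zero>\<^bsub>K\<^esub>"
      if "r < n" "j \<in> carrier_mat n r" for r n j d
      using P[THEN conjunct2, THEN conjunct2, THEN conjunct2, THEN conjunct1, of n] that by blast
    show "(\<Oplus>\<^bsub>K\<^esub>c \<in> carrier_mat n n. if s * c = d then \<epsilon> n c else \<zero>\<^bsub>K\<^esub>) = \<zero>\<^bsub>K\<^esub>"
      if "r < n" "s \<in> carrier_mat r n" for r n s d
      using P[THEN conjunct2, THEN conjunct2, THEN conjunct2, THEN conjunct2, of n] that by blast
  qed
  then have "kovacs_elements K \<epsilon>" by (rule kovacs_elements.intro[OF K])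
  then show ?thesis by blast
qed

locale matrix_rep = K: cring K
  for K :: "'k ring" and F :: "(nat, 'f :: {finite, field} mat, ('k, 'm) module, 'm \<Rightarrow> 'm) fctr" +
  assumes is_rep: "is_functor (mat_category TYPE('f)) (module_category TYPE('m) K (\<lambda>c. c)) F"
begin

abbreviation V :: "nat \<Rightarrow> ('k, 'm) module" where "V n \<equiv> omap F n"

definition app :: "'f mat \<Rightarrow> 'm \<Rightarrow> 'm" where
  "app A x = amap F (dim_col A) (dim_row A) A x"

lemma V_left_module: "left_module K (V n)"
  using is_functorD(1)[OF is_rep] by (simp add: mat_category_sel module_category_sel)

lemma amap_mhom: "A \<in> carrier_mat n m \<Longrightarrow> amap F m n A \<in> mhom K (V m) (V n)"
  using is_functorD(2)[OF is_rep, of m n A] unfolding mat_category_sel module_category_sel by simp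

lemma app_eq: "A \<in> carrier_mat n m \<Longrightarrow> app A = amap F m n A"
  by (intro ext) (auto simp: app_def)

lemma app_closed: "\<lbrakk>A \<in> carrier_mat n m; x \<in> carrier (V m)\<rbrakk> \<Longrightarrow> app A x \<in> carrier (V n)"
  using mhomD(1)[OF amap_mhom] by (simp add: app_eq)

lemma app_add:
  "\<lbrakk>A \<in> carrier_mat n m; x \<in> carrier (V m); y \<in> carrier (V m)\<rbrakk> \<Longrightarrow> app A (x \<oplus>\<^bsub>V m\<^esub> y) = app A x \<oplus>\<^bsub>V n\<^esub> app A y"
  using mhomD(2)[OF amap_mhom] by (simp add: app_eq)

lemma app_smult:
  "\<lbrakk>A \<in> carrier_mat n m; c \<in> carrier K; x \<in> carrier (V m)\<rbrakk> \<Longrightarrow> app A (c \<odot>\<^bsub>V m\<^esub> x) = c \<odot>\<^bsub>V n\<^esub> app A x"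
  using mhomD(3)[OF amap_mhom] by (simp add: app_eq)

lemma app_zero: "A \<in> carrier_mat n m \<Longrightarrow> app A \<zero>\<^bsub>V m\<^esub> = \<zero>\<^bsub>V n\<^esub>"
  using mhom_zero[OF V_left_module V_left_module amap_mhom] by (simp add: app_eq)

lemma app_one: "x \<in> carrier (V n) \<Longrightarrow> app (1\<^sub>m n) x = x"
  using is_functorD(3)[OF is_rep, of n] by (simp add: app_def mat_category_sel module_category_sel)

lemma app_mult:
  assumes "A \<in> carrier_mat m l" "B \<in> carrier_mat n m" "x \<in> carrier (V l)"
  shows "app (B * A) x = app B (app A x)"
  using is_functorD(4)[OF is_rep, of l m n A B] assms
  by (simp add: app_eq[OF mult_carrier_mat[OF assms(2,1)]] app_eq[OF assms(1)] app_eq[OF assms(2)]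
      mat_category_sel module_category_sel compose_def)

text \<open>
  Killing by all matrices with fewer rows is the same as killing by all matrices of rank less than \<open>n\<close>, as
  these factor.
\<close>

definition Prim :: "nat \<Rightarrow> 'm set" where
  "Prim n = {x \<in> carrier (V n). \<forall>r < n. \<forall>s \<in> carrier_mat r n. app s x = \<zero>\<^bsub>V r\<^esub>}"

lemma Prim_closed: "x \<in> Prim n \<Longrightarrow> x \<in> carrier (V n)" by (simp add: Prim_def)

lemma app_Prim: "\<lbrakk>x \<in> Prim n; r < n; s \<in> carrier_mat r n\<rbrakk> \<Longrightarrow> app s x = \<zero>\<^bsub>V r\<^esub>" by (simp add: Prim_def)

lemma app_singular_Prim:
  assumes x: "x \<in> Prim n" and c: "c \<in> carrier_mat n n" and no: "\<And>h. h \<in> carrier_mat n n \<Longrightarrow> c * h \<noteq> 1\<^sub>m n"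
  shows "app c x = \<zero>\<^bsub>V n\<^esub>"
proof -
  obtain r j s where "r < n" "j \<in> carrier_mat n r" "s \<in> carrier_mat r n" "c = j * s"
    using not_right_invertible_factors[OF c no] by blast
  then show ?thesis using app_mult Prim_closed[OF x] app_Prim[OF x] app_zero by simp
qed

lemma app_invertible_Prim:
  assumes x: "x \<in> Prim n" and g: "g \<in> carrier_mat n n"
  shows "app g x \<in> Prim n"
proof -
  have "app s (app g x) = \<zero>\<^bsub>V r\<^esub>" if "r < n" "s \<in> carrier_mat r n" for r s
    using app_mult[OF g that(2) Prim_closed[OF x]] app_Prim[OF x that(1), of "s * g"] that(2) g by simp
  then show ?thesis using app_closed[OF g Prim_closed[OF x]] by (simp add: Prim_def)
qed

lemma Prim_left_module: "left_module K ((V n)\<lparr>carrier := Prim n\<rparr>)"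
proof (rule left_module_sub[OF V_left_module])
  note Vr = left_module_rules[OF V_left_module]
  interpret left_module K "V r" for r by (rule V_left_module)
  show "\<zero>\<^bsub>V n\<^esub> \<in> Prim n" using app_zero Vr(2) by (simp add: Prim_def)
  show "x \<oplus>\<^bsub>V n\<^esub> y \<in> Prim n" if "x \<in> Prim n" "y \<in> Prim n" for x y
    using that Vr(1,2,5) by (simp add: Prim_def app_add)
  show "a \<odot>\<^bsub>V n\<^esub> x \<in> Prim n" if "a \<in> carrier K" "x \<in> Prim n" for a x
    using that Vr(7) by (simp add: Prim_def app_smult smult_zero_right)
qed (auto simp: Prim_def)

end

lemma GL_sel:
  "g \<in> carrier (GL TYPE('f :: {finite, field}) n) \<longleftrightarrow> g \<in> carrier_mat n n \<and> (\<exists>h \<in> carrier_mat n n. g * h = 1\<^sub>m n)"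
  "mult (GL TYPE('f) n) = (*)" "\<one>\<^bsub>GL TYPE('f) n\<^esub> = 1\<^sub>m n"
  using mat_mult_left_right_inverse[of g n]
  by (auto simp: GL_def units_of_def Units_def ring_mat_simps)

lemma GL_finite_group: "group (GL TYPE('f :: {finite, field}) n)" "finite (carrier (GL TYPE('f) n))"
proof -
  interpret R: ring "ring_mat TYPE('f) n ()" by (rule ring_mat)
  show "group (GL TYPE('f) n)" unfolding GL_def by (rule R.units_group)
  have "carrier (GL TYPE('f) n) \<subseteq> carrier_mat n n" by (auto simp: GL_sel)
  then show "finite (carrier (GL TYPE('f) n))" using finite_carrier_mat finite_subset by blast
qed

context matrix_rep
begin

abbreviation PrimV :: "nat \<Rightarrow> ('k, 'm) module" where "PrimV n \<equiv> (V n)\<lparr>carrier := Prim n\<rparr>"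

lemma Prim_action: "linear_action K (GL TYPE('f) n) (PrimV n) app"
proof -
  have "module K (PrimV n)" using Prim_left_module left_module_iff_module K.cring_axioms by blast
  moreover have "linear_action_axioms K (GL TYPE('f) n) (PrimV n) app"
    by (rule linear_action_axioms.intro)
      (auto simp: GL_finite_group GL_sel app_invertible_Prim app_add app_smult app_mult app_one Prim_closed)
  ultimately show ?thesis by (intro linear_action.intro K.cring_axioms GL_finite_group)
qed

end

locale kovacs_rep = kovacs_elements K \<epsilon> + matrix_rep K F
  for K :: "'k ring" and \<epsilon> :: "nat \<Rightarrow> 'f :: {finite, field} mat \<Rightarrow> 'k"
    and F :: "(nat, 'f mat, ('k, 'm) module, 'm \<Rightarrow> 'm) fctr"
begin

text \<open>
  The terms are grouped by the value of \<open>\<pi>\<close>. The two maps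
  \<open>\<pi>\<close> of interest are the multiplications by a matrix of smaller rank on the right and on the left.
\<close>

lemma sum_\<epsilon>_zero:
  assumes M: "left_module K M" and "finite D" and \<phi>: "\<And>d. d \<in> D \<Longrightarrow> \<phi> d \<in> carrier M"
    and \<pi>: "\<And>c. c \<in> carrier_mat n n \<Longrightarrow> \<pi> c \<in> D"
    and zero: "\<And>d. d \<in> D \<Longrightarrow> (\<Oplus>\<^bsub>K\<^esub>c \<in> carrier_mat n n. if \<pi> c = d then \<epsilon> n c else \<zero>\<^bsub>K\<^esub>) = \<zero>\<^bsub>K\<^esub>"
  shows "(\<Oplus>\<^bsub>M\<^esub>c \<in> carrier_mat n n. \<epsilon> n c \<odot>\<^bsub>M\<^esub> \<phi> (\<pi> c)) = \<zero>\<^bsub>M\<^esub>"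
proof -
  interpret M: left_module K M by (rule M)
  let ?t = "\<lambda>c d. (if \<pi> c = d then \<epsilon> n c else \<zero>\<^bsub>K\<^esub>) \<odot>\<^bsub>M\<^esub> \<phi> d"
  have t: "?t c d \<in> carrier M" if "d \<in> D" for c d using \<phi>[OF that] \<epsilon>_closed by (simp add: M.smult_closed)
  have "(\<Oplus>\<^bsub>M\<^esub>c \<in> carrier_mat n n. \<epsilon> n c \<odot>\<^bsub>M\<^esub> \<phi> (\<pi> c)) = (\<Oplus>\<^bsub>M\<^esub>c \<in> carrier_mat n n. \<Oplus>\<^bsub>M\<^esub>d \<in> D. ?t c d)"
  proof (rule M.M.finsum_cong'[OF refl])
    show "(\<lambda>c. \<Oplus>\<^bsub>M\<^esub>d \<in> D. ?t c d) \<in> carrier_mat n n \<rightarrow> carrier M" using t by (auto intro!: M.M.finsum_closed)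
    fix c :: "'f mat" assume c: "c \<in> carrier_mat n n"
    have "(\<Oplus>\<^bsub>M\<^esub>d \<in> D. ?t c d) = ?t c (\<pi> c)"
      by (rule M.M.finsum_single[where f = "?t c" and i = "\<pi> c", OF \<open>finite D\<close> \<pi>[OF c] t[OF \<pi>[OF c]]]) (use \<phi> in \<open>simp add: M.smult_zero_left\<close>)
    then show "\<epsilon> n c \<odot>\<^bsub>M\<^esub> \<phi> (\<pi> c) = (\<Oplus>\<^bsub>M\<^esub>d \<in> D. ?t c d)" by simp
  qed
  also have "\<dots> = (\<Oplus>\<^bsub>M\<^esub>d \<in> D. \<Oplus>\<^bsub>M\<^esub>c \<in> carrier_mat n n. ?t c d)"
    by (rule M.M.finsum_swap[OF finite_carrier_mat \<open>finite D\<close> t])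
  also have "\<dots> = \<zero>\<^bsub>M\<^esub>"
  proof (rule M.M.add.finprod_one_eqI)
    fix d assume d: "d \<in> D"
    have "(\<Oplus>\<^bsub>M\<^esub>c \<in> carrier_mat n n. ?t c d) = (\<Oplus>\<^bsub>K\<^esub>c \<in> carrier_mat n n. if \<pi> c = d then \<epsilon> n c else \<zero>\<^bsub>K\<^esub>) \<odot>\<^bsub>M\<^esub> \<phi> d"
      by (rule additive_finsum[where h = "\<lambda>a. a \<odot>\<^bsub>M\<^esub> \<phi> d", symmetric])
        (use \<phi>[OF d] \<epsilon>_closed in \<open>simp_all add: M.smult_closed M.smult_l_distr M.smult_zero_left finite_carrier_mat
          K.abelian_monoid_axioms M.M.abelian_monoid_axioms\<close>)
    then show "(\<Oplus>\<^bsub>M\<^esub>c \<in> carrier_mat n n. ?t c d) = \<zero>\<^bsub>M\<^esub>" using zero[OF d] \<phi>[OF d] by (simp add: M.smult_zero_left)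
  qed
  finally show ?thesis .
qed

text \<open>
  The action of \<open>\<epsilon> n\<close>: the projection of \<open>V n\<close> onto \<open>Prim n\<close> that vanishes on the elements coming from smaller
  dimensions, as the following lemmas show.
\<close>

definition E :: "nat \<Rightarrow> 'm \<Rightarrow> 'm" where
  "E n x = (\<Oplus>\<^bsub>V n\<^esub>c \<in> carrier_mat n n. \<epsilon> n c \<odot>\<^bsub>V n\<^esub> app c x)"

lemma E_term: "\<lbrakk>c \<in> carrier_mat n n; x \<in> carrier (V n)\<rbrakk> \<Longrightarrow> \<epsilon> n c \<odot>\<^bsub>V n\<^esub> app c x \<in> carrier (V n)"
  using left_module_rules(7)[OF V_left_module] \<epsilon>_closed app_closed by blast

lemma V_abelian: "abelian_monoid (V n)"
  using V_left_module[of n] by (simp add: left_module_def abelian_group_def)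

lemma E_closed: "x \<in> carrier (V n) \<Longrightarrow> E n x \<in> carrier (V n)"
  unfolding E_def using E_term by (intro abelian_monoid.finsum_closed[OF V_abelian]) auto

lemma E_add:
  assumes x: "x \<in> carrier (V n)" and y: "y \<in> carrier (V n)"
  shows "E n (x \<oplus>\<^bsub>V n\<^esub> y) = E n x \<oplus>\<^bsub>V n\<^esub> E n y"
proof -
  have "E n (x \<oplus>\<^bsub>V n\<^esub> y) = (\<Oplus>\<^bsub>V n\<^esub>c \<in> carrier_mat n n. \<epsilon> n c \<odot>\<^bsub>V n\<^esub> app c x \<oplus>\<^bsub>V n\<^esub> \<epsilon> n c \<odot>\<^bsub>V n\<^esub> app c y)"
    unfolding E_def using x y E_term
    by (intro abelian_monoid.finsum_cong'[OF V_abelian])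
      (auto simp: app_add left_module_rules(1,9)[OF V_left_module] \<epsilon>_closed app_closed)
  also have "\<dots> = E n x \<oplus>\<^bsub>V n\<^esub> E n y"
    unfolding E_def using x y E_term by (intro abelian_monoid.finsum_addf[OF V_abelian]) auto
  finally show ?thesis .
qed

lemma E_smult:
  assumes x: "x \<in> carrier (V n)" and a: "a \<in> carrier K"
  shows "E n (a \<odot>\<^bsub>V n\<^esub> x) = a \<odot>\<^bsub>V n\<^esub> E n x"
proof -
  interpret L: left_module K "V n" by (rule V_left_module)
  have "E n (a \<odot>\<^bsub>V n\<^esub> x) = (\<Oplus>\<^bsub>V n\<^esub>c \<in> carrier_mat n n. a \<odot>\<^bsub>V n\<^esub> (\<epsilon> n c \<odot>\<^bsub>V n\<^esub> app c x))"
    unfolding E_def using x a E_term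
    by (intro L.M.finsum_cong')
      (auto simp: app_smult \<epsilon>_closed app_closed L.smult_closed L.smult_assoc1[symmetric] K.m_comm)
  also have "\<dots> = a \<odot>\<^bsub>V n\<^esub> E n x"
    unfolding E_def by (rule additive_finsum[where h = "\<lambda>y. a \<odot>\<^bsub>V n\<^esub> y", symmetric])
      (use a x E_term in \<open>simp_all add: L.smult_closed L.smult_r_distr L.smult_zero_right V_abelian finite_carrier_mat\<close>)
  finally show ?thesis .
qed

lemma E_zero: "E n \<zero>\<^bsub>V n\<^esub> = \<zero>\<^bsub>V n\<^esub>"
proof -
  interpret L: left_module K "V n" by (rule V_left_module)
  show ?thesis using E_smult[of "\<zero>\<^bsub>V n\<^esub>" n "\<zero>\<^bsub>K\<^esub>"] E_closed[of "\<zero>\<^bsub>V n\<^esub>" n] by (simp add: L.smult_zero_left)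
qed

lemma E_app_lower:
  assumes r: "r < n" and j: "j \<in> carrier_mat n r" and x: "x \<in> carrier (V r)"
  shows "E n (app j x) = \<zero>\<^bsub>V n\<^esub>"
proof -
  have "E n (app j x) = (\<Oplus>\<^bsub>V n\<^esub>c \<in> carrier_mat n n. \<epsilon> n c \<odot>\<^bsub>V n\<^esub> app (c * j) x)"
    unfolding E_def using j x E_term app_mult app_closed
    by (intro abelian_monoid.finsum_cong'[OF V_abelian])
      (auto simp: left_module_rules(7)[OF V_left_module] \<epsilon>_closed)
  also have "\<dots> = \<zero>\<^bsub>V n\<^esub>"
    by (rule sum_\<epsilon>_zero[where \<phi> = "\<lambda>d. app d x" and D = "carrier_mat n r", OF V_left_module finite_carrier_mat])
      (use r j x app_closed in \<open>simp_all add: \<epsilon>_kills_left\<close>)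
  finally show ?thesis .
qed

lemma E_Prim:
  assumes x: "x \<in> carrier (V n)"
  shows "E n x \<in> Prim n"
proof -
  have "app s (E n x) = \<zero>\<^bsub>V r\<^esub>" if r: "r < n" and s: "s \<in> carrier_mat r n" for r s
  proof -
    have "app s (E n x) = (\<Oplus>\<^bsub>V r\<^esub>c \<in> carrier_mat n n. app s (\<epsilon> n c \<odot>\<^bsub>V n\<^esub> app c x))"
      unfolding E_def by (rule additive_finsum[OF V_abelian V_abelian])
        (use s x E_term in \<open>simp_all add: app_closed app_add app_zero finite_carrier_mat\<close>)
    also have "\<dots> = (\<Oplus>\<^bsub>V r\<^esub>c \<in> carrier_mat n n. \<epsilon> n c \<odot>\<^bsub>V r\<^esub> app (s * c) x)"
      using s x by (intro abelian_monoid.finsum_cong'[OF V_abelian])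
        (auto simp: app_smult app_mult \<epsilon>_closed app_closed left_module_rules(7)[OF V_left_module])
    also have "\<dots> = \<zero>\<^bsub>V r\<^esub>"
      by (rule sum_\<epsilon>_zero[where \<phi> = "\<lambda>d. app d x" and D = "carrier_mat r n", OF V_left_module finite_carrier_mat])
        (use r s x app_closed in \<open>simp_all add: \<epsilon>_kills_right\<close>)
    finally show ?thesis .
  qed
  then show ?thesis using E_closed[OF x] by (simp add: Prim_def)
qed

text \<open>
  Apart from the identity, only matrices that factor through a smaller dimension contribute to \<open>\<epsilon> n\<close>.
\<close>

lemma \<epsilon>_support:
  assumes c: "c \<in> carrier_mat n n" and "c \<noteq> 1\<^sub>m n"
  obtains "\<epsilon> n c = \<zero>\<^bsub>K\<^esub>" | r j s where "r < n" "j \<in> carrier_mat n r" "s \<in> carrier_mat r n" "c = j * s"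
proof (cases "\<exists>h \<in> carrier_mat n n. c * h = 1\<^sub>m n")
  case True
  then show ?thesis using that(1) \<epsilon>_invertible assms by blast
next
  case False
  then show ?thesis using that(2) not_right_invertible_factors[OF c] by blast
qed

lemma E_split:
  assumes x: "x \<in> carrier (V n)"
  shows "E n x = x \<oplus>\<^bsub>V n\<^esub> (\<Oplus>\<^bsub>V n\<^esub>c \<in> carrier_mat n n - {1\<^sub>m n}. \<epsilon> n c \<odot>\<^bsub>V n\<^esub> app c x)"
proof -
  interpret L: left_module K "V n" by (rule V_left_module)
  have "carrier_mat n n = insert (1\<^sub>m n) (carrier_mat n n - {1\<^sub>m n :: 'f mat})" by auto
  then have "E n x = (\<Oplus>\<^bsub>V n\<^esub>c \<in> insert (1\<^sub>m n) (carrier_mat n n - {1\<^sub>m n}). \<epsilon> n c \<odot>\<^bsub>V n\<^esub> app c x)"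
    unfolding E_def by (rule arg_cong)
  also have "\<dots> = \<epsilon> n (1\<^sub>m n) \<odot>\<^bsub>V n\<^esub> app (1\<^sub>m n) x \<oplus>\<^bsub>V n\<^esub>
      (\<Oplus>\<^bsub>V n\<^esub>c \<in> carrier_mat n n - {1\<^sub>m n}. \<epsilon> n c \<odot>\<^bsub>V n\<^esub> app c x)"
    by (rule L.M.finsum_insert) (use x E_term in \<open>auto simp: finite_carrier_mat\<close>)
  finally show ?thesis using x by (simp add: \<epsilon>_one app_one L.smult_one)
qed

lemma E_of_Prim:
  assumes x: "x \<in> Prim n"
  shows "E n x = x"
proof -
  interpret L: left_module K "V n" by (rule V_left_module)
  have "\<epsilon> n c \<odot>\<^bsub>V n\<^esub> app c x = \<zero>\<^bsub>V n\<^esub>" if "c \<in> carrier_mat n n - {1\<^sub>m n}" for c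
  proof -
    have c: "c \<in> carrier_mat n n" "c \<noteq> 1\<^sub>m n" using that by auto
    from c show ?thesis
    proof (cases rule: \<epsilon>_support)
      case 1
      then show ?thesis using app_closed[OF c(1) Prim_closed[OF x]] by (simp add: L.smult_zero_left)
    next
      case (2 r j s)
      then have "app c x = \<zero>\<^bsub>V n\<^esub>" using app_mult Prim_closed[OF x] app_Prim[OF x] app_zero by simp
      then show ?thesis using \<epsilon>_closed by (simp add: L.smult_zero_right)
    qed
  qed
  then have "(\<Oplus>\<^bsub>V n\<^esub>c \<in> carrier_mat n n - {1\<^sub>m n}. \<epsilon> n c \<odot>\<^bsub>V n\<^esub> app c x) = \<zero>\<^bsub>V n\<^esub>"
    by (rule L.M.add.finprod_one_eqI)
  then show ?thesis using E_split[OF Prim_closed[OF x]] Prim_closed[OF x] by simp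
qed

text \<open>
  Every representation is generated by its elements of the sets \<open>Prim n\<close>: \<open>x - E n x\<close> is a combination
  of images of elements of smaller degree.
\<close>

lemma generated_by_Prim:
  assumes prim: "\<And>n x. x \<in> Prim n \<Longrightarrow> P n x"
    and add: "\<And>n x y. \<lbrakk>x \<in> carrier (V n); y \<in> carrier (V n); P n x; P n y\<rbrakk> \<Longrightarrow> P n (x \<oplus>\<^bsub>V n\<^esub> y)"
    and smult: "\<And>n a x. \<lbrakk>a \<in> carrier K; x \<in> carrier (V n); P n x\<rbrakk> \<Longrightarrow> P n (a \<odot>\<^bsub>V n\<^esub> x)"
    and app: "\<And>m n A x. \<lbrakk>A \<in> carrier_mat n m; x \<in> carrier (V m); P m x\<rbrakk> \<Longrightarrow> P n (app A x)"
    and x: "x \<in> carrier (V n)"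
  shows "P n x"
  using x
proof (induction n arbitrary: x rule: less_induct)
  case (less n)
  interpret L: left_module K "V n" by (rule V_left_module)
  note x = less.prems
  have z: "P n \<zero>\<^bsub>V n\<^esub>" using smult[of "\<zero>\<^bsub>K\<^esub>" x n] smult[of "\<zero>\<^bsub>K\<^esub>" "E n x" n] prim[OF E_Prim[OF x]] E_closed[OF x]
    by (simp add: L.smult_zero_left)
  have t: "P n (\<epsilon> n c \<odot>\<^bsub>V n\<^esub> app c x)" if "c \<in> carrier_mat n n - {1\<^sub>m n}" for c
  proof -
    have c: "c \<in> carrier_mat n n" "c \<noteq> 1\<^sub>m n" using that by auto
    from c show ?thesis
    proof (cases rule: \<epsilon>_support)
      case 1
      then show ?thesis using z app_closed[OF c(1) x] by (simp add: L.smult_zero_left)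
    next
      case (2 r j s)
      have "P r (app s x)" by (rule less.IH[OF 2(1) app_closed[OF 2(3) x]])
      then have "P n (app j (app s x))" using app[OF 2(2) app_closed[OF 2(3) x]] by blast
      then show ?thesis using smult[OF \<epsilon>_closed app_closed[OF c(1) x]] app_mult[OF 2(3,2) x] 2(4) by simp
    qed
  qed
  have sum: "P n (\<Oplus>\<^bsub>V n\<^esub>c \<in> A. \<epsilon> n c \<odot>\<^bsub>V n\<^esub> app c x) \<and> (\<Oplus>\<^bsub>V n\<^esub>c \<in> A. \<epsilon> n c \<odot>\<^bsub>V n\<^esub> app c x) \<in> carrier (V n)"
    if "finite A" "A \<subseteq> carrier_mat n n - {1\<^sub>m n}" for A
    using that
  proof (induction A rule: finite_induct)
    case empty
    then show ?case using z by simp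
  next
    case (insert c A)
    then have c: "c \<in> carrier_mat n n - {1\<^sub>m n}" and A: "A \<subseteq> carrier_mat n n - {1\<^sub>m n}" by auto
    have cl: "\<epsilon> n c \<odot>\<^bsub>V n\<^esub> app c x \<in> carrier (V n)" if "c \<in> carrier_mat n n - {1\<^sub>m n}" for c using E_term x that by blast
    have "(\<Oplus>\<^bsub>V n\<^esub>c \<in> insert c A. \<epsilon> n c \<odot>\<^bsub>V n\<^esub> app c x) =
        \<epsilon> n c \<odot>\<^bsub>V n\<^esub> app c x \<oplus>\<^bsub>V n\<^esub> (\<Oplus>\<^bsub>V n\<^esub>c \<in> A. \<epsilon> n c \<odot>\<^bsub>V n\<^esub> app c x)"
      using insert.hyps A c cl by (intro L.M.finsum_insert) auto
    then show ?case using insert.IH[OF A] add[OF cl[OF c]] t[OF c] cl[OF c] by simp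
  qed
  define R where "R = (\<Oplus>\<^bsub>V n\<^esub>c \<in> carrier_mat n n - {1\<^sub>m n}. \<epsilon> n c \<odot>\<^bsub>V n\<^esub> app c x)"
  have R: "P n R" "R \<in> carrier (V n)" using sum[of "carrier_mat n n - {1\<^sub>m n}"] by (simp_all add: R_def finite_carrier_mat)
  have "x = E n x \<oplus>\<^bsub>V n\<^esub> (\<ominus>\<^bsub>V n\<^esub> R)"
    using E_split[OF x] x R(2) by (simp add: R_def[symmetric] L.M.a_assoc L.M.r_neg)
  moreover have "P n (\<ominus>\<^bsub>V n\<^esub> R)"
    using smult[of "\<ominus>\<^bsub>K\<^esub> \<one>\<^bsub>K\<^esub>" R n] R by (simp add: L.smult_minus_one)
  ultimately show ?case using add[OF E_closed[OF x] _ prim[OF E_Prim[OF x]], of "\<ominus>\<^bsub>V n\<^esub> R"] R(2) by simp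
qed

text \<open>
  The dual statement: by induction on \<open>m\<close>, all elements \<open>app t x\<close> in \<open>V m\<close> vanish, since the difference of such an
  element and its image under \<open>E m\<close> factors through smaller dimensions.
\<close>

lemma zero_if_E_app_zero:
  assumes x: "x \<in> carrier (V n)" and zero: "\<And>m t. t \<in> carrier_mat m n \<Longrightarrow> E m (app t x) = \<zero>\<^bsub>V m\<^esub>"
  shows "x = \<zero>\<^bsub>V n\<^esub>"
proof -
  have "app t x = \<zero>\<^bsub>V m\<^esub>" if "t \<in> carrier_mat m n" for m t
    using that
  proof (induction m arbitrary: t rule: less_induct)
    case (less m)
    interpret L: left_module K "V m" by (rule V_left_module)
    note t = less.prems
    have y: "app t x \<in> carrier (V m)" by (rule app_closed[OF t x])
    have "\<epsilon> m c \<odot>\<^bsub>V m\<^esub> app c (app t x) = \<zero>\<^bsub>V m\<^esub>" if "c \<in> carrier_mat m m - {1\<^sub>m m}" for c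
    proof -
      have c: "c \<in> carrier_mat m m" "c \<noteq> 1\<^sub>m m" using that by auto
      from c show ?thesis
      proof (cases rule: \<epsilon>_support)
        case 1
        then show ?thesis using app_closed[OF c(1) y] by (simp add: L.smult_zero_left)
      next
        case (2 r j s)
        have "app (s * t) x = \<zero>\<^bsub>V r\<^esub>" using 2 t by (intro less.IH) auto
        then have "app c (app t x) = \<zero>\<^bsub>V m\<^esub>"
          using app_mult[OF 2(3,2) y] app_mult[OF t 2(3) x] app_zero[OF 2(2)] 2(4) by simp
        then show ?thesis using \<epsilon>_closed by (simp add: L.smult_zero_right)
      qed
    qed
    then have "(\<Oplus>\<^bsub>V m\<^esub>c \<in> carrier_mat m m - {1\<^sub>m m}. \<epsilon> m c \<odot>\<^bsub>V m\<^esub> app c (app t x)) = \<zero>\<^bsub>V m\<^esub>"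
      by (rule L.M.add.finprod_one_eqI)
    then show ?case using E_split[OF y] zero[OF t] y by simp
  qed
  from this[of "1\<^sub>m n" n] show ?thesis using app_one[OF x] by simp
qed

end

section \<open>The modules of elements killed by smaller matrices\<close>

context matrix_rep
begin

definition Prim_module :: "nat \<Rightarrow> ('f mat \<Rightarrow> 'k, 'm) module" where
  "Prim_module n = linear_action.ring_module (GL TYPE('f) n) (PrimV n) app"

lemma Prim_module_sel: "carrier (Prim_module n) = Prim n" "\<zero>\<^bsub>Prim_module n\<^esub> = \<zero>\<^bsub>V n\<^esub>" "add (Prim_module n) = add (V n)"
  by (simp_all add: Prim_module_def linear_action.ring_module_sel[OF Prim_action])

lemma Prim_module_left_module: "left_module (group_ring K (GL TYPE('f) n)) (Prim_module n)"
  unfolding Prim_module_def by (rule linear_action.left_module_ring_module[OF Prim_action])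

lemma Prim_module_smult_\<delta>:
  "\<lbrakk>g \<in> carrier (GL TYPE('f) n); x \<in> Prim n\<rbrakk> \<Longrightarrow> finite_group_ring.\<delta> K (GL TYPE('f) n) g \<odot>\<^bsub>Prim_module n\<^esub> x = app g x"
  unfolding Prim_module_def linear_action.ring_module_sel[OF Prim_action]
  by (rule linear_action.ring_smult_\<delta>[OF Prim_action]) simp_all

lemma Prim_module_smult_\<iota>:
  "\<lbrakk>c \<in> carrier K; x \<in> Prim n\<rbrakk> \<Longrightarrow> group_ring_of_scalar K (GL TYPE('f) n) c \<odot>\<^bsub>Prim_module n\<^esub> x = c \<odot>\<^bsub>V n\<^esub> x"
  unfolding Prim_module_def linear_action.ring_module_sel[OF Prim_action]
  by (subst linear_action.ring_smult_\<iota>[OF Prim_action]) simp_all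

end

lemma finite_group_ring_GL: "cring K \<Longrightarrow> finite_group_ring K (GL TYPE('f :: {finite, field}) n)"
  by (intro finite_group_ring.intro finite_group_ring_axioms.intro GL_finite_group)

text \<open>
  Every element of the group ring is a combination of group elements, so that linearity is needed only for the
  scalars and for the group elements.
\<close>

lemma (in finite_group_ring) mhom_KG_I:
  assumes M: "left_module KG M" and N: "left_module KG N"
    and closed: "\<And>x. x \<in> carrier M \<Longrightarrow> f x \<in> carrier N"
    and add: "\<And>x y. \<lbrakk>x \<in> carrier M; y \<in> carrier M\<rbrakk> \<Longrightarrow> f (x \<oplus>\<^bsub>M\<^esub> y) = f x \<oplus>\<^bsub>N\<^esub> f y"
    and smult: "\<And>c x. \<lbrakk>c \<in> carrier K; x \<in> carrier M\<rbrakk> \<Longrightarrow> f (\<iota> c \<odot>\<^bsub>M\<^esub> x) = \<iota> c \<odot>\<^bsub>N\<^esub> f x"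
    and act: "\<And>g x. \<lbrakk>g \<in> carrier G; x \<in> carrier M\<rbrakk> \<Longrightarrow> f (\<delta> g \<odot>\<^bsub>M\<^esub> x) = \<delta> g \<odot>\<^bsub>N\<^esub> f x"
  shows "restrict f (carrier M) \<in> mhom KG M N"
proof (rule mhom_restrictI[OF M closed add])
  interpret M: left_module KG M by (rule M)
  interpret N: left_module KG N by (rule N)
  fix a x assume a: "a \<in> carrier KG" and x: "x \<in> carrier M"
  note am = PiE_mem[OF a[unfolded KG_sel]]
  have cl: "\<iota> (a g) \<odot>\<^bsub>M\<^esub> (\<delta> g \<odot>\<^bsub>M\<^esub> x) \<in> carrier M" if "g \<in> carrier G" for g
    by (rule M.smult_closed[OF \<iota>_closed[OF am[OF that]] M.smult_closed[OF \<delta>_closed x]])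
  have cl': "\<iota> (a g) \<odot>\<^bsub>N\<^esub> (\<delta> g \<odot>\<^bsub>N\<^esub> f x) \<in> carrier N" if "g \<in> carrier G" for g
    by (rule N.smult_closed[OF \<iota>_closed[OF am[OF that]] N.smult_closed[OF \<delta>_closed closed[OF x]]])
  have zero: "f \<zero>\<^bsub>M\<^esub> = \<zero>\<^bsub>N\<^esub>"
  proof -
    have "f \<zero>\<^bsub>M\<^esub> \<oplus>\<^bsub>N\<^esub> f \<zero>\<^bsub>M\<^esub> = f \<zero>\<^bsub>M\<^esub>" using add[of "\<zero>\<^bsub>M\<^esub>" "\<zero>\<^bsub>M\<^esub>"] by simp
    then show ?thesis using closed[of "\<zero>\<^bsub>M\<^esub>"] by simp
  qed
  have "f (a \<odot>\<^bsub>M\<^esub> x) = f (\<Oplus>\<^bsub>M\<^esub>g \<in> carrier G. \<iota> (a g) \<odot>\<^bsub>M\<^esub> (\<delta> g \<odot>\<^bsub>M\<^esub> x))"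
    using smult_eq_sum[OF M a x] by simp
  also have "\<dots> = (\<Oplus>\<^bsub>N\<^esub>g \<in> carrier G. f (\<iota> (a g) \<odot>\<^bsub>M\<^esub> (\<delta> g \<odot>\<^bsub>M\<^esub> x)))"
    by (rule additive_finsum[OF M.M.abelian_monoid_axioms N.M.abelian_monoid_axioms])
      (simp_all add: closed add zero finite_carrier cl)
  also have "\<dots> = (\<Oplus>\<^bsub>N\<^esub>g \<in> carrier G. \<iota> (a g) \<odot>\<^bsub>N\<^esub> (\<delta> g \<odot>\<^bsub>N\<^esub> f x))"
    using cl' by (intro N.M.finsum_cong') (auto simp: smult act am x M.smult_closed \<delta>_closed)
  finally show "f (a \<odot>\<^bsub>M\<^esub> x) = a \<odot>\<^bsub>N\<^esub> f x" using smult_eq_sum[OF N a closed[OF x]] by simp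
qed

locale matrix_rep_pair = F: matrix_rep K F + G: matrix_rep K G
  for K :: "'k ring" and F G :: "(nat, 'f :: {finite, field} mat, ('k, 'm) module, 'm \<Rightarrow> 'm) fctr"
begin

abbreviation "transformations \<equiv> nat_trans (mat_category TYPE('f)) (module_category TYPE('m) K (\<lambda>c. c)) F G"

lemma nat_trans_component: "\<alpha> \<in> transformations \<Longrightarrow> \<alpha> n \<in> mhom K (F.V n) (G.V n)"
  using nat_transD(1)[of \<alpha> "mat_category TYPE('f)" "module_category TYPE('m) K (\<lambda>c. c)" F G n]
  by (simp only: mat_category_sel module_category_sel UNIV_I)

lemma nat_trans_app:
  assumes \<alpha>: "\<alpha> \<in> transformations" and A: "A \<in> carrier_mat n m" and x: "x \<in> carrier (F.V m)"
  shows "\<alpha> n (F.app A x) = G.app A (\<alpha> m x)"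
proof -
  have "compose (carrier (F.V m)) (\<alpha> n) (amap F m n A) = compose (carrier (F.V m)) (amap G m n A) (\<alpha> m)"
    using nat_transD(2)[OF \<alpha>, of m n A] A by (simp only: mat_category_sel module_category_sel UNIV_I)
  then have "compose (carrier (F.V m)) (\<alpha> n) (amap F m n A) x = compose (carrier (F.V m)) (amap G m n A) (\<alpha> m) x"
    by (rule fun_cong)
  then show ?thesis using x by (simp add: compose_def F.app_eq[OF A] G.app_eq[OF A])
qed

lemma transformationI:
  assumes hom: "\<And>n. \<alpha> n \<in> mhom K (F.V n) (G.V n)"
    and nat: "\<And>m n A x. \<lbrakk>A \<in> carrier_mat n m; x \<in> carrier (F.V m)\<rbrakk> \<Longrightarrow> \<alpha> n (F.app A x) = G.app A (\<alpha> m x)"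
  shows "\<alpha> \<in> transformations"
proof (rule nat_transI)
  fix m n and A :: "'f mat" assume "A \<in> Hom (mat_category TYPE('f)) m n"
  then have A: "A \<in> carrier_mat n m" by (simp only: mat_category_sel)
  show "Comp (module_category TYPE('m) K (\<lambda>c. c)) (omap F m) (omap F n) (omap G n) (\<alpha> n) (amap F m n A)
      = Comp (module_category TYPE('m) K (\<lambda>c. c)) (omap F m) (omap G m) (omap G n) (amap G m n A) (\<alpha> m)"
    unfolding module_category_sel compose_def
    by (rule restrict_ext) (use nat[OF A] in \<open>simp add: F.app_eq[OF A] G.app_eq[OF A]\<close>)
qed (simp_all only: mat_category_sel module_category_sel hom extensional_UNIV UNIV_I)

text \<open>
  Naturality with respect to the matrices with fewer rows.
\<close>

lemma maps_Prim:
  assumes \<alpha>: "\<alpha> \<in> transformations" and x: "x \<in> F.Prim n"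
  shows "\<alpha> n x \<in> G.Prim n"
proof -
  note \<alpha>n = nat_trans_component[OF \<alpha>]
  have "G.app s (\<alpha> n x) = \<zero>\<^bsub>G.V r\<^esub>" if "r < n" "s \<in> carrier_mat r n" for r s
    using nat_trans_app[OF \<alpha> that(2) F.Prim_closed[OF x]] F.app_Prim[OF x that]
      mhom_zero[OF F.V_left_module G.V_left_module \<alpha>n] by simp
  then show ?thesis using mhomD(1)[OF \<alpha>n F.Prim_closed[OF x]] by (simp add: G.Prim_def)
qed

lemma restrict_Prim_mhom:
  assumes \<alpha>: "\<alpha> \<in> transformations"
  shows "restrict (\<alpha> n) (F.Prim n) \<in> mhom (group_ring K (GL TYPE('f) n)) (F.Prim_module n) (G.Prim_module n)"
proof -
  interpret KG: finite_group_ring K "GL TYPE('f) n" by (rule finite_group_ring_GL[OF F.K.cring_axioms])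
  note \<alpha>n = nat_trans_component[OF \<alpha>, of n]
  have "restrict (\<alpha> n) (carrier (F.Prim_module n)) \<in> mhom (group_ring K (GL TYPE('f) n)) (F.Prim_module n) (G.Prim_module n)"
  proof (rule KG.mhom_KG_I[OF F.Prim_module_left_module G.Prim_module_left_module], unfold F.Prim_module_sel G.Prim_module_sel)
    fix x assume x: "x \<in> F.Prim n"
    then have x': "x \<in> carrier (F.V n)" by (rule F.Prim_closed)
    show "\<alpha> n x \<in> G.Prim n" by (rule maps_Prim[OF \<alpha> x])
    show "\<alpha> n (x \<oplus>\<^bsub>F.V n\<^esub> y) = \<alpha> n x \<oplus>\<^bsub>G.V n\<^esub> \<alpha> n y" if "y \<in> F.Prim n" for y
      by (rule mhomD(2)[OF \<alpha>n x' F.Prim_closed[OF that]])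
    show "\<alpha> n (KG.\<iota> c \<odot>\<^bsub>F.Prim_module n\<^esub> x) = KG.\<iota> c \<odot>\<^bsub>G.Prim_module n\<^esub> \<alpha> n x" if "c \<in> carrier K" for c
      using mhomD(3)[OF \<alpha>n that x'] F.Prim_module_smult_\<iota>[OF that x] G.Prim_module_smult_\<iota>[OF that maps_Prim[OF \<alpha> x]] by simp
    show "\<alpha> n (KG.\<delta> g \<odot>\<^bsub>F.Prim_module n\<^esub> x) = KG.\<delta> g \<odot>\<^bsub>G.Prim_module n\<^esub> \<alpha> n x" if g: "g \<in> carrier (GL TYPE('f) n)" for g
    proof -
      have "g \<in> carrier_mat n n" using g by (simp add: GL_sel)
      from nat_trans_app[OF \<alpha> this x'] show ?thesis
        using F.Prim_module_smult_\<delta>[OF g x] G.Prim_module_smult_\<delta>[OF g maps_Prim[OF \<alpha> x]] by simp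
    qed
  qed
  then show ?thesis by (simp only: F.Prim_module_sel)
qed

end

locale kovacs_rep_pair = F: kovacs_rep K \<epsilon> F + G: kovacs_rep K \<epsilon> G
  for K :: "'k ring" and \<epsilon> :: "nat \<Rightarrow> 'f :: {finite, field} mat \<Rightarrow> 'k"
    and F G :: "(nat, 'f mat, ('k, 'm) module, 'm \<Rightarrow> 'm) fctr"
begin

sublocale matrix_rep_pair K F G by unfold_locales

lemma transformation_determined_by_Prim:
  assumes \<alpha>: "\<alpha> \<in> transformations" and \<beta>: "\<beta> \<in> transformations"
    and eq: "\<And>n. restrict (\<alpha> n) (F.Prim n) = restrict (\<beta> n) (F.Prim n)"
  shows "\<alpha> = \<beta>"
proof (rule ext)
  fix n
  note \<alpha>n = nat_trans_component[OF \<alpha>] and \<beta>n = nat_trans_component[OF \<beta>]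
  have "\<alpha> n x = \<beta> n x" if "x \<in> carrier (F.V n)" for x
  proof (rule F.generated_by_Prim[where P = "\<lambda>n x. \<alpha> n x = \<beta> n x", OF _ _ _ _ that])
    show "\<alpha> m x = \<beta> m x" if "x \<in> F.Prim m" for m x using eq[of m] that by (metis restrict_apply')
  qed (simp_all add: mhomD[OF \<alpha>n] mhomD[OF \<beta>n] nat_trans_app[OF \<alpha>] nat_trans_app[OF \<beta>])
  then show "\<alpha> n = \<beta> n" by (rule mhom_eqI[OF \<alpha>n \<beta>n])
qed

end

text \<open>
  Maps between the modules \<open>Prim_module n\<close> extend to a transformation of the representations. Its graph consists of
  the pairs \<open>(x, y)\<close> such that \<open>\<theta>\<close> matches all the elements \<open>E m (app t x)\<close> and \<open>E m (app t y)\<close>.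
  These determine \<open>y\<close>, and the \<open>x\<close> that occur form a subrepresentation containing all \<open>Prim n\<close>.
\<close>

locale prim_maps = kovacs_rep_pair K \<epsilon> F G
  for K :: "'k ring" and \<epsilon> :: "nat \<Rightarrow> 'f :: {finite, field} mat \<Rightarrow> 'k"
    and F G :: "(nat, 'f mat, ('k, 'm) module, 'm \<Rightarrow> 'm) fctr" +
  fixes \<theta> :: "nat \<Rightarrow> 'm \<Rightarrow> 'm"
  assumes \<theta>: "\<theta> n \<in> mhom (group_ring K (GL TYPE('f) n)) (F.Prim_module n) (G.Prim_module n)"
begin

lemma \<theta>_closed: "x \<in> F.Prim n \<Longrightarrow> \<theta> n x \<in> G.Prim n"
  using mhomD(1)[OF \<theta>] by (simp only: F.Prim_module_sel G.Prim_module_sel)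

lemma \<theta>_add: "\<lbrakk>x \<in> F.Prim n; y \<in> F.Prim n\<rbrakk> \<Longrightarrow> \<theta> n (x \<oplus>\<^bsub>F.V n\<^esub> y) = \<theta> n x \<oplus>\<^bsub>G.V n\<^esub> \<theta> n y"
  using mhomD(2)[OF \<theta>] by (simp only: F.Prim_module_sel G.Prim_module_sel)

lemma \<theta>_zero: "\<theta> n \<zero>\<^bsub>F.V n\<^esub> = \<zero>\<^bsub>G.V n\<^esub>"
  using mhom_zero[OF F.Prim_module_left_module G.Prim_module_left_module \<theta>] by (simp only: F.Prim_module_sel G.Prim_module_sel)

lemma \<theta>_smult:
  assumes c: "c \<in> carrier K" and x: "x \<in> F.Prim n"
  shows "\<theta> n (c \<odot>\<^bsub>F.V n\<^esub> x) = c \<odot>\<^bsub>G.V n\<^esub> \<theta> n x"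
proof -
  interpret KG: finite_group_ring K "GL TYPE('f) n" by (rule finite_group_ring_GL[OF F.K.cring_axioms])
  have "\<theta> n (KG.\<iota> c \<odot>\<^bsub>F.Prim_module n\<^esub> x) = KG.\<iota> c \<odot>\<^bsub>G.Prim_module n\<^esub> \<theta> n x"
    by (rule mhomD(3)[OF \<theta> KG.\<iota>_closed[OF c]]) (simp add: F.Prim_module_sel x)
  then show ?thesis unfolding F.Prim_module_smult_\<iota>[OF c x] G.Prim_module_smult_\<iota>[OF c \<theta>_closed[OF x]] .
qed

lemma \<theta>_app:
  assumes g: "g \<in> carrier (GL TYPE('f) n)" and x: "x \<in> F.Prim n"
  shows "\<theta> n (F.app g x) = G.app g (\<theta> n x)"
proof -
  interpret KG: finite_group_ring K "GL TYPE('f) n" by (rule finite_group_ring_GL[OF F.K.cring_axioms])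
  have "\<theta> n (KG.\<delta> g \<odot>\<^bsub>F.Prim_module n\<^esub> x) = KG.\<delta> g \<odot>\<^bsub>G.Prim_module n\<^esub> \<theta> n x"
    by (rule mhomD(3)[OF \<theta> KG.\<delta>_closed]) (simp add: F.Prim_module_sel x)
  then show ?thesis unfolding F.Prim_module_smult_\<delta>[OF g x] G.Prim_module_smult_\<delta>[OF g \<theta>_closed[OF x]] .
qed

definition graph :: "nat \<Rightarrow> 'm \<Rightarrow> 'm \<Rightarrow> bool" where
  "graph n x y \<longleftrightarrow> x \<in> carrier (F.V n) \<and> y \<in> carrier (G.V n) \<and>
     (\<forall>m. \<forall>t \<in> carrier_mat m n. G.E m (G.app t y) = \<theta> m (F.E m (F.app t x)))"

lemma graphD:
  assumes "graph n x y"
  shows "x \<in> carrier (F.V n)" "y \<in> carrier (G.V n)"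
    "t \<in> carrier_mat m n \<Longrightarrow> G.E m (G.app t y) = \<theta> m (F.E m (F.app t x))"
  using assms by (simp_all add: graph_def)

lemma graphI:
  assumes "x \<in> carrier (F.V n)" "y \<in> carrier (G.V n)"
    "\<And>m t. t \<in> carrier_mat m n \<Longrightarrow> G.E m (G.app t y) = \<theta> m (F.E m (F.app t x))"
  shows "graph n x y"
  using assms by (simp add: graph_def)

lemma graph_add:
  assumes xy: "graph n x y" and xy': "graph n x' y'"
  shows "graph n (x \<oplus>\<^bsub>F.V n\<^esub> x') (y \<oplus>\<^bsub>G.V n\<^esub> y')"
proof (rule graphI)
  note d = graphD[OF xy] and d' = graphD[OF xy']
  show "x \<oplus>\<^bsub>F.V n\<^esub> x' \<in> carrier (F.V n)" by (rule left_module_rules(1)[OF F.V_left_module d(1) d'(1)])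
  show "y \<oplus>\<^bsub>G.V n\<^esub> y' \<in> carrier (G.V n)" by (rule left_module_rules(1)[OF G.V_left_module d(2) d'(2)])
  fix m and t :: "'f mat" assume t: "t \<in> carrier_mat m n"
  show "G.E m (G.app t (y \<oplus>\<^bsub>G.V n\<^esub> y')) = \<theta> m (F.E m (F.app t (x \<oplus>\<^bsub>F.V n\<^esub> x')))"
    unfolding G.app_add[OF t d(2) d'(2)] F.app_add[OF t d(1) d'(1)]
      G.E_add[OF G.app_closed[OF t d(2)] G.app_closed[OF t d'(2)]]
      F.E_add[OF F.app_closed[OF t d(1)] F.app_closed[OF t d'(1)]]
      \<theta>_add[OF F.E_Prim[OF F.app_closed[OF t d(1)]] F.E_Prim[OF F.app_closed[OF t d'(1)]]]
      d(3)[OF t] d'(3)[OF t] by (rule refl)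
qed

lemma graph_smult:
  assumes xy: "graph n x y" and c: "c \<in> carrier K"
  shows "graph n (c \<odot>\<^bsub>F.V n\<^esub> x) (c \<odot>\<^bsub>G.V n\<^esub> y)"
proof (rule graphI)
  note d = graphD[OF xy]
  show "c \<odot>\<^bsub>F.V n\<^esub> x \<in> carrier (F.V n)" by (rule left_module_rules(7)[OF F.V_left_module c d(1)])
  show "c \<odot>\<^bsub>G.V n\<^esub> y \<in> carrier (G.V n)" by (rule left_module_rules(7)[OF G.V_left_module c d(2)])
  fix m and t :: "'f mat" assume t: "t \<in> carrier_mat m n"
  show "G.E m (G.app t (c \<odot>\<^bsub>G.V n\<^esub> y)) = \<theta> m (F.E m (F.app t (c \<odot>\<^bsub>F.V n\<^esub> x)))"
    unfolding G.app_smult[OF t c d(2)] F.app_smult[OF t c d(1)]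
      G.E_smult[OF G.app_closed[OF t d(2)] c] F.E_smult[OF F.app_closed[OF t d(1)] c]
      \<theta>_smult[OF c F.E_Prim[OF F.app_closed[OF t d(1)]]] d(3)[OF t] by (rule refl)
qed

lemma graph_app:
  assumes xy: "graph m x y" and A: "A \<in> carrier_mat n m"
  shows "graph n (F.app A x) (G.app A y)"
proof (rule graphI)
  note d = graphD[OF xy]
  show "F.app A x \<in> carrier (F.V n)" by (rule F.app_closed[OF A d(1)])
  show "G.app A y \<in> carrier (G.V n)" by (rule G.app_closed[OF A d(2)])
  fix l and t :: "'f mat" assume t: "t \<in> carrier_mat l n"
  show "G.E l (G.app t (G.app A y)) = \<theta> l (F.E l (F.app t (F.app A x)))"
    unfolding G.app_mult[OF A t d(2), symmetric] F.app_mult[OF A t d(1), symmetric]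
    by (rule d(3)[OF mult_carrier_mat[OF t A]])
qed

lemma graph_unique:
  assumes xy: "graph n x y" and xy': "graph n x y'"
  shows "y = y'"
proof -
  interpret Fn: left_module K "F.V n" by (rule F.V_left_module)
  interpret Gn: left_module K "G.V n" by (rule G.V_left_module)
  note d = graphD[OF xy] and d' = graphD[OF xy']
  have "graph n ((\<ominus>\<^bsub>K\<^esub> \<one>\<^bsub>K\<^esub>) \<odot>\<^bsub>F.V n\<^esub> x) ((\<ominus>\<^bsub>K\<^esub> \<one>\<^bsub>K\<^esub>) \<odot>\<^bsub>G.V n\<^esub> y')" by (rule graph_smult[OF xy']) simp
  from graph_add[OF xy this] have "graph n \<zero>\<^bsub>F.V n\<^esub> (y \<ominus>\<^bsub>G.V n\<^esub> y')"
    using d d' by (simp add: Fn.smult_minus_one Gn.smult_minus_one Fn.M.r_neg Gn.M.minus_eq)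
  note z = graphD[OF this]
  have "y \<ominus>\<^bsub>G.V n\<^esub> y' = \<zero>\<^bsub>G.V n\<^esub>"
    by (rule G.zero_if_E_app_zero[OF z(2)]) (simp add: z(3) F.app_zero F.E_zero \<theta>_zero)
  then show ?thesis using d(2) d'(2) by simp
qed

text \<open>
  For \<open>t\<close> with fewer than \<open>n\<close> rows, \<open>x\<close> and \<open>\<theta> n x\<close> are killed by \<open>t\<close>; for more than \<open>n\<close> rows, \<open>E m\<close> kills everything that comes
  from \<open>V n\<close>. Among the square matrices the singular ones kill \<open>Prim n\<close>, and \<open>\<theta> n\<close> is equivariant for the others.
\<close>

lemma graph_Prim:
  assumes x: "x \<in> F.Prim n"
  shows "graph n x (\<theta> n x)"
proof (rule graphI)
  note y = \<theta>_closed[OF x]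
  show x': "x \<in> carrier (F.V n)" by (rule F.Prim_closed[OF x])
  show y': "\<theta> n x \<in> carrier (G.V n)" by (rule G.Prim_closed[OF y])
  fix m and t :: "'f mat" assume t: "t \<in> carrier_mat m n"
  consider "m < n" | "n < m" | "m = n" "\<exists>h \<in> carrier_mat n n. t * h = 1\<^sub>m n"
    | "m = n" "\<And>h. h \<in> carrier_mat n n \<Longrightarrow> t * h \<noteq> 1\<^sub>m n" by (meson linorder_neqE_nat)
  then show "G.E m (G.app t (\<theta> n x)) = \<theta> m (F.E m (F.app t x))"
  proof cases
    case 1
    then show ?thesis using F.app_Prim[OF x 1 t] G.app_Prim[OF y 1 t] by (simp add: F.E_zero G.E_zero \<theta>_zero)
  next
    case 2
    then show ?thesis using F.E_app_lower[OF 2 t x'] G.E_app_lower[OF 2 t y'] by (simp add: \<theta>_zero)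
  next
    case 3
    then have g: "t \<in> carrier (GL TYPE('f) n)" "t \<in> carrier_mat n n" using t by (simp_all add: GL_sel)
    show ?thesis unfolding 3(1) F.E_of_Prim[OF F.app_invertible_Prim[OF x g(2)]]
        G.E_of_Prim[OF G.app_invertible_Prim[OF y g(2)]] \<theta>_app[OF g(1) x] by (rule refl)
  next
    case 4
    have t': "t \<in> carrier_mat n n" using t 4(1) by simp
    have "F.app t x = \<zero>\<^bsub>F.V n\<^esub>" by (rule F.app_singular_Prim[OF x t' 4(2)])
    moreover have "G.app t (\<theta> n x) = \<zero>\<^bsub>G.V n\<^esub>" by (rule G.app_singular_Prim[OF y t' 4(2)])
    ultimately show ?thesis by (simp add: 4(1) F.E_zero G.E_zero \<theta>_zero)
  qed
qed

lemma graph_total: "x \<in> carrier (F.V n) \<Longrightarrow> \<exists>y. graph n x y"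
  by (rule F.generated_by_Prim[where P = "\<lambda>n x. \<exists>y. graph n x y"])
    (blast intro: graph_Prim graph_add graph_smult graph_app)+

definition extension :: "nat \<Rightarrow> 'm \<Rightarrow> 'm" where
  "extension n = (\<lambda>x \<in> carrier (F.V n). THE y. graph n x y)"

lemma graph_extension: "x \<in> carrier (F.V n) \<Longrightarrow> graph n x (extension n x)"
  using graph_total[of x n] graph_unique by (auto simp: extension_def intro: theI2)

lemma extension_eqI: "graph n x y \<Longrightarrow> extension n x = y"
  using graph_extension[OF graphD(1)] graph_unique by blast

lemma extension_transformation: "extension \<in> transformations"
proof (rule transformationI)
  note ge = graph_extension
  show "extension n \<in> mhom K (F.V n) (G.V n)" for n
    by (rule mhomI)
      (use graphD(2)[OF ge] extension_eqI[OF graph_add[OF ge ge]] extension_eqI[OF graph_smult[OF ge]] in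
        \<open>auto simp: extension_def extensional_def\<close>)
  show "extension n (F.app A x) = G.app A (extension m x)"
    if "A \<in> carrier_mat n m" "x \<in> carrier (F.V m)" for m n x and A :: "'f mat"
    by (rule extension_eqI[OF graph_app[OF ge[OF that(2)] that(1)]])
qed

text \<open>
  Together with \<open>extension_transformation\<close> this says that \<open>\<theta>\<close> is in the image of the functor.
\<close>

lemma extension_Prim: "restrict (extension n) (F.Prim n) = \<theta> n"
proof (rule extensionalityI[of _ "F.Prim n"])
  show "\<theta> n \<in> extensional (F.Prim n)" using mhomD(4)[OF \<theta>] by (simp only: F.Prim_module_sel)
  show "restrict (extension n) (F.Prim n) x = \<theta> n x" if "x \<in> F.Prim n" for x
    using extension_eqI[OF graph_Prim[OF that]] that by simp
qed simp

end

definition prim_functor ::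
    "((nat, 'f :: {finite, field} mat, ('k, 'm) module, 'm \<Rightarrow> 'm) fctr, nat \<Rightarrow> 'm \<Rightarrow> 'm,
      nat \<Rightarrow> ('f mat \<Rightarrow> 'k, 'm) module, nat \<Rightarrow> 'm \<Rightarrow> 'm) fctr" where
  "prim_functor = \<lparr>omap = matrix_rep.Prim_module, amap = (\<lambda>F G \<alpha> n. restrict (\<alpha> n) (matrix_rep.Prim F n))\<rparr>"

lemma prim_functor_sel:
  "omap prim_functor F = matrix_rep.Prim_module F"
  "amap prim_functor F G = (\<lambda>\<alpha> n. restrict (\<alpha> n) (matrix_rep.Prim F n))"
  by (simp_all add: prim_functor_def)

abbreviation mat_reps where
  "mat_reps tf tm K \<equiv> functor_category (mat_category tf) (module_category tm K (\<lambda>c. c))"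

lemma GL_modules_sel:
  "Obj (product_category (GL_modules TYPE('f :: {finite, field}) TYPE('m) K)) = {N. \<forall>n. left_module (group_ring K (GL TYPE('f) n)) (N n)}"
  "Hom (product_category (GL_modules TYPE('f) TYPE('m) K)) M N = {f. \<forall>n. f n \<in> mhom (group_ring K (GL TYPE('f) n)) (M n) (N n)}"
  "Ident (product_category (GL_modules TYPE('f) TYPE('m) K)) M = (\<lambda>n. \<lambda>x \<in> carrier (M n). x)"
  "Comp (product_category (GL_modules TYPE('f) TYPE('m) K)) L M N g f = (\<lambda>n. compose (carrier (L n)) (g n) (f n))"
  "Hadd (product_category (GL_modules TYPE('f) TYPE('m) K)) M N f g = (\<lambda>n. \<lambda>x \<in> carrier (M n). f n x \<oplus>\<^bsub>N n\<^esub> g n x)"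
  "Hsmult (product_category (GL_modules TYPE('f) TYPE('m) K)) M N c f =
    (\<lambda>n. \<lambda>x \<in> carrier (M n). group_ring_of_scalar K (GL TYPE('f) n) c \<odot>\<^bsub>N n\<^esub> f n x)"
  by (simp_all add: product_category_sel GL_modules_def module_category_sel)

lemma prim_functor_linear:
  assumes K: "cring K"
  shows "is_linear_functor K (mat_reps TYPE('f :: {finite, field}) TYPE('m) K)
    (product_category (GL_modules TYPE('f) TYPE('m) K)) prim_functor"
    (is "is_linear_functor K ?R ?P ?\<Phi>")
proof -
  have rep: "matrix_rep K F" if "F \<in> Obj ?R" for F
    using that by (intro matrix_rep.intro matrix_rep_axioms.intro K) (simp only: functor_category_sel mem_Collect_eq)
  have pair: "matrix_rep_pair K F G" if "F \<in> Obj ?R" "G \<in> Obj ?R" for F G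
    using that by (intro matrix_rep_pair.intro rep)
  have arrow: "amap ?\<Phi> F G \<alpha> \<in> Hom ?P (omap ?\<Phi> F) (omap ?\<Phi> G)"
    if "F \<in> Obj ?R" "G \<in> Obj ?R" "\<alpha> \<in> Hom ?R F G" for F G \<alpha>
    using matrix_rep_pair.restrict_Prim_mhom[OF pair[OF that(1,2)], of \<alpha>] that(3)
    unfolding GL_modules_sel prim_functor_sel functor_category_sel by blast
  have "is_functor ?R ?P ?\<Phi>"
    unfolding is_functor_def
  proof (intro conjI ballI)
    show "omap ?\<Phi> F \<in> Obj ?P" if "F \<in> Obj ?R" for F
      using matrix_rep.Prim_module_left_module[OF rep[OF that]] by (simp add: GL_modules_sel prim_functor_sel)
    show "amap ?\<Phi> F G \<alpha> \<in> Hom ?P (omap ?\<Phi> F) (omap ?\<Phi> G)"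
      if "F \<in> Obj ?R" "G \<in> Obj ?R" "\<alpha> \<in> Hom ?R F G" for F G \<alpha> by (rule arrow[OF that])
    show "amap ?\<Phi> F F (Ident ?R F) = Ident ?P (omap ?\<Phi> F)" if "F \<in> Obj ?R" for F
    proof -
      interpret F: matrix_rep K F by (rule rep[OF that])
      show ?thesis
        unfolding GL_modules_sel prim_functor_sel functor_category_sel mat_category_sel module_category_sel F.Prim_module_sel
        by (intro ext) (auto simp: F.Prim_closed restrict_def)
    qed
    show "amap ?\<Phi> F H (Comp ?R F G H \<beta> \<alpha>) = Comp ?P (omap ?\<Phi> F) (omap ?\<Phi> G) (omap ?\<Phi> H) (amap ?\<Phi> G H \<beta>) (amap ?\<Phi> F G \<alpha>)"
      if F: "F \<in> Obj ?R" and G: "G \<in> Obj ?R" and "H \<in> Obj ?R" and \<alpha>: "\<alpha> \<in> Hom ?R F G" and "\<beta> \<in> Hom ?R G H" for F G H \<alpha> \<beta>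
    proof -
      interpret FG: matrix_rep_pair K F G by (rule pair[OF F G])
      have "\<alpha> n x \<in> FG.G.Prim n" if "x \<in> FG.F.Prim n" for n x
        using FG.maps_Prim \<alpha> that unfolding functor_category_sel by blast
      then show ?thesis
        unfolding GL_modules_sel prim_functor_sel functor_category_sel mat_category_sel module_category_sel FG.F.Prim_module_sel
        by (intro ext) (auto simp: FG.F.Prim_closed restrict_def compose_def)
    qed
  qed
  moreover have "amap ?\<Phi> F G \<in> module_hom K (hom_module ?R F G) (hom_module ?P (omap ?\<Phi> F) (omap ?\<Phi> G))"
    if F: "F \<in> Obj ?R" and G: "G \<in> Obj ?R" for F G
  proof -
    interpret FG: matrix_rep_pair K F G by (rule pair[OF F G])
    have mp: "\<alpha> n x \<in> FG.G.Prim n" if "\<alpha> \<in> Hom ?R F G" "x \<in> FG.F.Prim n" for \<alpha> n x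
      using FG.maps_Prim that unfolding functor_category_sel by blast
    have "amap ?\<Phi> F G (Hadd ?R F G \<alpha> \<beta>) = Hadd ?P (omap ?\<Phi> F) (omap ?\<Phi> G) (amap ?\<Phi> F G \<alpha>) (amap ?\<Phi> F G \<beta>)" for \<alpha> \<beta>
      unfolding GL_modules_sel prim_functor_sel functor_category_sel mat_category_sel module_category_sel FG.F.Prim_module_sel FG.G.Prim_module_sel
      by (intro ext) (auto simp: FG.F.Prim_closed restrict_def)
    moreover have "amap ?\<Phi> F G (Hsmult ?R F G c \<alpha>) = Hsmult ?P (omap ?\<Phi> F) (omap ?\<Phi> G) c (amap ?\<Phi> F G \<alpha>)"
      if c: "c \<in> carrier K" and \<alpha>: "\<alpha> \<in> Hom ?R F G" for c \<alpha>
      unfolding GL_modules_sel prim_functor_sel functor_category_sel mat_category_sel module_category_sel FG.F.Prim_module_sel FG.G.Prim_module_sel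
      using mp[OF \<alpha>] by (intro ext) (auto simp: FG.F.Prim_closed restrict_def FG.G.Prim_module_smult_\<iota>[OF c])
    ultimately show ?thesis
      using arrow[OF F G] unfolding module_hom_def hom_module_sel by blast
  qed
  ultimately show ?thesis unfolding is_linear_functor_def by blast
qed

lemma prim_functor_bij:
  assumes \<epsilon>: "kovacs_elements K (\<epsilon> :: nat \<Rightarrow> 'f :: {finite, field} mat \<Rightarrow> 'k)"
    and F: "F \<in> Obj (mat_reps TYPE('f) TYPE('m) K)" and G: "G \<in> Obj (mat_reps TYPE('f) TYPE('m) K)"
  shows "bij_betw (amap prim_functor F G) (Hom (mat_reps TYPE('f) TYPE('m) K) F G)
    (Hom (product_category (GL_modules TYPE('f) TYPE('m) K)) (omap prim_functor F) (omap prim_functor G))"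
proof -
  interpret \<epsilon>: kovacs_elements K \<epsilon> by (rule \<epsilon>)
  have rep: "kovacs_rep K \<epsilon> F" if "F \<in> Obj (mat_reps TYPE('f) TYPE('m) K)" for F :: "(nat, 'f mat, ('k, 'm) module, 'm \<Rightarrow> 'm) fctr"
    using that by (intro kovacs_rep.intro matrix_rep.intro matrix_rep_axioms.intro \<epsilon> \<epsilon>.K.cring_axioms)
      (simp only: functor_category_sel mem_Collect_eq)
  interpret FG: kovacs_rep_pair K \<epsilon> F G by (intro kovacs_rep_pair.intro rep F G)
  show ?thesis
    unfolding prim_functor_sel GL_modules_sel functor_category_sel
  proof (rule bij_betw_imageI)
    show "inj_on (\<lambda>\<alpha> n. restrict (\<alpha> n) (FG.F.Prim n)) FG.transformations"
      by (rule inj_onI) (rule FG.transformation_determined_by_Prim, auto dest: fun_cong)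
    have "\<theta> \<in> (\<lambda>\<alpha> n. restrict (\<alpha> n) (FG.F.Prim n)) ` FG.transformations"
      if "\<forall>n. \<theta> n \<in> mhom (group_ring K (GL TYPE('f) n)) (FG.F.Prim_module n) (FG.G.Prim_module n)" for \<theta>
    proof -
      interpret prim_maps K \<epsilon> F G \<theta>
        using that by (intro prim_maps.intro prim_maps_axioms.intro FG.kovacs_rep_pair_axioms) blast
      show ?thesis by (rule image_eqI[OF _ extension_transformation]) (simp add: extension_Prim)
    qed
    then show "(\<lambda>\<alpha> n. restrict (\<alpha> n) (FG.F.Prim n)) ` FG.transformations =
      {\<theta>. \<forall>n. \<theta> n \<in> mhom (group_ring K (GL TYPE('f) n)) (FG.F.Prim_module n) (FG.G.Prim_module n)}"
      using FG.restrict_Prim_mhom by blast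
  qed
qed

section \<open>A representation with prescribed modules\<close>

text \<open>
  An infinite type absorbs finitely many of its elements into one: the tuples of fixed finite length embed
  into it.
\<close>

lemma ex_code_of_restrictions:
  assumes inf: "infinite (UNIV :: 'm set)" and "finite S"
  shows "\<exists>c :: ('a \<Rightarrow> 'm) \<Rightarrow> 'm. \<forall>\<phi> \<psi>. c \<phi> = c \<psi> \<longrightarrow> (\<forall>s \<in> S. \<phi> s = \<psi> s)"
  using \<open>finite S\<close>
proof (induction S rule: finite_induct)
  case empty
  then show ?case by simp
next
  case (insert a S)
  obtain e :: "'m \<times> 'm \<Rightarrow> 'm" where e: "inj e" by (rule ex_inj_pair[OF inf])
  obtain c :: "('a \<Rightarrow> 'm) \<Rightarrow> 'm" where c: "\<forall>\<phi> \<psi>. c \<phi> = c \<psi> \<longrightarrow> (\<forall>s \<in> S. \<phi> s = \<psi> s)"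
    using insert.IH by blast
  have "\<forall>s \<in> insert a S. \<phi> s = \<psi> s" if "e (\<phi> a, c \<phi>) = e (\<psi> a, c \<psi>)" for \<phi> \<psi> :: "'a \<Rightarrow> 'm"
  proof -
    have "\<phi> a = \<psi> a" "c \<phi> = c \<psi>" using injD[OF e that] by simp_all
    then show ?thesis using c by blast
  qed
  then show ?case by (intro exI[of _ "\<lambda>\<phi>. e (\<phi> a, c \<phi>)"]) blast
qed

lemma GL_dim: "g \<in> carrier (GL TYPE('f :: {finite, field}) n) \<Longrightarrow> dim_row g = n \<and> dim_col g = n"
  by (simp add: GL_sel) (auto dest: carrier_matD)

locale GL_actions = K: cring K
  for K :: "'k ring" +
  fixes U :: "nat \<Rightarrow> ('k, 'm) module" and act :: "nat \<Rightarrow> 'f :: {finite, field} mat \<Rightarrow> 'm \<Rightarrow> 'm"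
  assumes action: "linear_action K (GL TYPE('f) n) (U n) (act n)"
    and inf: "infinite (UNIV :: 'm set)"
begin

sublocale A: linear_action K "GL TYPE('f) n" "U n" "act n" for n by (rule action)

lemma U_left_module: "left_module K (U n)"
  by (rule left_module_of_module) (rule A.M.module_axioms)

lemmas U_rules = left_module_rules[OF U_left_module]

lemma U_smult_zero: "c \<in> carrier K \<Longrightarrow> c \<odot>\<^bsub>U n\<^esub> \<zero>\<^bsub>U n\<^esub> = \<zero>\<^bsub>U n\<^esub>"
  by (rule left_module.smult_zero_right[OF U_left_module])

definition right_invertible :: "'f mat \<Rightarrow> bool" where
  "right_invertible s \<longleftrightarrow> (\<exists>h \<in> carrier_mat (dim_col s) (dim_row s). s * h = 1\<^sub>m (dim_row s))"

lemma right_invertible_dim: "right_invertible s \<Longrightarrow> dim_row s \<le> dim_col s"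
  unfolding right_invertible_def using dim_le_of_right_inverse[of s "dim_row s" "dim_col s"] by blast

lemma right_invertible_square: "dim_col s = dim_row s \<Longrightarrow> right_invertible s \<longleftrightarrow> s \<in> carrier (GL TYPE('f) (dim_row s))"
  by (auto simp: right_invertible_def GL_sel)

lemma right_invertible_mult:
  assumes "right_invertible (t * A)" "dim_col t = dim_row A"
  shows "right_invertible t"
proof -
  obtain h where h: "h \<in> carrier_mat (dim_col A) (dim_row t)" "t * A * h = 1\<^sub>m (dim_row t)"
    using assms(1) by (auto simp: right_invertible_def)
  then have "t * (A * h) = 1\<^sub>m (dim_row t)" using mat_assoc[of t A h] assms(2) by simp
  moreover have "A * h \<in> carrier_mat (dim_col t) (dim_row t)"
    by (rule mult_carrier_mat[of _ _ "dim_col A"]) (use h(1) assms(2) in simp_all)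
  ultimately show ?thesis unfolding right_invertible_def by blast
qed

text \<open>
  The value at \<open>d\<close> of the representation with prescribed modules \<open>U n\<close>. The index \<open>n\<close> of the module in which \<open>\<phi> s\<close> lies is the
  number of rows of \<open>s\<close>, so that one function covers all \<open>n\<close>. Matrices act by multiplying the argument on the right;
  this keeps functions vanishing off the right invertible matrices, because \<open>t\<close> is right invertible if \<open>t A\<close> is.
\<close>

definition equivariant :: "nat \<Rightarrow> ('f mat \<Rightarrow> 'm) set" where
  "equivariant d = {\<phi> \<in> (\<Pi>\<^sub>E s \<in> {s. dim_col s = d}. carrier (U (dim_row s))).
     (\<forall>g s. g \<in> carrier (GL TYPE('f) (dim_row s)) \<longrightarrow> dim_col s = d \<longrightarrow> \<phi> (g * s) = act (dim_row s) g (\<phi> s)) \<and>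
     (\<forall>s. dim_col s = d \<longrightarrow> \<not> right_invertible s \<longrightarrow> \<phi> s = \<zero>\<^bsub>U (dim_row s)\<^esub>)}"

lemma equivariantD:
  assumes "\<phi> \<in> equivariant d"
  shows "dim_col s = d \<Longrightarrow> \<phi> s \<in> carrier (U (dim_row s))" "\<phi> \<in> extensional {s. dim_col s = d}"
    "\<lbrakk>g \<in> carrier (GL TYPE('f) (dim_row s)); dim_col s = d\<rbrakk> \<Longrightarrow> \<phi> (g * s) = act (dim_row s) g (\<phi> s)"
    "\<lbrakk>dim_col s = d; \<not> right_invertible s\<rbrakk> \<Longrightarrow> \<phi> s = \<zero>\<^bsub>U (dim_row s)\<^esub>"
  using assms unfolding equivariant_def by (auto simp: PiE_def)

lemma equivariantI:
  assumes "\<And>s. dim_col s = d \<Longrightarrow> \<phi> s \<in> carrier (U (dim_row s))"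
    "\<And>g s. \<lbrakk>g \<in> carrier (GL TYPE('f) (dim_row s)); dim_col s = d\<rbrakk> \<Longrightarrow> \<phi> (g * s) = act (dim_row s) g (\<phi> s)"
    "\<And>s. \<lbrakk>dim_col s = d; \<not> right_invertible s\<rbrakk> \<Longrightarrow> \<phi> s = \<zero>\<^bsub>U (dim_row s)\<^esub>"
  shows "restrict \<phi> {s. dim_col s = d} \<in> equivariant d"
  unfolding equivariant_def using assms by auto

lemma equivariant_eqI:
  assumes \<phi>: "\<phi> \<in> equivariant d" and \<psi>: "\<psi> \<in> equivariant d"
    and eq: "\<And>s. \<lbrakk>dim_col s = d; right_invertible s\<rbrakk> \<Longrightarrow> \<phi> s = \<psi> s"
  shows "\<phi> = \<psi>"
proof (rule extensionalityI[OF equivariantD(2)[OF \<phi>] equivariantD(2)[OF \<psi>]])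
  fix s :: "'f mat" assume "s \<in> {s. dim_col s = d}"
  then have s: "dim_col s = d" by simp
  show "\<phi> s = \<psi> s"
    using eq[OF s] equivariantD(4)[OF \<phi> s] equivariantD(4)[OF \<psi> s] by (cases "right_invertible s") simp_all
qed

definition equivariant_module :: "nat \<Rightarrow> ('k, 'f mat \<Rightarrow> 'm) module" where
  "equivariant_module d = \<lparr>carrier = equivariant d, mult = undefined, one = undefined,
     zero = (\<lambda>s \<in> {s. dim_col s = d}. \<zero>\<^bsub>U (dim_row s)\<^esub>),
     add = (\<lambda>\<phi> \<psi>. \<lambda>s \<in> {s. dim_col s = d}. \<phi> s \<oplus>\<^bsub>U (dim_row s)\<^esub> \<psi> s),
     smult = (\<lambda>c \<phi>. \<lambda>s \<in> {s. dim_col s = d}. c \<odot>\<^bsub>U (dim_row s)\<^esub> \<phi> s)\<rparr>"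

lemma equivariant_module_sel:
  "carrier (equivariant_module d) = equivariant d"
  "\<zero>\<^bsub>equivariant_module d\<^esub> = (\<lambda>s \<in> {s. dim_col s = d}. \<zero>\<^bsub>U (dim_row s)\<^esub>)"
  "\<phi> \<oplus>\<^bsub>equivariant_module d\<^esub> \<psi> = (\<lambda>s \<in> {s. dim_col s = d}. \<phi> s \<oplus>\<^bsub>U (dim_row s)\<^esub> \<psi> s)"
  "c \<odot>\<^bsub>equivariant_module d\<^esub> \<phi> = (\<lambda>s \<in> {s. dim_col s = d}. c \<odot>\<^bsub>U (dim_row s)\<^esub> \<phi> s)"
  by (simp_all add: equivariant_module_def)

lemma equivariant_zero: "(\<lambda>s \<in> {s. dim_col s = d}. \<zero>\<^bsub>U (dim_row s)\<^esub>) \<in> equivariant d"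
  by (rule equivariantI) (auto simp: U_rules(2) A.act_zero GL_sel)

lemma equivariant_add:
  assumes \<phi>: "\<phi> \<in> equivariant d" and \<psi>: "\<psi> \<in> equivariant d"
  shows "(\<lambda>s \<in> {s. dim_col s = d}. \<phi> s \<oplus>\<^bsub>U (dim_row s)\<^esub> \<psi> s) \<in> equivariant d"
proof (rule equivariantI)
  note p = equivariantD[OF \<phi>] and q = equivariantD[OF \<psi>]
  fix s :: "'f mat" assume s: "dim_col s = d"
  show "\<phi> s \<oplus>\<^bsub>U (dim_row s)\<^esub> \<psi> s \<in> carrier (U (dim_row s))" by (rule U_rules(1)[OF p(1)[OF s] q(1)[OF s]])
  show "\<phi> (g * s) \<oplus>\<^bsub>U (dim_row (g * s))\<^esub> \<psi> (g * s) = act (dim_row s) g (\<phi> s \<oplus>\<^bsub>U (dim_row s)\<^esub> \<psi> s)"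
    if g: "g \<in> carrier (GL TYPE('f) (dim_row s))" for g
  proof -
    have "dim_row (g * s) = dim_row s" using GL_dim[OF g] by simp
    then show ?thesis
      by (simp only: p(3)[OF g s] q(3)[OF g s] A.act_add[OF g p(1)[OF s] q(1)[OF s]])
  qed
  show "\<phi> s \<oplus>\<^bsub>U (dim_row s)\<^esub> \<psi> s = \<zero>\<^bsub>U (dim_row s)\<^esub>" if "\<not> right_invertible s"
    using p(4)[OF s that] q(4)[OF s that] U_rules(5)[OF U_rules(2)] by simp
qed

lemma equivariant_smult:
  assumes \<phi>: "\<phi> \<in> equivariant d" and c: "c \<in> carrier K"
  shows "(\<lambda>s \<in> {s. dim_col s = d}. c \<odot>\<^bsub>U (dim_row s)\<^esub> \<phi> s) \<in> equivariant d"
proof (rule equivariantI)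
  note p = equivariantD[OF \<phi>]
  fix s :: "'f mat" assume s: "dim_col s = d"
  show "c \<odot>\<^bsub>U (dim_row s)\<^esub> \<phi> s \<in> carrier (U (dim_row s))" by (rule U_rules(7)[OF c p(1)[OF s]])
  show "c \<odot>\<^bsub>U (dim_row (g * s))\<^esub> \<phi> (g * s) = act (dim_row s) g (c \<odot>\<^bsub>U (dim_row s)\<^esub> \<phi> s)"
    if g: "g \<in> carrier (GL TYPE('f) (dim_row s))" for g
  proof -
    have "dim_row (g * s) = dim_row s" using GL_dim[OF g] by simp
    then show ?thesis by (simp only: p(3)[OF g s] A.act_smult[OF g c p(1)[OF s]])
  qed
  show "c \<odot>\<^bsub>U (dim_row s)\<^esub> \<phi> s = \<zero>\<^bsub>U (dim_row s)\<^esub>" if "\<not> right_invertible s"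
    using p(4)[OF s that] U_smult_zero[OF c] by simp
qed

lemma equivariant_left_module: "left_module K (equivariant_module d)"
proof (rule left_module_axiomsI, unfold equivariant_module_sel)
  let ?D = "{s :: 'f mat. dim_col s = d}"
  show "ring K" ..
  fix \<phi> assume \<phi>: "\<phi> \<in> equivariant d"
  note p = equivariantD[OF \<phi>]
  show "\<exists>\<psi> \<in> equivariant d. (\<lambda>s \<in> ?D. \<psi> s \<oplus>\<^bsub>U (dim_row s)\<^esub> \<phi> s) = (\<lambda>s \<in> ?D. \<zero>\<^bsub>U (dim_row s)\<^esub>)"
  proof (rule bexI[OF _ equivariant_smult[OF \<phi> K.a_inv_closed[OF K.one_closed]]], rule restrict_ext)
    fix s assume "s \<in> ?D"
    then have s: "dim_col s = d" by simp
    interpret left_module K "U (dim_row s)" by (rule U_left_module)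
    show "(\<lambda>s \<in> ?D. (\<ominus>\<^bsub>K\<^esub> \<one>\<^bsub>K\<^esub>) \<odot>\<^bsub>U (dim_row s)\<^esub> \<phi> s) s \<oplus>\<^bsub>U (dim_row s)\<^esub> \<phi> s = \<zero>\<^bsub>U (dim_row s)\<^esub>"
      using s p(1)[OF s] by (simp add: smult_minus_one A.M.l_neg)
  qed
  show "(\<lambda>s \<in> ?D. (\<lambda>s \<in> ?D. \<zero>\<^bsub>U (dim_row s)\<^esub>) s \<oplus>\<^bsub>U (dim_row s)\<^esub> \<phi> s) = \<phi>"
    "(\<lambda>s \<in> ?D. \<one>\<^bsub>K\<^esub> \<odot>\<^bsub>U (dim_row s)\<^esub> \<phi> s) = \<phi>"
    by (rule extensionalityI[OF restrict_extensional p(2)]; simp add: U_rules(5,11) p(1))+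
  show "(\<lambda>s \<in> ?D. (a \<oplus>\<^bsub>K\<^esub> b) \<odot>\<^bsub>U (dim_row s)\<^esub> \<phi> s) =
      (\<lambda>s \<in> ?D. (\<lambda>s \<in> ?D. a \<odot>\<^bsub>U (dim_row s)\<^esub> \<phi> s) s \<oplus>\<^bsub>U (dim_row s)\<^esub> (\<lambda>s \<in> ?D. b \<odot>\<^bsub>U (dim_row s)\<^esub> \<phi> s) s)"
    "(\<lambda>s \<in> ?D. (a \<otimes>\<^bsub>K\<^esub> b) \<odot>\<^bsub>U (dim_row s)\<^esub> \<phi> s) =
      (\<lambda>s \<in> ?D. a \<odot>\<^bsub>U (dim_row s)\<^esub> (\<lambda>s \<in> ?D. b \<odot>\<^bsub>U (dim_row s)\<^esub> \<phi> s) s)"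
    if "a \<in> carrier K" "b \<in> carrier K" for a b
    by (rule restrict_ext, simp add: U_rules(8,10) that p(1))+
  fix \<psi> assume \<psi>: "\<psi> \<in> equivariant d"
  note q = equivariantD[OF \<psi>]
  show "(\<lambda>s \<in> ?D. \<phi> s \<oplus>\<^bsub>U (dim_row s)\<^esub> \<psi> s) = (\<lambda>s \<in> ?D. \<psi> s \<oplus>\<^bsub>U (dim_row s)\<^esub> \<phi> s)"
    by (rule restrict_ext) (simp add: U_rules(4)[OF p(1) q(1)])
  show "(\<lambda>s \<in> ?D. a \<odot>\<^bsub>U (dim_row s)\<^esub> (\<lambda>s \<in> ?D. \<phi> s \<oplus>\<^bsub>U (dim_row s)\<^esub> \<psi> s) s) =
      (\<lambda>s \<in> ?D. (\<lambda>s \<in> ?D. a \<odot>\<^bsub>U (dim_row s)\<^esub> \<phi> s) s \<oplus>\<^bsub>U (dim_row s)\<^esub> (\<lambda>s \<in> ?D. a \<odot>\<^bsub>U (dim_row s)\<^esub> \<psi> s) s)"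
    if "a \<in> carrier K" for a
    by (rule restrict_ext) (simp add: U_rules(9) that p(1) q(1))
  fix \<chi> assume \<chi>: "\<chi> \<in> equivariant d"
  note r = equivariantD[OF \<chi>]
  show "(\<lambda>s \<in> ?D. (\<lambda>s \<in> ?D. \<phi> s \<oplus>\<^bsub>U (dim_row s)\<^esub> \<psi> s) s \<oplus>\<^bsub>U (dim_row s)\<^esub> \<chi> s) =
      (\<lambda>s \<in> ?D. \<phi> s \<oplus>\<^bsub>U (dim_row s)\<^esub> (\<lambda>s \<in> ?D. \<psi> s \<oplus>\<^bsub>U (dim_row s)\<^esub> \<chi> s) s)"
    by (rule restrict_ext) (simp add: U_rules(3) p(1) q(1) r(1))
qed (simp_all add: equivariant_zero equivariant_add equivariant_smult)

definition pull :: "'f mat \<Rightarrow> ('f mat \<Rightarrow> 'm) \<Rightarrow> 'f mat \<Rightarrow> 'm" where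
  "pull A \<phi> = (\<lambda>t \<in> {t. dim_col t = dim_row A}. \<phi> (t * A))"

lemma pull_equivariant:
  assumes \<phi>: "\<phi> \<in> equivariant d" and A: "A \<in> carrier_mat d' d"
  shows "pull A \<phi> \<in> equivariant d'"
proof -
  note p = equivariantD[OF \<phi>]
  have dA: "dim_row A = d'" "dim_col A = d" using A by auto
  show ?thesis unfolding pull_def dA(1)
  proof (rule equivariantI)
    fix t :: "'f mat" assume t: "dim_col t = d'"
    show "\<phi> (t * A) \<in> carrier (U (dim_row t))" using p(1)[of "t * A"] dA by simp
    show "\<phi> (g * t * A) = act (dim_row t) g (\<phi> (t * A))" if g: "g \<in> carrier (GL TYPE('f) (dim_row t))" for g
    proof -
      have "g * t * A = g * (t * A)" using GL_dim[OF g] t dA by (intro mat_assoc) simp_all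
      then show ?thesis using p(3)[of g "t * A"] g dA by simp
    qed
    show "\<phi> (t * A) = \<zero>\<^bsub>U (dim_row t)\<^esub>" if "\<not> right_invertible t"
      using p(4)[of "t * A"] right_invertible_mult[of t A] that t dA by auto
  qed
qed

text \<open>
  The values at matrices with at most \<open>d\<close> rows determine an element of \<open>equivariant d\<close>, because a matrix
  with more rows is not right invertible. They are finitely many, so that \<open>equivariant d\<close> embeds into the universe.
\<close>

lemma ex_code: "\<exists>c :: ('f mat \<Rightarrow> 'm) \<Rightarrow> 'm. inj_on c (equivariant d)"
proof -
  let ?S = "\<Union>n \<in> {..d}. (carrier_mat n d :: 'f mat set)"
  have "finite ?S" by (simp add: finite_carrier_mat)
  from ex_code_of_restrictions[OF inf this]
  obtain c :: "('f mat \<Rightarrow> 'm) \<Rightarrow> 'm" where c: "\<forall>\<phi> \<psi>. c \<phi> = c \<psi> \<longrightarrow> (\<forall>s \<in> ?S. \<phi> s = \<psi> s)" by blast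
  have "inj_on c (equivariant d)"
  proof (rule inj_onI)
    fix \<phi> \<psi> assume \<phi>: "\<phi> \<in> equivariant d" and \<psi>: "\<psi> \<in> equivariant d" and eq: "c \<phi> = c \<psi>"
    show "\<phi> = \<psi>"
    proof (rule equivariant_eqI[OF \<phi> \<psi>])
      fix s :: "'f mat" assume "dim_col s = d" "right_invertible s"
      then have "dim_row s \<in> {..d}" "s \<in> carrier_mat (dim_row s) d" using right_invertible_dim[of s] by auto
      then have "s \<in> ?S" by blast
      then show "\<phi> s = \<psi> s" using c eq by blast
    qed
  qed
  then show ?thesis by blast
qed

definition code :: "nat \<Rightarrow> ('f mat \<Rightarrow> 'm) \<Rightarrow> 'm" where
  "code d = (SOME c. inj_on c (equivariant d))"

definition decode :: "nat \<Rightarrow> 'm \<Rightarrow> 'f mat \<Rightarrow> 'm" where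
  "decode d = the_inv_into (equivariant d) (code d)"

lemma inj_code: "inj_on (code d) (equivariant d)"
  unfolding code_def by (rule someI_ex[OF ex_code])

lemma decode_code: "\<phi> \<in> equivariant d \<Longrightarrow> decode d (code d \<phi>) = \<phi>"
  unfolding decode_def by (rule the_inv_into_f_f[OF inj_code])

definition rep :: "(nat, 'f mat, ('k, 'm) module, 'm \<Rightarrow> 'm) fctr" where
  "rep = \<lparr>omap = (\<lambda>d. transport_module (code d) (equivariant_module d)),
    amap = (\<lambda>d d' A. \<lambda>x \<in> code d ` equivariant d. code d' (pull A (decode d x)))\<rparr>"

lemma rep_sel:
  "omap rep d = transport_module (code d) (equivariant_module d)"
  "amap rep d d' A = (\<lambda>x \<in> code d ` equivariant d. code d' (pull A (decode d x)))"
  by (simp_all add: rep_def)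

lemma V_sel:
  "carrier (omap rep d) = code d ` equivariant d" "\<zero>\<^bsub>omap rep d\<^esub> = code d (\<lambda>s \<in> {s. dim_col s = d}. \<zero>\<^bsub>U (dim_row s)\<^esub>)"
  "\<lbrakk>\<phi> \<in> equivariant d; \<psi> \<in> equivariant d\<rbrakk> \<Longrightarrow>
    code d \<phi> \<oplus>\<^bsub>omap rep d\<^esub> code d \<psi> = code d (\<lambda>s \<in> {s. dim_col s = d}. \<phi> s \<oplus>\<^bsub>U (dim_row s)\<^esub> \<psi> s)"
  "\<phi> \<in> equivariant d \<Longrightarrow> c \<odot>\<^bsub>omap rep d\<^esub> code d \<phi> = code d (\<lambda>s \<in> {s. dim_col s = d}. c \<odot>\<^bsub>U (dim_row s)\<^esub> \<phi> s)"
  using transport_module_sel[of "code d" "equivariant_module d"] inj_code[of d]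
  by (simp_all add: rep_sel equivariant_module_sel)

lemma amap_rep: "\<phi> \<in> equivariant d \<Longrightarrow> amap rep d d' A (code d \<phi>) = code d' (pull A \<phi>)"
  by (simp add: rep_sel decode_code)

lemma rep_functor: "is_functor (mat_category TYPE('f)) (module_category TYPE('m) K (\<lambda>c. c)) rep"
  unfolding is_functor_def
proof (intro conjI ballI)
  let ?C = "mat_category TYPE('f)" and ?D = "module_category TYPE('m) K (\<lambda>c. c)"
  show "omap rep d \<in> Obj ?D" for d
    using left_module_transport[OF equivariant_left_module, of "code d" d] inj_code[of d]
    by (simp add: rep_sel module_category_sel equivariant_module_sel)
  show "amap rep d d' A \<in> Hom ?D (omap rep d) (omap rep d')" if A: "A \<in> Hom ?C d d'" for d d' A
  proof -
    from A have A: "A \<in> carrier_mat d' d" by (simp add: mat_category_sel)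
    then have dA: "dim_row A = d'" "dim_col A = d" by auto
    note pe = pull_equivariant[OF _ A]
    have pa: "pull A (\<lambda>s \<in> {s. dim_col s = d}. \<phi> s \<oplus>\<^bsub>U (dim_row s)\<^esub> \<psi> s) =
      (\<lambda>s \<in> {s. dim_col s = d'}. pull A \<phi> s \<oplus>\<^bsub>U (dim_row s)\<^esub> pull A \<psi> s)" for \<phi> \<psi>
      unfolding pull_def dA by (rule restrict_ext) (simp add: dA)
    have ps: "pull A (\<lambda>s \<in> {s. dim_col s = d}. c \<odot>\<^bsub>U (dim_row s)\<^esub> \<phi> s) =
      (\<lambda>s \<in> {s. dim_col s = d'}. c \<odot>\<^bsub>U (dim_row s)\<^esub> pull A \<phi> s)" for c \<phi>
      unfolding pull_def dA by (rule restrict_ext) (simp add: dA)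
    show ?thesis unfolding module_category_sel
    proof (rule mhomI, unfold V_sel(1))
      fix x assume "x \<in> code d ` equivariant d"
      then obtain \<phi> where \<phi>: "\<phi> \<in> equivariant d" "x = code d \<phi>" by blast
      show "amap rep d d' A x \<in> code d' ` equivariant d'" using pe[OF \<phi>(1)] by (simp add: \<phi>(2) amap_rep[OF \<phi>(1)])
      show "amap rep d d' A (c \<odot>\<^bsub>omap rep d\<^esub> x) = c \<odot>\<^bsub>omap rep d'\<^esub> amap rep d d' A x" if "c \<in> carrier K" for c
        using equivariant_smult[OF \<phi>(1) that] \<phi>(1) pe by (simp add: \<phi>(2) V_sel(4) amap_rep ps)
      show "amap rep d d' A (x \<oplus>\<^bsub>omap rep d\<^esub> y) = amap rep d d' A x \<oplus>\<^bsub>omap rep d'\<^esub> amap rep d d' A y"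
        if y: "y \<in> code d ` equivariant d" for y
      proof -
        obtain \<psi> where \<psi>: "\<psi> \<in> equivariant d" "y = code d \<psi>" using y by blast
        show ?thesis using equivariant_add[OF \<phi>(1) \<psi>(1)] \<phi>(1) \<psi>(1) pe by (simp add: \<phi>(2) \<psi>(2) V_sel(3) amap_rep pa)
      qed
    qed (simp add: rep_sel)
  qed
  show "amap rep d d (Ident ?C d) = Ident ?D (omap rep d)" for d
  proof -
    have "pull (1\<^sub>m d) \<phi> = \<phi>" if "\<phi> \<in> equivariant d" for \<phi>
      using equivariantD(2)[OF that] by (intro extensionalityI[of _ "{s. dim_col s = d}"]) (auto simp: pull_def mat_one_right)
    then show ?thesis unfolding mat_category_sel module_category_sel V_sel(1) rep_sel(2)
      by (intro restrict_ext) (auto simp: decode_code)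
  qed
  show "amap rep l n (Comp ?C l m n B A) = Comp ?D (omap rep l) (omap rep m) (omap rep n) (amap rep m n B) (amap rep l m A)"
    if "A \<in> Hom ?C l m" "B \<in> Hom ?C m n" for l m n A B
  proof -
    have A: "A \<in> carrier_mat m l" and B: "B \<in> carrier_mat n m" using that by (simp_all add: mat_category_sel)
    then have dim: "dim_row B = n" "dim_col B = m" "dim_row A = m" by auto
    have pBA: "pull (B * A) \<phi> = pull B (pull A \<phi>)" for \<phi>
    proof -
      have "dim_row (B * A) = n" using dim by simp
      then show ?thesis unfolding pull_def dim by (simp only:, intro restrict_ext) (simp add: mat_assoc dim)
    qed
    note pe = pull_equivariant[OF _ A]
    show ?thesis unfolding mat_category_sel module_category_sel V_sel(1) rep_sel(2) compose_def
    proof (rule restrict_ext)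
      fix x assume "x \<in> code l ` equivariant l"
      then obtain \<phi> where \<phi>: "\<phi> \<in> equivariant l" "x = code l \<phi>" by blast
      show "code n (pull (B * A) (decode l x)) = (\<lambda>x \<in> code m ` equivariant m. code n (pull B (decode m x)))
          ((\<lambda>x \<in> code l ` equivariant l. code m (pull A (decode l x))) x)"
        by (simp add: \<phi> decode_code pe pBA)
    qed
  qed
qed

sublocale matrix_rep K rep
  by (intro matrix_rep.intro matrix_rep_axioms.intro rep_functor K.cring_axioms)

lemma app_code: "\<lbrakk>A \<in> carrier_mat d' d; \<phi> \<in> equivariant d\<rbrakk> \<Longrightarrow> app A (code d \<phi>) = code d' (pull A \<phi>)"
  by (simp add: app_eq amap_rep)

lemma code_eq_zero_iff:
  assumes "\<phi> \<in> equivariant d"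
  shows "code d \<phi> = \<zero>\<^bsub>V d\<^esub> \<longleftrightarrow> (\<forall>s. dim_col s = d \<longrightarrow> \<phi> s = \<zero>\<^bsub>U (dim_row s)\<^esub>)"
proof -
  have "code d \<phi> = \<zero>\<^bsub>V d\<^esub> \<longleftrightarrow> \<phi> = (\<lambda>s \<in> {s. dim_col s = d}. \<zero>\<^bsub>U (dim_row s)\<^esub>)"
    unfolding V_sel(2) using inj_code[of d] assms equivariant_zero by (simp add: inj_on_eq_iff)
  also have "\<dots> \<longleftrightarrow> (\<forall>s. dim_col s = d \<longrightarrow> \<phi> s = \<zero>\<^bsub>U (dim_row s)\<^esub>)"
    using equivariantD(2)[OF assms] by (auto intro!: extensionalityI[of _ "{s. dim_col s = d}"])
  finally show ?thesis .
qed

text \<open>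
  At the level of families, \<open>Prim n\<close> consists of the functions concentrated on square matrices. The values at matrices with
  fewer rows vanish by the definition of \<open>Prim n\<close>, the ones at matrices with more rows because these are never right
  invertible. Conversely, a product \<open>t s\<close> through a smaller dimension is never an invertible square matrix.
\<close>

lemma Prim_code_iff:
  assumes \<phi>: "\<phi> \<in> equivariant n"
  shows "code n \<phi> \<in> Prim n \<longleftrightarrow> (\<forall>s. dim_col s = n \<longrightarrow> dim_row s \<noteq> n \<longrightarrow> \<phi> s = \<zero>\<^bsub>U (dim_row s)\<^esub>)"
proof
  assume x: "code n \<phi> \<in> Prim n"
  show "\<forall>s. dim_col s = n \<longrightarrow> dim_row s \<noteq> n \<longrightarrow> \<phi> s = \<zero>\<^bsub>U (dim_row s)\<^esub>"
  proof (intro allI impI)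
    fix s :: "'f mat" assume s: "dim_col s = n" "dim_row s \<noteq> n"
    show "\<phi> s = \<zero>\<^bsub>U (dim_row s)\<^esub>"
    proof (cases "dim_row s < n")
      case True
      have sc: "s \<in> carrier_mat (dim_row s) n" using s by auto
      have "app s (code n \<phi>) = \<zero>\<^bsub>V (dim_row s)\<^esub>" by (rule app_Prim[OF x True sc])
      then have "pull s \<phi> (1\<^sub>m (dim_row s)) = \<zero>\<^bsub>U (dim_row s)\<^esub>"
        using code_eq_zero_iff[OF pull_equivariant[OF \<phi> sc]] app_code[OF sc \<phi>] by simp
      then show ?thesis by (simp add: pull_def mat_one_left)
    next
      case False
      then show ?thesis using equivariantD(4)[OF \<phi> s(1)] right_invertible_dim[of s] s by linarith
    qed
  qed
next
  assume z: "\<forall>s. dim_col s = n \<longrightarrow> dim_row s \<noteq> n \<longrightarrow> \<phi> s = \<zero>\<^bsub>U (dim_row s)\<^esub>"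
  have "app s (code n \<phi>) = \<zero>\<^bsub>V r\<^esub>" if r: "r < n" and s: "s \<in> carrier_mat r n" for r s
  proof -
    have "\<phi> (t * s) = \<zero>\<^bsub>U (dim_row t)\<^esub>" if t: "dim_col t = r" for t
    proof (cases "dim_row t = n")
      case True
      have "\<not> right_invertible t" using right_invertible_dim[of t] True t r by auto
      then have "\<not> right_invertible (t * s)" using right_invertible_mult[of t s] t s by auto
      then show ?thesis using equivariantD(4)[OF \<phi>, of "t * s"] s by simp
    next
      case False
      then show ?thesis using z[rule_format, of "t * s"] s by simp
    qed
    then have "\<forall>t. dim_col t = r \<longrightarrow> pull s \<phi> t = \<zero>\<^bsub>U (dim_row t)\<^esub>" using s by (auto simp: pull_def)
    then show ?thesis unfolding app_code[OF s \<phi>] using code_eq_zero_iff[OF pull_equivariant[OF \<phi> s]] by blast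
  qed
  then show "code n \<phi> \<in> Prim n" unfolding Prim_def using \<phi> by (simp add: V_sel(1))
qed

text \<open>
  Evaluation at the identity matrix is the isomorphism from \<open>Prim n\<close> to \<open>U n\<close>: an equivariant function on the invertible
  matrices is determined by its value at the identity, which is arbitrary.
\<close>

definition value_at_one :: "nat \<Rightarrow> 'm \<Rightarrow> 'm" where
  "value_at_one n x = decode n x (1\<^sub>m n)"

lemma value_at_one_code: "\<phi> \<in> equivariant n \<Longrightarrow> value_at_one n (code n \<phi>) = \<phi> (1\<^sub>m n)"
  by (simp add: value_at_one_def decode_code)

lemma obtain_code:
  assumes "x \<in> Prim n"
  obtains \<phi> where "\<phi> \<in> equivariant n" "x = code n \<phi>"
  using Prim_closed[OF assms] unfolding V_sel(1) by blast

lemma value_at_one_closed: "x \<in> Prim n \<Longrightarrow> value_at_one n x \<in> carrier (U n)"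
  by (erule obtain_code) (use equivariantD(1)[of _ n "1\<^sub>m n"] in \<open>simp add: value_at_one_code\<close>)

lemma value_at_one_add:
  assumes "x \<in> Prim n" "y \<in> Prim n"
  shows "value_at_one n (x \<oplus>\<^bsub>V n\<^esub> y) = value_at_one n x \<oplus>\<^bsub>U n\<^esub> value_at_one n y"
proof -
  obtain \<phi> \<psi> where "\<phi> \<in> equivariant n" "x = code n \<phi>" "\<psi> \<in> equivariant n" "y = code n \<psi>"
    using obtain_code[OF assms(1)] obtain_code[OF assms(2)] by metis
  then show ?thesis by (simp add: V_sel(3) value_at_one_code equivariant_add)
qed

lemma value_at_one_smult:
  assumes "x \<in> Prim n" "c \<in> carrier K"
  shows "value_at_one n (c \<odot>\<^bsub>V n\<^esub> x) = c \<odot>\<^bsub>U n\<^esub> value_at_one n x"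
proof -
  obtain \<phi> where "\<phi> \<in> equivariant n" "x = code n \<phi>" by (rule obtain_code[OF assms(1)])
  then show ?thesis using assms(2) by (simp add: V_sel(4) value_at_one_code equivariant_smult)
qed

lemma value_at_one_app:
  assumes x: "x \<in> Prim n" and g: "g \<in> carrier (GL TYPE('f) n)"
  shows "value_at_one n (app g x) = act n g (value_at_one n x)"
proof -
  obtain \<phi> where \<phi>: "\<phi> \<in> equivariant n" "x = code n \<phi>" by (rule obtain_code[OF x])
  have g': "g \<in> carrier_mat n n" using g by (simp add: GL_sel)
  have "value_at_one n (app g x) = \<phi> (1\<^sub>m n * g)"
    unfolding \<phi>(2) app_code[OF g' \<phi>(1)] value_at_one_code[OF pull_equivariant[OF \<phi>(1) g']]
    using g' by (simp add: pull_def)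
  also have "\<dots> = \<phi> (g * 1\<^sub>m n)" using g' by (simp add: mat_one_left mat_one_right)
  also have "\<dots> = act n g (\<phi> (1\<^sub>m n))" using equivariantD(3)[OF \<phi>(1), of g "1\<^sub>m n"] g by simp
  finally show ?thesis by (simp add: \<phi> value_at_one_code)
qed

lemma value_at_one_inj: "inj_on (value_at_one n) (Prim n)"
proof (rule inj_onI)
  fix x y assume x: "x \<in> Prim n" and y: "y \<in> Prim n" and eq: "value_at_one n x = value_at_one n y"
  obtain \<phi> where \<phi>: "\<phi> \<in> equivariant n" "x = code n \<phi>" by (rule obtain_code[OF x])
  obtain \<psi> where \<psi>: "\<psi> \<in> equivariant n" "y = code n \<psi>" by (rule obtain_code[OF y])
  have "\<phi> = \<psi>"
  proof (rule equivariant_eqI[OF \<phi>(1) \<psi>(1)])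
    fix s :: "'f mat" assume s: "dim_col s = n" "right_invertible s"
    show "\<phi> s = \<psi> s"
    proof (cases "dim_row s = n")
      case True
      then have g: "s \<in> carrier (GL TYPE('f) n)" using right_invertible_square[of s] s by simp
      have "\<phi> (1\<^sub>m n) = \<psi> (1\<^sub>m n)" using eq by (simp add: \<phi> \<psi> value_at_one_code)
      then have "\<phi> (s * 1\<^sub>m n) = \<psi> (s * 1\<^sub>m n)"
        using equivariantD(3)[OF \<phi>(1), of s "1\<^sub>m n"] equivariantD(3)[OF \<psi>(1), of s "1\<^sub>m n"] g by simp
      then show ?thesis using s(1) by (simp add: mat_one_right)
    next
      case False
      then show ?thesis using Prim_code_iff[OF \<phi>(1)] Prim_code_iff[OF \<psi>(1)] x y s(1) \<phi>(2) \<psi>(2) by simp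
    qed
  qed
  then show "x = y" by (simp add: \<phi>(2) \<psi>(2))
qed

lemma value_at_one_surj:
  assumes u: "u \<in> carrier (U n)"
  shows "u \<in> value_at_one n ` Prim n"
proof -
  define \<phi> where "\<phi> = (\<lambda>s \<in> {s. dim_col s = n}. if s \<in> carrier (GL TYPE('f) n) then act n s u else \<zero>\<^bsub>U (dim_row s)\<^esub>)"
  have dim: "dim_row g = n" "dim_col g = n" if "g \<in> carrier (GL TYPE('f) n)" for g using GL_dim[OF that] by simp_all
  have \<phi>: "\<phi> \<in> equivariant n"
    unfolding \<phi>_def
  proof (rule equivariantI)
    fix s :: "'f mat" assume s: "dim_col s = n"
    show "(if s \<in> carrier (GL TYPE('f) n) then act n s u else \<zero>\<^bsub>U (dim_row s)\<^esub>) \<in> carrier (U (dim_row s))"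
      using A.act_closed[of s n u] u dim by (simp add: U_rules(2))
    show "(if s \<in> carrier (GL TYPE('f) n) then act n s u else \<zero>\<^bsub>U (dim_row s)\<^esub>) = \<zero>\<^bsub>U (dim_row s)\<^esub>" if "\<not> right_invertible s"
    proof -
      have "s \<notin> carrier (GL TYPE('f) n)"
      proof
        assume g: "s \<in> carrier (GL TYPE('f) n)"
        then have "right_invertible s" using right_invertible_square[of s] dim[OF g] by simp
        then show False using that by blast
      qed
      then show ?thesis by simp
    qed
    fix g assume g: "g \<in> carrier (GL TYPE('f) (dim_row s))"
    then have dg: "dim_row g = dim_row s" using GL_dim by blast
    show "(if g * s \<in> carrier (GL TYPE('f) n) then act n (g * s) u else \<zero>\<^bsub>U (dim_row (g * s))\<^esub>) =
      act (dim_row s) g (if s \<in> carrier (GL TYPE('f) n) then act n s u else \<zero>\<^bsub>U (dim_row s)\<^esub>)"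
    proof (cases "dim_row s = n")
      case True
      then have g': "g \<in> carrier (GL TYPE('f) n)" using g by simp
      show ?thesis
      proof (cases "s \<in> carrier (GL TYPE('f) n)")
        case s': True
        then show ?thesis using A.G.m_closed[OF g' s'] A.act_mult[OF g' s' u] True by (simp add: GL_sel(2))
      next
        case False
        have "s \<in> carrier (GL TYPE('f) n)" if gs: "g * s \<in> carrier (GL TYPE('f) n)"
        proof -
          obtain k where k: "k \<in> carrier_mat n n" "g * s * k = 1\<^sub>m n" using gs unfolding GL_sel by blast
          have sc: "s \<in> carrier_mat n n" using s True by auto
          have gc: "g \<in> carrier_mat n n" using g' by (simp add: GL_sel)
          have "g * (s * k) = 1\<^sub>m n" using k mat_assoc[of g s k] sc gc by simp
          then have "s * k * g = 1\<^sub>m n" using mat_mult_left_right_inverse[OF gc mult_carrier_mat[OF sc k(1)]] by simp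
          then have "s * (k * g) = 1\<^sub>m n" using mat_assoc[of s k g] k sc gc by simp
          then show ?thesis using sc k(1) gc by (auto simp: GL_sel intro!: bexI[of _ "k * g"])
        qed
        then show ?thesis using False True dg A.act_zero[OF g'] by auto
      qed
    next
      case False
      then have "s \<notin> carrier (GL TYPE('f) n)" "g * s \<notin> carrier (GL TYPE('f) n)"
        using dim(1)[of s] dim(1)[of "g * s"] dg by auto
      then show ?thesis using A.act_zero[OF g] dg by simp
    qed
  qed
  have "code n \<phi> \<in> Prim n" unfolding Prim_code_iff[OF \<phi>] using dim by (auto simp: \<phi>_def)
  moreover have "value_at_one n (code n \<phi>) = u"
    unfolding value_at_one_code[OF \<phi>] using A.G.one_closed[of n] A.act_one[OF u] by (simp add: \<phi>_def GL_sel(3))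
  ultimately show ?thesis by (intro image_eqI[of _ _ "code n \<phi>"]) simp_all
qed

end

lemma prim_functor_ess_surj:
  fixes N :: "nat \<Rightarrow> ('f :: {finite, field} mat \<Rightarrow> 'k, 'm) module"
  assumes K: "cring K" and inf: "infinite (UNIV :: 'm set)"
    and N: "N \<in> Obj (product_category (GL_modules TYPE('f) TYPE('m) K))"
  shows "\<exists>F \<in> Obj (mat_reps TYPE('f) TYPE('m) K). \<exists>f.
    is_iso (product_category (GL_modules TYPE('f) TYPE('m) K)) (omap prim_functor F) N f"
proof -
  let ?G = "GL TYPE('f)"
  note KG = finite_group_ring_GL[OF K, where ?'f = 'f]
  have Nn: "left_module (group_ring K (?G n)) (N n)" for n using N by (simp add: GL_modules_sel)
  define U where "U n = finite_group_ring.underlying K (?G n) (N n)" for n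
  define act where "act n g x = finite_group_ring.\<delta> K (?G n) g \<odot>\<^bsub>N n\<^esub> x" for n g x
  have "linear_action K (?G n) (U n) (act n)" for n
    unfolding U_def act_def by (rule finite_group_ring.underlying_action[OF KG Nn])
  then interpret A: GL_actions K U act by (intro GL_actions.intro GL_actions_axioms.intro K inf)
  have U: "carrier (U n) = carrier (N n)" "add (U n) = add (N n)"
    "c \<odot>\<^bsub>U n\<^esub> x = group_ring_of_scalar K (?G n) c \<odot>\<^bsub>N n\<^esub> x" for n c x
    by (simp_all add: U_def finite_group_ring.underlying_sel[OF KG])
  define f where "f n = restrict (A.value_at_one n) (A.Prim n)" for n
  have hom: "f n \<in> mhom (group_ring K (?G n)) (A.Prim_module n) (N n)" for n
  proof -
    have "restrict (A.value_at_one n) (carrier (A.Prim_module n)) \<in> mhom (group_ring K (?G n)) (A.Prim_module n) (N n)"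
    proof (rule A.A.mhom_KG_I[OF A.Prim_module_left_module Nn], unfold A.Prim_module_sel)
      fix x assume x: "x \<in> A.Prim n"
      show "A.value_at_one n x \<in> carrier (N n)" using A.value_at_one_closed[OF x] by (simp add: U)
      show "A.value_at_one n (x \<oplus>\<^bsub>A.V n\<^esub> y) = A.value_at_one n x \<oplus>\<^bsub>N n\<^esub> A.value_at_one n y" if "y \<in> A.Prim n" for y
        using A.value_at_one_add[OF x that] by (simp add: U)
      show "A.value_at_one n (A.A.\<iota> n c \<odot>\<^bsub>A.Prim_module n\<^esub> x) = A.A.\<iota> n c \<odot>\<^bsub>N n\<^esub> A.value_at_one n x" if "c \<in> carrier K" for c
        using A.value_at_one_smult[OF x that] by (simp add: A.Prim_module_smult_\<iota>[OF that x] U)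
      show "A.value_at_one n (A.A.\<delta> n g \<odot>\<^bsub>A.Prim_module n\<^esub> x) = A.A.\<delta> n g \<odot>\<^bsub>N n\<^esub> A.value_at_one n x" if "g \<in> carrier (?G n)" for g
        using A.value_at_one_app[OF x that] by (simp add: A.Prim_module_smult_\<delta>[OF that x] act_def)
    qed
    then show ?thesis by (simp only: f_def A.Prim_module_sel)
  qed
  have bij: "bij_betw (f n) (carrier (A.Prim_module n)) (carrier (N n))" for n
  proof -
    have "bij_betw (A.value_at_one n) (A.Prim n) (carrier (N n))"
      using A.value_at_one_inj A.value_at_one_surj[of _ n] A.value_at_one_closed[of _ n]
      unfolding U by (intro bij_betw_imageI equalityI subsetI) auto
    then show ?thesis unfolding f_def A.Prim_module_sel by (simp only: bij_betw_restrict_eq)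
  qed
  have "\<exists>g. g \<in> mhom (group_ring K (?G n)) (N n) (A.Prim_module n) \<and>
    compose (carrier (A.Prim_module n)) g (f n) = (\<lambda>x \<in> carrier (A.Prim_module n). x) \<and> compose (carrier (N n)) (f n) g = (\<lambda>x \<in> carrier (N n). x)" for n
    using mhom_bij_inverse[OF A.Prim_module_left_module Nn hom bij, of n] by metis
  then have "\<exists>g. \<forall>n. g n \<in> mhom (group_ring K (?G n)) (N n) (A.Prim_module n) \<and>
    compose (carrier (A.Prim_module n)) (g n) (f n) = (\<lambda>x \<in> carrier (A.Prim_module n). x) \<and> compose (carrier (N n)) (f n) (g n) = (\<lambda>x \<in> carrier (N n). x)"
    by (intro choice allI)
  then obtain g where g: "\<And>n. g n \<in> mhom (group_ring K (?G n)) (N n) (A.Prim_module n)"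
    "\<And>n. compose (carrier (A.Prim_module n)) (g n) (f n) = (\<lambda>x \<in> carrier (A.Prim_module n). x)"
    "\<And>n. compose (carrier (N n)) (f n) (g n) = (\<lambda>x \<in> carrier (N n). x)" by blast
  have "is_iso (product_category (GL_modules TYPE('f) TYPE('m) K)) (omap prim_functor A.rep) N f"
    unfolding is_iso_def GL_modules_sel prim_functor_sel using hom g by (intro conjI bexI[of _ g]) simp_all
  moreover have "A.rep \<in> Obj (mat_reps TYPE('f) TYPE('m) K)"
    unfolding functor_category_sel using A.rep_functor by simp
  ultimately show ?thesis by blast
qed

section \<open>The equivalence\<close>

text \<open>
  This presents the \<open>K\<close>-modules as the case \<open>R = K\<close> of modules over an algebra.
\<close>

lemma central_ring_hom_id: "cring K \<Longrightarrow> central_ring_hom K K (\<lambda>c. c)"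
  by (intro central_ring_hom.intro central_ring_hom_axioms.intro)
    (auto simp: cring.axioms Ring.ring_hom_def cring.cring_simprules)

theorem theorem1p1:
  fixes K :: "'k ring" and p :: nat
  assumes "CHAR('f :: {finite, field}) = p"
    and "cring K"
    and "[p] \<cdot>\<^bsub>K\<^esub> \<one>\<^bsub>K\<^esub> \<in> Units K"
    and "infinite (UNIV :: 'v set)"
    and "infinite (UNIV :: 'm set)"
  shows "equivalent_linear_abelian_categories K
           (Rep TYPE('f) TYPE('v) TYPE('m) K)
           (product_category (GL_modules TYPE('f) TYPE('m) K))"
proof -
  note K = \<open>cring K\<close> and inf = \<open>infinite (UNIV :: 'm set)\<close>
  let ?M = "mat_category TYPE('f)" and ?V = "fd_vector_spaces TYPE('f) TYPE('v)"
  let ?T = "module_category TYPE('m) K (\<lambda>c. c)"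
  let ?Rep = "Rep TYPE('f) TYPE('v) TYPE('m) K" and ?R = "mat_reps TYPE('f) TYPE('m) K"
  let ?P = "product_category (GL_modules TYPE('f) TYPE('m) K)"
  \<comment> \<open>the abelian structure of the representations is transferred back from the product below\<close>
  have T: "linear_category K ?T"
    by (rule central_ring_hom.linear_category_module_category[OF central_ring_hom_id[OF K]])
  then have catT: "category ?T" by (rule linear_category.axioms(2))
  have P: "linear_abelian_category K ?P"
  proof (rule linear_abelian_category_product)
    fix n
    interpret finite_group_ring K "GL TYPE('f) n" by (rule finite_group_ring_GL[OF K])
    show "linear_abelian_category K (GL_modules TYPE('f) TYPE('m) K n)"
      unfolding GL_modules_def by (rule KG.linear_abelian_module_category[OF inf])
  qed
  then have P_lin: "linear_category K ?P" by (rule linear_abelian_category.axioms(1))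
  have Rep_lin: "linear_category K ?Rep"
    unfolding Rep_def by (rule linear_category_functor_category[OF category_fd_vector_spaces T])
  obtain e :: "nat \<Rightarrow> 'f vec \<Rightarrow> 'v" where "coordinate_embedding e"
    using ex_coordinate_embedding[OF \<open>infinite (UNIV :: 'v set)\<close>] by blast
  then interpret coordinate_embedding e .
  interpret MV: weakly_equivalent_categories ?M ?V realization
    by (intro weakly_equivalent_categories.intro weakly_equivalent_categories_axioms.intro
        category_mat_category category_fd_vector_spaces realization_weak_equivalence)
  obtain \<epsilon> :: "nat \<Rightarrow> 'f mat \<Rightarrow> 'k" where \<epsilon>: "kovacs_elements K \<epsilon>"
    using ex_kovacs_elements[OF K] assms(1,3) by blast
  have prim: "is_linear_functor K ?R ?P prim_functor" by (rule prim_functor_linear[OF K])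
  have prim_weak: "weak_equivalence ?R ?P prim_functor"
    unfolding weak_equivalence_def
    using prim prim_functor_bij[OF \<epsilon>] prim_functor_ess_surj[OF K inf] unfolding is_linear_functor_def by blast
  let ?F = "comp_functor prim_functor (precomposition ?M realization)"
  have "weak_equivalence ?Rep ?P ?F"
    unfolding Rep_def
    by (rule weak_equivalence_comp[OF MV.precomposition_weak_equivalence[OF catT] prim_weak linear_category.axioms(2)[OF P_lin]])
  moreover have "is_linear_functor K ?Rep ?P ?F"
    unfolding Rep_def by (rule is_linear_functor_comp[OF MV.precomposition_linear prim])
  ultimately interpret F: weakly_equivalent_linear_categories K ?Rep ?P ?F
    by (intro weakly_equivalent_linear_categories.intro weakly_equivalent_linear_categories_axioms.intro
        weakly_equivalent_categories.intro weakly_equivalent_categories_axioms.intro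
        linear_category.axioms(2)[OF Rep_lin] linear_category.axioms(2)[OF P_lin] Rep_lin P_lin)
  show ?thesis
    unfolding equivalent_linear_abelian_categories_def
    using F.transfer_abelian[OF P] P F.linear_equivalence by blast
qed

end
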